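(* Let $n \geq 1$. For all $1 \leq k \leq n$ there is an isomorphism of $\mathfrak{S}_n$-modules $$\mathbb{C}[\mathrm{NC}(n,k)] \;\cong\; (FDR_n)_{n-k,\,k-1},$$ where $\mathbb{C}[\mathrm{NC}(n,k)]$ carries the skein action of $\mathfrak{S}_n$ and $(FDR_n)_{n-k,k-1}$ is the bidegree $(n-k,k-1)$ component of the fermionic diagonal coinvariant ring.
   Context: Set partitions. $\Pi(n)$ is the set of all set partitions of $[n]=\{1,\dots,n\}$. A set partition $\pi$ is noncrossing if whenever $a<b<c<d$ with $a,c$ in the same block and $b,d$ in the same block, all four are in the same block. $\mathrm{NC}(n)$ is the set of noncrossing partitions of $[n]$, $\mathrm{NC}(n,k)$ those with $k$ blocks. For $w \in \mathfrak{S}_n$ and $\pi\in\Pi(n)$, $w(\pi)$ is the set partition with blocks $w(B)=\{w(i): i\in B\}$, $B$ a block of $\pi$. $s_i=(i,i+1)$. Skein action. For $\mu \in \Pi(n)$ not noncrossing with $s_i(\mu)$ noncrossing, the indices $i,i+1$ lie in different blocks $B_i \ni i$, $B_{i+1}\ni i+1$ of $\mu$, both of size at least 2. Let $\mu_1,\dots,\mu_4$ be obtained from $\mu$ by replacing the pair $B_i,B_{i+1}$ by the pair: $(B_i-\{i\})\cup\{i+1\}$ and $(B_{i+1}-\{i+1\})\cup\{i\}$ for $\mu_1$; $(B_i\cup B_{i+1})-\{i,i+1\}$ and $\{i,i+1\}$ for $\mu_2$; $B_i-\{i\}$ and $B_{i+1}\cup\{i\}$ for $\mu_3$; $B_{i+1}-\{i+1\}$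 and $B_i\cup\{i+1\}$ for $\mu_4$. Set $\sigma(\mu)=\mu_1+\mu_2$ if $|B_i|=|B_{i+1}|=2$; $\mu_1+\mu_2-\mu_3$ if $|B_i|>2,|B_{i+1}|=2$; $\mu_1+\mu_2-\mu_4$ if $|B_i|=2,|B_{i+1}|>2$; $\mu_1+\mu_2-\mu_3-\mu_4$ if $|B_i|,|B_{i+1}|>2$; this is an element of $\mathbb{C}[\mathrm{NC}(n)]$. The skein action on $\mathbb{C}[\mathrm{NC}(n)]$ (the vector space with basis $\mathrm{NC}(n)$) is given on generators by $s_i\cdot\pi=-s_i(\pi)$ if $s_i(\pi)$ is noncrossing and $s_i\cdot\pi=\sigma(s_i(\pi))$ otherwise. These operators satisfy the Coxeter relations, so they define an action of $\mathfrak{S}_n$; the span $\mathbb{C}[\mathrm{NC}(n,k)]$ is a submodule. Fermionic diagonal coinvariants. $\wedge\{\Theta_n,\Xi_n\}$ is the exterior algebra over $\mathbb{C}$ on $2n$ anticommuting generators $\theta_1,\dots,\theta_n,\xi_1,\dots,\xi_n$, bigraded by ($\theta$-degree, $\xi$-degree), with $\mathfrak{S}_n$ acting by algebra automorphisms $w\cdot\theta_i=\theta_{w(i)}$, $w\cdot\xi_i=\xi_{w(i)}$. $FDR_n$ is the quotient of $\wedge\{\Theta_n,\Xi_n\}$ by the ideal generated by all $\mathfrak{S}_n$-invariants with vanishing constant term; it is a bigraded $\mathfrak{S}_n$-module. *)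

theory Defs
  imports
    "HOL-Algebra.Algebra"
    "HOL-Algebra.Algebraic_Closure_Type"
    "HOL-Library.Disjoint_Sets"
    "HOL-Library.Product_Lexorder"
    Complex_Main
begin

section \<open>Vector spaces with a prescribed basis\<close>

definition basis_vec :: "'a \<Rightarrow> 'a \<Rightarrow> complex"
  where "basis_vec a = (\<lambda>b. of_bool (b = a))"

text \<open>
  The complex vector space with basis a \<^emph>\<open>finite\<close> set \<open>A\<close>; a vector is its coordinate function.
  HOL-Algebra's module records extend ring records, and its locale of modules ignores the
  fields for multiplication and unit.
\<close>

definition free_space :: "'a set \<Rightarrow> (complex, 'a \<Rightarrow> complex) module"
  where "free_space A =
    \<lparr>carrier = {f. \<forall>a. a \<notin> A \<longrightarrow> f a = 0},
     monoid.mult = undefined, one = undefined,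
     ring.zero = (\<lambda>a. 0), add = (\<lambda>f g a. f a + g a),
     module.smult = (\<lambda>c f a. c * f a)\<rparr>"


section \<open>Complex representations of symmetric groups\<close>

abbreviation complex_field :: "complex ring"
  where "complex_field \<equiv> ring_of_type_algebra"

definition linear_map ::
    "(complex, 'v) module \<Rightarrow> (complex, 'w) module \<Rightarrow> ('v \<Rightarrow> 'w) \<Rightarrow> bool"
  where "linear_map V W \<phi> \<longleftrightarrow>
    \<phi> \<in> carrier V \<rightarrow> carrier W \<and>
    (\<forall>x \<in> carrier V. \<forall>y \<in> carrier V. \<phi> (x \<oplus>\<^bsub>V\<^esub> y) = \<phi> x \<oplus>\<^bsub>W\<^esub> \<phi> y) \<and>
    (\<forall>c. \<forall>x \<in> carrier V. \<phi> (c \<odot>\<^bsub>V\<^esub> x) = c \<odot>\<^bsub>W\<^esub> \<phi> x)"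

text \<open>
  The restriction to the carrier is needed because the maps of a library group action are
  required to be extensional.
\<close>

definition sym_group_module ::
    "nat \<Rightarrow> (complex, 'v) module \<Rightarrow> ((nat \<Rightarrow> nat) \<Rightarrow> 'v \<Rightarrow> 'v) \<Rightarrow> bool"
  where "sym_group_module n V \<rho> \<longleftrightarrow>
    module complex_field V \<and>
    group_action (sym_group n) (carrier V) (\<lambda>w. restrict (\<rho> w) (carrier V)) \<and>
    (\<forall>w \<in> carrier (sym_group n). linear_map V V (\<rho> w))"

definition sym_group_module_isomorphic ::
    "nat \<Rightarrow> (complex, 'v) module \<Rightarrow> ((nat \<Rightarrow> nat) \<Rightarrow> 'v \<Rightarrow> 'v) \<Rightarrow>
      (complex, 'w) module \<Rightarrow> ((nat \<Rightarrow> nat) \<Rightarrow> 'w \<Rightarrow> 'w) \<Rightarrow> bool"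
  where "sym_group_module_isomorphic n V \<rho> W \<tau> \<longleftrightarrow>
    sym_group_module n V \<rho> \<and> sym_group_module n W \<tau> \<and>
    (\<exists>\<phi>. linear_map V W \<phi> \<and> bij_betw \<phi> (carrier V) (carrier W) \<and>
      (\<forall>w \<in> carrier (sym_group n). \<forall>x \<in> carrier V. \<phi> (\<rho> w x) = \<tau> w (\<phi> x)))"


section \<open>Noncrossing partitions and the skein action\<close>

definition noncrossing :: "nat set set \<Rightarrow> bool"
  where "noncrossing \<pi> \<longleftrightarrow>
    (\<forall>B \<in> \<pi>. \<forall>C \<in> \<pi>. \<forall>a \<in> B. \<forall>c \<in> B. \<forall>b \<in> C. \<forall>d \<in> C.
      a < b \<and> b < c \<and> c < d \<longrightarrow> B = C)"

definition NC :: "nat \<Rightarrow> nat set set set"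
  where "NC n = {\<pi>. partition_on {1..n} \<pi> \<and> noncrossing \<pi>}"

definition NC_blocks :: "nat \<Rightarrow> nat \<Rightarrow> nat set set set"
  where "NC_blocks n k = {\<pi> \<in> NC n. card \<pi> = k}"

definition perm_partition :: "(nat \<Rightarrow> nat) \<Rightarrow> nat set set \<Rightarrow> nat set set"
  where "perm_partition w \<pi> = (\<lambda>B. w ` B) ` \<pi>"

abbreviation adj_transp :: "nat \<Rightarrow> nat \<Rightarrow> nat"
  where "adj_transp i \<equiv> Transposition.transpose i (i + 1)"

definition block_of :: "nat set set \<Rightarrow> nat \<Rightarrow> nat set"
  where "block_of \<mu> i = (THE B. B \<in> \<mu> \<and> i \<in> B)"

definition skein_resolution :: "nat \<Rightarrow> nat set set \<Rightarrow> nat set set \<Rightarrow> complex"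
  where "skein_resolution i \<mu> =
    (let B = block_of \<mu> i; C = block_of \<mu> (i + 1); rest = \<mu> - {B, C};
         \<mu>1 = rest \<union> {(B - {i}) \<union> {i + 1}, (C - {i + 1}) \<union> {i}};
         \<mu>2 = rest \<union> {(B \<union> C) - {i, i + 1}, {i, i + 1}};
         \<mu>3 = rest \<union> {B - {i}, C \<union> {i}};
         \<mu>4 = rest \<union> {C - {i + 1}, B \<union> {i + 1}}
     in (\<lambda>\<nu>. basis_vec \<mu>1 \<nu> + basis_vec \<mu>2 \<nu>
           - (if card B > 2 then basis_vec \<mu>3 \<nu> else 0)
           - (if card C > 2 then basis_vec \<mu>4 \<nu> else 0)))"

definition skein_gen_basis :: "nat \<Rightarrow> nat set set \<Rightarrow> nat set set \<Rightarrow> complex"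
  where "skein_gen_basis i \<pi> =
    (let \<mu> = perm_partition (adj_transp i) \<pi>
     in if noncrossing \<mu> then (\<lambda>\<nu>. - basis_vec \<mu> \<nu>) else skein_resolution i \<mu>)"

definition skein_gen ::
    "nat \<Rightarrow> nat \<Rightarrow> (nat set set \<Rightarrow> complex) \<Rightarrow> (nat set set \<Rightarrow> complex)"
  where "skein_gen n i f = (\<lambda>\<nu>. \<Sum>\<pi> \<in> NC n. f \<pi> * skein_gen_basis i \<pi> \<nu>)"

text \<open>
  The action of \<open>w\<close> is the composition of the operators of the generators along any word for \<open>w\<close>;
  the choice of the word does not matter, because the operators satisfy the Coxeter relations.
\<close>

definition skein_act ::
    "nat \<Rightarrow> (nat \<Rightarrow> nat) \<Rightarrow> (nat set set \<Rightarrow> complex) \<Rightarrow> (nat set set \<Rightarrow> complex)"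
  where "skein_act n w f =
    (THE g. \<exists>is. set is \<subseteq> {1..<n} \<and> w = foldr (\<lambda>i u. adj_transp i \<circ> u) is id \<and>
      g = foldr (skein_gen n) is f)"


section \<open>Fermionic diagonal coinvariants\<close>

text \<open>
  The generators are the pairs \<open>(False, i)\<close> (for $\theta_i$) and \<open>(True, i)\<close> (for $\xi_i$), ordered
  lexicographically, that is, $\theta_1 < \dots < \theta_n < \xi_1 < \dots < \xi_n$. The exterior
  algebra has as basis the sets \<open>S\<close> of generators, where \<open>S\<close> stands for the product of its elements
  in increasing order. The product of the monomials of \<open>S\<close> and \<open>T\<close> vanishes if they intersect, and
  otherwise is the monomial of \<open>S \<union> T\<close> with the sign of the permutation that sorts the factors.
\<close>

type_synonym gen = "bool \<times> nat"

abbreviation (input) theta :: "nat \<Rightarrow> gen" where "theta i \<equiv> (False, i)"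
abbreviation (input) xi :: "nat \<Rightarrow> gen" where "xi i \<equiv> (True, i)"

definition gens :: "nat \<Rightarrow> gen set"
  where "gens n = theta ` {1..n} \<union> xi ` {1..n}"

definition merge_sign :: "gen set \<Rightarrow> gen set \<Rightarrow> complex"
  where "merge_sign S T = (- 1) ^ card {(s, t) \<in> S \<times> T. t < s}"

definition ext_mult :: "(gen set \<Rightarrow> complex) \<Rightarrow> (gen set \<Rightarrow> complex) \<Rightarrow> gen set \<Rightarrow> complex"
  where "ext_mult f g = (\<lambda>U. \<Sum>S \<in> Pow U. merge_sign S (U - S) * f S * g (U - S))"

definition ext_alg :: "nat \<Rightarrow> (complex, gen set \<Rightarrow> complex) module"
  where "ext_alg n = (free_space (Pow (gens n)))\<lparr>monoid.mult := ext_mult, one := basis_vec {}\<rparr>"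

definition perm_gen :: "(nat \<Rightarrow> nat) \<Rightarrow> gen \<Rightarrow> gen"
  where "perm_gen w = apsnd w"

text \<open>
  The algebra endomorphism extending the action on the generators: the monomial
  $g_1 \cdots g_m$ is sent to $w(g_1) \cdots w(g_m)$.
\<close>

definition ext_act :: "nat \<Rightarrow> (nat \<Rightarrow> nat) \<Rightarrow> (gen set \<Rightarrow> complex) \<Rightarrow> gen set \<Rightarrow> complex"
  where "ext_act n w f = (\<lambda>U. \<Sum>S \<in> Pow (gens n). f S *
    foldr (\<lambda>g. ext_mult (basis_vec {perm_gen w g})) (sorted_list_of_set S) (basis_vec {}) U)"

definition ext_bihomogeneous :: "nat \<Rightarrow> nat \<Rightarrow> nat \<Rightarrow> (gen set \<Rightarrow> complex) set"
  where "ext_bihomogeneous n a b = {f \<in> carrier (ext_alg n).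
    \<forall>S. f S \<noteq> 0 \<longrightarrow> card (S \<inter> range theta) = a \<and> card (S \<inter> range xi) = b}"

definition positive_invariants :: "nat \<Rightarrow> (gen set \<Rightarrow> complex) set"
  where "positive_invariants n = {f \<in> carrier (ext_alg n).
    (\<forall>w \<in> carrier (sym_group n). ext_act n w f = f) \<and> f {} = 0}"

definition coinvariant_ideal :: "nat \<Rightarrow> (gen set \<Rightarrow> complex) set"
  where "coinvariant_ideal n = Idl\<^bsub>ext_alg n\<^esub> (positive_invariants n)"

text \<open>
  The library's quotient ring, with the induced scalar multiplication added (as for the product of
  cosets in the library, the union is over all representatives).
\<close>

definition FDR :: "nat \<Rightarrow> (complex, (gen set \<Rightarrow> complex) set) module"
  where "FDR n = ring.extend (ext_alg n Quot coinvariant_ideal n)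
    \<lparr>module.smult = (\<lambda>c K. \<Union>x \<in> K. coinvariant_ideal n +>\<^bsub>ext_alg n\<^esub> (c \<odot>\<^bsub>ext_alg n\<^esub> x))\<rparr>"

definition FDR_component :: "nat \<Rightarrow> nat \<Rightarrow> nat \<Rightarrow> (complex, (gen set \<Rightarrow> complex) set) module"
  where "FDR_component n a b = (FDR n)
    \<lparr>carrier := (\<lambda>f. coinvariant_ideal n +>\<^bsub>ext_alg n\<^esub> f) ` ext_bihomogeneous n a b\<rparr>"

definition FDR_act ::
    "nat \<Rightarrow> (nat \<Rightarrow> nat) \<Rightarrow> (gen set \<Rightarrow> complex) set \<Rightarrow> (gen set \<Rightarrow> complex) set"
  where "FDR_act n w K = ext_act n w ` K"

end

theory Submission
  imports Defs "HOL-Library.Function_Algebras"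
begin

text \<open>
  Let $x_i$ be multiplication by $\xi_i$ and $d_i$ contraction with $\theta_i$; these operators
  anticommute, so the elements $x_i d_j + x_j d_i$ generate a commutative ring. To a set partition
  \<open>\<pi>\<close> attach the fermion \<open>fp n \<pi>\<close>: apply to $\theta_1 \cdots \theta_n$, for every block \<open>B\<close>, the sum of
  $x_i d_j + x_j d_i$ over the pairs in \<open>B\<close> (or $x_b d_b$ if \<open>B\<close> is the singleton of \<open>b\<close>), and then the sum of
  all contractions with $\xi_j$. A three-term quadratic relation between the generators turns into
  the skein relation for these fermions, so sending \<open>\<pi>\<close> to the class of \<open>fp n \<pi>\<close> is equivariant.

  Surjectivity: by the skein relation the fermions of all set partitions lie in the span of the noncrossing ones.
  A linear functional that vanishes on this span and on the ideal satisfies enough linear relations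
  (obtained by moving to the differences of the operators with those of index \<open>n\<close>) to vanish on the whole bidegree.

  Injectivity: the coinvariant ideal is generated by $\sum \theta_i$, $\sum \xi_i$ and $\sum \theta_i \xi_i$,
  so it is orthogonal to the elements killed by the three adjoint operators. Every noncrossing partition
  yields such a harmonic element of the right bidegree, whose leading monomial records the minima and
  the maxima of the blocks that do not contain \<open>n\<close>; these determine the partition. Hence the square matrix
  of the pairings between harmonic elements and fermions is nonsingular.
\<close>

text \<open>A sum of brackets over the pairs in a one-point block is empty. This explains two
  special rules at once: a singleton needs the separate factor \<open>x_b d_b\<close>, and the skein
  relation loses a correction term exactly when taking \<open>i\<close> or \<open>i + 1\<close> out
  of its block leaves a single point. Differences with index \<open>n\<close> are chosen because
  they anticommute with multiplication by the sum of the thetas and with the total contraction. In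
  these letters the point \<open>n\<close> disappears from the blocks and survives only in integer
  weights. Attaching \<open>n\<close> to one block after another gives linear relations with
  nonnegative weights; every time they reduce to one plus a sum of weights, times the unknown, being
  zero. Injectivity depends on surjectivity: a combination of harmonic elements that is orthogonal
  to all fermions is then orthogonal to its own bidegree, so it is zero. The Coxeter relations for
  the skein operators are not verified by calculation. The map to the exterior algebra turns every
  skein generator into a genuine group action and is injective, so two words for the same
  permutation give the same operator.\<close>

type_synonym vec = "gen set \<Rightarrow> complex"

section \<open>Complex functions as vectors, and linear maps between them\<close>

definition scl :: "complex \<Rightarrow> ('a \<Rightarrow> complex) \<Rightarrow> 'a \<Rightarrow> complex"
  where "scl c f = (\<lambda>x. c * f x)"

lemma scl_apply [simp]: "scl c f x = c * f x"
  by (simp add: scl_def)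

text \<open>The vector space is the whole function type; the finite-dimensional space in question is
  cut out of it later by \<open>supp_in\<close>.\<close>

interpretation fsp: vector_space scl
  by standard (simp_all add: fun_eq_iff distrib_left distrib_right)

abbreviation lin :: "(('a \<Rightarrow> complex) \<Rightarrow> ('b \<Rightarrow> complex)) \<Rightarrow> bool"
  where "lin \<equiv> module_hom scl scl"

lemma linI:
  assumes "\<And>x y. T (x + y) = T x + T y" "\<And>c x. T (scl c x) = scl c (T x)"
  shows "lin T"
  using assms by (simp add: module_hom_iff fsp.module_axioms)

lemma lin_compose: "lin S \<Longrightarrow> lin T \<Longrightarrow> lin (\<lambda>x. S (T x))"
  by (simp add: module_hom_iff)

lemma lin_minus: "lin S \<Longrightarrow> lin T \<Longrightarrow> lin (S - T)"
  by (simp add: module_hom_iff algebra_simps fsp.scale_right_diff_distrib)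

lemma lin_sum_ops: "(\<And>i. i \<in> A \<Longrightarrow> lin (T i)) \<Longrightarrow> lin (\<lambda>x. \<Sum>i\<in>A. T i x)"
proof (rule linI)
  assume T: "\<And>i. i \<in> A \<Longrightarrow> lin (T i)"
  show "(\<Sum>i\<in>A. T i (x + y)) = (\<Sum>i\<in>A. T i x) + (\<Sum>i\<in>A. T i y)" for x y
    using module_hom.add[OF T] by (simp add: sum.distrib[symmetric])
  show "(\<Sum>i\<in>A. T i (scl c x)) = scl c (\<Sum>i\<in>A. T i x)" for c x
    using module_hom.scale[OF T] by (simp add: fsp.scale_sum_right)
qed

lemma sum_fun_apply: "(\<Sum>i\<in>A. f i) x = (\<Sum>i\<in>A. f i x)"
  by (induction A rule: infinite_finite_induct) auto

lemma fun_self_eq_uminus: "f = - f \<Longrightarrow> f = (0 :: 'a \<Rightarrow> complex)"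
  by (auto simp: fun_eq_iff)

section \<open>Creation and annihilation operators\<close>

text \<open>The sign of sorting the single letter \<open>g\<close> into the monomial of
  \<open>U\<close>. Only strictly smaller letters count, so the sign is the same whether or not
  \<open>U\<close> contains \<open>g\<close>.\<close>

definition esign :: "gen \<Rightarrow> gen set \<Rightarrow> complex"
  where "esign g U = (- 1) ^ card {t \<in> U. t < g}"

definition cr :: "gen \<Rightarrow> vec \<Rightarrow> vec"
  where "cr g f = ext_mult (basis_vec {g}) f"

text \<open>Contraction with \<open>g\<close>, the adjoint of \<open>cr g\<close> for the pairing in
  which the monomials are orthonormal. It is cut off at infinite sets because \<open>cr g\<close>
  vanishes there too: the sum that defines \<open>ext_mult\<close> then has an infinite range and
  defaults to zero.\<close>

definition an :: "gen \<Rightarrow> vec \<Rightarrow> vec"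
  where "an g f = (\<lambda>U. if finite U \<and> g \<notin> U then esign g U * f (insert g U) else 0)"

lemma esign_square [simp]: "esign g U * esign g U = 1" "esign g U * (esign g U * c) = c"
  by (simp_all add: esign_def flip: power_add mult.assoc)

lemma esign_nonzero [simp]: "esign g U \<noteq> 0"
  by (simp add: esign_def)

lemma merge_sign_single: "merge_sign {g} T = esign g T"
proof -
  have "{(s, t). s \<in> {g} \<and> t \<in> T \<and> t < s} = Pair g ` {t \<in> T. t < g}" by auto
  then show ?thesis by (simp add: merge_sign_def esign_def card_image inj_on_def)
qed

lemma esign_diff_self [simp]: "esign g (U - {g}) = esign g U"
  unfolding esign_def by (rule arg_cong[where f="\<lambda>A. (-1) ^ card A"]) auto

lemma esign_insert_self [simp]: "esign g (insert g U) = esign g U"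
  unfolding esign_def by (rule arg_cong[where f="\<lambda>A. (-1) ^ card A"]) auto

lemma esign_insert:
  assumes "finite U" "h \<notin> U"
  shows "esign g (insert h U) = (if h < g then - 1 else 1) * esign g U"
proof -
  have "{t \<in> insert h U. t < g} = (if h < g then insert h {t \<in> U. t < g} else {t \<in> U. t < g})"
    by auto
  then show ?thesis using assms by (simp add: esign_def)
qed

lemma esign_remove:
  assumes "finite U" "h \<in> U"
  shows "esign g (U - {h}) = (if h < g then - 1 else 1) * esign g U"
proof -
  have "esign g U = esign g (insert h (U - {h}))" using assms by (simp add: insert_absorb)
  also have "\<dots> = (if h < g then - 1 else 1) * esign g (U - {h})"
    using assms by (subst esign_insert) auto
  finally show ?thesis by auto
qed

lemma cr_apply: "cr g f U = (if finite U \<and> g \<in> U then esign g U * f (U - {g}) else 0)"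
proof (cases "finite U \<and> g \<in> U")
  case True
  have "cr g f U = (\<Sum>S\<in>Pow U. if S = {g} then merge_sign {g} (U - {g}) * f (U - {g}) else 0)"
    unfolding cr_def ext_mult_def by (intro sum.cong) (auto simp: basis_vec_def)
  also have "\<dots> = merge_sign {g} (U - {g}) * f (U - {g})"
    using True by (subst sum.delta) auto
  finally show ?thesis using True by (simp add: merge_sign_single)
next
  case False
  then show ?thesis
  proof (cases "finite U")
    case True
    then show ?thesis using False unfolding cr_def ext_mult_def
      by (auto simp: basis_vec_def intro!: sum.neutral)
  qed (simp add: cr_def ext_mult_def)
qed

lemma lin_cr [intro]: "lin (cr g)"
  by (rule linI) (auto simp: fun_eq_iff cr_apply algebra_simps)

lemma lin_an [intro]: "lin (an g)"
  by (rule linI) (auto simp: fun_eq_iff an_def algebra_simps)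

lemma cr_anti: "cr g (cr h f) = - cr h (cr g f)"
proof (cases "g = h")
  case True
  then show ?thesis by (simp add: fun_eq_iff cr_apply)
next
  case False
  show ?thesis
  proof
    fix U
    have e: "U - {g} - {h} = U - {h} - {g}" by blast
    have "g < h \<or> h < g" "\<not> (g < h \<and> h < g)" using False by (auto dest: less_asym)
    then show "cr g (cr h f) U = (- cr h (cr g f)) U"
      using False by (cases "finite U \<and> g \<in> U \<and> h \<in> U") (auto simp: cr_apply esign_remove e)
  qed
qed

lemma an_anti: "an g (an h f) = - an h (an g f)"
proof (cases "g = h")
  case True
  then show ?thesis by (simp add: fun_eq_iff an_def)
next
  case False
  show ?thesis
  proof
    fix U
    have e: "insert g (insert h U) = insert h (insert g U)" by blast
    have "g < h \<or> h < g" "\<not> (g < h \<and> h < g)" using False by (auto dest: less_asym)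
    then show "an g (an h f) U = (- an h (an g f)) U"
      using False by (cases "finite U \<and> g \<notin> U \<and> h \<notin> U") (auto simp: an_def esign_insert e)
  qed
qed

lemma an_cr_neq:
  assumes "g \<noteq> h" shows "an g (cr h f) = - cr h (an g f)"
proof
  fix U
  show "an g (cr h f) U = (- cr h (an g f)) U"
  proof (cases "finite U \<and> g \<notin> U \<and> h \<in> U")
    case True
    have e: "insert g U - {h} = insert g (U - {h})" using assms by blast
    have "an g (cr h f) U = (esign g U * esign h (insert g U)) * f (insert g (U - {h}))"
      using True by (simp add: an_def cr_apply e)
    moreover have "cr h (an g f) U = (esign h U * esign g (U - {h})) * f (insert g (U - {h}))"
      using True assms by (simp add: an_def cr_apply)
    moreover have "g < h \<or> h < g" "\<not> (g < h \<and> h < g)" using assms by (auto dest: less_asym)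
    ultimately show ?thesis using True by (auto simp: esign_insert esign_remove)
  next
    case False
    then show ?thesis using assms by (auto simp: an_def cr_apply)
  qed
qed

text \<open>The value of a vector on infinite sets is junk that every operator below discards.\<close>

definition fin_part :: "vec \<Rightarrow> vec"
  where "fin_part f = (\<lambda>U. if finite U then f U else 0)"

text \<open>The canonical anticommutation relation. At a finite \<open>U\<close> exactly one of the
  two summands contributes, according to whether \<open>g\<close> belongs to
  \<open>U\<close>.\<close>

lemma an_cr_same: "an g (cr g f) + cr g (an g f) = fin_part f"
proof
  fix U
  show "(an g (cr g f) + cr g (an g f)) U = fin_part f U"
    by (cases "g \<in> U") (auto simp: an_def cr_apply fin_part_def insert_absorb)
qed

lemma cr_fin_part [simp]: "cr g (fin_part f) = cr g f" "fin_part (cr g f) = cr g f"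
  by (auto simp: fun_eq_iff cr_apply fin_part_def)

lemma an_fin_part [simp]: "an g (fin_part f) = an g f" "fin_part (an g f) = an g f"
  by (auto simp: fun_eq_iff an_def fin_part_def)

section \<open>Families of anticommuting operators\<close>

lemma merge_sign_insert_left:
  assumes "finite S" "finite T" "g \<notin> S"
  shows "merge_sign (insert g S) T = merge_sign {g} T * merge_sign S T"
proof -
  have e: "{(s, t). s \<in> insert g S \<and> t \<in> T \<and> t < s} =
     {(s, t). s \<in> {g} \<and> t \<in> T \<and> t < s} \<union> {(s, t). s \<in> S \<and> t \<in> T \<and> t < s}" by auto
  have f: "finite {(s, t). s \<in> A \<and> t \<in> T \<and> t < s}" if "finite A" for A
    by (rule finite_subset[of _ "A \<times> T"]) (use that assms in auto)
  have "card {(s, t). s \<in> insert g S \<and> t \<in> T \<and> t < s} =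
     card {(s, t). s \<in> {g} \<and> t \<in> T \<and> t < s} + card {(s, t). s \<in> S \<and> t \<in> T \<and> t < s}"
    unfolding e by (rule card_Un_disjoint) (use f[of "{g}"] f[OF assms(1)] assms in auto)
  then show ?thesis by (simp add: merge_sign_def power_add)
qed

text \<open>Such a family makes the space a module over the exterior algebra on all letters. The
  abstraction pays because the same identities are read through several families: the left
  multiplications \<open>cr\<close>, the permuted ones, the mixed operators \<open>op0\<close> and
  their differences \<open>op1\<close>.\<close>

locale anticommuting =
  fixes op :: "gen \<Rightarrow> vec \<Rightarrow> vec"
  assumes lin_op: "lin (op g)"
    and anti: "op g (op h x) = - op h (op g x)"
begin

definition word :: "gen set \<Rightarrow> vec \<Rightarrow> vec"
  where "word S x = foldr op (sorted_list_of_set S) x"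

lemma op_simps: "op g (x + y) = op g x + op g y" "op g (scl c x) = scl c (op g x)"
  "op g (- x) = - op g x" "op g 0 = 0" "op g (sum F A) = (\<Sum>a\<in>A. op g (F a))"
  using lin_op[of g] by (simp_all add: module_hom.add module_hom.scale module_hom.neg module_hom.zero module_hom.sum)

lemma op_if: "op g (if P then scl c y else 0) = (if P then scl c (op g y) else 0)"
  by (cases P) (simp_all only: op_simps if_True if_False)

lemma op_square: "op g (op g x) = 0"
  using anti[of g g x] by (rule fun_self_eq_uminus)

text \<open>Moving \<open>g\<close> rightwards past the smaller letters of a sorted word costs one
  sign per letter, the number counted by \<open>esign\<close>; meeting a copy of itself gives
  zero.\<close>

lemma op_foldr:
  assumes "sorted xs" "distinct xs"
  shows "op g (foldr op xs x) =
    (if g \<in> set xs then 0 else scl (esign g (set xs)) (foldr op (insort g xs) x))"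
  using assms
proof (induction xs)
  case Nil
  then show ?case by (simp add: esign_def scl_def)
next
  case (Cons a xs)
  have srt: "sorted xs" "distinct xs" "a \<notin> set xs" "\<And>t. t \<in> set xs \<Longrightarrow> a < t"
    using Cons.prems by (auto simp: order_less_le)
  consider "g = a" | "g < a" | "a < g" by fastforce
  then show ?case
  proof cases
    case 1
    then show ?thesis by (simp add: op_square)
  next
    case 2
    have lt: "g < t" if "t \<in> set (a # xs)" for t
      using that 2 srt(4)[of t] by (cases "t = a") (simp, metis less_trans set_ConsD)
    have "{t \<in> set (a # xs). t < g} = {}" using lt less_asym by blast
    then have "esign g (set (a # xs)) = 1" by (simp only: esign_def card.empty power_0)
    moreover have "g \<notin> set (a # xs)" using lt by blast
    moreover have "insort g (a # xs) = g # a # xs" using less_imp_le[OF 2] by simp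
    ultimately show ?thesis by (simp only: if_False fsp.scale_one foldr_Cons o_apply)
  next
    case 3
    have "op g (foldr op (a # xs) x) = - op a (op g (foldr op xs x))" by (simp add: anti[of g a])
    also have "\<dots> = - op a (if g \<in> set xs then 0 else scl (esign g (set xs)) (foldr op (insort g xs) x))"
      using Cons.IH srt by simp
    also have "\<dots> = (if g \<in> set (a # xs) then 0
        else scl (esign g (set (a # xs))) (foldr op (insort g (a # xs)) x))"
    proof (cases "g \<in> set xs")
      case True
      then show ?thesis by (simp add: op_simps)
    next
      case False
      have "esign g (set (a # xs)) = - esign g (set xs)" using 3 srt(3) by (simp add: esign_insert)
      moreover have "g \<notin> set (a # xs)" "insort g (a # xs) = a # insort g xs"
        using False leD[of g a] 3 by auto
      ultimately show ?thesis using False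
        by (simp only: if_False foldr_Cons o_apply op_simps fsp.scale_minus_left)
    qed
    finally show ?thesis .
  qed
qed

lemma op_word:
  assumes "finite S"
  shows "op g (word S x) = (if g \<in> S then 0 else scl (merge_sign {g} S) (word (insert g S) x))"
  using op_foldr[of "sorted_list_of_set S" g x] assms
  by (simp add: word_def merge_sign_single)

lemma lin_word: "lin (word S)"
proof -
  have "lin (foldr op xs)" for xs
  proof (induction xs)
    case Nil
    show ?case by (rule linI) auto
  next
    case (Cons a xs)
    have "foldr op (a # xs) = (\<lambda>x. op a (foldr op xs x))" by (rule ext) simp
    show ?case unfolding \<open>foldr op (a # xs) = _\<close> by (rule lin_compose[OF lin_op Cons])
  qed
  moreover have "word S = foldr op (sorted_list_of_set S)" by (auto simp: word_def)
  ultimately show ?thesis by simp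
qed

lemma word_insert_min:
  assumes "finite S" "\<And>t. t \<in> S \<Longrightarrow> g < t"
  shows "word (insert g S) x = op g (word S x)"
proof -
  have "g \<notin> S" using assms(2) by blast
  moreover have "merge_sign {g} S = 1"
    using assms(2) by (simp add: merge_sign_single esign_def) (metis (mono_tags, lifting) card.empty empty_Collect_eq order_less_asym power_0)
  ultimately show ?thesis using assms by (simp add: op_word scl_def)
qed

text \<open>Operator words multiply by the rule for monomials of the exterior algebra. Splitting off
  the least letter of \<open>S\<close> costs no sign, which suits the induction over increasing
  letters.\<close>

lemma word_word:
  assumes "finite S" "finite T"
  shows "word S (word T x) = (if S \<inter> T = {} then scl (merge_sign S T) (word (S \<union> T) x) else 0)"
  using assms(1)
proof (induction S rule: finite_linorder_min_induct)
  case empty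
  then show ?case by (simp add: word_def merge_sign_def scl_def)
next
  case (insert b A)
  have "word (insert b A) (word T x) = op b (word A (word T x))"
    using insert by (intro word_insert_min) auto
  also have "\<dots> = (if A \<inter> T = {} then scl (merge_sign A T) (op b (word (A \<union> T) x)) else 0)"
    unfolding insert.IH by (rule op_if)
  also have "\<dots> = (if insert b A \<inter> T = {} then scl (merge_sign (insert b A) T) (word (insert b A \<union> T) x) else 0)"
  proof (cases "insert b A \<inter> T = {}")
    case True
    have "b \<notin> A" using insert by blast
    have "{t \<in> A \<union> T. t < b} = {t \<in> T. t < b}" using insert by (auto dest: less_asym)
    then have "merge_sign {b} (A \<union> T) = merge_sign {b} T" by (simp add: merge_sign_single esign_def)
    moreover have "finite (A \<union> T)" "b \<notin> A \<union> T" "A \<inter> T = {}"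
      using True \<open>b \<notin> A\<close> \<open>finite A\<close> assms(2) by auto
    ultimately show ?thesis
      using True merge_sign_insert_left[OF \<open>finite A\<close> assms(2) \<open>b \<notin> A\<close>]
      by (simp add: op_word mult.commute)
  next
    case False
    then have "A \<inter> T \<noteq> {} \<or> b \<in> A \<union> T" by blast
    then show ?thesis using False op_word[of "A \<union> T" b x] \<open>finite A\<close> assms(2)
      by (cases "A \<inter> T = {}") (simp_all only: if_True if_False finite_Un simp_thms fsp.scale_zero_right)
  qed
  finally show ?case .
qed

text \<open>Evaluation of the element \<open>f\<close> at the operators, as in the universal
  property of the exterior algebra; \<open>lift_ext_mult\<close> is its multiplicativity. The set
  \<open>G\<close> is the alphabet.\<close>

definition lift :: "gen set \<Rightarrow> vec \<Rightarrow> vec \<Rightarrow> vec"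
  where "lift G f x = (\<Sum>S\<in>Pow G. scl (f S) (word S x))"

lemma lin_lift: "lin (lift G f)"
  unfolding lift_def
  by (intro lin_sum_ops linI)
    (simp_all only: module_hom.add[OF lin_word] module_hom.scale[OF lin_word] fsp.scale_right_distrib
      fsp.scale_scale mult.commute)

lemma lift_add: "lift G (f + g) x = lift G f x + lift G g x"
  by (simp add: lift_def fsp.scale_left_distrib sum.distrib)

lemma lift_scl: "lift G (scl c f) x = scl c (lift G f x)"
  by (simp add: lift_def fsp.scale_sum_right)

end

lemma sum_Pow_Pow:
  assumes "finite G"
  shows "(\<Sum>U\<in>Pow G. \<Sum>S\<in>Pow U. F S (U - S)) = (\<Sum>S\<in>Pow G. \<Sum>T\<in>Pow (G - S). F S T)"
proof -
  have "(\<Sum>U\<in>Pow G. \<Sum>S\<in>Pow U. F S (U - S)) = (\<Sum>(U, S)\<in>Sigma (Pow G) Pow. F S (U - S))"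
    using assms by (subst sum.Sigma) (auto intro: finite_subset)
  also have "\<dots> = (\<Sum>(S, T)\<in>Sigma (Pow G) (\<lambda>S. Pow (G - S)). F S T)"
    by (rule sum.reindex_bij_witness[where i="\<lambda>(S, T). (S \<union> T, S)" and j="\<lambda>(U, S). (S, U - S)"]) auto
  also have "\<dots> = (\<Sum>S\<in>Pow G. \<Sum>T\<in>Pow (G - S). F S T)"
    using assms by (subst sum.Sigma) (auto intro: finite_subset)
  finally show ?thesis .
qed

context anticommuting
begin

lemma lift_ext_mult:
  assumes "finite G"
  shows "lift G (ext_mult f g) x = lift G f (lift G g x)"
proof -
  have fin: "finite S" if "S \<subseteq> G" for S using that assms finite_subset by blast
  have "lift G (ext_mult f g) x =
      (\<Sum>U\<in>Pow G. \<Sum>S\<in>Pow U. scl (merge_sign S (U - S) * f S * g (U - S)) (word (S \<union> (U - S)) x))"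
    unfolding lift_def ext_mult_def
    by (intro sum.cong refl) (simp add: fsp.scale_sum_left Un_absorb1)
  also have "\<dots> = (\<Sum>S\<in>Pow G. \<Sum>T\<in>Pow (G - S). scl (merge_sign S T * f S * g T) (word (S \<union> T) x))"
    by (rule sum_Pow_Pow[OF assms])
  also have "\<dots> = (\<Sum>S\<in>Pow G. \<Sum>T\<in>Pow G. scl (f S * g T) (word S (word T x)))"
  proof (rule sum.cong[OF refl])
    fix S assume S: "S \<in> Pow G"
    have "(\<Sum>T\<in>Pow G. scl (f S * g T) (word S (word T x))) =
       (\<Sum>T\<in>Pow (G - S). scl (f S * g T) (word S (word T x)))"
    proof (rule sum.mono_neutral_right)
      show "\<forall>T\<in>Pow G - Pow (G - S). scl (f S * g T) (word S (word T x)) = 0"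
        using S fin by (auto simp: word_word)
    qed (use assms in auto)
    also have "\<dots> = (\<Sum>T\<in>Pow (G - S). scl (merge_sign S T * f S * g T) (word (S \<union> T) x))"
    proof (rule sum.cong[OF refl])
      fix T assume T: "T \<in> Pow (G - S)"
      then have "S \<inter> T = {}" "finite S" "finite T" using S fin[of S] fin[of T] by auto
      then show "scl (f S * g T) (word S (word T x)) = scl (merge_sign S T * f S * g T) (word (S \<union> T) x)"
        by (simp add: word_word mult_ac)
    qed
    finally show "(\<Sum>T\<in>Pow (G - S). scl (merge_sign S T * f S * g T) (word (S \<union> T) x)) =
       (\<Sum>T\<in>Pow G. scl (f S * g T) (word S (word T x)))" by simp
  qed
  also have "\<dots> = lift G f (lift G g x)"
    by (simp add: lift_def module_hom.sum[OF lin_word] module_hom.scale[OF lin_word] fsp.scale_sum_right)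
  finally show ?thesis .
qed

lemma lift_basis_vec:
  assumes "finite G" "S \<subseteq> G"
  shows "lift G (basis_vec S) x = word S x"
proof -
  have "lift G (basis_vec S) x = (\<Sum>T\<in>Pow G. if T = S then word S x else 0)"
    unfolding lift_def by (intro sum.cong) (auto simp: basis_vec_def fun_eq_iff)
  also have "\<dots> = word S x" using assms by (subst sum.delta) auto
  finally show ?thesis .
qed

lemma word_empty [simp]: "word {} x = x"
  by (simp add: word_def)

lemma word_single [simp]: "word {g} x = op g x"
  by (simp add: word_def)

end

interpretation cr: anticommuting cr
  by (rule anticommuting.intro) (rule lin_cr, rule cr_anti)

section \<open>The exterior algebra as a ring\<close>

lemma merge_sign_empty [simp]: "merge_sign {} T = 1" "merge_sign S {} = 1"
  by (simp_all add: merge_sign_def)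

lemma cr_word_apply:
  assumes "finite S" "finite U"
  shows "cr.word S y U = (if S \<subseteq> U then merge_sign S (U - S) * y (U - S) else 0)"
  using assms
proof (induction S arbitrary: U rule: finite_linorder_min_induct)
  case empty
  then show ?case by simp
next
  case (insert b A)
  have bA: "b \<notin> A" using insert by blast
  have w: "cr.word (insert b A) y = cr b (cr.word A y)"
    using insert by (intro cr.word_insert_min) auto
  show ?case
  proof (cases "insert b A \<subseteq> U")
    case True
    then have s: "A \<subseteq> U - {b}" "b \<in> U" "U - {b} - A = U - insert b A" using bA by auto
    have "{t \<in> U. t < b} = {t \<in> U - insert b A. t < b}" using insert.hyps by (auto dest: less_asym)
    then have e: "esign b U = merge_sign {b} (U - insert b A)" by (simp add: merge_sign_single esign_def)
    have "cr.word (insert b A) y U = esign b U * cr.word A y (U - {b})"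
      using s insert.prems by (simp add: w cr_apply[where U = U])
    also have "cr.word A y (U - {b}) = merge_sign A (U - insert b A) * y (U - insert b A)"
      using insert.IH[of "U - {b}"] insert.prems s by simp
    finally show ?thesis
      using True merge_sign_insert_left[OF insert.hyps(1) _ bA, of "U - insert b A"] insert.prems
      by (simp only: e if_True finite_Diff mult.assoc)
  next
    case False
    then have "b \<notin> U \<or> \<not> A \<subseteq> U - {b}" using bA by auto
    then have "cr b (cr.word A y) U = 0"
      using insert.IH[of "U - {b}"] insert.prems by (subst cr_apply) auto
    then show ?thesis using False w by auto
  qed
qed

lemma cr_lift_apply:
  assumes "finite G" "U \<subseteq> G"
  shows "cr.lift G f y U = ext_mult f y U"
proof -
  have fU: "finite U" using assms finite_subset by blast
  have "cr.lift G f y U = (\<Sum>S\<in>Pow G. f S * cr.word S y U)"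
    by (simp add: cr.lift_def sum_fun_apply)
  also have "\<dots> = (\<Sum>S\<in>Pow U. f S * cr.word S y U)"
  proof (rule sum.mono_neutral_right)
    show "\<forall>S\<in>Pow G - Pow U. f S * cr.word S y U = 0"
      using assms fU finite_subset[OF _ assms(1)] by (auto simp: cr_word_apply)
  qed (use assms in auto)
  also have "\<dots> = ext_mult f y U"
    unfolding ext_mult_def
    by (rule sum.cong[OF refl]) (use fU finite_subset[OF _ fU] in \<open>auto simp: cr_word_apply\<close>)
  finally show ?thesis .
qed

lemma ext_mult_infinite: "infinite U \<Longrightarrow> ext_mult f g U = 0"
  by (simp add: ext_mult_def)

lemma ext_mult_cong:
  assumes "\<And>S. S \<subseteq> U \<Longrightarrow> f S = f' S" "\<And>S. S \<subseteq> U \<Longrightarrow> g S = g' S"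
  shows "ext_mult f g U = ext_mult f' g' U"
  unfolding ext_mult_def using assms by (intro sum.cong) auto

text \<open>For the family of left multiplications \<open>lift\<close> is left multiplication
  itself, so associativity is \<open>lift_ext_mult\<close>. The value at \<open>U\<close> involves
  subsets of \<open>U\<close> only, so \<open>U\<close> can serve as the finite alphabet.\<close>

lemma ext_mult_assoc: "ext_mult (ext_mult f g) h = ext_mult f (ext_mult g h)"
proof
  fix U
  show "ext_mult (ext_mult f g) h U = ext_mult f (ext_mult g h) U"
  proof (cases "finite U")
    case True
    have "ext_mult (ext_mult f g) h U = cr.lift U f (cr.lift U g h) U"
      by (simp add: cr_lift_apply[OF True, symmetric] cr.lift_ext_mult[OF True])
    also have "\<dots> = ext_mult f (cr.lift U g h) U" by (simp add: cr_lift_apply[OF True])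
    also have "\<dots> = ext_mult f (ext_mult g h) U"
      by (rule ext_mult_cong) (simp_all add: cr_lift_apply[OF True])
    finally show ?thesis .
  qed (simp add: ext_mult_infinite)
qed

lemma ext_mult_add_left: "ext_mult (f + g) h = ext_mult f h + ext_mult g h"
  by (simp add: ext_mult_def fun_eq_iff distrib_left distrib_right sum.distrib)

lemma ext_mult_add_right: "ext_mult h (f + g) = ext_mult h f + ext_mult h g"
  by (simp add: ext_mult_def fun_eq_iff distrib_left sum.distrib)

lemma ext_mult_scl_left: "ext_mult (scl c f) h = scl c (ext_mult f h)"
  by (simp add: ext_mult_def fun_eq_iff sum_distrib_left mult_ac)

lemma ext_mult_scl_right: "ext_mult f (scl c h) = scl c (ext_mult f h)"
  by (simp add: ext_mult_def fun_eq_iff sum_distrib_left mult_ac)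

lemma lin_ext_mult_right: "lin (ext_mult f)"
  by (rule linI) (simp_all add: ext_mult_add_right ext_mult_scl_right)

lemma lin_ext_mult_left: "lin (\<lambda>f. ext_mult f h)"
  by (rule linI) (simp_all add: ext_mult_add_left ext_mult_scl_left)

lemma ext_mult_one_left: "ext_mult (basis_vec {}) f = fin_part f"
proof
  fix U
  show "ext_mult (basis_vec {}) f U = fin_part f U"
  proof (cases "finite U")
    case True
    have "ext_mult (basis_vec {}) f U = (\<Sum>S\<in>Pow U. if S = {} then f U else 0)"
      unfolding ext_mult_def by (intro sum.cong) (auto simp: basis_vec_def)
    also have "\<dots> = f U" using True by (subst sum.delta) auto
    finally show ?thesis using True by (simp add: fin_part_def)
  qed (simp add: ext_mult_infinite fin_part_def)
qed

lemma ext_mult_one_right: "ext_mult f (basis_vec {}) = fin_part f"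
proof
  fix U
  show "ext_mult f (basis_vec {}) U = fin_part f U"
  proof (cases "finite U")
    case True
    have "ext_mult f (basis_vec {}) U = (\<Sum>S\<in>Pow U. if S = U then f U else 0)"
      unfolding ext_mult_def by (intro sum.cong) (auto simp: basis_vec_def)
    also have "\<dots> = f U" using True by (subst sum.delta) auto
    finally show ?thesis using True by (simp add: fin_part_def)
  qed (simp add: ext_mult_infinite fin_part_def)
qed

text \<open>Each of the \<open>card S * card T\<close> pairs is an inversion for exactly one of the
  two orders of the factors.\<close>

lemma merge_sign_swap:
  assumes "finite S" "finite T" "S \<inter> T = {}"
  shows "merge_sign S T = (- 1) ^ (card S * card T) * merge_sign T S"
proof -
  let ?P = "\<lambda>p. snd p < (fst p :: gen)"
  have A: "{(s, t). s \<in> S \<and> t \<in> T \<and> t < s} = {p \<in> S \<times> T. ?P p}" by fastforce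
  have B: "{(t, s). t \<in> T \<and> s \<in> S \<and> s < t} = prod.swap ` {p \<in> S \<times> T. \<not> ?P p}"
  proof (intro equalityI subsetI)
    fix p assume "p \<in> {(t, s). t \<in> T \<and> s \<in> S \<and> s < t}"
    then obtain t s where p: "p = (t, s)" "t \<in> T" "s \<in> S" "s < t" by blast
    then have "(s, t) \<in> {p \<in> S \<times> T. \<not> ?P p}" using less_asym[of s t] by (simp del: less_prod_simp)
    then show "p \<in> prod.swap ` {p \<in> S \<times> T. \<not> ?P p}" unfolding p(1) by (rule rev_image_eqI) simp
  next
    fix p assume "p \<in> prod.swap ` {p \<in> S \<times> T. \<not> ?P p}"
    then obtain t s where p: "p = (t, s)" "t \<in> T" "s \<in> S" "\<not> t < s" by auto
    then have "s \<noteq> t" using assms(3) by blast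
    then show "p \<in> {(t, s). t \<in> T \<and> s \<in> S \<and> s < t}" using p linorder_neqE[of s t] by blast
  qed
  have cB: "card (prod.swap ` Y) = card Y" for Y :: "(gen \<times> gen) set" by (simp add: card_image)
  have "card S * card T = card {p \<in> S \<times> T. ?P p} + card {p \<in> S \<times> T. \<not> ?P p}"
  proof -
    have "card ({p \<in> S \<times> T. ?P p} \<union> {p \<in> S \<times> T. \<not> ?P p}) =
        card {p \<in> S \<times> T. ?P p} + card {p \<in> S \<times> T. \<not> ?P p}"
      using finite_cartesian_product[OF assms(1,2)]
      by (intro card_Un_disjoint) (blast intro: finite_subset, blast intro: finite_subset, blast)
    moreover have "{p \<in> S \<times> T. ?P p} \<union> {p \<in> S \<times> T. \<not> ?P p} = S \<times> T" by blast
    ultimately show ?thesis by (simp only: card_cartesian_product)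
  qed
  then have "merge_sign S T * merge_sign T S = (- 1) ^ (card S * card T)"
    by (simp add: merge_sign_def A B cB power_add)
  moreover have "merge_sign T S * merge_sign T S = 1" by (simp add: merge_sign_def flip: power_add)
  ultimately show ?thesis by (metis mult.assoc mult.right_neutral)
qed

lemma ext_mult_swap:
  "ext_mult f g U = (\<Sum>S\<in>Pow U. (- 1) ^ (card S * card (U - S)) * merge_sign S (U - S) * g S * f (U - S))"
proof (cases "finite U")
  case True
  have "ext_mult f g U = (\<Sum>S\<in>Pow U. merge_sign (U - S) S * f (U - S) * g S)"
    unfolding ext_mult_def
    by (rule sum.reindex_bij_witness[where i="\<lambda>S. U - S" and j="\<lambda>S. U - S"]) (auto simp: double_diff)
  also have "\<dots> = (\<Sum>S\<in>Pow U. (- 1) ^ (card S * card (U - S)) * merge_sign S (U - S) * g S * f (U - S))"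
  proof (rule sum.cong[OF refl])
    fix S assume "S \<in> Pow U"
    then have "finite S" "finite (U - S)" "(U - S) \<inter> S = {}" using True finite_subset by auto
    then show "merge_sign (U - S) S * f (U - S) * g S =
      (- 1) ^ (card S * card (U - S)) * merge_sign S (U - S) * g S * f (U - S)"
      by (simp add: merge_sign_swap[of "U - S" S] mult_ac)
  qed
  finally show ?thesis .
qed (simp add: ext_mult_infinite)

text \<open>The grading automorphism; it records the sign of carrying a generator through
  \<open>f\<close> from the right to the left.\<close>

definition parity :: "vec \<Rightarrow> vec"
  where "parity f = (\<lambda>U. (- 1) ^ card U * f U)"

lemma ext_mult_gen_right: "ext_mult f (basis_vec {g}) = cr g (parity f)"
proof
  fix U
  have "ext_mult f (basis_vec {g}) U = ext_mult (basis_vec {g}) (parity f) U"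
    unfolding ext_mult_swap[of f] unfolding ext_mult_def
    by (rule sum.cong) (auto simp: basis_vec_def parity_def)
  then show "ext_mult f (basis_vec {g}) U = cr g (parity f) U" by (simp add: cr_def)
qed

lemma parity_parity [simp]: "parity (parity f) = f"
  by (simp add: parity_def fun_eq_iff flip: mult.assoc power_add)

definition supp_in :: "gen set \<Rightarrow> vec set"
  where "supp_in G = {f. \<forall>S. S \<notin> Pow G \<longrightarrow> f S = 0}"

lemma ext_mult_supp_in:
  assumes "f \<in> supp_in G" "g \<in> supp_in G" shows "ext_mult f g \<in> supp_in G"
  unfolding supp_in_def
proof (intro CollectI allI impI)
  fix U assume U: "U \<notin> Pow G"
  have "S \<notin> Pow G \<or> U - S \<notin> Pow G" if "S \<in> Pow U" for S using U that by auto
  then show "ext_mult f g U = 0"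
    unfolding ext_mult_def using assms by (intro sum.neutral) (auto simp: supp_in_def)
qed

lemma ext_alg_simps:
  "carrier (ext_alg n) = supp_in (gens n)" "monoid.mult (ext_alg n) = ext_mult"
  "one (ext_alg n) = basis_vec {}" "ring.zero (ext_alg n) = 0" "add (ext_alg n) = (+)"
  "module.smult (ext_alg n) = scl"
  by (auto simp: ext_alg_def free_space_def supp_in_def fun_eq_iff scl_def)

lemma finite_gens [simp]: "finite (gens n)"
  by (simp add: gens_def)

lemma supp_in_fin_part [simp]: "finite G \<Longrightarrow> f \<in> supp_in G \<Longrightarrow> fin_part f = f"
  by (auto simp: supp_in_def fin_part_def fun_eq_iff dest: finite_subset)

lemma basis_vec_supp_in [simp]: "basis_vec S \<in> supp_in G \<longleftrightarrow> S \<subseteq> G"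
  by (auto simp: supp_in_def basis_vec_def)

lemma supp_in_closed [simp]:
  "0 \<in> supp_in G" "f \<in> supp_in G \<Longrightarrow> g \<in> supp_in G \<Longrightarrow> f + g \<in> supp_in G"
  "f \<in> supp_in G \<Longrightarrow> scl c f \<in> supp_in G" "f \<in> supp_in G \<Longrightarrow> - f \<in> supp_in G"
  by (simp_all add: supp_in_def)

lemma supp_in_sum: "(\<And>i. i \<in> A \<Longrightarrow> F i \<in> supp_in G) \<Longrightarrow> sum F A \<in> supp_in G"
  by (induction A rule: infinite_finite_induct) auto

lemma ring_ext_alg: "ring (ext_alg n)"
proof (rule ringI)
  show "abelian_group (ext_alg n)"
  proof (rule abelian_groupI; (unfold ext_alg_simps)?)
    fix x assume x: "x \<in> supp_in (gens n)"
    show "\<exists>y\<in>supp_in (gens n). y + x = 0" using x by (intro bexI[of _ "- x"]) auto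
  qed (auto simp: add_ac)
  show "Group.monoid (ext_alg n)"
    by (rule monoidI; unfold ext_alg_simps)
       (auto simp: ext_mult_supp_in ext_mult_assoc ext_mult_one_left ext_mult_one_right
         supp_in_fin_part[OF finite_gens])
qed (auto simp: ext_alg_simps ext_mult_add_left ext_mult_add_right)

lemma cr_supp_in: "g \<in> G \<Longrightarrow> f \<in> supp_in G \<Longrightarrow> cr g f \<in> supp_in G"
  by (simp add: cr_def ext_mult_supp_in)

lemma cr_word_one:
  assumes "finite S" shows "cr.word S (basis_vec {}) = basis_vec S"
proof
  fix U
  show "cr.word S (basis_vec {}) U = basis_vec S U"
  proof (cases "finite U")
    case True
    then show ?thesis using assms by (auto simp: cr_word_apply basis_vec_def)
  next
    case False
    have "cr.word T (basis_vec {}) U = 0" if "finite T" for T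
      using that
    proof (induction T rule: finite_linorder_min_induct)
      case empty
      then show ?case using False by (auto simp: basis_vec_def)
    next
      case (insert b A)
      then have "cr.word (insert b A) (basis_vec {}) = cr b (cr.word A (basis_vec {}))"
        by (intro cr.word_insert_min) auto
      then show ?case using False cr_apply[of b _ U] by simp
    qed
    then show ?thesis using False assms by (auto simp: basis_vec_def)
  qed
qed

lemma vec_expand:
  assumes "finite G" "f \<in> supp_in G"
  shows "f = (\<Sum>S\<in>Pow G. scl (f S) (basis_vec S))"
proof
  fix U
  have "(\<Sum>S\<in>Pow G. scl (f S) (basis_vec S)) U = (\<Sum>S\<in>Pow G. if S = U then f U else 0)"
    unfolding sum_fun_apply by (intro sum.cong) (auto simp: basis_vec_def)
  also have "\<dots> = f U" using assms by (subst sum.delta) (auto simp: supp_in_def)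
  finally show "f U = (\<Sum>S\<in>Pow G. scl (f S) (basis_vec S)) U" by simp
qed

lemma cr_basis_vec:
  assumes "finite S" "g \<notin> S"
  shows "cr g (basis_vec S) = scl (esign g S) (basis_vec (insert g S))"
  using cr.op_word[OF assms(1), of g "basis_vec {}"] assms
  by (simp add: cr_word_one merge_sign_single)

text \<open>The algebra arises from the unit by left multiplications with generators and linear
  combinations. Equivariance is proved through this rule, so that no explicit signs of permuted
  monomials appear.\<close>

lemma supp_in_induct [consumes 2, case_names add scl one cr]:
  assumes "finite G" "f \<in> supp_in G"
    and add: "\<And>f g. f \<in> supp_in G \<Longrightarrow> g \<in> supp_in G \<Longrightarrow> P f \<Longrightarrow> P g \<Longrightarrow> P (f + g)"
    and scl: "\<And>c f. f \<in> supp_in G \<Longrightarrow> P f \<Longrightarrow> P (scl c f)"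
    and one: "P (basis_vec {})"
    and cr: "\<And>g f. g \<in> G \<Longrightarrow> f \<in> supp_in G \<Longrightarrow> P f \<Longrightarrow> P (cr g f)"
  shows "P f"
proof -
  have b: "P (basis_vec S)" if "S \<subseteq> G" for S
    using finite_subset[OF that assms(1)] that
  proof (induction S rule: finite_linorder_min_induct)
    case empty
    then show ?case using one by simp
  next
    case (insert b A)
    then have "b \<notin> A" "P (cr b (basis_vec A))" using cr by auto
    moreover have "cr.word (insert b A) (basis_vec {}) = cr b (cr.word A (basis_vec {}))"
      using insert by (intro cr.word_insert_min) auto
    ultimately show ?case using insert.hyps(1) by (simp add: cr_word_one)
  qed
  have "P (\<Sum>S\<in>Y. scl (f S) (basis_vec S))" if "Y \<subseteq> Pow G" for Y
  proof -
    have "finite Y" using that assms(1) finite_subset by blast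
    then show ?thesis using that
    proof (induction Y rule: finite_induct)
      case empty
      have "P (scl 0 (basis_vec {}))" by (rule scl[OF _ one]) simp
      then show ?case by (simp only: fsp.scale_zero_left sum.empty)
    next
      case (insert S Y)
      then have "P (scl (f S) (basis_vec S) + (\<Sum>S\<in>Y. scl (f S) (basis_vec S)))"
        by (intro add scl b supp_in_sum supp_in_closed) (blast intro: basis_vec_supp_in[THEN iffD2])+
      then show ?case by (subst sum.insert[OF insert.hyps])
    qed
  qed
  then show ?thesis using vec_expand[OF assms(1,2)] by force
qed

text \<open>From here on vectors are handled as elements of a module, and evaluation at a set is
  requested explicitly.\<close>

lemmas pointwise = scl_apply plus_fun_apply zero_fun_apply minus_apply uminus_apply

declare pointwise [simp del]

section \<open>The commutative ring of even elements\<close>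

text \<open>Even elements commute. As a type of class \<open>comm_ring_1\<close> they admit ordinary
  ring arithmetic and unordered products, which anticommuting operators do not. Finiteness of the
  sets in the support makes the unit neutral; the indices are unbounded, so a spare index 0 is
  available.\<close>

typedef ev = "{f :: vec. \<forall>S. f S \<noteq> 0 \<longrightarrow> finite S \<and> even (card S)}"
  by (intro exI[of _ 0]) (simp add: pointwise)

setup_lifting type_definition_ev

lemma ext_mult_even:
  assumes "\<And>S. f S \<noteq> 0 \<Longrightarrow> finite S \<and> even (card S)" "\<And>S. g S \<noteq> 0 \<Longrightarrow> finite S \<and> even (card S)"
    and "ext_mult f g U \<noteq> 0"
  shows "finite U \<and> even (card U)"
proof -
  from assms(3) obtain S where S: "S \<in> Pow U" "merge_sign S (U - S) * f S * g (U - S) \<noteq> 0"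
    unfolding ext_mult_def using sum.neutral by meson
  then have "finite S \<and> even (card S)" "finite (U - S) \<and> even (card (U - S))"
    using assms(1)[of S] assms(2)[of "U - S"] by auto
  then have f: "finite S" "finite (U - S)" and e: "even (card S + card (U - S))" by (blast, blast, simp)
  have "card (S \<union> (U - S)) = card S + card (U - S)" by (rule card_Un_disjoint) (use f in auto)
  moreover have "S \<union> (U - S) = U" using S(1) by blast
  ultimately show ?thesis using f e by (metis finite_Un)
qed

lemma ext_mult_commute_even:
  assumes "\<And>S. f S \<noteq> 0 \<Longrightarrow> even (card S)"
  shows "ext_mult f g = ext_mult g f"
proof
  fix U
  show "ext_mult f g U = ext_mult g f U"
    unfolding ext_mult_swap[of f] unfolding ext_mult_def
  proof (rule sum.cong[OF refl])
    fix S
    show "(- 1) ^ (card S * card (U - S)) * merge_sign S (U - S) * g S * f (U - S) =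
      merge_sign S (U - S) * g S * f (U - S)"
      using assms[of "U - S"] by (cases "f (U - S) = 0") auto
  qed
qed

instantiation ev :: comm_ring_1
begin

lift_definition zero_ev :: ev is 0 by (simp add: pointwise)
lift_definition one_ev :: ev is "basis_vec {}" by (simp add: basis_vec_def)
lift_definition plus_ev :: "ev \<Rightarrow> ev \<Rightarrow> ev" is "(+)" by (simp only: pointwise) (metis add.right_neutral)
lift_definition uminus_ev :: "ev \<Rightarrow> ev" is uminus by (simp add: pointwise)
lift_definition minus_ev :: "ev \<Rightarrow> ev \<Rightarrow> ev" is "(-)" by (simp only: pointwise) (metis diff_zero)
lift_definition times_ev :: "ev \<Rightarrow> ev \<Rightarrow> ev" is ext_mult by (rule ext_mult_even) auto

instance
proof
  fix a b c :: ev
  show "a + b + c = a + (b + c)" by transfer (rule add.assoc)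
  show "a + b = b + a" by transfer (rule add.commute)
  show "0 + a = a" by transfer (rule add_0_left)
  show "- a + a = 0" by transfer (rule left_minus)
  show "a - b = a + - b" by transfer (rule diff_conv_add_uminus)
  show "a * b * c = a * (b * c)" by transfer (rule ext_mult_assoc)
  show "a * b = b * a" by transfer (rule ext_mult_commute_even, blast)
  show "1 * a = a"
  proof transfer
    fix f :: vec assume f: "\<forall>S. f S \<noteq> 0 \<longrightarrow> finite S \<and> even (card S)"
    show "ext_mult (basis_vec {}) f = f"
      using f unfolding ext_mult_one_left fin_part_def by (intro ext) auto
  qed
  show "(a + b) * c = a * c + b * c" by transfer (rule ext_mult_add_left)
  show "(0 :: ev) \<noteq> 1"
    by transfer (metis (mono_tags, lifting) basis_vec_def of_bool_eq(2) zero_fun_apply zero_neq_one)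
qed

end

section \<open>The bracket elements and their quadratic relations\<close>

lemma cr_gen_even:
  assumes "cr g (basis_vec {h}) S \<noteq> 0" shows "finite S \<and> even (card S)"
proof -
  have S: "finite S" "g \<in> S" "S - {g} = {h}"
    using assms by (auto simp: cr_apply basis_vec_def split: if_splits)
  then have "card S = 2" using card.remove[OF S(1,2)] by simp
  then show ?thesis using S by simp
qed

text \<open>The letters \<open>(True, i)\<close> and \<open>(False, i)\<close> stand for anticommuting $x_i$ and $y_i$, and
  \<open>br i j\<close> for $x_i y_j + x_j y_i$.\<close>

lift_definition br :: "nat \<Rightarrow> nat \<Rightarrow> ev"
  is "\<lambda>i j. cr (True, i) (basis_vec {(False, j)}) + cr (True, j) (basis_vec {(False, i)})"
  by (simp only: pointwise) (metis add.right_neutral cr_gen_even)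

lift_definition pp :: "nat \<Rightarrow> ev" is "\<lambda>i. cr (True, i) (basis_vec {(False, i)})"
  using cr_gen_even by blast

context anticommuting
begin

definition brop :: "nat \<Rightarrow> nat \<Rightarrow> vec \<Rightarrow> vec"
  where "brop i j x = op (True, i) (op (False, j) x) + op (True, j) (op (False, i) x)"

text \<open>After expansion, two of the four indices carry an x-letter. Every such choice of two
  indices occurs in two of the three products, with opposite signs.\<close>

lemma brop_relation: "brop b i (brop c j x) + brop b j (brop c i x) + brop b c (brop i j x) = 0"
proof -
  have FT: "op (False, k) (op (True, l) y) = - op (True, l) (op (False, k) y)" for k l y
    by (rule anti)
  have T: "op (True, c) (op (True, b) y) = - op (True, b) (op (True, c) y)"
    "op (True, i) (op (True, b) y) = - op (True, b) (op (True, i) y)"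
    "op (True, j) (op (True, b) y) = - op (True, b) (op (True, j) y)"
    "op (True, i) (op (True, c) y) = - op (True, c) (op (True, i) y)"
    "op (True, j) (op (True, c) y) = - op (True, c) (op (True, j) y)"
    "op (True, j) (op (True, i) y) = - op (True, i) (op (True, j) y)" for y
    by (rule anti)+
  have F: "op (False, c) (op (False, b) y) = - op (False, b) (op (False, c) y)"
    "op (False, i) (op (False, b) y) = - op (False, b) (op (False, i) y)"
    "op (False, j) (op (False, b) y) = - op (False, b) (op (False, j) y)"
    "op (False, i) (op (False, c) y) = - op (False, c) (op (False, i) y)"
    "op (False, j) (op (False, c) y) = - op (False, c) (op (False, j) y)"
    "op (False, j) (op (False, i) y) = - op (False, i) (op (False, j) y)" for y
    by (rule anti)+
  show ?thesis
    unfolding brop_def op_simps FT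
    unfolding T op_simps unfolding F op_simps by simp
qed

text \<open>An even element acts through its monomials in the alphabet \<open>G\<close>; monomials
  with other letters act as zero. The alphabet is explicit since \<open>ev\<close> itself does not
  bound the indices.\<close>

definition act :: "gen set \<Rightarrow> ev \<Rightarrow> vec \<Rightarrow> vec"
  where "act G r = lift G (Rep_ev r)"

lemma lin_act: "lin (act G r)"
  unfolding act_def by (rule lin_lift)

lemma act_add: "act G (r + s) x = act G r x + act G s x"
  by (simp add: act_def plus_ev.rep_eq lift_add)

lemma act_mult: "finite G \<Longrightarrow> act G (r * s) x = act G r (act G s x)"
  by (simp add: act_def times_ev.rep_eq lift_ext_mult)

lemma act_zero [simp]: "act G 0 x = 0"
  using act_add[of G 0 0 x] by simp

lemma act_uminus: "act G (- r) x = - act G r x"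
  using act_add[of G r "- r" x] by (simp add: add_eq_0_iff)

lemma act_diff: "act G (r - s) x = act G r x - act G s x"
  using act_add[of G r "- s" x] by (simp add: act_uminus)

lemma act_sum: "act G (sum F A) x = (\<Sum>a\<in>A. act G (F a) x)"
  by (induction A rule: infinite_finite_induct) (simp_all add: act_add)

lemma act_one: "finite G \<Longrightarrow> act G 1 x = x"
  by (simp add: act_def one_ev.rep_eq lift_basis_vec)

lemma lift_cr:
  assumes "finite G" "g \<in> G" shows "lift G (cr g f) x = op g (lift G f x)"
  unfolding cr_def using assms by (simp add: lift_ext_mult lift_basis_vec)

lemma act_br:
  assumes "finite G" "(True, i) \<in> G" "(True, j) \<in> G" "(False, i) \<in> G" "(False, j) \<in> G"
  shows "act G (br i j) x = brop i j x"
  using assms by (simp add: act_def br.rep_eq lift_add lift_cr lift_basis_vec brop_def)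

lemma act_pp:
  assumes "finite G" "(True, i) \<in> G" "(False, i) \<in> G"
  shows "act G (pp i) x = op (True, i) (op (False, i) x)"
  using assms by (simp add: act_def pp.rep_eq lift_cr lift_basis_vec)

end

lemma Rep_br_mult: "Rep_ev (br i j * r) = cr.brop i j (Rep_ev r)"
proof -
  have "ext_mult (cr g (basis_vec {h})) f = cr g (cr h f)" for g h f
    by (simp add: cr_def ext_mult_assoc)
  then show ?thesis
    by (simp add: times_ev.rep_eq br.rep_eq ext_mult_add_left cr.brop_def)
qed

lemma Rep_pp_mult: "Rep_ev (pp i * r) = cr (True, i) (cr (False, i) (Rep_ev r))"
  by (simp add: times_ev.rep_eq pp.rep_eq cr_def ext_mult_assoc)

text \<open>The operator relation for the family \<open>cr\<close>, applied to the unit, which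
  recovers an element from its left multiplication.\<close>

lemma br_relation: "br b i * br c j + br b j * br c i + br b c * br i j = 0"
proof -
  have "Rep_ev (br b i * (br c j * 1) + br b j * (br c i * 1) + br b c * (br i j * 1)) = Rep_ev 0"
    unfolding plus_ev.rep_eq Rep_br_mult cr.brop_relation zero_ev.rep_eq ..
  then show ?thesis by (simp add: Rep_ev_inject)
qed

lemma br_commute: "br i j = br j i"
  by transfer (rule add.commute)

lemma br_self: "br i i = 2 * pp i"
proof -
  have "br i i = pp i + pp i" by transfer simp
  then show ?thesis by simp
qed

lemma ev_double_eq_0: "x + x = 0 \<Longrightarrow> x = (0 :: ev)"
  by transfer (simp add: fun_eq_iff pointwise)

text \<open>The bracket relation with two indices equal to \<open>k\<close>, divided by 2. Two
  brackets that share an index thus contract to one.\<close>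

lemma pp_br: "br i k * br j k = - pp k * br i j"
proof -
  have "br k i * br k j + br k j * br k i + br k k * br i j = 0" by (rule br_relation)
  then have "(br i k * br j k + pp k * br i j) + (br i k * br j k + pp k * br i j) = 0"
    by (simp add: br_self br_commute[of k] algebra_simps)
  then have "br i k * br j k + pp k * br i j = 0" by (rule ev_double_eq_0)
  then show ?thesis by (simp add: eq_neg_iff_add_eq_0)
qed

lemma pp_square: "pp k * pp k = 0"
proof -
  have "Rep_ev (pp k * (pp k * 1)) = Rep_ev 0"
    unfolding Rep_pp_mult cr.anti[of "(False, k)" "(True, k)"] cr.op_simps cr.op_square zero_ev.rep_eq by simp
  then show ?thesis by (simp add: Rep_ev_inject)
qed

text \<open>Here three of the four indices coincide, and the relation says that three times the
  product is zero.\<close>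

lemma pp_br_zero: "pp k * br i k = 0"
proof -
  have "br k k * br i k = - pp k * br k i" using pp_br[of k k i] .
  then have "pp k * br i k + pp k * br i k + pp k * br i k = 0"
    by (simp add: br_self br_commute[of k i] algebra_simps)
  moreover have "x + x + x = 0 \<Longrightarrow> x = 0" for x :: ev
    by transfer (simp add: fun_eq_iff pointwise)
  ultimately show ?thesis by blast
qed

section \<open>Bracket sums over blocks and the skein identity\<close>

definition bs :: "nat set \<Rightarrow> nat \<Rightarrow> ev"
  where "bs A i = (\<Sum>a\<in>A. br a i)"

definition bss :: "nat set \<Rightarrow> nat set \<Rightarrow> ev"
  where "bss A B = (\<Sum>b\<in>B. bs A b)"

definition qq :: "nat set \<Rightarrow> ev"
  where "qq B = (\<Sum>i\<in>B. \<Sum>j\<in>{j \<in> B. i < j}. br i j)"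

lemma qq_empty [simp]: "qq {} = 0"
  by (simp add: qq_def)

lemma qq_insert:
  assumes "finite B" "a \<notin> B" shows "qq (insert a B) = qq B + bs B a"
proof -
  have 1: "{j \<in> insert a B. a < j} = {j \<in> B. a < j}" by auto
  have 2: "(\<Sum>j\<in>{j \<in> insert a B. i < j}. br i j) = (\<Sum>j\<in>{j \<in> B. i < j}. br i j) + (if i < a then br i a else 0)"
    for i
  proof (cases "i < a")
    case True
    then have "{j \<in> insert a B. i < j} = insert a {j \<in> B. i < j}" by auto
    then show ?thesis using True assms by (simp add: add.commute)
  next
    case False
    then have "{j \<in> insert a B. i < j} = {j \<in> B. i < j}" by auto
    then show ?thesis using False by simp
  qed
  have "bs B a = (\<Sum>i\<in>B. (if a < i then br a i else 0) + (if i < a then br i a else 0))"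
    unfolding bs_def
  proof (rule sum.cong[OF refl])
    fix i assume "i \<in> B"
    then have "i < a \<or> a < i" using assms(2) by (metis linorder_neqE)
    then show "br i a = (if a < i then br a i else 0) + (if i < a then br i a else 0)"
      using br_commute[of i a] by fastforce
  qed
  also have "\<dots> = (\<Sum>j\<in>{j \<in> B. a < j}. br a j) + (\<Sum>i\<in>B. if i < a then br i a else 0)"
    using assms by (simp add: sum.distrib sum.inter_filter)
  finally have b: "bs B a = \<dots>" .
  have "qq (insert a B) = (\<Sum>j\<in>{j \<in> insert a B. a < j}. br a j) +
      (\<Sum>i\<in>B. \<Sum>j\<in>{j \<in> insert a B. i < j}. br i j)"
    unfolding qq_def by (rule sum.insert[OF assms])
  then show ?thesis unfolding 1 2 sum.distrib b by (simp add: qq_def add_ac)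
qed

lemma qq_single [simp]: "qq {a} = 0"
  using qq_insert[of "{}" a] by (simp add: bs_def)

lemma bs_insert: "finite B \<Longrightarrow> b \<notin> B \<Longrightarrow> bs (insert b B) a = br b a + bs B a"
  by (simp add: bs_def)

lemma bs_Un: "finite A \<Longrightarrow> finite B \<Longrightarrow> A \<inter> B = {} \<Longrightarrow> bs (A \<union> B) a = bs A a + bs B a"
  by (simp add: bs_def sum.union_disjoint)

lemma qq_Un:
  assumes "finite A" "finite B" "A \<inter> B = {}"
  shows "qq (A \<union> B) = qq A + qq B + bss A B"
  using assms(2,3)
proof (induction B rule: finite_induct)
  case empty
  then show ?case by (simp add: bss_def)
next
  case (insert b B)
  then have d: "A \<inter> B = {}" "b \<notin> A" by auto
  have "qq (A \<union> insert b B) = qq (A \<union> B) + bs (A \<union> B) b"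
    using insert d assms(1) by (simp add: qq_insert)
  also have "\<dots> = qq A + qq (insert b B) + bss A (insert b B)"
    using insert d assms(1) by (simp add: qq_insert bs_Un bss_def algebra_simps)
  finally show ?case .
qed

text \<open>With \<open>pp_bs_zero\<close> and \<open>pp_square\<close> this truncates every
  polynomial in the sums \<open>bs B k\<close>: a product of three of them is zero, and a product of
  two is a multiple of \<open>pp k\<close>.\<close>

lemma bs_bs: "bs A k * bs B k = - pp k * bss A B"
proof -
  have "bs A k * bs B k = (\<Sum>b\<in>B. \<Sum>a\<in>A. br a k * br b k)"
    unfolding bs_def sum_product by (rule sum.swap)
  then show ?thesis
    unfolding bss_def bs_def by (simp add: pp_br sum_distrib_left sum_negf)
qed

lemma pp_bs_zero: "pp k * bs A k = 0"
  by (simp add: bs_def sum_distrib_left pp_br_zero)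

text \<open>When \<open>i\<close> and \<open>j\<close> are split off the sums, everything cancels
  except \<open>bs b i * bs c j + bs b j * bs c i + bss b c * br i j\<close>, which is the bracket
  relation summed over all pairs from \<open>b\<close> and \<open>c\<close>.\<close>

lemma qq_skein:
  assumes "finite b" "finite c" "b \<inter> c = {}" "i \<notin> b \<union> c" "j \<notin> b \<union> c" "i \<noteq> j"
  shows "qq (insert i b) * qq (insert j c) + qq (insert j b) * qq (insert i c) + qq (b \<union> c) * qq {i, j}
    - qq b * qq (insert i (insert j c)) - qq c * qq (insert j (insert i b)) = 0"
proof -
  have q: "qq (insert i b) = qq b + bs b i" "qq (insert j c) = qq c + bs c j"
    "qq (insert j b) = qq b + bs b j" "qq (insert i c) = qq c + bs c i"
    "qq (insert i (insert j c)) = qq c + bs c j + (br j i + bs c i)"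
    "qq (insert j (insert i b)) = qq b + bs b i + (br i j + bs b j)" "qq {i, j} = br j i"
    using assms by (simp_all add: qq_insert bs_insert) (simp add: bs_def)
  have "bss b c = (\<Sum>x\<in>b. \<Sum>y\<in>c. br x y)" unfolding bss_def bs_def by (rule sum.swap)
  then have "bs b i * bs c j + bs b j * bs c i + bss b c * br i j =
      (\<Sum>x\<in>b. \<Sum>y\<in>c. br x i * br y j + br x j * br y i + br x y * br i j)"
    unfolding bs_def sum_product by (simp only: sum.distrib sum_distrib_right)
  also have "\<dots> = 0" by (simp add: br_relation)
  finally have "bs b i * bs c j + bs b j * bs c i + bss b c * br i j = 0" .
  then show ?thesis
    unfolding q qq_Un[OF assms(1-3)] by (simp add: br_commute[of j i] algebra_simps)
qed

text \<open>Since \<open>qq\<close> vanishes on a singleton, a singleton receives \<open>pp\<close>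
  instead, half of \<open>br a a\<close>. Every block then contributes one x-letter and one
  y-letter.\<close>

definition bq :: "nat set \<Rightarrow> ev"
  where "bq B = (if is_singleton B then pp (the_elem B) else qq B)"

lemma bq_single [simp]: "bq {a} = pp a"
  by (simp add: bq_def)

lemma bq_not_single: "\<not> is_singleton B \<Longrightarrow> bq B = qq B"
  by (simp add: bq_def)

section \<open>The action on the exterior algebra\<close>

lemma pc_anticommuting: "anticommuting (\<lambda>g. cr (perm_gen w g))"
  by (rule anticommuting.intro) (rule lin_cr, rule cr_anti)

interpretation pc: anticommuting "\<lambda>g. cr (perm_gen w g)" for w
  by (rule pc_anticommuting)

text \<open>Seen as a \<open>lift\<close> for the permuted family, the action inherits linearity and
  its rule for \<open>cr\<close> from the general lemmas.\<close>

lemma ext_act_lift: "ext_act n w f = pc.lift w (gens n) f (basis_vec {})"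
proof -
  have "(\<lambda>g. ext_mult (basis_vec {perm_gen w g})) = (\<lambda>g. cr (perm_gen w g))"
    by (intro ext) (simp add: cr_def)
  then show ?thesis
    by (intro ext) (simp add: ext_act_def pc.lift_def pc.word_def sum_fun_apply pointwise)
qed

lemma lin_ext_act: "lin (ext_act n w)"
  by (rule linI) (simp_all add: ext_act_lift pc.lift_add pc.lift_scl)

lemmas ext_act_simps = module_hom.add[OF lin_ext_act] module_hom.scale[OF lin_ext_act]
  module_hom.neg[OF lin_ext_act] module_hom.zero[OF lin_ext_act] module_hom.sum[OF lin_ext_act]

lemma ext_act_cr: "g \<in> gens n \<Longrightarrow> ext_act n w (cr g f) = cr (perm_gen w g) (ext_act n w f)"
  by (simp add: ext_act_lift pc.lift_cr)

lemma ext_act_one [simp]: "ext_act n w (basis_vec {}) = basis_vec {}"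
  by (simp add: ext_act_lift pc.lift_basis_vec)

lemma perm_gen_gens: "w permutes {1..n} \<Longrightarrow> g \<in> gens n \<Longrightarrow> perm_gen w g \<in> gens n"
  by (auto simp: gens_def perm_gen_def permutes_in_image simp del: atLeastAtMost_iff)

lemma perm_gen_inj: "w permutes T \<Longrightarrow> inj (perm_gen w)"
  by (auto simp: perm_gen_def inj_def dest: permutes_inj[THEN injD])

lemma ext_act_supp:
  assumes "w permutes {1..n}" "f \<in> supp_in (gens n)" shows "ext_act n w f \<in> supp_in (gens n)"
  using finite_gens assms(2)
  by (induction f rule: supp_in_induct)
    (simp_all add: ext_act_simps ext_act_cr cr_supp_in perm_gen_gens[OF assms(1)])

lemma ext_act_compose:
  assumes "w' permutes {1..n}" "f \<in> supp_in (gens n)"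
  shows "ext_act n (w \<circ> w') f = ext_act n w (ext_act n w' f)"
  using finite_gens assms(2)
proof (induction f rule: supp_in_induct)
  case (cr g f)
  have "perm_gen (w \<circ> w') g = perm_gen w (perm_gen w' g)"
    by (cases g) (simp add: perm_gen_def)
  then show ?case using cr perm_gen_gens[OF assms(1)] by (simp only: ext_act_cr)
qed (simp_all add: ext_act_simps)

lemma ext_act_id: "f \<in> supp_in (gens n) \<Longrightarrow> ext_act n id f = f"
  using finite_gens
proof (induction f rule: supp_in_induct)
  case (cr g f)
  have "perm_gen id g = g" by (cases g) (simp add: perm_gen_def)
  then show ?case using cr by (simp only: ext_act_cr)
qed (simp_all add: ext_act_simps)

lemma ext_act_mult:
  assumes "f \<in> supp_in (gens n)" "h \<in> supp_in (gens n)" "w permutes {1..n}"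
  shows "ext_act n w (ext_mult f h) = ext_mult (ext_act n w f) (ext_act n w h)"
  using finite_gens assms(1)
proof (induction f rule: supp_in_induct)
  case one
  then show ?case
    using assms(2) ext_act_supp[OF assms(3,2)] by (simp add: ext_mult_one_left supp_in_fin_part[OF finite_gens])
next
  case (cr g f)
  have "ext_mult (cr g f) h = cr g (ext_mult f h)" for g f h by (simp add: cr_def ext_mult_assoc)
  then show ?case using cr by (simp add: ext_act_cr)
qed (simp_all add: ext_act_simps ext_mult_add_left ext_mult_scl_left)

lemma ext_act_basis_vec:
  assumes "S \<subseteq> gens n" "w permutes {1..n}"
  shows "\<exists>c. ext_act n w (basis_vec S) = scl c (basis_vec (perm_gen w ` S))"
  using finite_subset[OF assms(1) finite_gens] assms(1)
proof (induction S rule: finite_linorder_min_induct)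
  case empty
  show ?case by (rule exI[of _ 1]) simp
next
  case (insert b A)
  then obtain c where c: "ext_act n w (basis_vec A) = scl c (basis_vec (perm_gen w ` A))" by auto
  have b: "b \<notin> A" using insert by blast
  have "basis_vec (insert b A) = cr b (basis_vec A)"
    using cr.word_insert_min[of A b "basis_vec {}"] insert.hyps by (simp add: cr_word_one)
  then have "ext_act n w (basis_vec (insert b A)) = scl c (cr (perm_gen w b) (basis_vec (perm_gen w ` A)))"
    using insert.prems by (simp add: ext_act_cr c cr.op_simps)
  also have "perm_gen w b \<notin> perm_gen w ` A" using b inj_image_mem_iff[OF perm_gen_inj[OF assms(2)]] by blast
  then have "scl c (cr (perm_gen w b) (basis_vec (perm_gen w ` A))) =
      scl (c * esign (perm_gen w b) (perm_gen w ` A)) (basis_vec (perm_gen w ` insert b A))"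
    using insert.hyps by (simp add: cr_basis_vec)
  finally show ?case by blast
qed

section \<open>Bihomogeneous elements\<close>

definition bideg :: "nat \<Rightarrow> nat \<Rightarrow> vec \<Rightarrow> bool"
  where "bideg a b f \<longleftrightarrow> (\<forall>S. f S \<noteq> 0 \<longrightarrow> card (S \<inter> range theta) = a \<and> card (S \<inter> range xi) = b)"

lemma ext_bihomogeneous_eq: "ext_bihomogeneous n a b = {f \<in> supp_in (gens n). bideg a b f}"
  by (simp add: ext_bihomogeneous_def bideg_def ext_alg_simps)

lemma bideg_closed:
  "bideg a b 0" "bideg a b f \<Longrightarrow> bideg a b g \<Longrightarrow> bideg a b (f + g)"
  "bideg a b f \<Longrightarrow> bideg a b (scl c f)" "bideg a b f \<Longrightarrow> bideg a b (- f)"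
  by (auto simp: bideg_def pointwise) (metis add.right_neutral)+

lemma bideg_sum: "(\<And>i. i \<in> A \<Longrightarrow> bideg a b (F i)) \<Longrightarrow> bideg a b (sum F A)"
  by (induction A rule: infinite_finite_induct) (auto intro: bideg_closed)

lemma bideg_basis_vec:
  "bideg a b (basis_vec S) \<longleftrightarrow> card (S \<inter> range theta) = a \<and> card (S \<inter> range xi) = b"
  by (auto simp: bideg_def basis_vec_def)

lemma bideg_ext_act:
  assumes "f \<in> supp_in (gens n)" "bideg a b f" "w permutes {1..n}"
  shows "bideg a b (ext_act n w f)"
proof -
  have inj: "inj_on (perm_gen w) T" for T using perm_gen_inj[OF assms(3)] inj_on_subset by blast
  have r: "perm_gen w ` S \<inter> range (Pair c) = perm_gen w ` (S \<inter> range (Pair c))" for S and c :: bool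
    by (force simp: perm_gen_def)
  have e: "ext_act n w f = (\<Sum>S\<in>Pow (gens n). scl (f S) (ext_act n w (basis_vec S)))"
    by (subst vec_expand[OF finite_gens assms(1)]) (simp add: ext_act_simps)
  have d: "bideg a b (scl (f S) (ext_act n w (basis_vec S)))" if "S \<in> Pow (gens n)" for S
  proof (cases "f S = 0")
    case True
    then show ?thesis by (simp add: bideg_closed)
  next
    case False
    have "\<exists>c. ext_act n w (basis_vec S) = scl c (basis_vec (perm_gen w ` S))"
      by (rule ext_act_basis_vec[OF PowD[OF that] assms(3)])
    then obtain c where "ext_act n w (basis_vec S) = scl c (basis_vec (perm_gen w ` S))"
      by (elim exE)
    moreover have "bideg a b (basis_vec (perm_gen w ` S))"
      using assms(2)[unfolded bideg_def, rule_format, OF False]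
      by (simp only: bideg_basis_vec r card_image[OF inj])
    ultimately show ?thesis by (simp only: bideg_closed)
  qed
  show ?thesis unfolding e by (rule bideg_sum) (rule d)
qed

lemma card_insert_range:
  "finite S \<Longrightarrow> g \<in> S \<Longrightarrow> card (S \<inter> range (Pair c)) =
    card ((S - {g}) \<inter> range (Pair c)) + of_bool (fst g = c)"
proof -
  assume S: "finite S" "g \<in> S"
  have "S \<inter> range (Pair c) = (if fst g = c then insert g ((S - {g}) \<inter> range (Pair c)) else (S - {g}) \<inter> range (Pair c))"
    using S by (cases g) auto
  then show ?thesis using S by simp
qed

lemma bideg_cr_xi: "bideg a b f \<Longrightarrow> bideg a (Suc b) (cr (xi i) f)"
  using card_insert_range[of _ "xi i"] by (auto simp: bideg_def cr_apply split: if_splits)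

lemma bideg_an_xi:
  assumes "bideg a (Suc b) f" shows "bideg a b (an (xi i) f)"
  unfolding bideg_def
proof (intro allI impI)
  fix S assume "an (xi i) f S \<noteq> 0"
  then have S: "finite S" "xi i \<notin> S" "f (insert (xi i) S) \<noteq> 0" by (auto simp: an_def split: if_splits)
  then show "card (S \<inter> range theta) = a \<and> card (S \<inter> range xi) = b"
    using assms card_insert_range[of "insert (xi i) S" "xi i" False]
      card_insert_range[of "insert (xi i) S" "xi i" True] by (auto simp: bideg_def)
qed

lemma bideg_an_theta:
  assumes "bideg (Suc a) b f" shows "bideg a b (an (theta i) f)"
  unfolding bideg_def
proof (intro allI impI)
  fix S assume "an (theta i) f S \<noteq> 0"
  then have S: "finite S" "theta i \<notin> S" "f (insert (theta i) S) \<noteq> 0" by (auto simp: an_def split: if_splits)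
  then show "card (S \<inter> range theta) = a \<and> card (S \<inter> range xi) = b"
    using assms card_insert_range[of "insert (theta i) S" "theta i" False]
      card_insert_range[of "insert (theta i) S" "theta i" True] by (auto simp: bideg_def)
qed

section \<open>The coinvariant ring\<close>

text \<open>Bijectivity comes for free: by the composition law the inverse permutation acts as the
  inverse map.\<close>

lemma sym_group_actionI:
  assumes cl: "\<And>w x. w permutes {1..n} \<Longrightarrow> x \<in> E \<Longrightarrow> \<rho> w x \<in> E"
    and id: "\<And>x. x \<in> E \<Longrightarrow> \<rho> id x = x"
    and comp: "\<And>v w x. v permutes {1..n} \<Longrightarrow> w permutes {1..n} \<Longrightarrow> x \<in> E \<Longrightarrow> \<rho> (v \<circ> w) x = \<rho> v (\<rho> w x)"
  shows "group_action (sym_group n) E (\<lambda>w. restrict (\<rho> w) E)"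
proof -
  have bij: "restrict (\<rho> w) E \<in> Bij E" if w: "w permutes {1..n}" for w
  proof -
    have "bij_betw (\<rho> w) E E"
    proof (rule bij_betw_byWitness[where f' = "\<rho> (Hilbert_Choice.inv w)"])
      show "\<forall>x\<in>E. \<rho> (Hilbert_Choice.inv w) (\<rho> w x) = x"
        using comp[OF permutes_inv[OF w] w] id by (simp add: permutes_inv_o[OF w])
      show "\<forall>x\<in>E. \<rho> w (\<rho> (Hilbert_Choice.inv w) x) = x"
        using comp[OF w permutes_inv[OF w]] id by (simp add: permutes_inv_o[OF w])
    qed (use cl w permutes_inv[OF w] in auto)
    then show ?thesis by (simp add: Bij_def)
  qed
  have "group_hom (sym_group n) (BijGroup E) (\<lambda>w. restrict (\<rho> w) E)"
  proof (intro group_hom.intro group_hom_axioms.intro homI)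
    show "group (sym_group n)" by (rule sym_group_is_group)
    show "group (BijGroup E)" by (rule group_BijGroup)
    fix v assume v: "v \<in> carrier (sym_group n)"
    then show "restrict (\<rho> v) E \<in> carrier (BijGroup E)" using bij by (simp add: BijGroup_def sym_group_def)
    fix w assume w: "w \<in> carrier (sym_group n)"
    have "restrict (\<rho> (v \<circ> w)) E = compose E (restrict (\<rho> v) E) (restrict (\<rho> w) E)"
      using v w comp cl by (auto simp: compose_def sym_group_def fun_eq_iff)
    then show "restrict (\<rho> (v \<otimes>\<^bsub>sym_group n\<^esub> w)) E =
        restrict (\<rho> v) E \<otimes>\<^bsub>BijGroup E\<^esub> restrict (\<rho> w) E"
      using v w bij by (simp add: BijGroup_def sym_group_def)
  qed
  then show ?thesis by (rule group_action.intro)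
qed

lemma complex_field_simps: "carrier complex_field = UNIV" "add complex_field = (+)"
  "monoid.mult complex_field = (*)" "one complex_field = 1"
  by (simp_all add: ring_of_type_algebra_def)

lemma cring_complex_field: "cring complex_field"
  by (rule cring_from_type_algebra)

lemma ideal_coinvariant: "ideal (coinvariant_ideal n) (ext_alg n)"
proof -
  interpret ring "ext_alg n" by (rule ring_ext_alg)
  show ?thesis unfolding coinvariant_ideal_def
    by (rule genideal_ideal) (auto simp: positive_invariants_def)
qed

lemma positive_invariants_subset: "positive_invariants n \<subseteq> coinvariant_ideal n"
proof -
  interpret ring "ext_alg n" by (rule ring_ext_alg)
  show ?thesis unfolding coinvariant_ideal_def
    by (rule genideal_self) (auto simp: positive_invariants_def)
qed

lemma coinvariant_idealD: "x \<in> coinvariant_ideal n \<Longrightarrow> x \<in> supp_in (gens n)"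
  using ideal.Icarr[OF ideal_coinvariant] by (simp add: ext_alg_simps)

lemma coinvariant_ideal_closed:
  "0 \<in> coinvariant_ideal n"
  "x \<in> coinvariant_ideal n \<Longrightarrow> y \<in> coinvariant_ideal n \<Longrightarrow> x + y \<in> coinvariant_ideal n"
  "x \<in> coinvariant_ideal n \<Longrightarrow> f \<in> supp_in (gens n) \<Longrightarrow> ext_mult f x \<in> coinvariant_ideal n"
  "x \<in> coinvariant_ideal n \<Longrightarrow> f \<in> supp_in (gens n) \<Longrightarrow> ext_mult x f \<in> coinvariant_ideal n"
  using additive_subgroup.zero_closed[OF ideal.axioms(1)[OF ideal_coinvariant[of n]]]
    additive_subgroup.a_closed[OF ideal.axioms(1)[OF ideal_coinvariant[of n]]]
    ideal.I_l_closed[OF ideal_coinvariant[of n]] ideal.I_r_closed[OF ideal_coinvariant[of n]]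
  by (auto simp: ext_alg_simps)

lemma coinvariant_ideal_scl:
  assumes "x \<in> coinvariant_ideal n" shows "scl c x \<in> coinvariant_ideal n"
proof -
  have "ext_mult (scl c (basis_vec {})) x \<in> coinvariant_ideal n"
    by (rule coinvariant_ideal_closed) (use assms in simp_all)
  then show ?thesis using coinvariant_idealD[OF assms]
    by (simp add: ext_mult_scl_left ext_mult_one_left supp_in_fin_part[OF finite_gens])
qed

lemma coinvariant_ideal_uminus: "x \<in> coinvariant_ideal n \<Longrightarrow> - x \<in> coinvariant_ideal n"
  using coinvariant_ideal_scl[of x n "- 1"] by simp

lemma ideal_ext_algI:
  assumes "J \<subseteq> supp_in (gens n)" "0 \<in> J" "\<And>x y. x \<in> J \<Longrightarrow> y \<in> J \<Longrightarrow> x + y \<in> J"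
    "\<And>x. x \<in> J \<Longrightarrow> - x \<in> J"
    "\<And>x f. x \<in> J \<Longrightarrow> f \<in> supp_in (gens n) \<Longrightarrow> ext_mult f x \<in> J"
    "\<And>x f. x \<in> J \<Longrightarrow> f \<in> supp_in (gens n) \<Longrightarrow> ext_mult x f \<in> J"
  shows "ideal J (ext_alg n)"
proof (rule idealI[OF ring_ext_alg])
  interpret ring "ext_alg n" by (rule ring_ext_alg)
  have inv: "\<ominus>\<^bsub>ext_alg n\<^esub> x = - x" if "x \<in> J" for x
    by (rule minus_equality) (use that assms(1) in \<open>auto simp: ext_alg_simps\<close>)
  show "subgroup J (add_monoid (ext_alg n))"
    by (rule add.subgroupI) (use assms inv in \<open>auto simp: ext_alg_simps a_inv_def[symmetric]\<close>)
qed (use assms in \<open>auto simp: ext_alg_simps\<close>)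

lemma coinvariant_ideal_minimal:
  assumes "ideal J (ext_alg n)" "positive_invariants n \<subseteq> J"
  shows "coinvariant_ideal n \<subseteq> J"
proof -
  interpret ring "ext_alg n" by (rule ring_ext_alg)
  show ?thesis unfolding coinvariant_ideal_def using assms by (rule genideal_minimal)
qed

text \<open>The elements that \<open>w\<close> maps into the coinvariant ideal form an ideal
  containing all positive invariants, so minimality applies.\<close>

lemma ext_act_coinvariant_ideal:
  assumes w: "w permutes {1..n}" and "x \<in> coinvariant_ideal n"
  shows "ext_act n w x \<in> coinvariant_ideal n"
proof -
  let ?J = "{x \<in> supp_in (gens n). ext_act n w x \<in> coinvariant_ideal n}"
  have "ideal ?J (ext_alg n)"
    by (rule ideal_ext_algI)
       (auto simp: ext_act_simps ext_act_mult[OF _ _ w] ext_act_supp[OF w] ext_mult_supp_in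
          intro: coinvariant_ideal_closed coinvariant_ideal_uminus)
  moreover have "x \<in> ?J" if x: "x \<in> positive_invariants n" for x
  proof -
    have "x \<in> supp_in (gens n)" "ext_act n w x = x"
      using x w by (simp_all add: positive_invariants_def ext_alg_simps sym_group_def)
    moreover have "x \<in> coinvariant_ideal n" using x positive_invariants_subset by blast
    ultimately show ?thesis by simp
  qed
  ultimately show ?thesis using coinvariant_ideal_minimal[of ?J n] assms(2) by blast
qed

definition cst :: "nat \<Rightarrow> vec \<Rightarrow> vec set"
  where "cst n x = coinvariant_ideal n +>\<^bsub>ext_alg n\<^esub> x"

lemma cst_eq: "cst n x = (\<lambda>i. i + x) ` coinvariant_ideal n"
  by (auto simp: cst_def a_r_coset_def r_coset_def ext_alg_simps)

lemma cst_eq_iff: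
  assumes "x \<in> supp_in (gens n)" "y \<in> supp_in (gens n)"
  shows "cst n x = cst n y \<longleftrightarrow> x - y \<in> coinvariant_ideal n"
proof
  assume "cst n x = cst n y"
  moreover have "x \<in> cst n x" unfolding cst_eq
    by (rule image_eqI[of _ _ 0]) (simp_all add: coinvariant_ideal_closed)
  ultimately obtain i where "i \<in> coinvariant_ideal n" "x = i + y" unfolding cst_eq by blast
  then show "x - y \<in> coinvariant_ideal n" by simp
next
  assume d: "x - y \<in> coinvariant_ideal n"
  have "i + x \<in> cst n y" if "i \<in> coinvariant_ideal n" for i
    unfolding cst_eq by (rule image_eqI[of _ _ "i + (x - y)"]) (use that d in \<open>simp_all add: coinvariant_ideal_closed\<close>)
  moreover have "i + y \<in> cst n x" if "i \<in> coinvariant_ideal n" for i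
    unfolding cst_eq by (rule image_eqI[of _ _ "i + - (x - y)"])
      (use that d in \<open>simp_all only: coinvariant_ideal_closed coinvariant_ideal_uminus\<close>, simp)
  ultimately show "cst n x = cst n y" unfolding cst_eq[of n x] cst_eq[of n y] by (metis (no_types, lifting) cst_eq image_subsetI subset_antisym)
qed

text \<open>The cosets in the union all coincide, because the ideal is closed under scalars.\<close>

lemma cst_smult:
  assumes "x \<in> supp_in (gens n)"
  shows "(\<Union>y\<in>cst n x. coinvariant_ideal n +>\<^bsub>ext_alg n\<^esub> (c \<odot>\<^bsub>ext_alg n\<^esub> y)) = cst n (scl c x)"
proof -
  have "cst n (scl c y) = cst n (scl c x)" if y: "y \<in> cst n x" for y
  proof -
    obtain i where i: "i \<in> coinvariant_ideal n" "y = i + x" using y unfolding cst_eq by blast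
    then have "scl c y - scl c x = scl c i" by (simp add: fsp.scale_right_distrib)
    moreover have "y \<in> supp_in (gens n)" using i assms coinvariant_idealD by simp
    ultimately show ?thesis using i(1) assms by (simp add: cst_eq_iff coinvariant_ideal_scl)
  qed
  moreover have "x \<in> cst n x" unfolding cst_eq
    by (rule image_eqI[of _ _ 0]) (simp_all add: coinvariant_ideal_closed)
  ultimately show ?thesis unfolding ext_alg_simps cst_def[symmetric] by blast
qed

lemma FDR_component_simps:
  "carrier (FDR_component n a b) = cst n ` ext_bihomogeneous n a b"
  "ring.zero (FDR_component n a b) = cst n 0"
  "x \<in> supp_in (gens n) \<Longrightarrow> y \<in> supp_in (gens n) \<Longrightarrow> cst n x \<oplus>\<^bsub>FDR_component n a b\<^esub> cst n y = cst n (x + y)"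
  "x \<in> supp_in (gens n) \<Longrightarrow> c \<odot>\<^bsub>FDR_component n a b\<^esub> cst n x = cst n (scl c x)"
  using ideal.a_rcos_sum[OF ideal_coinvariant, of x n y] cst_smult[of x n c]
  by (auto simp: FDR_component_def FDR_def ring.extend_def FactRing_def ext_alg_simps cst_def)
    (auto simp: cst_def[symmetric] cst_eq)

lemma FDR_act_cst:
  assumes w: "w permutes {1..n}" and x: "x \<in> supp_in (gens n)"
  shows "FDR_act n w (cst n x) = cst n (ext_act n w x)"
proof -
  have inv: "ext_act n w (ext_act n (Hilbert_Choice.inv w) i) = i" if "i \<in> coinvariant_ideal n" for i
    using ext_act_compose[OF permutes_inv[OF w] coinvariant_idealD[OF that], of w] that
    by (simp add: permutes_inv_o[OF w] ext_act_id coinvariant_idealD)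
  have "i + ext_act n w x \<in> ext_act n w ` cst n x" if i: "i \<in> coinvariant_ideal n" for i
    by (rule image_eqI[of _ _ "ext_act n (Hilbert_Choice.inv w) i + x"])
      (use i inv ext_act_coinvariant_ideal[OF permutes_inv[OF w] i] in \<open>auto simp: ext_act_simps cst_eq\<close>)
  moreover have "ext_act n w ` cst n x \<subseteq> cst n (ext_act n w x)"
    using ext_act_coinvariant_ideal[OF w] by (auto simp: cst_eq ext_act_simps)
  ultimately show ?thesis unfolding FDR_act_def cst_eq[of n "ext_act n w x"] by blast
qed

lemma sym_group_module_FDR_component: "sym_group_module n (FDR_component n a b) (FDR_act n)"
proof -
  let ?M = "FDR_component n a b"
  have bh: "x \<in> supp_in (gens n)" if "x \<in> ext_bihomogeneous n a b" for x
    using that by (simp add: ext_bihomogeneous_eq)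
  have cl: "0 \<in> ext_bihomogeneous n a b"
    "x \<in> ext_bihomogeneous n a b \<Longrightarrow> y \<in> ext_bihomogeneous n a b \<Longrightarrow> x + y \<in> ext_bihomogeneous n a b"
    "x \<in> ext_bihomogeneous n a b \<Longrightarrow> scl c x \<in> ext_bihomogeneous n a b"
    "x \<in> ext_bihomogeneous n a b \<Longrightarrow> - x \<in> ext_bihomogeneous n a b"
    "w permutes {1..n} \<Longrightarrow> x \<in> ext_bihomogeneous n a b \<Longrightarrow> ext_act n w x \<in> ext_bihomogeneous n a b" for x y c w
    by (auto simp: ext_bihomogeneous_eq bideg_closed bideg_ext_act ext_act_supp)
  note s = FDR_component_simps bh cl FDR_act_cst ext_act_supp
  have "abelian_group ?M"
  proof (rule abelian_groupI)
    fix x assume "x \<in> carrier ?M"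
    then obtain f where f: "x = cst n f" "f \<in> ext_bihomogeneous n a b" by (auto simp: s)
    show "\<exists>y\<in>carrier ?M. y \<oplus>\<^bsub>?M\<^esub> x = \<zero>\<^bsub>?M\<^esub>"
      by (rule bexI[of _ "cst n (- f)"]) (use f in \<open>auto simp: s\<close>)
  qed (auto simp: s add_ac)
  then have "module complex_field ?M"
    by (intro moduleI cring_complex_field)
      (auto simp: s complex_field_simps fsp.scale_left_distrib fsp.scale_right_distrib)
  moreover have "group_action (sym_group n) (carrier ?M) (\<lambda>w. restrict (FDR_act n w) (carrier ?M))"
  proof (rule sym_group_actionI)
    fix v w x assume vw: "v permutes {1..n}" "w permutes {1..n}" and "x \<in> carrier ?M"
    then obtain f where f: "x = cst n f" "f \<in> ext_bihomogeneous n a b" by (auto simp: s)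
    show "FDR_act n (v \<circ> w) x = FDR_act n v (FDR_act n w x)"
      using vw bh[OF f(2)]
      by (simp only: f(1) FDR_act_cst permutes_compose ext_act_compose ext_act_supp)
  next
    fix x assume "x \<in> carrier ?M"
    then obtain f where f: "x = cst n f" "f \<in> ext_bihomogeneous n a b" by (auto simp: s)
    then show "FDR_act n id x = x"
      using bh[OF f(2)] by (simp only: FDR_act_cst permutes_id ext_act_id)
  qed (auto simp: s)
  moreover have "linear_map ?M ?M (FDR_act n w)" if "w \<in> carrier (sym_group n)" for w
    using that by (auto simp: linear_map_def sym_group_def s ext_act_simps)
  ultimately show ?thesis by (simp add: sym_group_module_def)
qed

section \<open>Noncrossing partitions and the skein resolution\<close>

text \<open>\<open>E\<close> lies in a single gap of \<open>D\<close>, where the two outer sides of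
  \<open>D\<close> count as one gap. In this form noncrossing is easy to preserve when a block is
  enlarged by a neighbour of one of its points; for disjoint sets the relation is symmetric.\<close>

definition sep :: "nat set \<Rightarrow> nat set \<Rightarrow> bool"
  where "sep D E \<longleftrightarrow> (\<forall>x\<in>D. \<forall>z\<in>D. \<forall>y\<in>E. \<forall>w\<in>E. x < y \<and> y < z \<longrightarrow> x < w \<and> w < z)"

lemma sepD: "sep D E \<Longrightarrow> x \<in> D \<Longrightarrow> z \<in> D \<Longrightarrow> y \<in> E \<Longrightarrow> w \<in> E \<Longrightarrow> x < y \<Longrightarrow> y < z \<Longrightarrow> x < w \<and> w < z"
  unfolding sep_def by blast

lemma sep_subset: "sep D E \<Longrightarrow> D' \<subseteq> D \<Longrightarrow> E' \<subseteq> E \<Longrightarrow> sep D' E'"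
  unfolding sep_def by (meson subsetD)

lemma sep_sym:
  assumes "sep D E" "D \<inter> E = {}" shows "sep E D"
  unfolding sep_def
proof (intro ballI impI)
  fix y w x z assume m: "y \<in> E" "w \<in> E" "x \<in> D" "z \<in> D" and o: "y < x \<and> x < w"
  have ne: "z \<noteq> y" "z \<noteq> w" using m assms(2) by auto
  have "\<not> z < y" using sepD[OF assms(1), of z x y w] m o by auto
  moreover have "\<not> w < z" using sepD[OF assms(1), of x z w y] m o by auto
  ultimately show "y < z \<and> z < w" using ne by linarith
qed

lemma noncrossing_iff_sep:
  assumes "partition_on A \<pi>"
  shows "noncrossing \<pi> \<longleftrightarrow> (\<forall>D\<in>\<pi>. \<forall>E\<in>\<pi>. D \<noteq> E \<longrightarrow> sep D E)"
proof
  assume nc: "noncrossing \<pi>"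
  show "\<forall>D\<in>\<pi>. \<forall>E\<in>\<pi>. D \<noteq> E \<longrightarrow> sep D E"
    unfolding sep_def
  proof (intro ballI impI)
    fix D E x z y w
    assume m: "D \<in> \<pi>" "E \<in> \<pi>" "D \<noteq> E" "x \<in> D" "z \<in> D" "y \<in> E" "w \<in> E" and o: "x < y \<and> y < z"
    have "D \<inter> E = {}" using assms m unfolding partition_on_def disjoint_def by blast
    then have ne: "w \<noteq> x" "w \<noteq> z" using m by auto
    have "\<not> w < x" using nc m o unfolding noncrossing_def by metis
    moreover have "\<not> z < w" using nc m o unfolding noncrossing_def by metis
    ultimately show "x < w \<and> w < z" using ne by linarith
  qed
next
  assume s: "\<forall>D\<in>\<pi>. \<forall>E\<in>\<pi>. D \<noteq> E \<longrightarrow> sep D E"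
  show "noncrossing \<pi>"
    unfolding noncrossing_def
  proof (intro ballI impI)
    fix B C a c b d
    assume m: "B \<in> \<pi>" "C \<in> \<pi>" "a \<in> B" "c \<in> B" "b \<in> C" "d \<in> C" and o: "a < b \<and> b < c \<and> c < d"
    show "B = C"
    proof (rule ccontr)
      assume "B \<noteq> C"
      then have "sep B C" using s m by blast
      from sepD[OF this m(3,4,5,6)] o show False by simp
    qed
  qed
qed

lemma partition_replace_two:
  assumes "partition_on A \<pi>" "Y \<in> \<pi>" "Z \<in> \<pi>" "Y \<noteq> Z" "U \<union> V = Y \<union> Z" "U \<inter> V = {}" "U \<noteq> {}" "V \<noteq> {}"
  shows "partition_on A (\<pi> - {Y, Z} \<union> {U, V})" "U \<notin> \<pi> - {Y, Z}" "V \<notin> \<pi> - {Y, Z}" "U \<noteq> V"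
proof -
  have disj: "D \<inter> E = {}" if "D \<in> \<pi>" "E \<in> \<pi>" "D \<noteq> E" for D E
    using assms(1) that unfolding partition_on_def disjoint_def by blast
  have D: "D \<inter> (U \<union> V) = {}" if "D \<in> \<pi> - {Y, Z}" for D
    using disj[of D Y] disj[of D Z] that assms(2,3,5) by auto
  show "U \<notin> \<pi> - {Y, Z}" "V \<notin> \<pi> - {Y, Z}" "U \<noteq> V" using D assms(6-8) by blast+
  have un: "\<Union> \<pi> = A" and ne: "{} \<notin> \<pi>" using assms(1) unfolding partition_on_def by auto
  have "\<Union> (\<pi> - {Y, Z} \<union> {U, V}) = \<Union> (\<pi> - {Y, Z}) \<union> (Y \<union> Z)" using assms(5) by auto
  also have "\<dots> = A" using un assms(2,3) by auto
  finally have "\<Union> (\<pi> - {Y, Z} \<union> {U, V}) = A" .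
  moreover have "disjoint (\<pi> - {Y, Z} \<union> {U, V})"
    unfolding disjoint_def
  proof (intro ballI impI)
    fix D E assume DE: "D \<in> \<pi> - {Y, Z} \<union> {U, V}" "E \<in> \<pi> - {Y, Z} \<union> {U, V}" "D \<noteq> E"
    have UV: "B \<subseteq> U \<union> V" if "B \<in> {U, V}" for B using that by auto
    show "D \<inter> E = {}"
    proof (cases "D \<in> {U, V}")
      case True
      then show ?thesis
        using UV[OF True] D[of E] DE(2,3) assms(6) by (cases "E \<in> {U, V}") (elim insertE emptyE, simp_all add: Int_commute, blast)
    next
      case False
      then have d: "D \<in> \<pi> - {Y, Z}" using DE(1) by (simp only: Un_iff simp_thms)
      show ?thesis
      proof (cases "E \<in> {U, V}")
        case True
        then show ?thesis using UV[OF True] D[OF d] by blast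
      next
        case False
        then have "E \<in> \<pi> - {Y, Z}" using DE(2) by (simp only: Un_iff simp_thms)
        then have "E \<in> \<pi>" "D \<in> \<pi>" using d by (simp_all only: Diff_iff)
        then show ?thesis using disj DE(3) by (simp only: simp_thms)
      qed
    qed
  qed
  ultimately show "partition_on A (\<pi> - {Y, Z} \<union> {U, V})"
    using ne assms(7,8) unfolding partition_on_def by auto
qed

lemma card_replace_two:
  assumes "finite \<pi>" "Y \<in> \<pi>" "Z \<in> \<pi>" "Y \<noteq> Z" "U \<notin> \<pi> - {Y, Z}" "V \<notin> \<pi> - {Y, Z}" "U \<noteq> V"
  shows "card (\<pi> - {Y, Z} \<union> {U, V}) = card \<pi>"
proof -
  have "card (\<pi> - {Y, Z} \<union> {U, V}) = card (\<pi> - {Y, Z}) + 2"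
    using assms by (subst card_Un_disjoint) auto
  moreover have "card (\<pi> - {Y, Z}) = card \<pi> - 2" using assms by (subst card_Diff_subset) auto
  moreover have "card {Y, Z} \<le> card \<pi>" using assms by (intro card_mono) auto
  ultimately show ?thesis using assms(4) by simp
qed

lemma NC_D:
  assumes "\<pi> \<in> NC n"
  shows "partition_on {1..n} \<pi>" "noncrossing \<pi>" "finite \<pi>" "\<And>B. B \<in> \<pi> \<Longrightarrow> finite B"
    "\<And>B. B \<in> \<pi> \<Longrightarrow> B \<subseteq> {1..n}" "\<And>B. B \<in> \<pi> \<Longrightarrow> B \<noteq> {}"
proof -
  show p: "partition_on {1..n} \<pi>" "noncrossing \<pi>" using assms by (auto simp: NC_def)
  show "finite \<pi>" using finite_elements[OF _ p(1)] by simp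
  show s: "B \<subseteq> {1..n}" if "B \<in> \<pi>" for B using p(1) that unfolding partition_on_def by blast
  show "finite B" if "B \<in> \<pi>" for B using s[OF that] finite_subset by blast
  show "B \<noteq> {}" if "B \<in> \<pi>" for B using p(1) that unfolding partition_on_def by blast
qed

text \<open>No other block separates the neighbours \<open>i\<close> and \<open>i + 1\<close>, so the two blocks
  containing them can be regrouped freely as long as the two new blocks do not cross each other.\<close>

lemma NC_replace_two:
  assumes "\<pi> \<in> NC n" "Y \<in> \<pi>" "Z \<in> \<pi>" "Y \<noteq> Z" "i \<in> Y" "Suc i \<in> Z"
    "U \<union> V = Y \<union> Z" "U \<inter> V = {}" "U \<noteq> {}" "V \<noteq> {}" "sep U V"
  shows "\<pi> - {Y, Z} \<union> {U, V} \<in> NC n" "card (\<pi> - {Y, Z} \<union> {U, V}) = card \<pi>"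
proof -
  note p = NC_D[OF assms(1)]
  note r = partition_replace_two[OF p(1) assms(2-4,7-10)]
  show "card (\<pi> - {Y, Z} \<union> {U, V}) = card \<pi>"
    using card_replace_two[OF p(3) assms(2-4) r(2-4)] .
  have sp: "sep D E" if "D \<in> \<pi>" "E \<in> \<pi>" "D \<noteq> E" for D E
    using p(2) noncrossing_iff_sep[OF p(1)] that by blast
  have disj: "D \<inter> E = {}" if "D \<in> \<pi> - {Y, Z} \<union> {U, V}" "E \<in> \<pi> - {Y, Z} \<union> {U, V}" "D \<noteq> E" for D E
    using r(1) that unfolding partition_on_def disjoint_def by blast
  have dis: "D \<inter> E = {}" if "D \<in> \<pi>" "E \<in> \<pi>" "D \<noteq> E" for D E
    using p(1) that unfolding partition_on_def disjoint_def by blast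
  have D: "sep D (Y \<union> Z)" if D: "D \<in> \<pi> - {Y, Z}" for D
    unfolding sep_def
  proof (intro ballI impI)
    fix x z y w assume m: "x \<in> D" "z \<in> D" "y \<in> Y \<union> Z" "w \<in> Y \<union> Z" and o: "x < y \<and> y < z"
    have n: "i \<notin> D" "Suc i \<notin> D" using dis[of D Y] dis[of D Z] D assms(2,3,5,6) by auto
    have sY: "sep D Y" "sep D Z" using sp D assms(2,3) by auto
    have i: "x < i \<and> i < z \<longleftrightarrow> x < Suc i \<and> Suc i < z"
      using n m(1,2) by (metis Suc_lessI less_SucI less_Suc_eq Suc_lessD)
    have "x < i \<and> i < z"
    proof (cases "y \<in> Y")
      case True
      then show ?thesis using sepD[OF sY(1) m(1,2) True assms(5)] o by blast
    next
      case False
      then have "y \<in> Z" using m(3) by blast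
      then show ?thesis using sepD[OF sY(2) m(1,2) _ assms(6)] o i by blast
    qed
    then show "x < w \<and> w < z"
      using sepD[OF sY(1) m(1,2) assms(5), of w] sepD[OF sY(2) m(1,2) assms(6), of w] i m(4) by blast
  qed
  have "U \<subseteq> Y \<union> Z" "V \<subseteq> Y \<union> Z" using assms(7) by auto
  then have DUV: "sep D U" "sep D V" if "D \<in> \<pi> - {Y, Z}" for D
    using sep_subset[OF D[OF that] order_refl] by simp_all
  have "sep D E" if DE: "D \<in> \<pi> - {Y, Z} \<union> {U, V}" "E \<in> \<pi> - {Y, Z} \<union> {U, V}" "D \<noteq> E" for D E
  proof -
    have "E \<inter> D = {}" using disj[OF DE(2,1)] DE(3) by (simp only: simp_thms)
    have VU: "sep V U" using sep_sym[OF assms(11,8)] .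
    show ?thesis
    proof (cases "D \<in> {U, V}")
      case True
      show ?thesis
      proof (cases "E \<in> {U, V}")
        case E: True
        then show ?thesis using True DE(3) assms(11) VU by (elim insertE emptyE) simp_all
      next
        case False
        then have "E \<in> \<pi> - {Y, Z}" using DE(2) by (simp only: Un_iff simp_thms)
        then have "sep E D" using True DUV[of E] by (elim insertE emptyE) simp_all
        then show ?thesis using \<open>E \<inter> D = {}\<close> by (rule sep_sym)
      qed
    next
      case False
      then have d: "D \<in> \<pi> - {Y, Z}" using DE(1) by (simp only: Un_iff simp_thms)
      show ?thesis
      proof (cases "E \<in> {U, V}")
        case True
        then show ?thesis using DUV[OF d] by (elim insertE emptyE) simp_all
      next
        case False
        then have "E \<in> \<pi>" "D \<in> \<pi>" using d DE(2) by (simp_all only: Un_iff simp_thms Diff_iff)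
        then show ?thesis using sp DE(3) by (simp only: simp_thms)
      qed
    qed
  qed
  then show "\<pi> - {Y, Z} \<union> {U, V} \<in> NC n"
    using r(1) noncrossing_iff_sep[OF r(1)] unfolding NC_def by blast
qed

text \<open>No point lies between neighbours, so \<open>j\<close> and \<open>k\<close> are in the
  same gap of \<open>D\<close>.\<close>

lemma sep_insert_neighbour:
  assumes "sep D E" "j \<in> E" "k \<notin> D" "j \<notin> D" "k = Suc j \<or> j = Suc k"
  shows "sep D (insert k E)"
proof -
  have j: "x < j \<and> j < z \<longleftrightarrow> x < k \<and> k < z" if "x \<in> D" "z \<in> D" for x z
  proof -
    have "x \<noteq> j" "x \<noteq> k" "z \<noteq> j" "z \<noteq> k" using that assms(3,4) by auto
    then show ?thesis using assms(5) by auto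
  qed
  show ?thesis
    unfolding sep_def
  proof (intro ballI impI)
    fix x z y w assume m: "x \<in> D" "z \<in> D" "y \<in> insert k E" "w \<in> insert k E" and o: "x < y \<and> y < z"
    have "x < j \<and> j < z"
      using m(3) sepD[OF assms(1) m(1,2) _ assms(2), of y] j[OF m(1,2)] o by blast
    then show "x < w \<and> w < z"
      using m(4) sepD[OF assms(1) m(1,2) assms(2), of w] j[OF m(1,2)] by blast
  qed
qed

lemma transpose_image:
  "i \<notin> D \<Longrightarrow> Suc i \<notin> D \<Longrightarrow> adj_transp i ` D = D"
  "i \<notin> D \<Longrightarrow> Suc i \<notin> D \<Longrightarrow> adj_transp i ` insert i D = insert (Suc i) D"
  "i \<notin> D \<Longrightarrow> Suc i \<notin> D \<Longrightarrow> adj_transp i ` insert (Suc i) D = insert i D"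
proof -
  assume D: "i \<notin> D" "Suc i \<notin> D"
  have e: "adj_transp i x = x" if "x \<in> D" for x using that D by (auto simp: transpose_def)
  then show a: "adj_transp i ` D = D" by force
  show "adj_transp i ` insert i D = insert (Suc i) D" "adj_transp i ` insert (Suc i) D = insert i D"
    unfolding image_insert a by simp_all
qed

lemma adj_transp_permutes: "1 \<le> i \<Longrightarrow> i < n \<Longrightarrow> adj_transp i permutes {1..n}"
  by (rule permutes_swap_id) auto

lemma perm_partition_partition:
  assumes "partition_on {1..n} \<pi>" "w permutes {1..n}"
  shows "partition_on {1..n} (perm_partition w \<pi>)" "card (perm_partition w \<pi>) = card \<pi>"
proof -
  have inj: "inj w" using assms(2) by (rule permutes_inj)
  have im: "w ` {1..n} = {1..n}" using assms(2) by (rule permutes_image)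
  have un: "\<Union> \<pi> = {1..n}" and dj: "disjoint \<pi>" and ne: "{} \<notin> \<pi>" using assms(1) unfolding partition_on_def by auto
  have "\<Union> (perm_partition w \<pi>) = w ` \<Union> \<pi>" unfolding perm_partition_def by blast
  then have "\<Union> (perm_partition w \<pi>) = {1..n}" using un im by simp
  moreover have "disjoint (perm_partition w \<pi>)"
    unfolding disjoint_def perm_partition_def
  proof (intro ballI impI)
    fix D E assume "D \<in> (`) w ` \<pi>" "E \<in> (`) w ` \<pi>" "D \<noteq> E"
    then obtain D' E' where d: "D = w ` D'" "E = w ` E'" "D' \<in> \<pi>" "E' \<in> \<pi>" "D' \<noteq> E'" by blast
    then have "D' \<inter> E' = {}" using dj unfolding disjoint_def by blast
    then show "D \<inter> E = {}" unfolding d image_Int[OF inj, symmetric] by simp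
  qed
  moreover have "{} \<notin> perm_partition w \<pi>" using ne unfolding perm_partition_def by auto
  ultimately show "partition_on {1..n} (perm_partition w \<pi>)" unfolding partition_on_def by blast
  have "inj_on ((`) w) \<pi>" using inj_image_eq_iff[OF inj] by (auto simp: inj_on_def)
  then show "card (perm_partition w \<pi>) = card \<pi>" unfolding perm_partition_def by (rule card_image)
qed

lemma block_of_eq:
  assumes "partition_on A \<mu>" "B \<in> \<mu>" "i \<in> B" shows "block_of \<mu> i = B"
  unfolding block_of_def
proof (rule the_equality)
  fix C assume "C \<in> \<mu> \<and> i \<in> C"
  then show "C = B" using assms unfolding partition_on_def disjoint_def by blast
qed (use assms in auto)

text \<open>In the crossing case \<open>b\<close> and \<open>c\<close> are named after \<mu>, whose
  two blocks are \<open>insert i b\<close> and \<open>insert (Suc i) c\<close>. The first resolution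
  exchanges \<open>i\<close> and \<open>i + 1\<close> back and is therefore \<pi> itself, and the
  size condition \<open>card B > 2\<close> of the definition becomes
  \<open>card b > 1\<close>.\<close>

lemma skein_gen_basis_cases:
  assumes "\<pi> \<in> NC n" "1 \<le> i" "i < n"
  defines "\<mu> \<equiv> perm_partition (adj_transp i) \<pi>"
  obtains (flip) "\<mu> \<in> NC n" "card \<mu> = card \<pi>" "skein_gen_basis i \<pi> = (\<lambda>\<nu>. - basis_vec \<mu> \<nu>)"
  | (resolve) b c \<rho> where "b \<noteq> {}" "c \<noteq> {}" "finite b" "finite c" "b \<inter> c = {}" "i \<notin> b \<union> c" "Suc i \<notin> b \<union> c"
      "finite \<rho>" "\<Union> \<rho> \<inter> (b \<union> c \<union> {i, Suc i}) = {}" "{} \<notin> \<rho>"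
      "\<pi> = \<rho> \<union> {insert (Suc i) b, insert i c}" "\<mu> = \<rho> \<union> {insert i b, insert (Suc i) c}"
      "\<rho> \<union> {b \<union> c, {i, Suc i}} \<in> NC n" "card (\<rho> \<union> {b \<union> c, {i, Suc i}}) = card \<pi>"
      "\<rho> \<union> {b, insert i (insert (Suc i) c)} \<in> NC n" "card (\<rho> \<union> {b, insert i (insert (Suc i) c)}) = card \<pi>"
      "\<rho> \<union> {c, insert (Suc i) (insert i b)} \<in> NC n" "card (\<rho> \<union> {c, insert (Suc i) (insert i b)}) = card \<pi>"
      "skein_gen_basis i \<pi> = (\<lambda>\<nu>. basis_vec \<pi> \<nu> + basis_vec (\<rho> \<union> {b \<union> c, {i, Suc i}}) \<nu>
         - (if card b > 1 then basis_vec (\<rho> \<union> {b, insert i (insert (Suc i) c)}) \<nu> else 0)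
         - (if card c > 1 then basis_vec (\<rho> \<union> {c, insert (Suc i) (insert i b)}) \<nu> else 0))"
proof -
  note p = NC_D[OF assms(1)]
  have s: "adj_transp i permutes {1..n}" using assms(2,3) by (rule adj_transp_permutes)
  note mp = perm_partition_partition[OF p(1) s, folded \<mu>_def]
  have dis: "D \<inter> E = {}" if "D \<in> \<pi>" "E \<in> \<pi>" "D \<noteq> E" for D E
    using p(1) that unfolding partition_on_def disjoint_def by blast
  show thesis
  proof (cases "noncrossing \<mu>")
    case True
    then show thesis using flip mp by (simp add: NC_def skein_gen_basis_def \<mu>_def Let_def)
  next
    case False
    have "i \<in> \<Union> \<pi>" "Suc i \<in> \<Union> \<pi>" using p(1) assms(2,3) unfolding partition_on_def by auto
    then obtain Y Z where YZ: "Y \<in> \<pi>" "i \<in> Y" "Z \<in> \<pi>" "Suc i \<in> Z" by blast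
    have im: "adj_transp i ` D = D" if "D \<in> \<pi>" "D \<noteq> Y" "D \<noteq> Z" for D
      using dis[of D Y] dis[of D Z] that YZ by (intro transpose_image(1)) auto
    have YneZ: "Y \<noteq> Z"
    proof
      assume "Y = Z"
      define D where "D = Y - {i, Suc i}"
      have Y: "Y = insert i (insert (Suc i) D)" using YZ \<open>Y = Z\<close> by (auto simp: D_def)
      have D: "adj_transp i ` D = D" by (rule transpose_image(1)) (auto simp: D_def)
      have "adj_transp i ` Y = insert (Suc i) (insert i D)" unfolding Y image_insert D by simp
      then have "adj_transp i ` Y = Y" by (simp only: Y insert_commute)
      then have im': "adj_transp i ` E = E" if "E \<in> \<pi>" for E
        using im[OF that] \<open>Y = Z\<close> by (cases "E = Y") simp_all
      have "\<mu> = \<pi>" unfolding \<mu>_def perm_partition_def using im' by (simp cong: image_cong)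
      then show False using False p(2) by simp
    qed
    define b c \<rho> where "b = Z - {Suc i}" and "c = Y - {i}" and "\<rho> = \<pi> - {Y, Z}"
    have YZd: "Y \<inter> Z = {}" using dis YZ YneZ by blast
    have Z: "Z = insert (Suc i) b" and Y: "Y = insert i c" using YZ by (auto simp: b_def c_def)
    have m: "i \<notin> b \<union> c" "Suc i \<notin> b \<union> c" "b \<inter> c = {}" using YZd YZ by (auto simp: b_def c_def)
    have fin: "finite b" "finite c" using p(4) YZ by (auto simp: b_def c_def)
    have "(`) (adj_transp i) ` \<rho> = (\<lambda>D. D) ` \<rho>"
      by (rule image_cong) (use im in \<open>auto simp: \<rho>_def\<close>)
    then have \<rho>im: "(`) (adj_transp i) ` \<rho> = \<rho>" by simp
    have pi: "\<pi> = \<rho> \<union> {Z, Y}" using YZ by (auto simp: \<rho>_def)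
    have mu: "\<mu> = \<rho> \<union> {insert i b, insert (Suc i) c}"
      unfolding \<mu>_def perm_partition_def pi image_Un \<rho>im using m by (simp add: Z Y transpose_image)
    have rep: "\<rho> \<union> {U, V} \<in> NC n" "card (\<rho> \<union> {U, V}) = card \<pi>"
      if "U \<union> V = insert i (insert (Suc i) (b \<union> c))" "U \<inter> V = {}" "U \<noteq> {}" "V \<noteq> {}" "sep U V" for U V
    proof -
      have "U \<union> V = Y \<union> Z" unfolding that(1) Y Z by auto
      from NC_replace_two[OF assms(1) YZ(1,3) YneZ YZ(2,4) this that(2-5)]
      show "\<rho> \<union> {U, V} \<in> NC n" "card (\<rho> \<union> {U, V}) = card \<pi>" by (simp_all only: \<rho>_def)
    qed
    have sYZ: "sep Y Z" "sep Z Y" using noncrossing_iff_sep[OF p(1)] p(2) YZ YneZ by auto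
    \<comment> \<open>Otherwise the block of \<open>i\<close> in \<mu> would be a singleton, which
      crosses nothing, and \<mu> would be noncrossing.\<close>
    have "b \<noteq> {}"
    proof
      assume b: "b = {}"
      have "\<rho> \<union> {{i}, insert (Suc i) c} \<in> NC n" by (rule rep) (use m b in \<open>auto simp: sep_def\<close>)
      then show False using False mu b by (simp add: NC_def)
    qed
    have "c \<noteq> {}"
    proof
      assume c: "c = {}"
      have "\<rho> \<union> {{Suc i}, insert i b} \<in> NC n" by (rule rep) (use m c in \<open>auto simp: sep_def\<close>)
      then show False using False mu c by (simp add: NC_def insert_commute)
    qed
    have "\<rho> \<union> {{i, Suc i}, b \<union> c} \<in> NC n" "card (\<rho> \<union> {{i, Suc i}, b \<union> c}) = card \<pi>"
      by (rule rep; use m \<open>b \<noteq> {}\<close> in \<open>auto simp: sep_def\<close>)+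
    then have mu2: "\<rho> \<union> {b \<union> c, {i, Suc i}} \<in> NC n" "card (\<rho> \<union> {b \<union> c, {i, Suc i}}) = card \<pi>"
      by (simp_all only: insert_commute)
    have "sep b (insert (Suc i) Y)"
      by (rule sep_insert_neighbour[where j = i]) (use m YZ sep_subset[OF sYZ(2)] in \<open>auto simp: Z\<close>)
    then have s3: "sep b (insert i (insert (Suc i) c))" by (simp add: Y insert_commute)
    have mu3: "\<rho> \<union> {b, insert i (insert (Suc i) c)} \<in> NC n"
      "card (\<rho> \<union> {b, insert i (insert (Suc i) c)}) = card \<pi>"
      by (rule rep; use m \<open>b \<noteq> {}\<close> s3 in auto)+
    have "sep c (insert i Z)"
      by (rule sep_insert_neighbour[where j = "Suc i"]) (use m YZ sep_subset[OF sYZ(1)] in \<open>auto simp: Y\<close>)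
    then have s4: "sep c (insert (Suc i) (insert i b))" by (simp add: Z insert_commute)
    have mu4: "\<rho> \<union> {c, insert (Suc i) (insert i b)} \<in> NC n"
      "card (\<rho> \<union> {c, insert (Suc i) (insert i b)}) = card \<pi>"
      by (rule rep; use m \<open>c \<noteq> {}\<close> s4 in auto)+
    have dr: "\<Union> \<rho> \<inter> (b \<union> c \<union> {i, Suc i}) = {}"
    proof -
      have "D \<inter> (Y \<union> Z) = {}" if "D \<in> \<rho>" for D using dis[of D Y] dis[of D Z] that YZ by (auto simp: \<rho>_def)
      moreover have "b \<union> c \<union> {i, Suc i} = Y \<union> Z" by (auto simp: Y Z)
      ultimately show ?thesis by blast
    qed
    have ne: "{} \<notin> \<rho>" using p(6) by (auto simp: \<rho>_def)
    have B: "block_of \<mu> i = insert i b" by (rule block_of_eq[OF mp(1)]) (simp_all add: mu)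
    have C: "block_of \<mu> (i + 1) = insert (Suc i) c" by (rule block_of_eq[OF mp(1)]) (simp_all add: mu)
    have nr: "insert i b \<notin> \<rho>" "insert (Suc i) c \<notin> \<rho>" using dr by auto
    have rest: "\<mu> - {insert i b, insert (Suc i) c} = \<rho>" unfolding mu using nr by auto
    have cb: "card (insert i b) > 2 \<longleftrightarrow> card b > 1" "card (insert (Suc i) c) > 2 \<longleftrightarrow> card c > 1"
      using m fin by auto
    have e: "insert i b - {i} = b" "insert (Suc i) c - {Suc i} = c"
      "insert (Suc i) (insert i b \<union> c) - {i, Suc i} = b \<union> c" using m by auto
    have "skein_gen_basis i \<pi> = skein_resolution i \<mu>"
      using False by (simp add: skein_gen_basis_def \<mu>_def Let_def)
    also have "\<dots> = (\<lambda>\<nu>. basis_vec \<pi> \<nu> + basis_vec (\<rho> \<union> {b \<union> c, {i, Suc i}}) \<nu>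
         - (if card b > 1 then basis_vec (\<rho> \<union> {b, insert i (insert (Suc i) c)}) \<nu> else 0)
         - (if card c > 1 then basis_vec (\<rho> \<union> {c, insert (Suc i) (insert i b)}) \<nu> else 0))"
      unfolding skein_resolution_def Let_def B C rest cb
      by (simp only: Suc_eq_plus1[symmetric] e pi Z Y Un_insert_right Un_empty_right)
    finally have sk: "skein_gen_basis i \<pi> = \<dots>" .
    show thesis
      by (rule resolve[of b c \<rho>])
        (fact \<open>b \<noteq> {}\<close> \<open>c \<noteq> {}\<close> fin m dr ne mu mu2 mu3 mu4 sk pi[unfolded Z Y] | use p(3) in \<open>simp add: \<rho>_def\<close>)+
  qed
qed

section \<open>Fermions attached to set partitions\<close>

definition op0 :: "gen \<Rightarrow> vec \<Rightarrow> vec"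
  where "op0 g = (if fst g then cr g else an g)"

lemma op0_simps [simp]: "op0 (True, i) = cr (xi i)" "op0 (False, i) = an (theta i)"
  by (simp_all add: op0_def)

lemma op0_anti: "op0 g (op0 h x) = - op0 h (op0 g x)"
proof -
  have m: "an (theta i) (cr (xi j) y) = - cr (xi j) (an (theta i) y)" for i j y by (rule an_cr_neq) simp
  have m': "cr (xi j) (an (theta i) y) = - an (theta i) (cr (xi j) y)" for i j y unfolding m by simp
  obtain c i d j where g: "g = (c, i)" "h = (d, j)" by (cases g, cases h)
  show ?thesis
    unfolding g by (cases c; cases d; simp only: op0_simps; rule cr_anti an_anti m m')
qed

interpretation o0: anticommuting op0
proof (rule anticommuting.intro)
  show "lin (op0 g)" for g by (simp add: op0_def lin_cr lin_an)
qed (rule op0_anti)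

abbreviation act0 :: "nat \<Rightarrow> ev \<Rightarrow> vec \<Rightarrow> vec"
  where "act0 n \<equiv> o0.act (gens n)"

definition dxi :: "nat \<Rightarrow> vec \<Rightarrow> vec"
  where "dxi n y = (\<Sum>j\<in>{1..n}. an (xi j) y)"

definition Theta :: "nat \<Rightarrow> vec"
  where "Theta n = basis_vec (theta ` {1..n})"

definition bprod :: "nat set set \<Rightarrow> ev"
  where "bprod \<pi> = (\<Prod>B\<in>\<pi>. bq B)"

definition fp :: "nat \<Rightarrow> nat set set \<Rightarrow> vec"
  where "fp n \<pi> = dxi n (act0 n (bprod \<pi>) (Theta n))"

lemma gens_iff [simp]: "(c, i) \<in> gens n \<longleftrightarrow> 1 \<le> i \<and> i \<le> n"
  by (cases c) (auto simp: gens_def)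

lemma lin_dxi: "lin (dxi n)"
  unfolding dxi_def by (intro lin_sum_ops lin_an)

lemmas dxi_simps = module_hom.add[OF lin_dxi] module_hom.scale[OF lin_dxi]
  module_hom.neg[OF lin_dxi] module_hom.zero[OF lin_dxi] module_hom.sum[OF lin_dxi] module_hom.diff[OF lin_dxi]

lemmas an_simps = module_hom.add[OF lin_an] module_hom.scale[OF lin_an]
  module_hom.neg[OF lin_an] module_hom.zero[OF lin_an] module_hom.sum[OF lin_an] module_hom.diff[OF lin_an]

lemma bprod_two:
  assumes "finite \<rho>" "U \<notin> \<rho>" "V \<notin> \<rho>" "U \<noteq> V"
  shows "bprod (\<rho> \<union> {U, V}) = bprod \<rho> * (bq U * bq V)"
  using assms by (simp add: bprod_def mult_ac)

text \<open>The unaffected blocks form a common factor, and what remains is \<open>qq_skein\<close>.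
  A correction term is dropped when its block \<open>b\<close> or \<open>c\<close> is a singleton;
  in \<open>qq_skein\<close> that term is present, but it has a factor \<open>qq\<close> of a
  singleton, which is zero.\<close>

lemma fp_skein:
  assumes "b \<noteq> {}" "c \<noteq> {}" "finite b" "finite c" "b \<inter> c = {}" "i \<notin> b \<union> c" "Suc i \<notin> b \<union> c"
    "finite \<rho>" "\<Union> \<rho> \<inter> (b \<union> c \<union> {i, Suc i}) = {}" "{} \<notin> \<rho>"
  shows "fp n (\<rho> \<union> {insert i b, insert (Suc i) c}) + fp n (\<rho> \<union> {insert (Suc i) b, insert i c})
    + fp n (\<rho> \<union> {b \<union> c, {i, Suc i}})
    - (if card b > 1 then fp n (\<rho> \<union> {b, insert i (insert (Suc i) c)}) else 0)
    - (if card c > 1 then fp n (\<rho> \<union> {c, insert (Suc i) (insert i b)}) else 0) = 0"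
proof -
  have ni: "U \<notin> \<rho>" if "U \<noteq> {}" "U \<subseteq> b \<union> c \<union> {i, Suc i}" for U
  proof
    assume "U \<in> \<rho>"
    then have "U \<subseteq> \<Union> \<rho> \<inter> (b \<union> c \<union> {i, Suc i})" using that(2) by blast
    then show False using that(1) assms(9) by blast
  qed
  have E: "bprod (\<rho> \<union> {U, V}) = bprod \<rho> * (bq U * bq V)"
    if "U \<noteq> {}" "V \<noteq> {}" "U \<union> V \<subseteq> b \<union> c \<union> {i, Suc i}" "U \<inter> V = {}" for U V
    using that ni[of U] ni[of V] by (intro bprod_two assms(8)) auto
  have big: "bq (insert x U) = qq (insert x U)" if "U \<noteq> {}" "x \<notin> U" for x U
    using that by (intro bq_not_single) (auto simp: is_singleton_def)
  have q12: "bq (insert i b) = qq (insert i b)" "bq (insert (Suc i) c) = qq (insert (Suc i) c)"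
    "bq (insert (Suc i) b) = qq (insert (Suc i) b)" "bq (insert i c) = qq (insert i c)"
    "bq {i, Suc i} = qq {i, Suc i}" "bq (insert i (insert (Suc i) c)) = qq (insert i (insert (Suc i) c))"
    "bq (insert (Suc i) (insert i b)) = qq (insert (Suc i) (insert i b))"
    using assms by (simp_all add: big)
  obtain x y where xy: "x \<in> b" "y \<in> c" using assms(1,2) by blast
  have q3: "bq (b \<union> c) = qq (b \<union> c)"
  proof (rule bq_not_single, rule notI)
    assume "is_singleton (b \<union> c)"
    then obtain a where a: "b \<union> c = {a}" by (auto simp: is_singleton_def)
    have "x = a" "y = a" using xy a by blast+
    then show False using xy assms(5) by blast
  qed
  have q4: "(if card d > 1 then r * (bq d * s) else 0) = r * (qq d * s)" if d: "d \<noteq> {}" "finite d" for d and r s :: ev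
  proof (cases "is_singleton d")
    case True
    then show ?thesis by (auto simp: is_singleton_def)
  next
    case False
    have "card d \<noteq> 1" using False by (simp add: is_singleton_altdef)
    moreover have "card d \<noteq> 0" using d by simp
    ultimately have "card d > 1" by linarith
    then show ?thesis unfolding bq_not_single[OF False] by (simp only: if_True)
  qed
  let ?\<mu> = "\<rho> \<union> {insert i b, insert (Suc i) c}" and ?\<mu>1 = "\<rho> \<union> {insert (Suc i) b, insert i c}"
    and ?\<mu>2 = "\<rho> \<union> {b \<union> c, {i, Suc i}}" and ?\<mu>3 = "\<rho> \<union> {b, insert i (insert (Suc i) c)}"
    and ?\<mu>4 = "\<rho> \<union> {c, insert (Suc i) (insert i b)}"
  have e: "bprod ?\<mu> = bprod \<rho> * (qq (insert i b) * qq (insert (Suc i) c))"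
    "bprod ?\<mu>1 = bprod \<rho> * (qq (insert (Suc i) b) * qq (insert i c))"
    "bprod ?\<mu>2 = bprod \<rho> * (qq (b \<union> c) * qq {i, Suc i})"
    using assms by (subst E; auto simp: q12 q3)+
  have e3: "(if card b > 1 then bprod ?\<mu>3 else 0) = bprod \<rho> * (qq b * qq (insert i (insert (Suc i) c)))"
    "(if card c > 1 then bprod ?\<mu>4 else 0) = bprod \<rho> * (qq c * qq (insert (Suc i) (insert i b)))"
    unfolding q4[OF assms(1,3), symmetric] q4[OF assms(2,4), symmetric] q12(6,7)[symmetric]
    using assms by (subst E; auto)+
  have z: "bprod ?\<mu> + bprod ?\<mu>1 + bprod ?\<mu>2 - (if card b > 1 then bprod ?\<mu>3 else 0)
    - (if card c > 1 then bprod ?\<mu>4 else 0) = 0"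
  proof -
    have "bprod ?\<mu> + bprod ?\<mu>1 + bprod ?\<mu>2 - (if card b > 1 then bprod ?\<mu>3 else 0)
      - (if card c > 1 then bprod ?\<mu>4 else 0) = bprod \<rho> * (qq (insert i b) * qq (insert (Suc i) c)
      + qq (insert (Suc i) b) * qq (insert i c) + qq (b \<union> c) * qq {i, Suc i}
      - qq b * qq (insert i (insert (Suc i) c)) - qq c * qq (insert (Suc i) (insert i b)))"
      unfolding e e3 by (simp add: algebra_simps)
    also have "\<dots> = 0" using qq_skein[OF assms(3-5), of i "Suc i"] assms(6,7) by simp
    finally show ?thesis .
  qed
  define L where "L r = dxi n (act0 n r (Theta n))" for r
  have L: "L (r + s) = L r + L s" "L (r - s) = L r - L s" "L 0 = 0" for r s
    by (simp_all add: L_def o0.act_add o0.act_diff dxi_simps)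
  have if3: "L (if P then bprod \<nu> else 0) = (if P then fp n \<nu> else 0)" for P \<nu>
    by (cases P) (simp_all only: if_True if_False L, simp only: fp_def L_def)
  have f: "fp n \<nu> = L (bprod \<nu>)" for \<nu> by (simp only: fp_def L_def)
  have "L (bprod ?\<mu> + bprod ?\<mu>1 + bprod ?\<mu>2 - (if card b > 1 then bprod ?\<mu>3 else 0)
    - (if card c > 1 then bprod ?\<mu>4 else 0)) = 0"
    unfolding z by (rule L(3))
  then show ?thesis by (simp only: L(1,2) if3 f)
qed

lemma an_supp_in:
  assumes "g \<in> G" "f \<in> supp_in G" shows "an g f \<in> supp_in G"
  unfolding supp_in_def
proof (intro CollectI allI impI)
  fix S assume "S \<notin> Pow G"
  then have "insert g S \<notin> Pow G" by blast
  then show "an g f S = 0" using assms(2) by (simp add: an_def supp_in_def)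
qed

lemma op0_supp_in: "g \<in> G \<Longrightarrow> f \<in> supp_in G \<Longrightarrow> op0 g f \<in> supp_in G"
  by (simp add: op0_def cr_supp_in an_supp_in)

lemma act0_supp_in:
  assumes "f \<in> supp_in (gens n)" shows "act0 n r f \<in> supp_in (gens n)"
proof -
  have w: "o0.word S f \<in> supp_in (gens n)" if "S \<in> Pow (gens n)" for S
  proof -
    have "finite S" "S \<subseteq> gens n" using that finite_subset[OF _ finite_gens] by auto
    then show ?thesis
    proof (induction S rule: finite_linorder_min_induct)
      case empty
      then show ?case using assms by simp
    next
      case (insert b A)
      have "o0.word (insert b A) f = op0 b (o0.word A f)"
        using insert.hyps by (intro o0.word_insert_min) auto
      then show ?case using insert by (simp add: op0_supp_in)
    qed
  qed
  show ?thesis unfolding o0.act_def o0.lift_def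
    by (intro supp_in_sum supp_in_closed w)
qed

lemma Theta_supp_in: "Theta n \<in> supp_in (gens n)"
  by (auto simp: Theta_def)

lemma dxi_supp_in: "f \<in> supp_in (gens n) \<Longrightarrow> dxi n f \<in> supp_in (gens n)"
  unfolding dxi_def by (intro supp_in_sum an_supp_in) auto

lemma fp_supp_in: "fp n \<pi> \<in> supp_in (gens n)"
  unfolding fp_def by (intro dxi_supp_in act0_supp_in Theta_supp_in)

text \<open>A contraction is not multiplication by an element, so multiplicativity of the action
  does not apply. The contraction is carried past one generator at a time by the anticommutation
  relations.\<close>

lemma ext_act_an:
  assumes w: "w permutes {1..n}" and g: "g \<in> gens n" and f: "f \<in> supp_in (gens n)"
  shows "ext_act n w (an g f) = an (perm_gen w g) (ext_act n w f)"
  using finite_gens f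
proof (induction f rule: supp_in_induct)
  case one
  have "an g (basis_vec {}) = 0" for g
    by (rule ext) (simp add: an_def basis_vec_def zero_fun_apply)
  then show ?case by (simp add: ext_act_simps)
next
  case (cr h f)
  show ?case
  proof (cases "g = h")
    case True
    have e: "an h (cr h y) = y - cr h (an h y)" if "y \<in> supp_in (gens n)" for h y
      using an_cr_same[of h y] supp_in_fin_part[OF finite_gens that] by (simp add: eq_diff_eq)
    have "ext_act n w (an g (cr h f)) = ext_act n w f - cr (perm_gen w g) (an (perm_gen w g) (ext_act n w f))"
      using cr e[OF cr(2)] True by (simp add: module_hom.diff[OF lin_ext_act] ext_act_cr)
    also have "\<dots> = an (perm_gen w g) (cr (perm_gen w g) (ext_act n w f))"
      using e[OF ext_act_supp[OF w cr(2)]] by simp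
    finally show ?thesis using True cr(1) by (simp add: ext_act_cr)
  next
    case False
    then have "perm_gen w g \<noteq> perm_gen w h" using perm_gen_inj[OF w] by (metis injD)
    then show ?thesis using False cr by (simp add: an_cr_neq ext_act_cr ext_act_simps)
  qed
qed (simp_all add: ext_act_simps an_simps)

lemma ext_act_op0:
  assumes "w permutes {1..n}" "1 \<le> i" "i \<le> n" "f \<in> supp_in (gens n)"
  shows "ext_act n w (op0 (c, i) f) = op0 (c, w i) (ext_act n w f)"
  using assms ext_act_an[OF assms(1) _ assms(4), of "theta i"] by (cases c) (simp_all add: ext_act_cr perm_gen_def)

text \<open>The relation is closed under sums and products, so equivariance of a block product
  reduces to single brackets.\<close>

definition intertwines :: "nat \<Rightarrow> (nat \<Rightarrow> nat) \<Rightarrow> ev \<Rightarrow> ev \<Rightarrow> bool"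
  where "intertwines n w r r' \<longleftrightarrow>
    (\<forall>y\<in>supp_in (gens n). ext_act n w (act0 n r y) = act0 n r' (ext_act n w y))"

lemma intertwines_closed:
  "intertwines n w 0 0" "intertwines n w 1 1"
  "intertwines n w r r' \<Longrightarrow> intertwines n w s s' \<Longrightarrow> intertwines n w (r + s) (r' + s')"
  "intertwines n w r r' \<Longrightarrow> intertwines n w s s' \<Longrightarrow> intertwines n w (r * s) (r' * s')"
  by (simp_all add: intertwines_def o0.act_add o0.act_mult o0.act_one ext_act_simps act0_supp_in)

lemma intertwines_br:
  assumes w: "w permutes {1..n}" and "i \<in> {1..n}" "j \<in> {1..n}"
  shows "intertwines n w (br i j) (br (w i) (w j))" "intertwines n w (pp i) (pp (w i))"
proof -
  have wi: "w i \<in> {1..n}" "w j \<in> {1..n}" using assms permutes_in_image[OF w] by blast+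
  have h: "ext_act n w (op0 (True, a) (op0 (False, b) y)) = op0 (True, w a) (op0 (False, w b) (ext_act n w y))"
    if "1 \<le> a" "a \<le> n" "1 \<le> b" "b \<le> n" "y \<in> supp_in (gens n)" for a b y
    using that by (simp add: ext_act_op0[OF w] op0_supp_in del: op0_simps)
  show "intertwines n w (br i j) (br (w i) (w j))" "intertwines n w (pp i) (pp (w i))"
    unfolding intertwines_def using assms(2,3) wi
    by (simp_all add: o0.act_br o0.act_pp o0.brop_def ext_act_simps h del: op0_simps)
qed

lemma intertwines_qq:
  assumes w: "w permutes {1..n}" and "finite B" "B \<subseteq> {1..n}"
  shows "intertwines n w (qq B) (qq (w ` B))"
  using assms(2,3)
proof (induction B rule: finite_induct)
  case empty
  then show ?case by (simp add: intertwines_closed)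
next
  case (insert a B)
  have inj: "inj w" using w by (rule permutes_inj)
  have bsB: "intertwines n w (bs C a) (bs (w ` C) (w a))" if "finite C" "C \<subseteq> B" for C
    using that
  proof (induction C rule: finite_induct)
    case empty
    then show ?case by (simp add: bs_def intertwines_closed)
  next
    case (insert x C)
    have "intertwines n w (br x a) (br (w x) (w a))"
      by (rule intertwines_br[OF w]) (use insert.prems \<open>insert a B \<subseteq> {1..n}\<close> in blast)+
    then show ?case using insert inj
      by (simp add: bs_insert inj_image_mem_iff intertwines_closed)
  qed
  show ?case using insert inj bsB[of B]
    by (simp add: qq_insert inj_image_mem_iff intertwines_closed)
qed

lemma intertwines_bq:
  assumes w: "w permutes {1..n}" and "finite B" "B \<subseteq> {1..n}"
  shows "intertwines n w (bq B) (bq (w ` B))"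
proof (cases "is_singleton B")
  case True
  then obtain a where B: "B = {a}" by (auto simp: is_singleton_def)
  then show ?thesis using intertwines_br(2)[OF w, of a a] assms(3) by simp
next
  case False
  have "\<not> is_singleton (w ` B)"
    using False card_image[OF inj_on_subset[OF permutes_inj[OF w]], of B] by (simp add: is_singleton_altdef)
  then show ?thesis using intertwines_qq[OF assms] False by (simp add: bq_not_single)
qed

lemma intertwines_bprod:
  assumes w: "w permutes {1..n}" and p: "partition_on {1..n} \<pi>"
  shows "intertwines n w (bprod \<pi>) (bprod (perm_partition w \<pi>))"
proof -
  have "intertwines n w (bprod \<sigma>) (\<Prod>B\<in>\<sigma>. bq (w ` B))" if "finite \<sigma>" "\<sigma> \<subseteq> \<pi>" for \<sigma>
    using that
  proof (induction \<sigma> rule: finite_induct)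
    case empty
    then show ?case by (simp add: bprod_def intertwines_closed)
  next
    case (insert B \<sigma>)
    have "B \<subseteq> {1..n}" using insert.prems p unfolding partition_on_def by blast
    moreover from this have "finite B" using finite_subset by blast
    ultimately show ?case using insert intertwines_bq[OF w]
      by (simp add: bprod_def intertwines_closed)
  qed
  from this[of \<pi>] have "intertwines n w (bprod \<pi>) (\<Prod>B\<in>\<pi>. bq (w ` B))"
    using finite_elements[OF _ p] by simp
  moreover have "inj_on ((`) w) \<pi>" using inj_image_eq_iff[OF permutes_inj[OF w]] by (auto simp: inj_on_def)
  then have "(\<Prod>B\<in>\<pi>. bq (w ` B)) = bprod (perm_partition w \<pi>)"
    by (simp add: bprod_def perm_partition_def prod.reindex)
  ultimately show ?thesis by simp
qed

lemma ext_act_dxi: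
  assumes w: "w permutes {1..n}" and "f \<in> supp_in (gens n)"
  shows "ext_act n w (dxi n f) = dxi n (ext_act n w f)"
proof -
  have "ext_act n w (dxi n f) = (\<Sum>j\<in>{1..n}. an (xi (w j)) (ext_act n w f))"
    unfolding dxi_def ext_act_simps
    by (rule sum.cong[OF refl]) (use assms in \<open>simp add: ext_act_an perm_gen_def\<close>)
  also have "\<dots> = dxi n (ext_act n w f)"
    unfolding dxi_def by (rule sum.reindex_bij_betw[OF permutes_imp_bij[OF w]])
  finally show ?thesis .
qed

lemma ext_act_basis_vec_fixed:
  assumes "S \<subseteq> gens n" "\<And>g. g \<in> S \<Longrightarrow> perm_gen w g = g"
  shows "ext_act n w (basis_vec S) = basis_vec S"
  using finite_subset[OF assms(1) finite_gens] assms
proof (induction S rule: finite_linorder_min_induct)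
  case (insert b A)
  have "basis_vec (insert b A) = cr b (basis_vec A)"
    using cr.word_insert_min[of A b "basis_vec {}"] insert.hyps by (simp add: cr_word_one)
  then show ?case using insert by (simp add: ext_act_cr)
qed simp

text \<open>Two anticommuting factors are exchanged. This sign is the source of the minus sign in
  the skein action on a partition with noncrossing image.\<close>

lemma ext_act_Theta:
  assumes "1 \<le> i" "i < n"
  shows "ext_act n (adj_transp i) (Theta n) = - Theta n"
proof -
  let ?R = "theta ` {1..n} - {theta i, theta (Suc i)}" and ?w = "adj_transp i"
  have fin: "finite ?R" by simp
  have R: "theta ` {1..n} = insert (theta i) (insert (theta (Suc i)) ?R)" using assms by auto
  have fix': "ext_act n ?w (basis_vec ?R) = basis_vec ?R"
    by (rule ext_act_basis_vec_fixed) (auto simp: gens_def perm_gen_def transpose_def split: if_splits)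
  \<comment> \<open>Here the two affected factors of \<open>Theta n\<close> stand in front, at the
    cost of the sign \<open>c\<close>.\<close>
  obtain c where c: "cr (theta i) (cr (theta (Suc i)) (basis_vec ?R)) = scl c (Theta n)" "c \<noteq> 0"
  proof
    show "cr (theta i) (cr (theta (Suc i)) (basis_vec ?R)) =
      scl (esign (theta (Suc i)) ?R * esign (theta i) (insert (theta (Suc i)) ?R)) (Theta n)"
      unfolding Theta_def by (subst (2) R) (simp add: cr_basis_vec cr.op_simps)
  qed simp
  have "scl c (ext_act n ?w (Theta n)) = ext_act n ?w (cr (theta i) (cr (theta (Suc i)) (basis_vec ?R)))"
    by (simp only: c(1) ext_act_simps)
  also have "\<dots> = cr (theta (Suc i)) (cr (theta i) (basis_vec ?R))"
    using assms fix' by (simp add: ext_act_cr perm_gen_def)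
  also have "\<dots> = - scl c (Theta n)" using c(1) cr_anti[of "theta (Suc i)" "theta i"] by simp
  finally have "scl (1 / c) (scl c (ext_act n ?w (Theta n))) = scl (1 / c) (scl c (- Theta n))" by simp
  then show ?thesis using c(2) by (simp only: fsp.scale_scale) simp
qed

lemma ext_act_fp:
  assumes "partition_on {1..n} \<pi>" "1 \<le> i" "i < n"
  shows "ext_act n (adj_transp i) (fp n \<pi>) = - fp n (perm_partition (adj_transp i) \<pi>)"
proof -
  note w = adj_transp_permutes[OF assms(2,3)]
  have "ext_act n (adj_transp i) (fp n \<pi>) =
      dxi n (ext_act n (adj_transp i) (act0 n (bprod \<pi>) (Theta n)))"
    unfolding fp_def by (rule ext_act_dxi[OF w act0_supp_in[OF Theta_supp_in]])
  also have "\<dots> = dxi n (act0 n (bprod (perm_partition (adj_transp i) \<pi>)) (ext_act n (adj_transp i) (Theta n)))"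
    by (rule arg_cong[where f = "dxi n"])
      (rule bspec[OF intertwines_bprod[OF w assms(1), unfolded intertwines_def] Theta_supp_in])
  also have "\<dots> = dxi n (- act0 n (bprod (perm_partition (adj_transp i) \<pi>)) (Theta n))"
    unfolding ext_act_Theta[OF assms(2,3)] by (rule arg_cong[where f = "dxi n"]) (rule module_hom.neg[OF o0.lin_act])
  also have "\<dots> = - fp n (perm_partition (adj_transp i) \<pi>)"
    unfolding fp_def by (rule module_hom.neg[OF lin_dxi])
  finally show ?thesis .
qed

lemma bideg_act0_br:
  assumes "bideg (Suc a) b y" "i \<in> {1..n}" "j \<in> {1..n}"
  shows "bideg a (Suc b) (act0 n (br i j) y)" "bideg a (Suc b) (act0 n (pp i) y)"
  using assms by (auto simp: o0.act_br o0.act_pp o0.brop_def intro!: bideg_closed bideg_cr_xi bideg_an_theta)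

lemma bideg_act0_bq:
  assumes "bideg (Suc a) b y" "B \<subseteq> {1..n}"
  shows "bideg a (Suc b) (act0 n (bq B) y)"
proof (cases "is_singleton B")
  case True
  then show ?thesis using assms bideg_act0_br(2)[OF assms(1)] by (auto simp: is_singleton_def)
next
  case False
  have "bideg a (Suc b) (act0 n (br i j) y)" if "i \<in> B" "j \<in> B" for i j
    by (rule bideg_act0_br(1)[OF assms(1)]) (use that assms(2) in blast)+
  then show ?thesis using False by (auto simp: bq_not_single qq_def o0.act_sum intro!: bideg_sum)
qed

text \<open>Starting from bidegree \<open>(n, 0)\<close>, every block factor trades a theta for a
  xi, and the final \<open>dxi\<close> removes one xi.\<close>

lemma bideg_fp:
  assumes p: "partition_on {1..n} \<pi>" "card \<pi> = Suc k" "Suc k \<le> n"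
  shows "bideg (n - Suc k) k (fp n \<pi>)"
proof -
  have fin: "finite \<pi>" using finite_elements[OF _ p(1)] by simp
  have "bideg (n - card \<sigma>) (card \<sigma>) (act0 n (bprod \<sigma>) (Theta n))" if "finite \<sigma>" "\<sigma> \<subseteq> \<pi>" for \<sigma>
    using that
  proof (induction \<sigma> rule: finite_induct)
    case empty
    have "theta ` {1..n} \<inter> range theta = theta ` {1..n}" "theta ` {1..n} \<inter> range xi = {}" by auto
    then show ?case
      by (simp add: bprod_def o0.act_one Theta_def bideg_basis_vec card_image inj_on_def)
  next
    case (insert B \<sigma>)
    have "card (insert B \<sigma>) \<le> n" using card_mono[OF fin insert.prems] p(2,3) by simp
    then have n: "n - card \<sigma> = Suc (n - card (insert B \<sigma>))" using insert.hyps by simp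
    have "B \<subseteq> {1..n}" using insert.prems p(1) unfolding partition_on_def by blast
    then have "bideg (n - card (insert B \<sigma>)) (Suc (card \<sigma>)) (act0 n (bq B) (act0 n (bprod \<sigma>) (Theta n)))"
      using insert n by (intro bideg_act0_bq) auto
    then show ?case using insert.hyps by (simp add: bprod_def o0.act_mult)
  qed
  from this[of \<pi>] fin p(2) have "bideg (n - Suc k) (Suc k) (act0 n (bprod \<pi>) (Theta n))" by simp
  then show ?thesis unfolding fp_def dxi_def by (intro bideg_sum bideg_an_xi)
qed

section \<open>Adjacent transpositions\<close>

definition tword :: "nat list \<Rightarrow> nat \<Rightarrow> nat"
  where "tword is = foldr (\<lambda>i u. adj_transp i \<circ> u) is id"

lemma tword_simps [simp]: "tword [] = id" "tword (i # is) = adj_transp i \<circ> tword is"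
  by (simp_all add: tword_def)

lemma tword_append: "tword (is @ js) = tword is \<circ> tword js"
  by (induction "is") (auto simp: comp_assoc)

lemma tword_transpose:
  assumes "1 \<le> a" "a < b" "b \<le> n"
  shows "\<exists>is. set is \<subseteq> {1..<n} \<and> tword is = Transposition.transpose a b"
  using assms(2,3)
proof (induction b)
  case (Suc b)
  show ?case
  proof (cases "a = b")
    case True
    then show ?thesis using Suc.prems assms(1) by (intro exI[of _ "[a]"]) auto
  next
    case False
    then obtain "is" where i: "set is \<subseteq> {1..<n}" "tword is = Transposition.transpose a b"
      using Suc by auto
    have "Transposition.transpose a (Suc b) = adj_transp b \<circ> Transposition.transpose a b \<circ> adj_transp b"
      using False Suc.prems by (auto simp: fun_eq_iff transpose_def)
    then have "tword (b # is @ [b]) = Transposition.transpose a (Suc b)"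
      using i by (simp add: tword_append comp_assoc)
    moreover have "set (b # is @ [b]) \<subseteq> {1..<n}" using i Suc.prems assms(1) False by auto
    ultimately show ?thesis by blast
  qed
qed simp

lemma permutes_tword:
  assumes "w permutes {1..n}"
  shows "\<exists>is. set is \<subseteq> {1..<n} \<and> tword is = w"
  using assms finite_atLeastAtMost
proof (induction w rule: permutes_induct)
  case id
  then show ?case by (intro exI[of _ "[]"]) simp
next
  case (swap a b p)
  then obtain "is" where i: "set is \<subseteq> {1..<n}" "tword is = p" by blast
  have "\<exists>js. set js \<subseteq> {1..<n} \<and> tword js = Transposition.transpose a b"
  proof (cases a b rule: linorder_cases)
    case less
    then show ?thesis using tword_transpose[of a b n] swap by auto
  next
    case equal
    then show ?thesis by (intro exI[of _ "[]"]) auto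
  next
    case greater
    then show ?thesis using tword_transpose[of b a n] swap by (auto simp: transpose_commute)
  qed
  then obtain js where "set js \<subseteq> {1..<n}" "tword js = Transposition.transpose a b" by blast
  then show ?case using i by (intro exI[of _ "js @ is"]) (auto simp: tword_append)
qed

lemma tword_permutes: "set is \<subseteq> {1..<n} \<Longrightarrow> tword is permutes {1..n}"
proof (induction "is")
  case (Cons i "is")
  then have "adj_transp i permutes {1..n}" by (intro adj_transp_permutes) auto
  then show ?case unfolding tword_simps using Cons by (intro permutes_compose) auto
qed (simp add: permutes_id)

lemma perm_partition_compose: "perm_partition (v \<circ> w) \<pi> = perm_partition v (perm_partition w \<pi>)"
  by (simp add: perm_partition_def image_image image_comp)

text \<open>Sorting the points by the blocks that contain them makes every block an interval.\<close>

lemma partition_conjugate_NC: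
  assumes p: "partition_on {1..n} \<pi>"
  shows "\<exists>w \<sigma>. w permutes {1..n} \<and> \<sigma> \<in> NC n \<and> perm_partition w \<sigma> = \<pi>"
proof -
  have fin: "finite \<pi>" using finite_elements[OF _ p] by simp
  obtain h :: "nat set \<Rightarrow> nat" where h: "inj_on h \<pi>" using finite_imp_inj_to_nat_seg[OF fin] by blast
  define l where "l x = h (block_of \<pi> x)" for x
  have lB: "l x = h B" if "B \<in> \<pi>" "x \<in> B" for x B
    using block_of_eq[OF p that] by (simp add: l_def)
  define xs where "xs = sort_key l [1..<Suc n]"
  have xs: "distinct xs" "set xs = {1..n}" "length xs = n" "sorted (map l xs)"
    by (auto simp: xs_def)
  define w where "w i = (if i \<in> {1..n} then xs ! (i - 1) else i)" for i
  have "bij_betw w {1..n} {1..n}"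
  proof (rule bij_betw_imageI)
    show "inj_on w {1..n}" using xs(1,3) by (auto simp: inj_on_def w_def nth_eq_iff_index_eq)
    have "w ` {1..n} = (!) xs ` {..<n}"
    proof (intro equalityI subsetI)
      fix y assume "y \<in> (!) xs ` {..<n}"
      then obtain j where "j < n" "y = xs ! j" by auto
      then show "y \<in> w ` {1..n}" by (intro image_eqI[of _ _ "Suc j"]) (auto simp: w_def)
    qed (auto simp: w_def intro!: imageI)
    also have "\<dots> = {1..n}" using xs(2,3) by (metis lessThan_atLeast0 atLeast_upt nth_image order_refl set_conv_nth take_all_iff list.set_map map_nth)
    finally show "w ` {1..n} = {1..n}" .
  qed
  then have w: "w permutes {1..n}" by (rule bij_imp_permutes) (auto simp: w_def)
  let ?v = "Hilbert_Choice.inv w"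
  have v: "?v permutes {1..n}" by (rule permutes_inv[OF w])
  let ?\<sigma> = "perm_partition ?v \<pi>"
  have ps: "partition_on {1..n} ?\<sigma>" by (rule perm_partition_partition[OF p v])
  have "noncrossing ?\<sigma>"
    unfolding noncrossing_def
  proof (intro ballI impI)
    fix B C a c b d assume m: "B \<in> ?\<sigma>" "C \<in> ?\<sigma>" "a \<in> B" "c \<in> B" "b \<in> C" "d \<in> C"
      and o: "a < b \<and> b < c \<and> c < d"
    obtain B' C' where B': "B' \<in> \<pi>" "B = ?v ` B'" "C' \<in> \<pi>" "C = ?v ` C'"
      using m(1,2) unfolding perm_partition_def by blast
    have wm: "w a \<in> B'" "w c \<in> B'" "w b \<in> C'" using m B' permutes_inverses(1)[OF w] by auto
    have r: "a \<in> {1..n}" "b \<in> {1..n}" "c \<in> {1..n}" using m ps unfolding partition_on_def by auto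
    have mono: "l (w x) \<le> l (w y)" if "x \<in> {1..n}" "y \<in> {1..n}" "x < y" for x y
    proof -
      have "map l xs ! (x - 1) \<le> map l xs ! (y - 1)"
        by (rule sorted_nth_mono[OF xs(4)]) (use that xs(3) in auto)
      then show ?thesis using that xs(3) by (auto simp: w_def)
    qed
    have "l (w a) \<le> l (w b)" "l (w b) \<le> l (w c)" using mono r o by auto
    then have "h B' = h C'" using lB[OF B'(1)] lB[OF B'(3)] wm by simp
    then have "B' = C'" using h B' by (auto simp: inj_on_def)
    then show "B = C" using B' by simp
  qed
  moreover have "perm_partition w ?\<sigma> = \<pi>"
    unfolding perm_partition_compose[symmetric] permutes_inv_o(1)[OF w] by (simp add: perm_partition_def)
  ultimately show ?thesis using w ps unfolding NC_def by blast
qed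

section \<open>The span of the noncrossing fermions\<close>

definition NCspan :: "nat \<Rightarrow> nat \<Rightarrow> vec set"
  where "NCspan n k = fsp.span (fp n ` NC_blocks n k)"

lemma neg_of_sum_zero: "a + b + c - d - e = 0 \<Longrightarrow> - a = b + c - d - (e :: 'a :: ab_group_add)"
proof -
  assume "a + b + c - d - e = 0"
  then have "a + (b + c - d - e) = 0" by (simp add: add_diff_eq add.assoc)
  then show ?thesis by (rule minus_unique)
qed

text \<open>If the permuted partition has a crossing, \<open>fp_skein\<close> rewrites its fermion
  in noncrossing ones with the same number of blocks.\<close>

lemma ext_act_NCspan:
  assumes i: "1 \<le> i" "i < n" and "x \<in> NCspan n k"
  shows "ext_act n (adj_transp i) x \<in> NCspan n k"
  using assms(3) unfolding NCspan_def
proof (induction x rule: fsp.span_induct_alt)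
  case base
  then show ?case by (simp add: ext_act_simps fsp.span_zero)
next
  case (step c x y)
  then obtain \<pi> where \<pi>: "\<pi> \<in> NC_blocks n k" "x = fp n \<pi>" by blast
  then have nc: "\<pi> \<in> NC n" "card \<pi> = k" by (auto simp: NC_blocks_def)
  have b: "fp n \<sigma> \<in> fsp.span (fp n ` NC_blocks n k)" if "\<sigma> \<in> NC n" "card \<sigma> = card \<pi>" for \<sigma>
    using that nc by (intro fsp.span_base) (auto simp: NC_blocks_def)
  have "- fp n (perm_partition (adj_transp i) \<pi>) \<in> fsp.span (fp n ` NC_blocks n k)"
    using nc(1) i
  proof (cases rule: skein_gen_basis_cases)
    case flip
    show ?thesis using fsp.span_neg[OF b[OF flip(1,2)]] .
  next
    case (resolve B C \<rho>)
    have "- fp n (perm_partition (adj_transp i) \<pi>) = fp n \<pi> + fp n (\<rho> \<union> {B \<union> C, {i, Suc i}})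
      - (if card B > 1 then fp n (\<rho> \<union> {B, insert i (insert (Suc i) C)}) else 0)
      - (if card C > 1 then fp n (\<rho> \<union> {C, insert (Suc i) (insert i B)}) else 0)"
      using fp_skein[OF resolve(1-10), of n] unfolding resolve(12) unfolding resolve(11)[symmetric]
      by (rule neg_of_sum_zero)
    also have "\<dots> \<in> fsp.span (fp n ` NC_blocks n k)"
      using resolve(13-18) nc(1) by (intro fsp.span_diff fsp.span_add) (auto intro: b fsp.span_zero)
    finally show ?thesis .
  qed
  then have "scl c (- fp n (perm_partition (adj_transp i) \<pi>)) + ext_act n (adj_transp i) y
      \<in> fsp.span (fp n ` NC_blocks n k)"
    by (intro fsp.span_add fsp.span_scale step(2))
  then show ?case
    by (simp only: ext_act_simps \<pi>(2) ext_act_fp[OF NC_D(1)[OF nc(1)] i])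
qed

text \<open>Every partition is the image of a noncrossing one under some permutation, and the span
  is stable under each letter of a word for that permutation.\<close>

lemma fp_in_NCspan:
  assumes "partition_on {1..n} \<pi>" "card \<pi> = k"
  shows "fp n \<pi> \<in> NCspan n k"
proof -
  obtain w \<sigma> where w: "w permutes {1..n}" "\<sigma> \<in> NC n" "perm_partition w \<sigma> = \<pi>"
    using partition_conjugate_NC[OF assms(1)] by blast
  obtain "is" where i: "set is \<subseteq> {1..<n}" "tword is = w" using permutes_tword[OF w(1)] by blast
  have ps: "partition_on {1..n} \<sigma>" using NC_D(1)[OF w(2)] .
  have "card \<sigma> = k" using perm_partition_partition(2)[OF ps w(1)] w(3) assms(2) by simp
  then have "fp n \<sigma> \<in> NCspan n k"
    unfolding NCspan_def using w(2) by (intro fsp.span_base) (auto simp: NC_blocks_def)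
  then have "fp n (perm_partition (tword js) \<sigma>) \<in> NCspan n k" if "set js \<subseteq> {1..<n}" for js
    using that
  proof (induction js)
    case Nil
    then show ?case by (simp add: perm_partition_def)
  next
    case (Cons j js)
    have j: "1 \<le> j" "j < n" "set js \<subseteq> {1..<n}" using Cons.prems by auto
    have "ext_act n (adj_transp j) (fp n (perm_partition (tword js) \<sigma>)) \<in> NCspan n k"
      using Cons j by (intro ext_act_NCspan) auto
    moreover have "ext_act n (adj_transp j) (fp n (perm_partition (tword js) \<sigma>)) =
        - fp n (perm_partition (tword (j # js)) \<sigma>)"
      using ext_act_fp[OF perm_partition_partition(1)[OF ps tword_permutes[OF j(3)]] j(1,2)]
      by (simp only: tword_simps perm_partition_compose)
    ultimately have "- fp n (perm_partition (tword (j # js)) \<sigma>) \<in> NCspan n k" by (simp only:)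
    from fsp.span_neg[OF this[unfolded NCspan_def]] show ?case by (simp only: NCspan_def minus_minus)
  qed
  from this[OF i(1)] show ?thesis using i(2) w(3) by simp
qed

section \<open>A product expansion\<close>

lemma prod_insert_remove:
  "finite \<tau> \<Longrightarrow> E \<notin> \<tau> \<Longrightarrow> B \<in> \<tau> \<Longrightarrow> (\<Prod>D\<in>insert E \<tau> - {B}. R D) = R E * (\<Prod>D\<in>\<tau> - {B}. R D :: 'a :: comm_monoid_mult)"
proof -
  assume a: "finite \<tau>" "E \<notin> \<tau>" "B \<in> \<tau>"
  then have "insert E \<tau> - {B} = insert E (\<tau> - {B})" by auto
  then show ?thesis using a by simp
qed

text \<open>To be applied with \<open>Y B = bs B 0\<close> and \<open>p = pp 0\<close>. The
  hypotheses leave only terms with no special factor, with one or two factors \<open>Y\<close>, or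
  with one factor \<open>p\<close>. The double sum meets every pair of blocks in both orders; the
  overall factor 2 replaces a division by 2.\<close>

lemma prod_expand:
  fixes R Y a c :: "'b \<Rightarrow> 'a :: comm_ring_1"
  assumes "finite \<tau>" and YYY: "\<And>B D E. Y B * (Y D * Y E) = 0" and Yp: "\<And>B. Y B * p = 0" and pp: "p * p = 0"
  shows "2 * (\<Prod>B\<in>\<tau>. R B + a B * Y B + c B * p) =
    2 * (\<Prod>B\<in>\<tau>. R B) + 2 * (\<Sum>B\<in>\<tau>. a B * (Y B * (\<Prod>D\<in>\<tau> - {B}. R D)))
    + 2 * (p * (\<Sum>B\<in>\<tau>. c B * (\<Prod>D\<in>\<tau> - {B}. R D)))
    + (\<Sum>B\<in>\<tau>. \<Sum>D\<in>\<tau> - {B}. a B * a D * (Y B * Y D * (\<Prod>E\<in>\<tau> - {B} - {D}. R E)))"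
  using assms(1)
proof (induction \<tau> rule: finite_induct)
  case empty
  then show ?case by simp
next
  case (insert E \<tau>)
  define P where "P = (\<Prod>B\<in>\<tau>. R B)"
  define S1 where "S1 = (\<Sum>B\<in>\<tau>. a B * (Y B * (\<Prod>D\<in>\<tau> - {B}. R D)))"
  define S2 where "S2 = (\<Sum>B\<in>\<tau>. c B * (\<Prod>D\<in>\<tau> - {B}. R D))"
  define S3 where "S3 = (\<Sum>B\<in>\<tau>. \<Sum>D\<in>\<tau> - {B}. a B * a D * (Y B * Y D * (\<Prod>E\<in>\<tau> - {B} - {D}. R E)))"
  note rem = prod_insert_remove[OF insert.hyps(1,2)]
  have iE: "insert E \<tau> - {E} = \<tau>" using insert.hyps by auto
  have s1: "(\<Sum>B\<in>insert E \<tau>. a B * (Y B * (\<Prod>D\<in>insert E \<tau> - {B}. R D))) = a E * (Y E * P) + R E * S1"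
  proof -
    have "(\<Sum>B\<in>\<tau>. a B * (Y B * (\<Prod>D\<in>insert E \<tau> - {B}. R D))) = R E * S1"
      unfolding S1_def sum_distrib_left by (rule sum.cong[OF refl]) (simp only: rem mult_ac)
    then show ?thesis by (simp only: sum.insert[OF insert.hyps] iE P_def)
  qed
  have s2: "(\<Sum>B\<in>insert E \<tau>. c B * (\<Prod>D\<in>insert E \<tau> - {B}. R D)) = c E * P + R E * S2"
  proof -
    have "(\<Sum>B\<in>\<tau>. c B * (\<Prod>D\<in>insert E \<tau> - {B}. R D)) = R E * S2"
      unfolding S2_def sum_distrib_left by (rule sum.cong[OF refl]) (simp only: rem mult_ac)
    then show ?thesis by (simp only: sum.insert[OF insert.hyps] iE P_def)
  qed
  have s3: "(\<Sum>B\<in>insert E \<tau>. \<Sum>D\<in>insert E \<tau> - {B}. a B * a D * (Y B * Y D * (\<Prod>F\<in>insert E \<tau> - {B} - {D}. R F)))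
      = 2 * (a E * (Y E * S1)) + R E * S3"
  proof -
    have 1: "(\<Sum>D\<in>\<tau>. a E * a D * (Y E * Y D * (\<Prod>F\<in>\<tau> - {D}. R F))) = a E * (Y E * S1)"
      unfolding S1_def sum_distrib_left by (rule sum.cong[OF refl]) (simp only: mult_ac)
    have 2: "(\<Sum>D\<in>insert E \<tau> - {B}. a B * a D * (Y B * Y D * (\<Prod>F\<in>insert E \<tau> - {B} - {D}. R F))) =
        a E * (Y E * (a B * (Y B * (\<Prod>D\<in>\<tau> - {B}. R D))))
        + R E * (\<Sum>D\<in>\<tau> - {B}. a B * a D * (Y B * Y D * (\<Prod>F\<in>\<tau> - {B} - {D}. R F)))"
      if B: "B \<in> \<tau>" for B
    proof -
      have i: "insert E \<tau> - {B} = insert E (\<tau> - {B})" using B insert.hyps by auto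
      have f: "finite (\<tau> - {B})" "E \<notin> \<tau> - {B}" using insert.hyps by auto
      have iE': "insert E (\<tau> - {B}) - {E} = \<tau> - {B}" using f by auto
      have "(\<Sum>D\<in>\<tau> - {B}. a B * a D * (Y B * Y D * (\<Prod>F\<in>insert E (\<tau> - {B}) - {D}. R F))) =
         R E * (\<Sum>D\<in>\<tau> - {B}. a B * a D * (Y B * Y D * (\<Prod>F\<in>\<tau> - {B} - {D}. R F)))"
        unfolding sum_distrib_left
        by (rule sum.cong[OF refl]) (simp only: prod_insert_remove[OF f] mult_ac)
      then show ?thesis unfolding i sum.insert[OF f] iE' by (simp only: mult_ac)
    qed
    have "(\<Sum>B\<in>\<tau>. \<Sum>D\<in>insert E \<tau> - {B}. a B * a D * (Y B * Y D * (\<Prod>F\<in>insert E \<tau> - {B} - {D}. R F)))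
        = (\<Sum>B\<in>\<tau>. a E * (Y E * (a B * (Y B * (\<Prod>D\<in>\<tau> - {B}. R D))))
        + R E * (\<Sum>D\<in>\<tau> - {B}. a B * a D * (Y B * Y D * (\<Prod>F\<in>\<tau> - {B} - {D}. R F))))"
      by (rule sum.cong[OF refl]) (rule 2)
    also have "\<dots> = a E * (Y E * S1) + R E * S3"
      unfolding S1_def S3_def by (simp only: sum.distrib sum_distrib_left)
    finally show ?thesis unfolding sum.insert[OF insert.hyps] iE 1 by simp
  qed
  have z1: "Y E * S3 = 0"
    unfolding S3_def sum_distrib_left
  proof (intro sum.neutral ballI)
    fix B D
    have "Y E * (a B * a D * (Y B * Y D * (\<Prod>E\<in>\<tau> - {B} - {D}. R E))) =
       Y E * (Y B * Y D) * (a B * a D * (\<Prod>E\<in>\<tau> - {B} - {D}. R E))" by (simp only: mult_ac)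
    then show "Y E * (a B * a D * (Y B * Y D * (\<Prod>E\<in>\<tau> - {B} - {D}. R E))) = 0" by (simp add: YYY)
  qed
  have pY: "p * Y B = 0" for B using Yp[of B] by (simp only: mult.commute)
  have z2: "p * S1 = 0"
    unfolding S1_def sum_distrib_left
  proof (intro sum.neutral ballI)
    fix B
    have "p * (a B * (Y B * (\<Prod>D\<in>\<tau> - {B}. R D))) = p * Y B * (a B * (\<Prod>D\<in>\<tau> - {B}. R D))" by (simp only: mult_ac)
    then show "p * (a B * (Y B * (\<Prod>D\<in>\<tau> - {B}. R D))) = 0" by (simp add: pY)
  qed
  have z3: "p * S3 = 0"
    unfolding S3_def sum_distrib_left
  proof (intro sum.neutral ballI)
    fix B D
    have "p * (a B * a D * (Y B * Y D * (\<Prod>E\<in>\<tau> - {B} - {D}. R E))) =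
       p * Y B * (Y D * (a B * a D * (\<Prod>E\<in>\<tau> - {B} - {D}. R E)))" by (simp only: mult_ac)
    then show "p * (a B * a D * (Y B * Y D * (\<Prod>E\<in>\<tau> - {B} - {D}. R E))) = 0" by (simp add: pY)
  qed
  have IH: "2 * (\<Prod>B\<in>\<tau>. R B + a B * Y B + c B * p) = 2 * P + 2 * S1 + 2 * (p * S2) + S3"
    unfolding insert.IH P_def S1_def S2_def S3_def ..
  have "2 * (\<Prod>B\<in>insert E \<tau>. R B + a B * Y B + c B * p) =
      (R E + a E * Y E + c E * p) * (2 * P + 2 * S1 + 2 * (p * S2) + S3)"
    unfolding IH[symmetric] prod.insert[OF insert.hyps] by (rule mult.left_commute)
  also have "\<dots> = R E * (2 * P + 2 * S1 + 2 * (p * S2) + S3) + a E * (2 * (Y E * P) + 2 * (Y E * S1) + 2 * (Y E * p * S2) + Y E * S3)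
      + c E * (2 * (p * P) + 2 * (p * S1) + 2 * (p * p * S2) + p * S3)"
    by (simp add: algebra_simps)
  also have "\<dots> = 2 * (R E * P) + 2 * (a E * (Y E * P) + R E * S1) + 2 * (p * (c E * P + R E * S2))
      + (2 * (a E * (Y E * S1)) + R E * S3)"
    unfolding z1 z2 z3 Yp pp by (simp add: algebra_simps)
  finally show ?case
    unfolding s1 s2 s3 prod.insert[OF insert.hyps] P_def by (simp only: P_def)
qed

section \<open>Difference letters\<close>

text \<open>The spare index 0 holds the original letter of index \<open>n\<close>, and the other
  letters act as differences with it, so the letter of index \<open>n\<close> itself acts as zero.
  Such differences pass the total operators without extra terms, see
  \<open>antic_tot\<close>.\<close>

definition op1 :: "nat \<Rightarrow> gen \<Rightarrow> vec \<Rightarrow> vec"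
  where "op1 n g y = (if snd g = 0 then op0 (fst g, n) y else op0 g y - op0 (fst g, n) y)"

lemma op0_diff: "op0 g (x - y) = op0 g x - op0 g y"
  using o0.lin_op by (rule module_hom.diff)

lemma op1_zero: "snd g = 0 \<Longrightarrow> op1 n g y = op0 (fst g, n) y"
  and op1_pos: "snd g \<noteq> 0 \<Longrightarrow> op1 n g y = op0 g y - op0 (fst g, n) y"
  by (simp_all add: op1_def)

lemma op1_anti: "op1 n g (op1 n h x) = - op1 n h (op1 n g x)"
proof -
  have a: "op0 g (op0 h x) = - op0 h (op0 g x)" "op0 (fst g, n) (op0 (fst h, n) x) = - op0 (fst h, n) (op0 (fst g, n) x)"
    "op0 (fst g, n) (op0 h x) = - op0 h (op0 (fst g, n) x)" "op0 g (op0 (fst h, n) x) = - op0 (fst h, n) (op0 g x)"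
    by (rule op0_anti)+
  show ?thesis
  proof (cases "snd g = 0"; cases "snd h = 0")
    assume g: "snd g = 0" and h: "snd h = 0"
    show ?thesis unfolding op1_zero[OF g] op1_zero[OF h] by (rule a(2))
  next
    assume g: "snd g = 0" and h: "snd h \<noteq> 0"
    show ?thesis unfolding op1_zero[OF g] op1_pos[OF h] op0_diff a(2) a(3) by simp
  next
    assume g: "snd g \<noteq> 0" and h: "snd h = 0"
    show ?thesis unfolding op1_pos[OF g] op1_zero[OF h] op0_diff a(2) a(4) by simp
  next
    assume g: "snd g \<noteq> 0" and h: "snd h \<noteq> 0"
    show ?thesis unfolding op1_pos[OF g] op1_pos[OF h] op0_diff a(1) a(2) a(3) a(4) by simp
  qed
qed

lemma lin_op1: "lin (op1 n g)"
proof (cases "snd g = 0")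
  case True
  then have "op1 n g = op0 (fst g, n)" by (intro ext) (simp add: op1_def)
  then show ?thesis by (simp add: o0.lin_op)
next
  case False
  then have "op1 n g = op0 g - op0 (fst g, n)"
    by (intro ext[of "op1 n g"]) (simp only: op1_def minus_apply if_False)
  then show ?thesis by (simp add: lin_minus o0.lin_op)
qed

interpretation o1: anticommuting "op1 n" for n
  by (rule anticommuting.intro) (rule lin_op1, rule op1_anti)

definition lets :: "nat \<Rightarrow> gen set"
  where "lets n = UNIV \<times> {0..n}"

lemma lets_simps [simp]: "finite (lets n)" "(c, i) \<in> lets n \<longleftrightarrow> i \<le> n"
  by (auto simp: lets_def)

abbreviation act1 :: "nat \<Rightarrow> ev \<Rightarrow> vec \<Rightarrow> vec"
  where "act1 n \<equiv> o1.act n (lets n)"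

lemma op0_op1: "1 \<le> i \<Longrightarrow> op0 (c, i) y = op1 n (c, i) y + op1 n (c, 0) y"
  by (simp add: op1_def)

lemma op1_n [simp]: "1 \<le> n \<Longrightarrow> op1 n (c, n) y = 0"
  by (simp add: op1_def)

text \<open>A change of letters: \<open>s\<close> in the difference letters acts as \<open>r\<close>
  does in the original ones. The relation respects sums and products, so it suffices to substitute
  in brackets.\<close>

definition same_act :: "nat \<Rightarrow> ev \<Rightarrow> ev \<Rightarrow> bool"
  where "same_act n r s \<longleftrightarrow> (\<forall>y. act0 n r y = act1 n s y)"

lemma same_act_closed:
  "same_act n 0 0" "same_act n 1 1"
  "same_act n r r' \<Longrightarrow> same_act n s s' \<Longrightarrow> same_act n (r + s) (r' + s')"
  "same_act n r r' \<Longrightarrow> same_act n s s' \<Longrightarrow> same_act n (r * s) (r' * s')"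
  by (simp_all add: same_act_def o0.act_add o0.act_mult o0.act_one o1.act_add o1.act_mult o1.act_one)

lemma same_act_br:
  assumes "i \<in> {1..n}" "j \<in> {1..n}"
  shows "same_act n (br i j) (br i j + br i 0 + br j 0 + 2 * pp 0)"
    "same_act n (pp i) (pp i + br i 0 + pp 0)"
proof -
  have ij: "1 \<le> i" "i \<le> n" "1 \<le> j" "j \<le> n" using assms by auto
  have two: "2 * pp 0 = pp 0 + pp 0" by simp
  show "same_act n (br i j) (br i j + br i 0 + br j 0 + 2 * pp 0)"
    unfolding same_act_def two
    by (simp only: o0.act_br o1.act_br o1.act_pp o1.act_add finite_gens lets_simps gens_iff ij le0 simp_thms
        o0.brop_def o1.brop_def op0_op1[OF ij(1), where n = n] op0_op1[OF ij(3), where n = n] o1.op_simps)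
       (simp add: add_ac)
  show "same_act n (pp i) (pp i + br i 0 + pp 0)"
    unfolding same_act_def
    by (simp only: o0.act_pp o1.act_br o1.act_pp o1.act_add finite_gens lets_simps gens_iff ij le0 simp_thms
        o1.brop_def op0_op1[OF ij(1), where n = n] o1.op_simps)
       (simp add: add_ac)
qed

text \<open>Every point of \<open>B\<close> lies in \<open>card B - 1\<close> pairs, and each of the
  \<open>card B * (card B - 1) / 2\<close> pairs contributes \<open>2 * pp 0\<close>.\<close>

lemma same_act_qq:
  assumes "finite B" "B \<subseteq> {1..n}"
  shows "same_act n (qq B) (qq B + (of_nat (card B) - 1) * bs B 0 + of_nat (card B) * (of_nat (card B) - 1) * pp 0)"
  using assms
proof (induction B rule: finite_induct)
  case empty
  then show ?case by (simp add: same_act_closed bs_def)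
next
  case (insert a B)
  have b: "same_act n (bs C a) (bs C a + bs C 0 + of_nat (card C) * br a 0 + 2 * of_nat (card C) * pp 0)"
    if "finite C" "C \<subseteq> B" for C
    using that
  proof (induction C rule: finite_induct)
    case empty
    then show ?case by (simp add: same_act_closed bs_def)
  next
    case (insert x C)
    have "same_act n (br x a) (br x a + br x 0 + br a 0 + 2 * pp 0)"
      by (rule same_act_br) (use insert.prems \<open>insert a B \<subseteq> {1..n}\<close> in blast)+
    moreover have "same_act n (bs C a) (bs C a + bs C 0 + of_nat (card C) * br a 0 + 2 * of_nat (card C) * pp 0)"
      using insert by blast
    ultimately have "same_act n (br x a + bs C a)
      ((br x a + br x 0 + br a 0 + 2 * pp 0) + (bs C a + bs C 0 + of_nat (card C) * br a 0 + 2 * of_nat (card C) * pp 0))"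
      by (rule same_act_closed)
    then show ?case using insert.hyps by (simp add: bs_insert algebra_simps)
  qed
  have "same_act n (qq B) (qq B + (of_nat (card B) - 1) * bs B 0 + of_nat (card B) * (of_nat (card B) - 1) * pp 0)"
    using insert by blast
  from same_act_closed(3)[OF this b[OF insert.hyps(1) order_refl]]
  show ?case using insert.hyps by (simp add: qq_insert bs_insert algebra_simps)
qed

section \<open>Total operators\<close>

text \<open>The operators \<open>xtot\<close>, \<open>ttot\<close> and \<open>dlt\<close> multiply
  by the three generators of the ideal; \<open>dth\<close> and \<open>dxi\<close> are the adjoints
  of \<open>ttot\<close> and \<open>xtot\<close>.\<close>

definition xtot :: "nat \<Rightarrow> vec \<Rightarrow> vec" where "xtot n y = (\<Sum>j\<in>{1..n}. cr (xi j) y)"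
definition ttot :: "nat \<Rightarrow> vec \<Rightarrow> vec" where "ttot n y = (\<Sum>j\<in>{1..n}. cr (theta j) y)"
definition dth :: "nat \<Rightarrow> vec \<Rightarrow> vec" where "dth n y = (\<Sum>j\<in>{1..n}. an (theta j) y)"
definition dlt :: "nat \<Rightarrow> vec \<Rightarrow> vec" where "dlt n y = (\<Sum>j\<in>{1..n}. cr (theta j) (cr (xi j) y))"

lemma lin_tot: "lin (xtot n)" "lin (ttot n)" "lin (dth n)" "lin (dlt n)"
  unfolding xtot_def ttot_def dth_def dlt_def
  by (intro lin_sum_ops lin_an lin_cr lin_compose[OF lin_cr lin_cr])+

lemma cr_an_neq: "g \<noteq> h \<Longrightarrow> cr g (an h f) = - an h (cr g f)"
  using an_cr_neq[of h g f] by simp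

lemma an_cr_eq: "an g (cr g f) = fin_part f - cr g (an g f)"
  using an_cr_same[of g f] by (simp add: eq_diff_eq)

lemma cr_an_eq: "cr g (an g f) = fin_part f - an g (cr g f)"
  using an_cr_same[of g f] by (simp add: eq_diff_eq add.commute)

lemma xtot_op0: "xtot n (op0 (c, i) y) = - op0 (c, i) (xtot n y)"
proof -
  have "cr (xi j) (op0 (c, i) y) = - op0 (c, i) (cr (xi j) y)" for j
    using op0_anti[of "(True, j)" "(c, i)" y] by simp
  then show ?thesis by (simp add: xtot_def o0.op_simps sum_negf)
qed

lemma dth_op0: "dth n (op0 (c, i) y) = - op0 (c, i) (dth n y)"
proof -
  have "an (theta j) (op0 (c, i) y) = - op0 (c, i) (an (theta j) y)" for j
    using op0_anti[of "(False, j)" "(c, i)" y] by simp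
  then show ?thesis by (simp add: dth_def o0.op_simps sum_negf)
qed

lemma ttot_xi: "ttot n (cr (xi i) y) = - cr (xi i) (ttot n y)"
  unfolding ttot_def cr.op_simps by (simp only: cr_anti[of "theta _" "xi i"] sum_negf)

lemma dxi_theta: "dxi n (an (theta i) y) = - an (theta i) (dxi n y)"
  unfolding dxi_def an_simps by (simp only: an_anti[of "xi _" "theta i"] sum_negf)

text \<open>For carrying a sum of operators past one letter: only the summand with the same index
  produces the extra term \<open>z\<close>.\<close>

lemma sum_single_term:
  assumes "i \<in> {1..n :: nat}" "f i = z - g i" "\<And>j. j \<noteq> i \<Longrightarrow> f j = - g j"
  shows "(\<Sum>j\<in>{1..n}. f j) = (z :: 'a :: ab_group_add) - (\<Sum>j\<in>{1..n}. g j)"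
proof -
  have "(\<Sum>j\<in>{1..n}. f j) = f i + (\<Sum>j\<in>{1..n} - {i}. f j)" using assms(1) by (intro sum.remove) auto
  also have "(\<Sum>j\<in>{1..n} - {i}. f j) = - (\<Sum>j\<in>{1..n} - {i}. g j)"
    unfolding sum_negf[symmetric] by (rule sum.cong) (use assms(3) in auto)
  also have "f i + \<dots> = z - (g i + (\<Sum>j\<in>{1..n} - {i}. g j))" using assms(2) by simp
  also have "g i + (\<Sum>j\<in>{1..n} - {i}. g j) = (\<Sum>j\<in>{1..n}. g j)"
    using assms(1) by (intro sum.remove[symmetric]) auto
  finally show ?thesis .
qed

lemma ttot_theta: "i \<in> {1..n} \<Longrightarrow> ttot n (an (theta i) y) = fin_part y - an (theta i) (ttot n y)"
  unfolding ttot_def an_simps by (rule sum_single_term, assumption, rule cr_an_eq, rule cr_an_neq, simp)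

lemma dxi_xi: "i \<in> {1..n} \<Longrightarrow> dxi n (cr (xi i) y) = fin_part y - cr (xi i) (dxi n y)"
  unfolding dxi_def cr.op_simps by (rule sum_single_term, assumption, rule an_cr_eq, rule an_cr_neq, simp)

lemma dlt_xi: "dlt n (cr (xi i) y) = cr (xi i) (dlt n y)"
proof -
  have "cr (theta j) (cr (xi j) (cr (xi i) y)) = cr (xi i) (cr (theta j) (cr (xi j) y))" for j
  proof -
    have "cr (theta j) (cr (xi j) (cr (xi i) y)) = - cr (theta j) (cr (xi i) (cr (xi j) y))"
      by (simp only: cr_anti[of "xi j" "xi i"] cr.op_simps)
    also have "\<dots> = cr (xi i) (cr (theta j) (cr (xi j) y))"
      by (simp only: cr_anti[of "theta j" "xi i"] minus_minus)
    finally show ?thesis .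
  qed
  then show ?thesis by (simp add: dlt_def cr.op_simps)
qed

text \<open>The commutator of \<open>dlt\<close> with a contraction is a multiplication:
  \<open>dlt\<close> turns a y-letter into an x-letter. The treatment of mixed words in
  \<open>L_word_zero\<close> rests on this.\<close>

lemma dlt_theta: "i \<in> {1..n} \<Longrightarrow> dlt n (an (theta i) y) = an (theta i) (dlt n y) - cr (xi i) y"
proof -
  assume i: "i \<in> {1..n}"
  have "(\<Sum>j\<in>{1..n}. - cr (theta j) (cr (xi j) (an (theta i) y))) =
     cr (xi i) y - (\<Sum>j\<in>{1..n}. an (theta i) (cr (theta j) (cr (xi j) y)))"
  proof (rule sum_single_term[OF i])
    have "cr (xi j) (an (theta i) y) = - an (theta i) (cr (xi j) y)" for j by (rule cr_an_neq) simp
    then have e: "- cr (theta j) (cr (xi j) (an (theta i) y)) = cr (theta j) (an (theta i) (cr (xi j) y))" for j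
      by (simp only: cr.op_simps minus_minus)
    show "- cr (theta i) (cr (xi i) (an (theta i) y)) = cr (xi i) y - an (theta i) (cr (theta i) (cr (xi i) y))"
      unfolding e by (simp only: cr_an_eq[of "theta i"] cr_fin_part)
    show "- cr (theta j) (cr (xi j) (an (theta i) y)) = - an (theta i) (cr (theta j) (cr (xi j) y))" if "j \<noteq> i" for j
      unfolding e by (rule cr_an_neq) (use that in simp)
  qed
  then have "- dlt n (an (theta i) y) = cr (xi i) y - an (theta i) (dlt n y)"
    by (simp only: sum_negf dlt_def an_simps)
  then show ?thesis by (metis minus_diff_eq minus_minus)
qed

section \<open>Elements that commute with the total operators\<close>

definition antic :: "nat \<Rightarrow> (vec \<Rightarrow> vec) \<Rightarrow> gen \<Rightarrow> bool"
  where "antic n T g \<longleftrightarrow> (\<forall>y. T (op1 n g y) = - op1 n g (T y))"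

lemma antic_tot:
  assumes "1 \<le> n"
  shows "antic n (xtot n) g" "antic n (dth n) g" "1 \<le> i \<Longrightarrow> i \<le> n \<Longrightarrow> antic n (ttot n) (c, i)"
    "1 \<le> i \<Longrightarrow> i \<le> n \<Longrightarrow> antic n (dxi n) (c, i)" "antic n (ttot n) (True, 0)" "antic n (dxi n) (False, 0)"
    "antic n (op1 n h) g"
proof -
  have n: "n \<in> {1..n}" using assms by simp
  note d = module_hom.diff[OF lin_tot(1)] module_hom.diff[OF lin_tot(2)] module_hom.diff[OF lin_tot(3)]
    module_hom.diff[OF lin_dxi]
  show "antic n (xtot n) g" "antic n (dth n) g"
    unfolding antic_def op1_def
    by (cases g; cases "snd g = 0"; simp only: if_True if_False fst_conv snd_conv d xtot_op0 dth_op0; simp)+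
  show "antic n (ttot n) (True, 0)" "antic n (dxi n) (False, 0)"
    by (simp_all add: antic_def op1_def ttot_xi dxi_theta)
  show "antic n (op1 n h) g" unfolding antic_def by (intro allI op1_anti)
  assume i: "1 \<le> i" "i \<le> n"
  then have i': "i \<noteq> 0" "i \<in> {1..n}" by auto
  show "antic n (ttot n) (c, i)"
    unfolding antic_def op1_def using i'(1)
    by (cases c; simp only: fst_conv snd_conv if_False op0_simps d ttot_xi ttot_theta[OF i'(2)] ttot_theta[OF n]; simp)
  show "antic n (dxi n) (c, i)"
    unfolding antic_def op1_def using i'(1)
    by (cases c; simp only: fst_conv snd_conv if_False op0_simps d dxi_theta dxi_xi[OF i'(2)] dxi_xi[OF n]; simp)
qed

lemma dlt_op1:
  assumes "1 \<le> i" "i \<le> n"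
  shows "dlt n (op1 n (True, i) y) = op1 n (True, i) (dlt n y)"
    "dlt n (op1 n (False, i) y) = op1 n (False, i) (dlt n y) - op1 n (True, i) y"
proof -
  have i: "i \<noteq> 0" "i \<in> {1..n}" "n \<in> {1..n}" using assms by auto
  show "dlt n (op1 n (True, i) y) = op1 n (True, i) (dlt n y)"
    using i by (simp add: op1_def module_hom.diff[OF lin_tot(4)] dlt_xi)
  show "dlt n (op1 n (False, i) y) = op1 n (False, i) (dlt n y) - op1 n (True, i) y"
    using i by (simp add: op1_def module_hom.diff[OF lin_tot(4)] dlt_theta)
qed

definition commutes :: "nat \<Rightarrow> (vec \<Rightarrow> vec) \<Rightarrow> ev \<Rightarrow> bool"
  where "commutes n T r \<longleftrightarrow> (\<forall>y. T (act1 n r y) = act1 n r (T y))"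

text \<open>An intrinsic substitute for being a polynomial in brackets with indices from 1 to
  \<open>n\<close>, free of the spare index 0. The operator \<open>dlt\<close> is listed separately
  because a y-letter has an extra term with it; in a bracket the two extra terms cancel.\<close>

definition good :: "nat \<Rightarrow> ev \<Rightarrow> bool"
  where "good n r \<longleftrightarrow> commutes n (dlt n) r \<and>
    (\<forall>T. lin T \<longrightarrow> (\<forall>c i. 1 \<le> i \<and> i \<le> n \<longrightarrow> antic n T (c, i)) \<longrightarrow> commutes n T r)"

lemma good_mult: "good n r \<Longrightarrow> good n s \<Longrightarrow> good n (r * s)"
  by (simp add: good_def commutes_def o1.act_mult)

lemma good_one: "good n 1"
  by (simp add: good_def commutes_def o1.act_one)

lemma good_add: "good n r \<Longrightarrow> good n s \<Longrightarrow> good n (r + s)"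
  unfolding good_def commutes_def o1.act_add by (simp add: module_hom.add module_hom.add[OF lin_tot(4)])

lemma good_zero: "good n 0"
  unfolding good_def commutes_def by (simp add: module_hom.zero module_hom.zero[OF lin_tot(4)])

lemma good_prod: "(\<And>a. a \<in> A \<Longrightarrow> good n (f a)) \<Longrightarrow> good n (prod f A)"
  by (induction A rule: infinite_finite_induct) (simp_all add: good_one good_mult)

lemma good_sum: "(\<And>a. a \<in> A \<Longrightarrow> good n (f a)) \<Longrightarrow> good n (sum f A)"
  by (induction A rule: infinite_finite_induct) (simp_all add: good_zero good_add)

lemma good_br:
  assumes "i \<in> {1..n}" "j \<in> {1..n}" shows "good n (br i j)" "good n (pp i)"
proof -
  have ij: "1 \<le> i" "i \<le> n" "1 \<le> j" "j \<le> n" using assms by auto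
  have a: "commutes n T (br i j) \<and> commutes n T (pp i)"
    if T: "lin T" "\<forall>c i. 1 \<le> i \<and> i \<le> n \<longrightarrow> antic n T (c, i)" for T
  proof -
    have t: "T (op1 n (c, l) y) = - op1 n (c, l) (T y)" if "1 \<le> l" "l \<le> n" for c l y
      using T(2) that by (simp add: antic_def)
    show ?thesis unfolding commutes_def using ij
      by (simp add: o1.act_br o1.act_pp o1.brop_def module_hom.add[OF T(1)] t o1.op_simps)
  qed
  have TT: "op1 n (True, i) (op1 n (True, j) y) = - op1 n (True, j) (op1 n (True, i) y)" for y by (rule op1_anti)
  have d: "commutes n (dlt n) (br i j)" "commutes n (dlt n) (pp i)"
    unfolding commutes_def using ij
    by (simp_all add: o1.act_br o1.act_pp o1.brop_def module_hom.add[OF lin_tot(4)] dlt_op1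
        module_hom.diff[OF o1.lin_op] o1.op_square TT)
  show "good n (br i j)" "good n (pp i)" using a d by (simp_all add: good_def)
qed

lemma good_qq: "B \<subseteq> {1..n} \<Longrightarrow> good n (qq B)"
  unfolding qq_def by (intro good_sum good_br) auto

lemma good_bss: "A \<subseteq> {1..n} \<Longrightarrow> B \<subseteq> {1..n} \<Longrightarrow> good n (bss A B)"
  unfolding bss_def bs_def by (intro good_sum good_br) auto

text \<open>The monomial \<open>Theta n\<close> is a multiple of \<open>ttot n (vbase n)\<close> and
  so lies in the ideal for \<open>n \<ge> 1\<close>. The vector \<open>vbase n\<close>, one degree
  below, takes over as starting vector; it is also killed by \<open>dth\<close>, \<open>dxi\<close>
  and \<open>dlta\<close>.\<close>

definition vbase :: "nat \<Rightarrow> vec"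
  where "vbase n = dth n (Theta n)"

lemma fin_Theta: "fin_part (Theta n) = Theta n"
  using supp_in_fin_part[OF finite_gens Theta_supp_in] .

lemma cr_Theta_zero: "i \<in> {1..n} \<Longrightarrow> cr (theta i) (Theta n) = 0"
proof (rule ext)
  fix U assume "i \<in> {1..n}"
  then have "theta i \<in> theta ` {1..n}" by (rule imageI)
  then have "(U - {theta i} = theta ` {1..n}) = False" by blast
  then show "cr (theta i) (Theta n) U = 0 U"
    by (simp only: cr_apply[of _ _ U] Theta_def basis_vec_def zero_fun_apply of_bool_eq mult_zero_right if_cancel)
qed

lemma an_xi_Theta: "an (xi i) (Theta n) = 0"
proof (rule ext)
  fix U
  have "xi i \<notin> theta ` {1..n}" by blast
  then have "(insert (xi i) U = theta ` {1..n}) = False" by blast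
  then show "an (xi i) (Theta n) U = 0 U"
    by (simp only: an_def Theta_def basis_vec_def zero_fun_apply of_bool_eq mult_zero_right if_cancel)
qed

lemma Theta_facts:
  "ttot n (Theta n) = 0" "dxi n (Theta n) = 0" "dlt n (Theta n) = 0"
proof -
  have "cr (theta j) (cr (xi j) (Theta n)) = 0" if "j \<in> {1..n}" for j
    unfolding cr_anti[of "theta j"] cr_Theta_zero[OF that] cr.op_simps by simp
  then show "dlt n (Theta n) = 0" unfolding dlt_def by (rule sum.neutral[rule_format])
  show "ttot n (Theta n) = 0" unfolding ttot_def by (intro sum.neutral ballI cr_Theta_zero)
  show "dxi n (Theta n) = 0" unfolding dxi_def by (intro sum.neutral ballI an_xi_Theta)
qed

lemma dth_dth: "dth n (dth n y) = 0"
proof -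
  have "dth n (dth n y) = - dth n (dth n y)"
  proof -
    have "dth n (an (theta i) z) = - an (theta i) (dth n z)" for i z using dth_op0[of n False i z] by simp
    then have "(\<Sum>j\<in>{1..n}. dth n (an (theta j) y)) = - dth n (dth n y)"
      by (simp add: dth_def[of n "dth n y"] sum_negf)
    then show ?thesis by (simp add: dth_def[of n y] module_hom.sum[OF lin_tot(3)])
  qed
  then show ?thesis by (rule fun_self_eq_uminus)
qed

lemma fin_vbase: "fin_part (vbase n) = vbase n"
  by (rule ext) (simp add: vbase_def dth_def fin_part_def sum_fun_apply an_def)

lemma vbase_facts:
  "ttot n (vbase n) = scl (of_nat n) (Theta n)" "dth n (vbase n) = 0"
  "dlt n (vbase n) = - xtot n (Theta n)"
proof -
  have "ttot n (vbase n) = (\<Sum>j\<in>{1..n}. ttot n (an (theta j) (Theta n)))"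
    unfolding vbase_def dth_def by (rule module_hom.sum[OF lin_tot(2)])
  also have "\<dots> = (\<Sum>j\<in>{1..n}. Theta n)"
    by (rule sum.cong[OF refl]) (simp add: ttot_theta fin_Theta Theta_facts an_simps)
  also have "\<dots> = scl (of_nat n) (Theta n)" by (rule ext) (simp add: sum_fun_apply pointwise)
  finally show "ttot n (vbase n) = scl (of_nat n) (Theta n)" .
  show "dth n (vbase n) = 0" unfolding vbase_def by (rule dth_dth)
  have "dlt n (vbase n) = (\<Sum>j\<in>{1..n}. dlt n (an (theta j) (Theta n)))"
    unfolding vbase_def dth_def by (rule module_hom.sum[OF lin_tot(4)])
  also have "\<dots> = (\<Sum>j\<in>{1..n}. - cr (xi j) (Theta n))"
    by (rule sum.cong[OF refl]) (simp add: dlt_theta Theta_facts an_simps)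
  finally show "dlt n (vbase n) = - xtot n (Theta n)" by (simp add: xtot_def sum_negf)
qed

section \<open>Functionals that vanish on the fermions of set partitions\<close>

text \<open>If the fermions and the ideal failed to span the bidegree, some linear functional would
  vanish on both but not on the bidegree. The locale collects what such a functional satisfies and
  derives that it does vanish there. Fermions of crossing partitions are included, since the
  relations below come from arbitrary set partitions.\<close>

locale killing_functional =
  fixes n k :: nat and L :: "vec \<Rightarrow> complex"
  assumes n: "1 \<le> n" and k: "1 \<le> k" "k \<le> n"
    and lin_L: "module_hom scl (*) L"
    and L_fin: "L (fin_part y) = L y"
    and L_ttot: "L (ttot n y) = 0" and L_xtot: "L (xtot n y) = 0" and L_dlt: "L (dlt n y) = 0"
    and L_fp: "partition_on {1..n} \<pi> \<Longrightarrow> card \<pi> = k \<Longrightarrow> L (fp n \<pi>) = 0"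
begin

lemmas L_simps = module_hom.add[OF lin_L] module_hom.scale[OF lin_L] module_hom.neg[OF lin_L]
  module_hom.zero[OF lin_L] module_hom.sum[OF lin_L] module_hom.diff[OF lin_L]

text \<open>The functional on fermions written in difference letters. \<open>M_pp0\<close> relates
  it to \<open>Lam\<close>, from which the total contraction \<open>dxi\<close> has
  disappeared.\<close>

definition M :: "ev \<Rightarrow> complex"
  where "M r = L (dxi n (act1 n r (Theta n)))"

definition Lam :: "ev \<Rightarrow> complex"
  where "Lam r = L (act1 n r (vbase n))"

lemma M_add: "M (r + s) = M r + M s"
  by (simp add: M_def o1.act_add dxi_simps L_simps)

lemma M_zero: "M 0 = 0"
  by (simp add: M_def dxi_simps L_simps)

lemma M_sum: "M (sum f A) = (\<Sum>a\<in>A. M (f a))"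
  by (induction A rule: infinite_finite_induct) (simp_all add: M_add M_zero)

lemma M_of_nat: "M (of_nat a * r) = of_nat a * M r"
  by (induction a) (simp_all add: M_zero M_add distrib_right)

lemma Lam_diff: "Lam (r - s) = Lam r - Lam s"
  by (simp add: Lam_def o1.act_diff L_simps)

lemma Lam_zero: "Lam 0 = 0"
  by (simp add: Lam_def L_simps)

lemma good_commutes:
  assumes "good n r"
  shows "dlt n (act1 n r y) = act1 n r (dlt n y)" "dxi n (act1 n r y) = act1 n r (dxi n y)"
    "ttot n (act1 n r y) = act1 n r (ttot n y)" "xtot n (act1 n r y) = act1 n r (xtot n y)"
    "op1 n g (act1 n r y) = act1 n r (op1 n g y)"
  using assms n unfolding good_def commutes_def
  by (auto simp: lin_dxi lin_tot lin_op1 antic_tot)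

lemma Theta_eq: "Theta n = scl (1 / of_nat n) (ttot n (vbase n))"
  using n by (simp add: vbase_facts)

text \<open>\<open>Theta n\<close> is in the image of \<open>ttot\<close>, which can be carried to
  the front, where \<open>L\<close> kills it.\<close>

lemma L_theta_zero:
  assumes "good n r" "i \<in> {1..n}"
  shows "L (op1 n (False, i) (act1 n r (Theta n))) = 0"
proof -
  have "antic n (ttot n) (False, i)" using antic_tot(3)[OF n] assms(2) by auto
  then have "op1 n (False, i) (act1 n r (ttot n (vbase n))) = - ttot n (op1 n (False, i) (act1 n r (vbase n)))"
    unfolding antic_def good_commutes(3)[OF assms(1), symmetric] by simp
  then show ?thesis
    by (subst Theta_eq) (simp add: module_hom.scale[OF o1.lin_act] o1.op_simps L_simps L_ttot)
qed

lemma M_good: "good n r \<Longrightarrow> M r = 0"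
  by (simp add: M_def good_commutes Theta_facts module_hom.zero[OF o1.lin_act] L_simps)

lemma dxi_first:
  "L (dxi n (op1 n (True, 0) z)) = L z - L (cr (xi n) (dxi n z))"
  using n by (simp add: op1_def dxi_xi L_simps L_fin)

lemma dxi_z: "good n r \<Longrightarrow> dxi n (act1 n r (Theta n)) = 0"
  by (simp add: good_commutes Theta_facts module_hom.zero[OF o1.lin_act])

lemma dxi_op1:
  assumes "1 \<le> i" "i \<le> n"
  shows "dxi n (op1 n (c, i) y) = - op1 n (c, i) (dxi n y)"
  using antic_tot(4)[OF n assms, of c] by (simp add: antic_def)

lemma dxi_op1_0: "dxi n (op1 n (False, 0) y) = - op1 n (False, 0) (dxi n y)"
  using antic_tot(6)[OF n] by (simp add: antic_def)

text \<open>In one summand the total contraction reaches \<open>Theta n\<close> and vanishes; in the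
  other it removes the letter \<open>(True, 0)\<close> and leaves a case of
  \<open>L_theta_zero\<close>.\<close>

lemma M_br0:
  assumes r: "good n r" and i: "i \<in> {1..n}"
  shows "M (br i 0 * r) = 0"
proof -
  let ?z = "act1 n r (Theta n)"
  have i': "1 \<le> i" "i \<le> n" using i by auto
  have "M (br i 0 * r) = L (dxi n (op1 n (True, i) (op1 n (False, 0) ?z))) + L (dxi n (op1 n (True, 0) (op1 n (False, i) ?z)))"
    unfolding M_def using i' by (simp add: o1.act_mult o1.act_br o1.brop_def dxi_simps L_simps)
  also have "L (dxi n (op1 n (True, i) (op1 n (False, 0) ?z))) = 0"
    unfolding dxi_op1[OF i'] dxi_op1_0 dxi_z[OF r] by (simp add: o1.op_simps L_simps)
  also have "L (dxi n (op1 n (True, 0) (op1 n (False, i) ?z))) = 0"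
    unfolding dxi_first dxi_op1[OF i'] dxi_z[OF r] L_theta_zero[OF r i] by (simp add: o1.op_simps cr.op_simps L_simps)
  finally show ?thesis by simp
qed

text \<open>The contraction \<open>dxi\<close> removes the x-letter of \<open>pp 0\<close> and
  leaves the contraction with \<open>theta n\<close>. As \<open>n\<close> times
  \<open>Theta n\<close> is \<open>ttot n (vbase n)\<close>, that contraction gives
  \<open>vbase n\<close> up to the image of \<open>ttot\<close>.\<close>

lemma M_pp0:
  assumes r: "good n r"
  shows "of_nat n * M (pp 0 * r) = Lam r"
proof -
  let ?z = "act1 n r (Theta n)"
  have "M (pp 0 * r) = L (dxi n (op1 n (True, 0) (op1 n (False, 0) ?z)))"
    unfolding M_def by (simp add: o1.act_mult o1.act_pp)
  also have "\<dots> = L (op1 n (False, 0) ?z)"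
    unfolding dxi_first dxi_op1_0 dxi_z[OF r] by (simp add: o1.op_simps cr.op_simps L_simps)
  finally have "of_nat n * M (pp 0 * r) = L (scl (of_nat n) (op1 n (False, 0) ?z))" by (simp add: L_simps)
  also have "scl (of_nat n) (op1 n (False, 0) ?z) = op1 n (False, 0) (act1 n r (scl (of_nat n) (Theta n)))"
    by (simp add: module_hom.scale[OF o1.lin_act] o1.op_simps)
  also have "\<dots> = act1 n r (op1 n (False, 0) (ttot n (vbase n)))"
    by (simp only: vbase_facts(1) good_commutes(5)[OF r])
  also have "op1 n (False, 0) (ttot n (vbase n)) = vbase n - ttot n (an (theta n) (vbase n))"
    using n ttot_theta[of n n "vbase n"] by (simp add: op1_def fin_vbase)
  also have "act1 n r (vbase n - ttot n (an (theta n) (vbase n))) =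
      act1 n r (vbase n) - ttot n (act1 n r (an (theta n) (vbase n)))"
    unfolding good_commutes(3)[OF r] by (rule module_hom.diff[OF o1.lin_act])
  finally show ?thesis by (simp add: L_simps L_ttot Lam_def)
qed

text \<open>The master relation: a set partition of \<open>{1..n}\<close> is encoded by a partition \<open>\<tau>\<close> of
  \<open>{1..n-1}\<close> with weights, where the point \<open>n\<close> contributes only to the weights.\<close>

lemma master_relation:
  assumes fin: "finite \<tau>" and sub: "\<And>B. B \<in> \<tau> \<Longrightarrow> B \<subseteq> {1..n}" and R: "\<And>B. B \<in> \<tau> \<Longrightarrow> good n (R B)"
    and z: "M (\<Prod>B\<in>\<tau>. R B + of_nat (a B) * bs B 0 + of_nat (c B) * pp 0) = 0"
  shows "2 * (\<Sum>B\<in>\<tau>. of_nat (c B) * Lam (\<Prod>D\<in>\<tau> - {B}. R D)) =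
    (\<Sum>B\<in>\<tau>. \<Sum>D\<in>\<tau> - {B}. of_nat (a B) * of_nat (a D) * Lam (bss B D * (\<Prod>E\<in>\<tau> - {B} - {D}. R E)))"
proof -
  define P where "P = (\<Prod>B\<in>\<tau>. R B)"
  define S1 where "S1 = (\<Sum>B\<in>\<tau>. of_nat (a B) * (bs B 0 * (\<Prod>D\<in>\<tau> - {B}. R D)))"
  define S2 where "S2 = pp 0 * (\<Sum>B\<in>\<tau>. of_nat (c B) * (\<Prod>D\<in>\<tau> - {B}. R D))"
  define S3 where "S3 = (\<Sum>B\<in>\<tau>. \<Sum>D\<in>\<tau> - {B}. of_nat (a B) * of_nat (a D) * (bs B 0 * bs D 0 * (\<Prod>E\<in>\<tau> - {B} - {D}. R E)))"
  have Yp: "bs B 0 * pp 0 = 0" for B using pp_bs_zero[of 0 B] by (simp only: mult.commute)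
  have YYY: "bs B 0 * (bs D 0 * bs E 0) = 0" for B D E
  proof -
    have "bs B 0 * (bs D 0 * bs E 0) = bs B 0 * pp 0 * (- bss D E)" unfolding bs_bs by simp
    then show ?thesis by (simp add: Yp)
  qed
  have e: "2 * (\<Prod>B\<in>\<tau>. R B + of_nat (a B) * bs B 0 + of_nat (c B) * pp 0) = 2 * P + 2 * S1 + 2 * S2 + S3"
    unfolding P_def S1_def S2_def S3_def by (rule prod_expand[OF fin YYY Yp pp_square])
  have two: "M (2 * r) = 2 * M r" for r using M_of_nat[of 2 r] by simp
  have gp: "good n (\<Prod>D\<in>A. R D)" if "A \<subseteq> \<tau>" for A using R that by (intro good_prod) auto
  have mP: "M P = 0" unfolding P_def by (rule M_good[OF gp]) simp
  have mS1: "M S1 = 0"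
    unfolding S1_def M_sum M_of_nat
  proof (rule sum.neutral, rule ballI)
    fix B assume B: "B \<in> \<tau>"
    have "M (bs B 0 * (\<Prod>D\<in>\<tau> - {B}. R D)) = (\<Sum>b\<in>B. M (br b 0 * (\<Prod>D\<in>\<tau> - {B}. R D)))"
      by (simp add: bs_def sum_distrib_right M_sum)
    also have "\<dots> = 0" using sub[OF B] gp by (intro sum.neutral ballI M_br0) auto
    finally show "of_nat (a B) * M (bs B 0 * (\<Prod>D\<in>\<tau> - {B}. R D)) = 0" by simp
  qed
  have mS2: "of_nat n * M S2 = (\<Sum>B\<in>\<tau>. of_nat (c B) * Lam (\<Prod>D\<in>\<tau> - {B}. R D))"
  proof -
    have "S2 = (\<Sum>B\<in>\<tau>. of_nat (c B) * (pp 0 * (\<Prod>D\<in>\<tau> - {B}. R D)))"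
      unfolding S2_def sum_distrib_left by (rule sum.cong[OF refl]) (simp only: mult_ac)
    then have "M S2 = (\<Sum>B\<in>\<tau>. of_nat (c B) * M (pp 0 * (\<Prod>D\<in>\<tau> - {B}. R D)))"
      by (simp only: M_sum M_of_nat)
    then have "of_nat n * M S2 = (\<Sum>B\<in>\<tau>. of_nat (c B) * (of_nat n * M (pp 0 * (\<Prod>D\<in>\<tau> - {B}. R D))))"
      by (simp only: sum_distrib_left mult.left_commute)
    also have "\<dots> = (\<Sum>B\<in>\<tau>. of_nat (c B) * Lam (\<Prod>D\<in>\<tau> - {B}. R D))"
      by (rule sum.cong[OF refl]) (simp only: M_pp0[OF gp[OF Diff_subset]])
    finally show ?thesis .
  qed
  have mS3: "of_nat n * M S3 =
    - (\<Sum>B\<in>\<tau>. \<Sum>D\<in>\<tau> - {B}. of_nat (a B) * of_nat (a D) * Lam (bss B D * (\<Prod>E\<in>\<tau> - {B} - {D}. R E)))"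
  proof -
    have t: "of_nat n * M (of_nat (a B) * of_nat (a D) * (bs B 0 * bs D 0 * (\<Prod>E\<in>\<tau> - {B} - {D}. R E))) =
        - (of_nat (a B) * of_nat (a D) * Lam (bss B D * (\<Prod>E\<in>\<tau> - {B} - {D}. R E)))"
      if BD: "B \<in> \<tau>" "D \<in> \<tau>" for B D
    proof -
      let ?Q = "\<Prod>E\<in>\<tau> - {B} - {D}. R E"
      have g: "good n (bss B D * ?Q)" using sub BD by (intro good_mult good_bss gp) auto
      \<comment> \<open>Two brackets with index 0 contract to \<open>- pp 0\<close> times a bracket
        sum without that index, so \<open>M_pp0\<close> applies to these terms too.\<close>
      have "bs B 0 * bs D 0 * ?Q + pp 0 * (bss B D * ?Q) = 0" unfolding bs_bs by (simp add: mult.assoc)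
      then have "M (bs B 0 * bs D 0 * ?Q) + M (pp 0 * (bss B D * ?Q)) = 0" by (metis M_add M_zero)
      then have "of_nat n * (M (bs B 0 * bs D 0 * ?Q) + M (pp 0 * (bss B D * ?Q))) = 0" by simp
      then have *: "of_nat n * M (bs B 0 * bs D 0 * ?Q) = - Lam (bss B D * ?Q)"
        by (simp add: distrib_left M_pp0[OF g] eq_neg_iff_add_eq_0)
      have "of_nat n * M (of_nat (a B) * of_nat (a D) * (bs B 0 * bs D 0 * ?Q)) =
          of_nat (a B) * of_nat (a D) * (of_nat n * M (bs B 0 * bs D 0 * ?Q))"
        by (simp only: mult.assoc M_of_nat) (simp only: mult_ac)
      then show ?thesis by (simp only: * mult_minus_right)
    qed
    have "of_nat n * M S3 = (\<Sum>B\<in>\<tau>. \<Sum>D\<in>\<tau> - {B}.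
        of_nat n * M (of_nat (a B) * of_nat (a D) * (bs B 0 * bs D 0 * (\<Prod>E\<in>\<tau> - {B} - {D}. R E))))"
      unfolding S3_def M_sum sum_distrib_left ..
    also have "\<dots> = (\<Sum>B\<in>\<tau>. \<Sum>D\<in>\<tau> - {B}. - (of_nat (a B) * of_nat (a D) * Lam (bss B D * (\<Prod>E\<in>\<tau> - {B} - {D}. R E))))"
      by (intro sum.cong refl t) auto
    finally show ?thesis by (simp only: sum_negf)
  qed
  have "0 = of_nat n * M (2 * (\<Prod>B\<in>\<tau>. R B + of_nat (a B) * bs B 0 + of_nat (c B) * pp 0))"
    unfolding two z by simp
  also have "\<dots> = 2 * (of_nat n * M S2) + of_nat n * M S3"
    unfolding e M_add two mP mS1 by (simp add: algebra_simps)
  finally show ?thesis unfolding mS2 mS3 by simp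
qed

section \<open>Values of the functional on products over blocks that avoid the last point\<close>

definition Pf :: "nat set \<Rightarrow> nat set set \<Rightarrow> complex"
  where "Pf Z \<B> = Lam ((\<Prod>z\<in>Z. pp z) * (\<Prod>B\<in>\<B>. qq B))"

text \<open>In \<open>Pf Z \<B>\<close> the points of \<open>Z\<close> carry factors
  \<open>pp\<close> and the blocks carry factors \<open>qq\<close>; a one-point block is allowed and
  makes the value zero. The point \<open>n\<close> is left out because its difference letters act as
  zero. Some points may remain uncovered, the generality in which \<open>Pf_zero\<close> is
  needed.\<close>

definition blocks_ok :: "nat set \<Rightarrow> nat set set \<Rightarrow> bool"
  where "blocks_ok Z \<B> \<longleftrightarrow> disjoint \<B> \<and> {} \<notin> \<B> \<and> \<Union> \<B> \<inter> Z = {} \<and> \<Union> \<B> \<union> Z \<subseteq> {1..<n}"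

lemma blocks_ok_finite:
  assumes "blocks_ok Z \<B>"
  shows "finite Z" "finite \<B>" "\<And>B. B \<in> \<B> \<Longrightarrow> finite B" "\<And>B. B \<in> \<B> \<Longrightarrow> B \<subseteq> {1..<n}" "Z \<subseteq> {1..<n}"
proof -
  have s: "\<Union> \<B> \<subseteq> {1..<n}" "Z \<subseteq> {1..<n}" using assms by (auto simp: blocks_ok_def)
  show "Z \<subseteq> {1..<n}" "finite Z" by (rule s(2), rule finite_subset[OF s(2)], simp)
  show B: "B \<subseteq> {1..<n}" if "B \<in> \<B>" for B using s(1) that by blast
  show "finite B" if "B \<in> \<B>" for B by (rule finite_subset[OF B[OF that]]) simp
  have "finite (\<Union> \<B>)" by (rule finite_subset[OF s(1)]) simp
  then show "finite \<B>" by (rule finite_UnionD)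
qed

lemma Pf_single_zero: "finite \<B> \<Longrightarrow> {b} \<in> \<B> \<Longrightarrow> Pf Z \<B> = 0"
  by (simp add: Pf_def prod_zero Lam_zero)
     (metis Lam_zero mult_zero_right prod_zero qq_single)?

lemma fp_same_act:
  assumes "same_act n (bprod \<pi>) r" "partition_on {1..n} \<pi>" "card \<pi> = k"
  shows "M r = 0"
  using assms L_fp[OF assms(2,3)] by (simp add: fp_def M_def same_act_def)

lemma same_act_prod:
  "(\<And>B. B \<in> A \<Longrightarrow> same_act n (f B) (g B)) \<Longrightarrow> same_act n (prod f A) (prod g A)"
  by (induction A rule: infinite_finite_induct) (simp_all add: same_act_closed)

lemma same_act_cong1:
  assumes "same_act n r s" "\<And>y. act1 n s y = act1 n s' y" shows "same_act n r s'"
  using assms by (simp add: same_act_def)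

text \<open>The coefficients of \<open>bs B 0\<close> and \<open>pp 0\<close> when
  \<open>bq B\<close> is rewritten in difference letters: from \<open>same_act_br\<close> for a
  singleton, from \<open>same_act_qq\<close> otherwise.\<close>

definition wgt :: "nat set \<Rightarrow> nat \<times> nat"
  where "wgt B = (if is_singleton B then (1, 1) else (card B - 1, card B * (card B - 1)))"

lemma same_act_bq:
  assumes "B \<subseteq> {1..n}" "B \<noteq> {}"
  shows "same_act n (bq B) (bq B + of_nat (fst (wgt B)) * bs B 0 + of_nat (snd (wgt B)) * pp 0)"
proof (cases "is_singleton B")
  case True
  then obtain a where B: "B = {a}" by (auto simp: is_singleton_def)
  show ?thesis using same_act_br(2)[of a n a] assms by (simp add: B wgt_def bs_def)
next
  case False
  have fin: "finite B" using assms(1) finite_subset by blast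
  then have "card B \<ge> 1" using assms(2) by (simp add: Suc_leI card_gt_0_iff)
  then have e: "of_nat (card B - Suc 0) = (of_nat (card B) - 1 :: ev)" by (simp add: of_nat_diff)
  show ?thesis using same_act_qq[OF fin assms(1)] False
    by (simp add: bq_not_single wgt_def e)
qed

lemma act1_n_zero:
  assumes "i \<le> n" shows "act1 n (br i n * r) y = 0" "act1 n (pp n * r) y = 0"
  using assms n by (simp_all add: o1.act_mult o1.act_br o1.act_pp o1.brop_def o1.op_simps)

lemma partition_singletons:
  assumes ok: "blocks_ok Z \<B>" and cov: "Z \<union> \<Union> \<B> = {1..<n}"
  shows "partition_on {1..<n} ((\<lambda>z. {z}) ` Z \<union> \<B>)" "card ((\<lambda>z. {z}) ` Z \<union> \<B>) = card Z + card \<B>"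
    "(\<lambda>z. {z}) ` Z \<inter> \<B> = {}"
proof -
  have d: "\<Union> \<B> \<inter> Z = {}" "disjoint \<B>" "{} \<notin> \<B>" using ok by (auto simp: blocks_ok_def)
  show i: "(\<lambda>z. {z}) ` Z \<inter> \<B> = {}" using d(1) by auto
  have "disjoint ((\<lambda>z. {z}) ` Z \<union> \<B>)"
  proof (rule disjoint_union)
    show "disjoint ((\<lambda>z. {z}) ` Z)" unfolding disjoint_def by auto
    show "\<Union> ((\<lambda>z. {z}) ` Z) \<inter> \<Union> \<B> = {}" using d(1) by auto
  qed (rule d)
  then show "partition_on {1..<n} ((\<lambda>z. {z}) ` Z \<union> \<B>)"
    unfolding partition_on_def using cov d(3) by auto
  show "card ((\<lambda>z. {z}) ` Z \<union> \<B>) = card Z + card \<B>"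
    using card_Un_disjoint[OF _ blocks_ok_finite(2)[OF ok] i] blocks_ok_finite(1)[OF ok]
    by (simp add: card_image)
qed

lemma prod_singletons:
  assumes "finite Z" "finite \<B>" "(\<lambda>z. {z}) ` Z \<inter> \<B> = {}" "\<And>B. B \<in> \<B> \<Longrightarrow> g B = qq B" "\<And>z. z \<in> Z \<Longrightarrow> g {z} = pp z"
  shows "(\<Prod>B\<in>(\<lambda>z. {z}) ` Z \<union> \<B>. g B) = (\<Prod>z\<in>Z. pp z) * (\<Prod>B\<in>\<B>. qq B)"
proof -
  have "(\<Prod>B\<in>(\<lambda>z. {z}) ` Z \<union> \<B>. g B) = (\<Prod>B\<in>(\<lambda>z. {z}) ` Z. g B) * (\<Prod>B\<in>\<B>. g B)"
    using assms(1-3) by (intro prod.union_disjoint) auto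
  also have "(\<Prod>B\<in>(\<lambda>z. {z}) ` Z. g B) = (\<Prod>z\<in>Z. pp z)"
    using assms(5) by (simp add: prod.reindex)
  also have "(\<Prod>B\<in>\<B>. g B) = (\<Prod>B\<in>\<B>. qq B)" using assms(4) by (intro prod.cong) auto
  finally show ?thesis .
qed

text \<open>Add the block \<open>{n}\<close> to the partition \<sigma> made of the given blocks and
  the singletons of \<open>Z\<close>. In difference letters the new factor becomes
  \<open>pp 0\<close>, which annihilates all corrections with index 0 in the other factors. Hence
  \<open>M (pp 0 * bprod \<sigma>)\<close> is zero, and \<open>M_pp0\<close> turns this into the
  claim.\<close>

lemma Pf_full:
  assumes ok: "blocks_ok Z \<B>" and cov: "Z \<union> \<Union> \<B> = {1..<n}" and crd: "card Z + card \<B> = k - 1"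
  shows "Pf Z \<B> = 0"
proof (cases "\<forall>B\<in>\<B>. card B \<ge> 2")
  case False
  then obtain B where B: "B \<in> \<B>" "card B < 2" by auto
  moreover have "card B \<noteq> 0" using B blocks_ok_finite(3)[OF ok] ok by (auto simp: blocks_ok_def)
  ultimately have "card B = 1" by simp
  then obtain b where "B = {b}" by (rule card_1_singletonE)
  then show ?thesis using Pf_single_zero blocks_ok_finite(2)[OF ok] B(1) by blast
next
  case True
  define \<sigma> where "\<sigma> = (\<lambda>z. {z}) ` Z \<union> \<B>"
  note p = partition_singletons[OF ok cov, folded \<sigma>_def]
  have ps: "partition_on {1..<n} \<sigma>" "card \<sigma> = k - 1" using p True crd by auto
  have fin\<sigma>: "finite \<sigma>" using finite_elements[OF _ ps(1)] by simp
  have sub: "B \<subseteq> {1..n}" "B \<noteq> {}" if "B \<in> \<sigma>" for B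
  proof -
    have "B \<subseteq> {1..<n}" using ps(1) that unfolding partition_on_def by blast
    then show "B \<subseteq> {1..n}" by auto
    show "B \<noteq> {}" using ps(1) that unfolding partition_on_def by blast
  qed
  have nn: "{n} \<notin> \<sigma>" using ps(1) unfolding partition_on_def by auto
  have pn: "partition_on {1..n} (insert {n} \<sigma>)"
  proof -
    have "\<Union> \<sigma> = {1..<n}" using ps(1) unfolding partition_on_def by (rule conjunct1)
    then have d: "disjnt {n} (\<Union> \<sigma>)" by simp
    have "{n} \<union> {1..<n} - {n} = {1..<n}" by auto
    then have "partition_on ({n} \<union> {1..<n}) (insert {n} \<sigma>)"
      unfolding partition_on_insert[OF d] using ps(1) by simp
    moreover have "{n} \<union> {1..<n} = {1..n}" using n by auto
    ultimately show ?thesis by simp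
  qed
  have cn: "card (insert {n} \<sigma>) = k" using nn fin\<sigma> ps(2) k by simp
  have bqp: "bprod \<sigma> = (\<Prod>z\<in>Z. pp z) * (\<Prod>B\<in>\<B>. qq B)"
    unfolding bprod_def \<sigma>_def
    by (rule prod_singletons) (use blocks_ok_finite[OF ok] p(3) True in \<open>auto simp: bq_not_single is_singleton_altdef \<sigma>_def\<close>)
  define r where "r = (\<Prod>B\<in>\<sigma>. bq B + of_nat (fst (wgt B)) * bs B 0 + of_nat (snd (wgt B)) * pp 0)"
  have r: "same_act n (bprod \<sigma>) r"
    unfolding r_def bprod_def using sub by (intro same_act_prod same_act_bq) auto
  have "same_act n (pp n) (pp n + br n 0 + pp 0)" using same_act_br(2)[of n n n] n by simp
  then have "same_act n (pp n) (pp 0)"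
    by (rule same_act_cong1)
       (use n act1_n_zero(2)[of n 1] in \<open>simp add: o1.act_add o1.act_br o1.brop_def o1.op_simps\<close>)
  then have "same_act n (pp n * bprod \<sigma>) (pp 0 * r)" using r by (rule same_act_closed)
  moreover have "bprod (insert {n} \<sigma>) = pp n * bprod \<sigma>" using nn fin\<sigma> by (simp add: bprod_def)
  ultimately have "M (pp 0 * r) = 0" using fp_same_act[OF _ pn cn] by simp
  moreover have "pp 0 * r = pp 0 * bprod \<sigma>"
    unfolding r_def bprod_def using fin\<sigma>
  proof (induction \<sigma> rule: finite_induct)
    case (insert B \<sigma>)
    let ?f = "\<lambda>B. bq B + of_nat (fst (wgt B)) * bs B 0 + of_nat (snd (wgt B)) * pp 0"
    have "pp 0 * (\<Prod>B\<in>insert B \<sigma>. ?f B) = ?f B * (pp 0 * (\<Prod>B\<in>\<sigma>. ?f B))"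
      using insert.hyps by (simp add: mult.left_commute)
    also have "\<dots> = (pp 0 * ?f B) * (\<Prod>B\<in>\<sigma>. bq B)" unfolding insert.IH by (simp only: mult_ac)
    also have "pp 0 * ?f B = pp 0 * bq B + of_nat (fst (wgt B)) * (pp 0 * bs B 0) + of_nat (snd (wgt B)) * (pp 0 * pp 0)"
      by (simp only: distrib_left mult_ac)
    also have "\<dots> = pp 0 * bq B" by (simp add: pp_bs_zero pp_square)
    finally show ?case using insert.hyps by (simp add: mult.assoc)
  qed simp
  moreover have "good n (bprod \<sigma>)"
    unfolding bprod_def
  proof (rule good_prod)
    fix B assume "B \<in> \<sigma>"
    then have B: "B \<subseteq> {1..n}" by (rule sub)
    show "good n (bq B)"
    proof (cases "is_singleton B")
      case True
      then show ?thesis using B good_br(2) by (auto simp: is_singleton_def)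
    next
      case False
      then show ?thesis using good_qq[OF B] by (simp add: bq_not_single)
    qed
  qed
  ultimately have "Lam (bprod \<sigma>) = 0" using M_pp0 by fastforce
  then show ?thesis by (simp add: Pf_def bqp)
qed

end

lemma bss_commute: "bss A B = bss B A"
  unfolding bss_def bs_def by (subst sum.swap) (simp only: br_commute)

context killing_functional
begin

text \<open>Adding \<open>n\<close> to the block \<open>C\<close> creates no new bracket, as the
  letters of index \<open>n\<close> act as zero; it only raises the weights from those of
  \<open>card C\<close> points to those of \<open>card C + 1\<close> points.\<close>

lemma same_act_marked:
  assumes C: "C \<subseteq> {1..<n}" "C \<noteq> {}"
  shows "same_act n (bq (insert n C)) (qq C + of_nat (card C) * bs C 0 + of_nat (card C * (card C + 1)) * pp 0)"
proof -
  have fin: "finite C" by (rule finite_subset[OF C(1)]) simp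
  have nC: "n \<notin> C" using C(1) by auto
  have sub: "insert n C \<subseteq> {1..n}" using C(1) n by auto
  have ns: "\<not> is_singleton (insert n C)" using nC C(2) by (auto simp: is_singleton_def)
  have b0: "act1 n (bs C n) y = 0" for y
  proof -
    have "act1 n (br b n) y = 0" if "b \<in> C" for b
    proof -
      have "b \<le> n" using that C(1) by auto
      from act1_n_zero(1)[OF this, of 1] show ?thesis by simp
    qed
    then show ?thesis unfolding bs_def o1.act_sum by (intro sum.neutral ballI)
  qed
  have n0: "act1 n (br n 0) y = 0" for y
    using n by (simp add: o1.act_br o1.brop_def o1.op_simps)
  have qn: "same_act n (bq (insert n C)) (qq (insert n C) + (of_nat (card (insert n C)) - 1) * bs (insert n C) 0
    + of_nat (card (insert n C)) * (of_nat (card (insert n C)) - 1) * pp 0)"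
    unfolding bq_not_single[OF ns] using fin by (intro same_act_qq sub) simp
  have cc: "(of_nat (card (insert n C)) :: ev) = of_nat (card C) + 1" using fin nC by simp
  have e: "qq (insert n C) + (of_nat (card (insert n C)) - 1) * bs (insert n C) 0
    + of_nat (card (insert n C)) * (of_nat (card (insert n C)) - 1) * pp 0
    = (qq C + of_nat (card C) * bs C 0 + of_nat (card C * (card C + 1)) * pp 0) + (bs C n + of_nat (card C) * br n 0)"
    unfolding cc qq_insert[OF fin nC] bs_insert[OF fin nC] by (simp add: algebra_simps)
  have z: "act1 n (bs C n + of_nat (card C) * br n 0) y = 0" for y
    by (simp add: o1.act_add o1.act_mult b0 n0 module_hom.zero[OF o1.lin_act])
  show ?thesis using qn unfolding e by (rule same_act_cong1) (simp only: o1.act_add[of n _ _ "bs C n + _"] z add_0_right)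
qed

text \<open>The partition used is the one with \<open>n\<close> added to \<open>C\<close>. In the
  master relation the terms that involve a point of \<open>Z\<close> vanish by \<open>IH\<close>.
  For two blocks, \<open>bss B D = qq (B \<union> D) - qq B - qq D\<close>: the merged term is zero
  by \<open>Pf_full\<close>, and the other two are the values with \<open>D\<close> or
  \<open>B\<close> removed. So the relation becomes linear in the values
  \<open>Pf Z (\<tau>0 - {B})\<close>.\<close>

lemma Pf_relation:
  assumes ok: "blocks_ok Z \<tau>0" and cov: "Z \<union> \<Union> \<tau>0 = {1..<n}" and crd: "card Z + card \<tau>0 = k"
    and C: "C \<in> \<tau>0" and big: "\<And>B. B \<in> \<tau>0 \<Longrightarrow> B \<noteq> C \<Longrightarrow> card B \<ge> 2"
    and IH: "\<And>Z' \<B>'. blocks_ok Z' \<B>' \<Longrightarrow> card Z' < card Z \<Longrightarrow> card Z' + card \<B>' = k - 1 \<Longrightarrow> Pf Z' \<B>' = 0"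
  shows "(\<Sum>B\<in>\<tau>0. of_nat (if B = C then card B else card B - 1) * Pf Z (\<tau>0 - {B})) = 0"
proof -
  let ?s = "\<lambda>z::nat. {z}"
  define \<tau> where "\<tau> = ?s ` Z \<union> \<tau>0"
  note ps = partition_singletons[OF ok cov, folded \<tau>_def]
  note fin = blocks_ok_finite[OF ok]
  have fin\<tau>: "finite \<tau>" unfolding \<tau>_def using fin(1,2) by simp
  have dj: "B \<inter> D = {}" if "B \<in> \<tau>" "D \<in> \<tau>" "B \<noteq> D" for B D
    using ps(1) that unfolding partition_on_def disjoint_def by blast
  have sub: "B \<subseteq> {1..<n}" if "B \<in> \<tau>" for B using ps(1) that unfolding partition_on_def by blast
  have sub': "B \<subseteq> {1..n}" if "B \<in> \<tau>" for B using sub[OF that] by auto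
  have ne: "B \<noteq> {}" if "B \<in> \<tau>" for B using ps(1) that unfolding partition_on_def by blast
  have finB: "finite B" if "B \<in> \<tau>" for B by (rule finite_subset[OF sub[OF that]]) simp
  have t0: "B \<in> \<tau>" if "B \<in> \<tau>0" for B using that by (simp add: \<tau>_def)
  have ts: "{z} \<in> \<tau>" if "z \<in> Z" for z using that by (simp add: \<tau>_def)
  have n0: "{z} \<notin> \<tau>0" if "z \<in> Z" for z using ps(3) that by blast
  define R where "R B = (if B \<in> \<tau>0 then qq B else bq B)" for B
  \<comment> \<open>\<open>a\<close> and \<open>c\<close> are the coefficients from
    \<open>same_act_marked\<close> for \<open>C\<close> and from \<open>wgt\<close> for the other
    blocks. For every block of \<open>\<tau>0\<close> the second is the first times its
    successor.\<close>
  define a where "a B = (if B \<in> \<tau>0 then (if B = C then card B else card B - 1) else 1)" for B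
  define c where "c B = (if B \<in> \<tau>0 then a B * (a B + 1) else 1)" for B
  have goodR: "good n (R B)" if Bt: "B \<in> \<tau>" for B
  proof (cases "B \<in> \<tau>0")
    case True
    then show ?thesis using good_qq[OF sub'[OF Bt]] by (simp add: R_def)
  next
    case False
    then obtain z where z: "B = {z}" using Bt by (auto simp: \<tau>_def)
    then have "z \<in> {1..n}" using sub'[OF Bt] by blast
    then show ?thesis using z False good_br(2)[of z n z] by (simp add: R_def)
  qed
  have M0: "M (\<Prod>B\<in>\<tau>. R B + of_nat (a B) * bs B 0 + of_nat (c B) * pp 0) = 0"
  proof (rule fp_same_act)
    let ?\<pi> = "insert (insert n C) (\<tau> - {C})"
    have Ct: "C \<in> \<tau>" using C by (rule t0)
    have un: "\<Union> \<tau> = {1..<n}" using ps(1) unfolding partition_on_def by blast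
    have nC: "insert n C \<notin> \<tau> - {C}"
    proof
      assume "insert n C \<in> \<tau> - {C}"
      then have "insert n C \<subseteq> {1..<n}" using sub by blast
      then show False by simp
    qed
    have dC: "D \<inter> C = {}" if "D \<in> \<tau> - {C}" for D using dj[of D C] that Ct by blast
    have "\<Union> (\<tau> - {C}) = \<Union> \<tau> - C"
    proof (intro equalityI subsetI)
      fix x assume "x \<in> \<Union> (\<tau> - {C})"
      then obtain D where "D \<in> \<tau> - {C}" "x \<in> D" by (rule UnionE)
      then show "x \<in> \<Union> \<tau> - C" using dC by blast
    qed auto
    then have unC: "\<Union> (\<tau> - {C}) = {1..<n} - C" by (simp only: un)
    have d: "disjnt (insert n C) (\<Union> (\<tau> - {C}))" unfolding unC by (auto simp: disjnt_def)
    have pC: "partition_on ({1..<n} - C) (\<tau> - {C})"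
      unfolding partition_on_def
    proof (intro conjI)
      show "\<Union> (\<tau> - {C}) = {1..<n} - C" by (rule unC)
      show "disjoint (\<tau> - {C})" unfolding disjoint_def using dj by simp
      show "{} \<notin> \<tau> - {C}" using ne by blast
    qed
    have "{1..n} - insert n C = {1..<n} - C" by auto
    moreover have "insert n C \<subseteq> {1..n}" using sub'[OF Ct] n by auto
    ultimately show "partition_on {1..n} ?\<pi>"
      unfolding partition_on_insert[OF d] using pC by simp
    have "card ?\<pi> = card \<tau>" using nC fin\<tau> Ct by (simp add: card_Suc_Diff1 del: card_Diff_insert)
    then show "card ?\<pi> = k" using ps(2) crd by simp
    let ?f = "\<lambda>B. R B + of_nat (a B) * bs B 0 + of_nat (c B) * pp 0"
    have "same_act n (\<Prod>B\<in>\<tau> - {C}. bq B) (\<Prod>B\<in>\<tau> - {C}. ?f B)"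
    proof (rule same_act_prod)
      fix B assume B: "B \<in> \<tau> - {C}"
      then have Bt: "B \<in> \<tau>" by blast
      have "?f B = bq B + of_nat (fst (wgt B)) * bs B 0 + of_nat (snd (wgt B)) * pp 0"
      proof (cases "B \<in> \<tau>0")
        case True
        then have c2: "card B \<ge> 2" using big B by blast
        then have "\<not> is_singleton B" by (auto simp: is_singleton_altdef)
        moreover have "card B - 1 + 1 = card B" using c2 by simp
        ultimately show ?thesis using True B
          by (simp add: R_def a_def c_def bq_not_single wgt_def mult.commute)
      next
        case False
        then obtain z where "B = {z}" using Bt by (auto simp: \<tau>_def)
        then show ?thesis using False by (simp add: R_def a_def c_def wgt_def)
      qed
      then show "same_act n (bq B) (?f B)"
        using same_act_bq[OF sub'[OF Bt] ne[OF Bt]] by simp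
    qed
    moreover have "same_act n (bq (insert n C)) (?f C)"
      using same_act_marked[OF sub[OF Ct] ne[OF Ct]] C by (simp add: R_def a_def c_def)
    ultimately have "same_act n (bq (insert n C) * (\<Prod>B\<in>\<tau> - {C}. bq B)) (?f C * (\<Prod>B\<in>\<tau> - {C}. ?f B))"
      by (intro same_act_closed)
    moreover have "?f C * (\<Prod>B\<in>\<tau> - {C}. ?f B) = (\<Prod>B\<in>\<tau>. ?f B)" by (rule prod.remove[OF fin\<tau> Ct, symmetric])
    moreover have "bq (insert n C) * (\<Prod>B\<in>\<tau> - {C}. bq B) = bprod ?\<pi>"
      unfolding bprod_def using nC fin\<tau> by simp
    ultimately show "same_act n (bprod ?\<pi>) (\<Prod>B\<in>\<tau>. ?f B)" by simp
  qed
  define u where "u B = Lam (\<Prod>D\<in>\<tau> - {B}. R D)" for B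
  define t where "t B D = Lam (bss B D * (\<Prod>E\<in>\<tau> - {B} - {D}. R E))" for B D
  have master: "2 * (\<Sum>B\<in>\<tau>. of_nat (c B) * u B) = (\<Sum>B\<in>\<tau>. \<Sum>D\<in>\<tau> - {B}. of_nat (a B) * of_nat (a D) * t B D)"
    unfolding u_def t_def by (rule master_relation[OF fin\<tau> sub' goodR M0])
  have pr: "(\<Prod>E\<in>?s ` A \<union> \<A>. R E) = (\<Prod>z\<in>A. pp z) * (\<Prod>B\<in>\<A>. qq B)" if "A \<subseteq> Z" "\<A> \<subseteq> \<tau>0" for A \<A>
  proof (rule prod_singletons)
    show "finite A" "finite \<A>" using finite_subset[OF that(1) fin(1)] finite_subset[OF that(2) fin(2)] .
    show "?s ` A \<inter> \<A> = {}" using that ps(3) by blast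
    fix B assume "B \<in> \<A>"
    then have "B \<in> \<tau>0" using that(2) by blast
    then show "R B = qq B" by (simp add: R_def)
  next
    fix z assume "z \<in> A"
    then have "{z} \<notin> \<tau>0" using that(1) n0 by blast
    then show "R {z} = pp z" by (simp add: R_def)
  qed
  have ok_sub: "blocks_ok Z' \<B>'" if "Z' \<subseteq> Z" "\<B>' \<subseteq> \<tau>0" for Z' \<B>'
  proof -
    have "\<Union> \<B>' \<subseteq> \<Union> \<tau>0" using that(2) by (rule Union_mono)
    moreover have "disjoint \<tau>0" using ok by (simp add: blocks_ok_def)
    then have "disjoint \<B>'" using that(2) unfolding disjoint_def by (simp add: subset_eq)
    ultimately show ?thesis using ok that unfolding blocks_ok_def by blast
  qed
  have ok_ins: "blocks_ok Z' (insert U \<B>')" if "Z' \<subseteq> Z" "\<B>' \<subseteq> \<tau>0" "U \<noteq> {}" "U \<subseteq> {1..<n}" "U \<inter> Z' = {}" "U \<inter> \<Union> \<B>' = {}"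
    for Z' \<B>' U
  proof -
    have o: "blocks_ok Z' \<B>'" by (rule ok_sub[OF that(1,2)])
    have "disjoint (insert U \<B>')"
      unfolding disjoint_def
    proof (intro ballI impI)
      fix D E assume DE: "D \<in> insert U \<B>'" "E \<in> insert U \<B>'" "D \<noteq> E"
      have "disjoint \<B>'" using o by (simp add: blocks_ok_def)
      then have "D \<inter> E = {}" if "D \<in> \<B>'" "E \<in> \<B>'" using that DE(3) unfolding disjoint_def by simp
      moreover have "U \<inter> F = {}" if "F \<in> \<B>'" for F using that(1) \<open>U \<inter> \<Union> \<B>' = {}\<close> by blast
      ultimately show "D \<inter> E = {}" using DE by (elim insertE) (simp_all add: Int_commute)
    qed
    moreover have "\<Union> (insert U \<B>') = U \<union> \<Union> \<B>'" by (rule Union_insert)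
    ultimately show ?thesis using o that(3-5) unfolding blocks_ok_def by (simp add: Int_Un_distrib2)
  qed
  have u0: "u B = Pf Z (\<tau>0 - {B})" if B: "B \<in> \<tau>0" for B
  proof -
    have "\<tau> - {B} = ?s ` Z \<union> (\<tau>0 - {B})" using ps(3) B by (auto simp: \<tau>_def)
    then show ?thesis using pr[of Z "\<tau>0 - {B}"] by (simp add: u_def Pf_def)
  qed
  have us: "u {z} = 0" if z: "z \<in> Z" for z
  proof -
    have e: "\<tau> - {{z}} = ?s ` (Z - {z}) \<union> \<tau>0" using n0[OF z] by (auto simp: \<tau>_def)
    have "card (Z - {z}) < card Z" using z fin(1) by (intro psubset_card_mono) auto
    moreover have "card (Z - {z}) + card \<tau>0 = k - 1" using crd card.remove[OF fin(1) z] by linarith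
    ultimately have "Pf (Z - {z}) \<tau>0 = 0" by (intro IH ok_sub) auto
    then show ?thesis using pr[of "Z - {z}" \<tau>0] unfolding u_def e by (simp add: Pf_def)
  qed
  have bss: "bss B D = qq (B \<union> D) - qq B - qq D" if "B \<in> \<tau>" "D \<in> \<tau>" "B \<noteq> D" for B D
    using qq_Un[OF finB[OF that(1)] finB[OF that(2)] dj[OF that]] by (simp add: algebra_simps)
  have t3: "t B D = Lam (qq (B \<union> D) * (\<Prod>E\<in>\<tau> - {B} - {D}. R E)) - Lam (qq B * (\<Prod>E\<in>\<tau> - {B} - {D}. R E))
      - Lam (qq D * (\<Prod>E\<in>\<tau> - {B} - {D}. R E))" if "B \<in> \<tau>" "D \<in> \<tau>" "B \<noteq> D" for B D
    unfolding t_def bss[OF that] by (simp only: left_diff_distrib Lam_diff)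
  have Pins: "Lam (qq U * ((\<Prod>z\<in>A. pp z) * (\<Prod>B\<in>\<A>. qq B))) = Pf A (insert U \<A>)"
    if "finite \<A>" "U \<notin> \<A>" for U A \<A>
    using that by (simp add: Pf_def mult.left_commute)
  have tt: "t B D = - (u B + u D)" if B: "B \<in> \<tau>0" and D: "D \<in> \<tau>0" and BD: "B \<noteq> D" for B D
  proof -
    have e: "\<tau> - {B} - {D} = ?s ` Z \<union> (\<tau>0 - {B} - {D})" using ps(3) B D by (auto simp: \<tau>_def)
    have U: "(B \<union> D) \<inter> E = {}" if "E \<in> \<tau>0 - {B} - {D}" for E
      using dj[OF t0[OF B] t0, of E] dj[OF t0[OF D] t0, of E] that by blast
    have nU: "B \<union> D \<notin> \<tau>0 - {B} - {D}" using U ne[OF t0[OF B]] by blast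
    have f: "finite (\<tau>0 - {B} - {D})" using fin(2) by simp
    have "Pf Z (insert (B \<union> D) (\<tau>0 - {B} - {D})) = 0"
    proof (rule Pf_full)
      show "blocks_ok Z (insert (B \<union> D) (\<tau>0 - {B} - {D}))"
      proof (rule ok_ins)
        show "B \<union> D \<noteq> {}" using ne[OF t0[OF B]] by blast
        show "B \<union> D \<subseteq> {1..<n}" using sub[OF t0[OF B]] sub[OF t0[OF D]] by blast
        show "(B \<union> D) \<inter> Z = {}" using ok B D unfolding blocks_ok_def by blast
        show "(B \<union> D) \<inter> \<Union> (\<tau>0 - {B} - {D}) = {}" using U by blast
      qed auto
      show "Z \<union> \<Union> (insert (B \<union> D) (\<tau>0 - {B} - {D})) = {1..<n}" using cov B D by blast
      have "card (insert (B \<union> D) (\<tau>0 - {B} - {D})) = Suc (card (\<tau>0 - {B} - {D}))"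
        by (rule card_insert_disjoint[OF f nU])
      moreover have "card (\<tau>0 - {B}) = Suc (card (\<tau>0 - {B} - {D}))"
        by (rule card.remove) (use fin(2) D BD in auto)
      moreover note card.remove[OF fin(2) B]
      ultimately show "card Z + card (insert (B \<union> D) (\<tau>0 - {B} - {D})) = k - 1" using crd by linarith
    qed
    moreover have "insert B (\<tau>0 - {B} - {D}) = \<tau>0 - {D}" "insert D (\<tau>0 - {B} - {D}) = \<tau>0 - {B}"
      using B D BD by auto
    ultimately show ?thesis
      unfolding t3[OF t0[OF B] t0[OF D] BD] e pr[OF order_refl, of "\<tau>0 - {B} - {D}", OF subset_trans[OF Diff_subset Diff_subset]]
      using Pins[OF f nU] Pins[OF f, of B] Pins[OF f, of D] u0[OF B] u0[OF D] by simp
  qed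
  \<comment> \<open>Every resulting term has fewer points in \<open>Z\<close>, so that
    \<open>IH\<close> applies, or a factor \<open>qq\<close> of a singleton.\<close>
  have ts0: "t {z} D = 0" if z: "z \<in> Z" and D: "D \<in> \<tau>" and zD: "{z} \<noteq> D" for z D
  proof (cases "D \<in> \<tau>0")
    case True
    have e: "\<tau> - {{z}} - {D} = ?s ` (Z - {z}) \<union> (\<tau>0 - {D})" using ps(3) z True by (auto simp: \<tau>_def)
    have f: "finite (\<tau>0 - {D})" using fin(2) by simp
    have cz: "card Z = Suc (card (Z - {z}))" using card.remove[OF fin(1) z] .
    have cD: "card \<tau>0 = Suc (card (\<tau>0 - {D}))" using card.remove[OF fin(2) True] .
    have U: "({z} \<union> D) \<inter> E = {}" if "E \<in> \<tau>0 - {D}" for E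
      using dj[OF ts[OF z] t0, of E] dj[OF D t0, of E] that n0[OF z] by blast
    have nU: "{z} \<union> D \<notin> \<tau>0 - {D}" using U by blast
    have "Pf (Z - {z}) (insert ({z} \<union> D) (\<tau>0 - {D})) = 0"
    proof (rule IH)
      show "blocks_ok (Z - {z}) (insert ({z} \<union> D) (\<tau>0 - {D}))"
      proof (rule ok_ins)
        show "{z} \<union> D \<subseteq> {1..<n}" using sub[OF D] fin(5) z by blast
        show "({z} \<union> D) \<inter> (Z - {z}) = {}" using ok True unfolding blocks_ok_def by blast
        show "({z} \<union> D) \<inter> \<Union> (\<tau>0 - {D}) = {}" using U by blast
      qed auto
      show "card (Z - {z}) < card Z" using cz by simp
      show "card (Z - {z}) + card (insert ({z} \<union> D) (\<tau>0 - {D})) = k - 1"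
        using card_insert_disjoint[OF f nU] cz cD crd by linarith
    qed
    moreover have "Pf (Z - {z}) (insert D (\<tau>0 - {D})) = 0"
      by (rule IH) (use ok_sub[of "Z - {z}" \<tau>0] True cz cD crd f in \<open>auto simp: insert_absorb\<close>)
    ultimately show ?thesis
      unfolding t3[OF ts[OF z] D zD] e pr[OF Diff_subset Diff_subset]
      using Pins[OF f nU] Pins[OF f, of D] by (simp add: Lam_zero)
  next
    case False
    then obtain y where y: "y \<in> Z" "D = {y}" using D by (auto simp: \<tau>_def)
    have zy: "z \<noteq> y" using zD y(2) by blast
    have e: "\<tau> - {{z}} - {D} = ?s ` (Z - {z} - {y}) \<union> \<tau>0"
      using n0[OF z] n0[OF y(1)] by (auto simp: \<tau>_def y(2))
    have "card (Z - {z}) = Suc (card (Z - {z} - {y}))"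
      by (rule card.remove) (use fin(1) y(1) zy in auto)
    then have cz: "card Z = Suc (Suc (card (Z - {z} - {y})))"
      using card.remove[OF fin(1) z] by simp
    have nU: "{z} \<union> D \<notin> \<tau>0" using ok z unfolding blocks_ok_def by blast
    have "Pf (Z - {z} - {y}) (insert ({z} \<union> D) \<tau>0) = 0"
    proof (rule IH)
      show "blocks_ok (Z - {z} - {y}) (insert ({z} \<union> D) \<tau>0)"
      proof (rule ok_ins)
        show "{z} \<union> D \<subseteq> {1..<n}" using sub[OF D] fin(5) z by blast
        show "({z} \<union> D) \<inter> (Z - {z} - {y}) = {}" using y by blast
        show "({z} \<union> D) \<inter> \<Union> \<tau>0 = {}" using ok z y unfolding blocks_ok_def by blast
      qed auto
      show "card (Z - {z} - {y}) < card Z" using cz by simp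
      show "card (Z - {z} - {y}) + card (insert ({z} \<union> D) \<tau>0) = k - 1"
        using nU fin(2) cz crd by simp
    qed
    then show ?thesis
      unfolding t3[OF ts[OF z] D zD] e pr[OF subset_trans[OF Diff_subset Diff_subset] order_refl]
      using Pins[OF fin(2) nU] by (simp add: Lam_zero y(2))
  qed
  have tsym: "t B D = t D B" for B D
  proof -
    have "\<tau> - {B} - {D} = \<tau> - {D} - {B}" by blast
    then show ?thesis by (simp only: t_def bss_commute[of B D])
  qed
  have ss: "\<exists>z\<in>Z. B = {z}" if "B \<in> \<tau> - \<tau>0" for B using that by (auto simp: \<tau>_def)
  have \<tau>0: "\<tau>0 \<subseteq> \<tau>" by (auto simp: \<tau>_def)
  have lhs: "(\<Sum>B\<in>\<tau>. of_nat (c B) * u B) = (\<Sum>B\<in>\<tau>0. of_nat (c B) * u B)"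
    by (rule sum.mono_neutral_right[OF fin\<tau> \<tau>0]) (use ss us in fastforce)
  have rhs: "(\<Sum>B\<in>\<tau>. \<Sum>D\<in>\<tau> - {B}. of_nat (a B) * of_nat (a D) * t B D) =
     (\<Sum>B\<in>\<tau>0. \<Sum>D\<in>\<tau>0 - {B}. - (of_nat (a B) * of_nat (a D) * (u B + u D)))"
  proof -
    have "(\<Sum>B\<in>\<tau>. \<Sum>D\<in>\<tau> - {B}. of_nat (a B) * of_nat (a D) * t B D) =
        (\<Sum>B\<in>\<tau>0. \<Sum>D\<in>\<tau> - {B}. of_nat (a B) * of_nat (a D) * t B D)"
    proof (rule sum.mono_neutral_right[OF fin\<tau> \<tau>0], rule ballI, rule sum.neutral, rule ballI)
      fix B D assume B: "B \<in> \<tau> - \<tau>0" and D: "D \<in> \<tau> - {B}"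
      from ss[OF B] obtain z where "z \<in> Z" "B = {z}" by blast
      then have "t B D = 0" using ts0 D by blast
      then show "of_nat (a B) * of_nat (a D) * t B D = 0" by simp
    qed
    also have "\<dots> = (\<Sum>B\<in>\<tau>0. \<Sum>D\<in>\<tau>0 - {B}. of_nat (a B) * of_nat (a D) * t B D)"
    proof (rule sum.cong[OF refl], rule sum.mono_neutral_right)
      fix B assume B: "B \<in> \<tau>0"
      show "finite (\<tau> - {B})" "\<tau>0 - {B} \<subseteq> \<tau> - {B}" using fin\<tau> \<tau>0 by auto
      show "\<forall>D\<in>\<tau> - {B} - (\<tau>0 - {B}). of_nat (a B) * of_nat (a D) * t B D = 0"
      proof
        fix D assume D: "D \<in> \<tau> - {B} - (\<tau>0 - {B})"
        then have "D \<in> \<tau> - \<tau>0" by blast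
        from ss[OF this] obtain z where "z \<in> Z" "D = {z}" by blast
        then have "t D B = 0" using ts0[of z B] t0[OF B] D by blast
        then show "of_nat (a B) * of_nat (a D) * t B D = 0" by (simp add: tsym[of B D])
      qed
    qed
    also have "\<dots> = (\<Sum>B\<in>\<tau>0. \<Sum>D\<in>\<tau>0 - {B}. - (of_nat (a B) * of_nat (a D) * (u B + u D)))"
    proof (intro sum.cong refl)
      fix B D assume "B \<in> \<tau>0" "D \<in> \<tau>0 - {B}"
      then have "t B D = - (u B + u D)" by (intro tt) auto
      then show "of_nat (a B) * of_nat (a D) * t B D = - (of_nat (a B) * of_nat (a D) * (u B + u D))"
        by (simp only: mult_minus_right)
    qed
    finally show ?thesis .
  qed
  \<comment> \<open>The sum over pairs of distinct blocks is the full double sum minus its diagonal,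
    expressed through the total weight \<open>A\<close> and the weighted sums \<open>U\<close> and
    \<open>W\<close>.\<close>
  define A where "A = (\<Sum>B\<in>\<tau>0. a B)"
  define U where "U = (\<Sum>B\<in>\<tau>0. of_nat (a B) * u B)"
  define W where "W = (\<Sum>B\<in>\<tau>0. of_nat (a B) * of_nat (a B) * u B)"
  have inner: "(\<Sum>D\<in>\<tau>0 - {B}. - (of_nat (a B) * of_nat (a D) * (u B + u D))) =
      2 * (of_nat (a B) * of_nat (a B) * u B) - (of_nat (a B) * u B) * of_nat A - of_nat (a B) * U" if "B \<in> \<tau>0" for B
  proof -
    have "(\<Sum>D\<in>\<tau>0 - {B}. - (of_nat (a B) * of_nat (a D) * (u B + u D))) =
      (\<Sum>D\<in>\<tau>0. - (of_nat (a B) * of_nat (a D) * (u B + u D))) + of_nat (a B) * of_nat (a B) * (u B + u B)"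
      using sum.remove[OF fin(2) that, of "\<lambda>D. - (of_nat (a B) * of_nat (a D) * (u B + u D))"] by simp
    also have "(\<Sum>D\<in>\<tau>0. - (of_nat (a B) * of_nat (a D) * (u B + u D))) =
      (\<Sum>D\<in>\<tau>0. - ((of_nat (a B) * u B) * of_nat (a D)) - of_nat (a B) * (of_nat (a D) * u D))"
      by (rule sum.cong[OF refl]) (simp add: algebra_simps)
    also have "\<dots> = - ((of_nat (a B) * u B) * of_nat A) - of_nat (a B) * U"
      unfolding sum_subtractf sum_negf U_def A_def of_nat_sum sum_distrib_left ..
    finally show ?thesis by (simp add: algebra_simps)
  qed
  have "(\<Sum>B\<in>\<tau>0. \<Sum>D\<in>\<tau>0 - {B}. - (of_nat (a B) * of_nat (a D) * (u B + u D))) =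
      (\<Sum>B\<in>\<tau>0. 2 * (of_nat (a B) * of_nat (a B) * u B) - (of_nat (a B) * u B) * of_nat A - of_nat (a B) * U)"
    by (rule sum.cong[OF refl]) (rule inner)
  also have "\<dots> = 2 * W - U * of_nat A - of_nat A * U"
    unfolding sum_subtractf W_def U_def[symmetric] sum_distrib_left[symmetric] sum_distrib_right[symmetric]
    by (simp add: A_def)
  finally have r: "(\<Sum>B\<in>\<tau>0. \<Sum>D\<in>\<tau>0 - {B}. - (of_nat (a B) * of_nat (a D) * (u B + u D))) = \<dots>" .
  have "(\<Sum>B\<in>\<tau>0. of_nat (c B) * u B) = W + U"
    unfolding W_def U_def sum.distrib[symmetric] by (rule sum.cong[OF refl]) (simp add: c_def algebra_simps)
  \<comment> \<open>Because \<open>c\<close> is \<open>a\<close> times \<open>a + 1\<close>, the sum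
    \<open>W\<close> cancels, and \<open>U\<close> times \<open>Suc A\<close> remains.\<close>
  then have "2 * (W + U) = 2 * W - U * of_nat A - of_nat A * U"
    using master unfolding lhs rhs r by simp
  then have "2 * (U * of_nat (Suc A)) = 0" by (simp add: algebra_simps)
  then have "U = 0" by (simp del: of_nat_Suc)
  then have "(\<Sum>B\<in>\<tau>0. of_nat (a B) * u B) = 0" by (simp only: U_def)
  then show ?thesis by (simp add: a_def u0)
qed

text \<open>The uncovered points form an extra block \<open>C\<close>, which gives partitions with
  \<open>k\<close> blocks and thus the relations of \<open>Pf_relation\<close>. If \<open>C\<close>
  is a single point, all other terms of the relation contain it as a block and vanish. Otherwise
  every block can be marked in turn, and the relations together force all values to be zero.
  Induction on \<open>card Z\<close> supplies the hypothesis \<open>IH\<close>.\<close>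

lemma Pf_zero:
  assumes "blocks_ok Z \<B>" "card Z + card \<B> = k - 1"
  shows "Pf Z \<B> = 0"
  using assms
proof (induction "card Z" arbitrary: Z \<B> rule: less_induct)
  case less
  note ok = less.prems(1) and crd = less.prems(2)
  note fin = blocks_ok_finite[OF ok]
  define C where "C = {1..<n} - Z - \<Union> \<B>"
  have B1: "card B \<ge> 1" if "B \<in> \<B>" for B
    using fin(3)[OF that] ok that by (auto simp: blocks_ok_def Suc_le_eq card_gt_0_iff)
  show ?case
  proof (cases "C = {}")
    case True
    then have "Z \<union> \<Union> \<B> = {1..<n}" using ok unfolding blocks_ok_def C_def by blast
    then show ?thesis using Pf_full ok crd by blast
  next
    case Cne: False
    show ?thesis
    proof (cases "\<exists>B\<in>\<B>. card B = 1")
      case True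
      then obtain B b where "B \<in> \<B>" "B = {b}" by (auto simp: card_1_singleton_iff)
      then show ?thesis using Pf_single_zero fin(2) by blast
    next
      case nosing: False
      have big: "card B \<ge> 2" if "B \<in> \<B>" for B
      proof -
        have "card B \<noteq> 1" using nosing that by blast
        then show ?thesis using B1[OF that] by linarith
      qed
      define \<tau>0 where "\<tau>0 = insert C \<B>"
      have CB: "C \<notin> \<B>" using Cne unfolding C_def by blast
      have CD: "C \<inter> D = {}" if "D \<in> \<B>" for D using that unfolding C_def by blast
      have "disjoint \<tau>0" using ok CD unfolding \<tau>0_def blocks_ok_def disjoint_def by blast
      then have ok0: "blocks_ok Z \<tau>0"
        using ok Cne unfolding blocks_ok_def \<tau>0_def C_def by blast
      have cov: "Z \<union> \<Union> \<tau>0 = {1..<n}" using ok unfolding blocks_ok_def \<tau>0_def C_def by blast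
      have ct: "card \<tau>0 = Suc (card \<B>)" using CB fin(2) by (simp add: \<tau>0_def)
      then have crd0: "card Z + card \<tau>0 = k" using crd k by simp
      have fin0: "finite \<tau>0" using fin(2) by (simp add: \<tau>0_def)
      have \<tau>C: "\<tau>0 - {C} = \<B>" using CB by (auto simp: \<tau>0_def)
      have IH: "Pf Z' \<B>' = 0" if "blocks_ok Z' \<B>'" "card Z' < card Z" "card Z' + card \<B>' = k - 1" for Z' \<B>'
        using less.hyps that by blast
      have finC: "finite C" unfolding C_def by simp
      have C1: "card C \<ge> 1" using Cne finC by (simp add: Suc_le_eq card_gt_0_iff)
      note rel = Pf_relation[OF ok0 cov crd0 _ _ IH]
      show ?thesis
      proof (cases "card C = 1")
        case True
        then obtain x where x: "C = {x}" by (rule card_1_singletonE)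
        have "(\<Sum>B\<in>\<tau>0. of_nat (if B = C then card B else card B - 1) * Pf Z (\<tau>0 - {B})) = 0"
          by (rule rel) (use big in \<open>auto simp: \<tau>0_def\<close>)
        moreover have "(\<Sum>B\<in>\<B>. of_nat (if B = C then card B else card B - 1) * Pf Z (\<tau>0 - {B})) = 0"
        proof (rule sum.neutral, rule ballI)
          fix B assume "B \<in> \<B>"
          then have "{x} \<in> \<tau>0 - {B}" using CB x by (auto simp: \<tau>0_def)
          then have "Pf Z (\<tau>0 - {B}) = 0" using Pf_single_zero[of "\<tau>0 - {B}" x Z] fin0 by simp
          then show "of_nat (if B = C then card B else card B - 1) * Pf Z (\<tau>0 - {B}) = 0" by simp
        qed
        ultimately show ?thesis
          unfolding sum.remove[OF fin0 insertI1[of C \<B>, folded \<tau>0_def]] \<tau>C using True by simp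
      next
        case False
        define S where "S = (\<Sum>B\<in>\<tau>0. of_nat (card B - 1) * Pf Z (\<tau>0 - {B}))"
        have big0: "card B \<ge> 2" if "B \<in> \<tau>0" for B using big that False C1 by (auto simp: \<tau>0_def)
        \<comment> \<open>Marking \<open>E\<close> raises its coefficient in \<open>S\<close> by
          one, so all the values are equal to \<open>- S\<close>; put back into the definition of
          \<open>S\<close>, this gives \<open>S\<close> times \<open>Suc m\<close> equal to
          zero.\<close>
        have E: "Pf Z (\<tau>0 - {E}) = - S" if E: "E \<in> \<tau>0" for E
        proof -
          have "(\<Sum>B\<in>\<tau>0. of_nat (if B = E then card B else card B - 1) * Pf Z (\<tau>0 - {B})) = 0"
            by (rule rel) (use big0 E in auto)
          moreover have "(\<Sum>B\<in>\<tau>0. of_nat (if B = E then card B else card B - 1) * Pf Z (\<tau>0 - {B})) =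
            (\<Sum>B\<in>\<tau>0. of_nat (card B - 1) * Pf Z (\<tau>0 - {B}) + (if B = E then Pf Z (\<tau>0 - {E}) else 0))"
          proof (rule sum.cong[OF refl])
            fix B assume "B \<in> \<tau>0"
            then have "card B = Suc (card B - 1)" using big0 by fastforce
            then have "(of_nat (card B) :: complex) = of_nat (card B - 1) + 1" by (metis of_nat_Suc add.commute)
            then show "of_nat (if B = E then card B else card B - 1) * Pf Z (\<tau>0 - {B}) =
              of_nat (card B - 1) * Pf Z (\<tau>0 - {B}) + (if B = E then Pf Z (\<tau>0 - {E}) else 0)"
              by (cases "B = E") (simp_all only: if_True if_False distrib_right mult_1 add_0_right simp_thms)
          qed
          moreover have "(\<Sum>B\<in>\<tau>0. of_nat (card B - 1) * Pf Z (\<tau>0 - {B}) + (if B = E then Pf Z (\<tau>0 - {E}) else 0))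
              = S + Pf Z (\<tau>0 - {E})"
            unfolding sum.distrib sum.delta[OF fin0] S_def using E by (simp only: if_True)
          ultimately have "S + Pf Z (\<tau>0 - {E}) = 0" by (simp only:)
          then show ?thesis by (simp only: add_eq_0_iff)
        qed
        define m where "m = (\<Sum>B\<in>\<tau>0. card B - 1)"
        have "(\<Sum>B\<in>\<tau>0. of_nat (card B - 1) * Pf Z (\<tau>0 - {B})) = (\<Sum>B\<in>\<tau>0. of_nat (card B - 1) * (- S))"
          by (rule sum.cong[OF refl]) (simp only: E)
        then have "S = (\<Sum>B\<in>\<tau>0. of_nat (card B - 1) * (- S))" by (simp only: S_def[symmetric])
        also have "\<dots> = of_nat m * (- S)" unfolding m_def of_nat_sum sum_distrib_right ..
        finally have "S + of_nat m * S = 0" by (simp only: eq_neg_iff_add_eq_0 mult_minus_right)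
        then have "of_nat (Suc m) * S = 0" by (simp add: distrib_right)
        then have "S = 0" by (simp del: of_nat_Suc)
        then show ?thesis using E[of C] \<tau>C by (simp add: \<tau>0_def)
      qed
    qed
  qed
qed

end

section \<open>Words in the letters\<close>

lemma lin_foldr:
  assumes "\<And>g. lin (f g)" shows "lin (foldr f gs)"
proof (induction gs)
  case Nil
  show ?case by (rule linI) simp_all
next
  case (Cons g gs)
  have "foldr f (g # gs) = (\<lambda>x. f g (foldr f gs x))" by (rule ext) simp
  then show ?case using lin_compose[OF assms Cons] by (simp only:)
qed

lemma foldr_anti:
  assumes "\<And>g y. g \<in> set gs \<Longrightarrow> T (f g y) = - f g (T y)" "\<And>g. lin (f g)"
  shows "T (foldr f gs y) = scl ((- 1) ^ length gs) (foldr f gs (T y))"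
  using assms(1)
proof (induction gs)
  case Nil
  show ?case by simp
next
  case (Cons g gs)
  have "T (foldr f (g # gs) y) = - f g (T (foldr f gs y))" using Cons.prems by simp
  also have "T (foldr f gs y) = scl ((- 1) ^ length gs) (foldr f gs (T y))" using Cons by simp
  also have "- f g (scl ((- 1) ^ length gs) (foldr f gs (T y))) = scl ((- 1) ^ length (g # gs)) (foldr f (g # gs) (T y))"
    by (simp add: module_hom.scale[OF assms(2)])
  finally show ?case .
qed

lemma foldr_pull:
  assumes "\<And>g y. g \<in> set gs \<Longrightarrow> T (f g y) = - f g (T y)" "\<And>g. lin (f g)"
  shows "foldr f gs (T y) = scl ((- 1) ^ length gs) (T (foldr f gs y))"
  by (subst foldr_anti[where T = T and f = f, OF assms]) (simp_all flip: power_add)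

lemma an_basis_vec:
  assumes "finite V" "g \<in> V"
  shows "an g (basis_vec V) = scl (esign g (V - {g})) (basis_vec (V - {g}))"
proof (rule ext)
  fix U
  show "an g (basis_vec V) U = scl (esign g (V - {g})) (basis_vec (V - {g})) U"
  proof (cases "U = V - {g}")
    case True
    then have "insert g U = V" "finite U" "g \<notin> U" using assms by auto
    then show ?thesis using True by (simp add: an_def basis_vec_def scl_apply)
  next
    case False
    then have "g \<notin> U \<Longrightarrow> insert g U \<noteq> V" by auto
    then show ?thesis using False by (simp add: an_def basis_vec_def scl_apply)
  qed
qed

text \<open>Together with \<open>cr_word_basis\<close> this presents a monomial, up to a nonzero
  factor, as a word in the original letters applied to \<open>Theta n\<close>.\<close>

lemma an_word_Theta:
  assumes "S \<subseteq> {1..n}"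
  shows "\<exists>J c. set J = S \<and> length J = card S \<and> c \<noteq> 0 \<and>
    foldr op0 (map (Pair False) J) (Theta n) = scl c (basis_vec (theta ` ({1..n} - S)))"
  using finite_subset[OF assms finite_atLeastAtMost] assms
proof (induction S rule: finite_induct)
  case empty
  show ?case by (intro exI[of _ "[]"] exI[of _ 1]) (simp add: Theta_def)
next
  case (insert a S)
  then obtain J c where J: "set J = S" "length J = card S" "c \<noteq> 0"
    "foldr op0 (map (Pair False) J) (Theta n) = scl c (basis_vec (theta ` ({1..n} - S)))" by auto
  let ?V = "theta ` ({1..n} - S)"
  have a: "theta a \<in> ?V" "finite ?V" using insert by auto
  have V: "?V - {theta a} = theta ` ({1..n} - insert a S)" by auto
  have "foldr op0 (map (Pair False) (a # J)) (Theta n) = scl (c * esign (theta a) (?V - {theta a})) (basis_vec (theta ` ({1..n} - insert a S)))"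
  proof -
    have "foldr op0 (map (Pair False) (a # J)) (Theta n) = an (theta a) (scl c (basis_vec ?V))"
      using J(4) by simp
    also have "\<dots> = scl c (an (theta a) (basis_vec ?V))" by (rule module_hom.scale[OF lin_an])
    finally show ?thesis unfolding an_basis_vec[OF a(2,1)] V fsp.scale_scale .
  qed
  moreover have "c * esign (theta a) (?V - {theta a}) \<noteq> 0" using J(3) by simp
  moreover have "set (a # J) = insert a S" "length (a # J) = card (insert a S)" using J insert.hyps by auto
  ultimately show ?case by blast
qed

lemma cr_word_basis:
  assumes "finite S" "finite V" "xi ` S \<inter> V = {}"
  shows "\<exists>J c. set J = S \<and> length J = card S \<and> c \<noteq> 0 \<and>
    foldr op0 (map (Pair True) J) (basis_vec V) = scl c (basis_vec (xi ` S \<union> V))"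
  using assms(1,3)
proof (induction S rule: finite_induct)
  case empty
  show ?case by (intro exI[of _ "[]"] exI[of _ 1]) simp
next
  case (insert a S)
  then obtain J c where J: "set J = S" "length J = card S" "c \<noteq> 0"
    "foldr op0 (map (Pair True) J) (basis_vec V) = scl c (basis_vec (xi ` S \<union> V))" by auto
  let ?W = "xi ` S \<union> V"
  have a: "xi a \<notin> ?W" "finite ?W" using insert assms(2) by auto
  have "foldr op0 (map (Pair True) (a # J)) (basis_vec V) = scl (c * esign (xi a) ?W) (basis_vec (xi ` insert a S \<union> V))"
    using J(4) by (simp add: cr.op_simps cr_basis_vec[OF a(2,1)])
  moreover have "c * esign (xi a) ?W \<noteq> 0" using J(3) by simp
  moreover have "set (a # J) = insert a S" "length (a # J) = card (insert a S)" using J insert.hyps by auto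
  ultimately show ?case by blast
qed

section \<open>Vanishing on words: first in difference letters, then in the original ones\<close>

context killing_functional
begin

abbreviation W :: "gen list \<Rightarrow> vec \<Rightarrow> vec"
  where "W gs \<equiv> foldr (op1 n) gs"

abbreviation W0 :: "gen list \<Rightarrow> vec \<Rightarrow> vec"
  where "W0 gs \<equiv> foldr op0 gs"

lemmas lin_W = lin_foldr[where f = "op1 n", OF lin_op1]
lemmas lin_W0 = lin_foldr[where f = op0, OF o0.lin_op]

lemmas W_simps = module_hom.add[OF lin_W] module_hom.scale[OF lin_W] module_hom.neg[OF lin_W]
  module_hom.zero[OF lin_W] module_hom.sum[OF lin_W] module_hom.diff[OF lin_W]

lemmas act1_simps = module_hom.add[OF o1.lin_act] module_hom.scale[OF o1.lin_act] module_hom.neg[OF o1.lin_act]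
  module_hom.zero[OF o1.lin_act] module_hom.sum[OF o1.lin_act] module_hom.diff[OF o1.lin_act]

lemma W_pull: "W gs (op1 n g y) = scl ((- 1) ^ length gs) (op1 n g (W gs y))"
  by (rule foldr_pull) (rule op1_anti, rule lin_op1)

lemma L_W_xtot:
  assumes "good n r" shows "L (act1 n r (W gs (xtot n y))) = 0"
proof -
  have "W gs (xtot n y) = scl ((- 1) ^ length gs) (xtot n (W gs y))"
    using antic_tot(1)[OF n] by (intro foldr_pull lin_op1) (simp add: antic_def)
  then show ?thesis
    by (simp add: act1_simps L_simps good_commutes(4)[OF assms, symmetric] L_xtot)
qed

definition zq :: "nat set \<Rightarrow> nat set set \<Rightarrow> ev"
  where "zq Z \<B> = (\<Prod>z\<in>Z. pp z) * (\<Prod>B\<in>\<B>. qq B)"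

lemma good_zq: "blocks_ok Z \<B> \<Longrightarrow> good n (zq Z \<B>)"
proof -
  assume ok: "blocks_ok Z \<B>"
  have Z: "Z \<subseteq> {1..n}" using blocks_ok_finite(5)[OF ok] by auto
  have B: "B \<subseteq> {1..n}" if "B \<in> \<B>" for B
  proof -
    have "B \<subseteq> {1..<n}" using ok that unfolding blocks_ok_def by blast
    then show ?thesis by auto
  qed
  show ?thesis unfolding zq_def using Z B
    by (intro good_mult good_prod good_qq good_br(2) B) (erule subsetD | assumption)+
qed

text \<open>Modulo the image of \<open>dlt\<close>, an exchange of an \<open>x\<close>-letter with a \<open>y\<close>-letter costs
  only terms that contain a bracket, so every word reduces to products of brackets.\<close>

lemma L_word_zero:
  assumes "blocks_ok Z \<B>" "length J = length I" "distinct I" "distinct J"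
    "set I \<subseteq> {1..<n}" "set J \<subseteq> {1..<n}" "(set I \<union> set J) \<inter> (Z \<union> \<Union> \<B>) = {}"
    "card Z + card \<B> + length I = k - 1"
  shows "L (act1 n (zq Z \<B>) (W (map (Pair True) I @ map (Pair False) J) (vbase n))) = 0"
  using assms
proof (induction "length I" arbitrary: I J Z \<B> rule: less_induct)
  case less
  note ok = less.prems(1)
  note fin = blocks_ok_finite[OF ok]
  have g: "good n (zq Z \<B>)" by (rule good_zq[OF ok])
  show ?case
  proof (cases I)
    case Nil
    then show ?thesis using less.prems Pf_zero[OF ok] by (simp add: Pf_def Lam_def zq_def)
  next
    case (Cons a I')
    show ?thesis
    proof (cases "set I \<inter> set J = {}")
      case False
      \<comment> \<open>The two letters with a common index \<open>b\<close> combine to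
        \<open>pp b\<close>, so \<open>b\<close> moves to \<open>Z\<close> and the words get
        shorter.\<close>
      then obtain b where b: "b \<in> set I" "b \<in> set J" by blast
      obtain I1 I2 where I: "I = I1 @ b # I2" using split_list[OF b(1)] by blast
      obtain J1 J2 where J: "J = J1 @ b # J2" using split_list[OF b(2)] by blast
      let ?w = "W (map (Pair True) (I1 @ I2) @ map (Pair False) (J1 @ J2)) (vbase n)"
      have bn: "b \<in> {1..<n}" "b \<notin> Z" "b \<notin> \<Union> \<B>" using b less.prems(5,7) by blast+
      have "W (map (Pair True) I @ map (Pair False) J) (vbase n) =
        W (map (Pair True) I1) (op1 n (True, b) (W (map (Pair True) I2 @ map (Pair False) J1)
          (op1 n (False, b) (W (map (Pair False) J2) (vbase n)))))"
        by (simp add: I J)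
      also have "\<dots> = scl ((- 1) ^ length J1 * (- 1) ^ length I2)
          (op1 n (True, b) (op1 n (False, b) ?w))"
        by (simp add: W_pull W_simps o1.op_simps mult_ac)
      finally obtain s where s: "W (map (Pair True) I @ map (Pair False) J) (vbase n) =
          scl s (op1 n (True, b) (op1 n (False, b) ?w))" by blast
      have e: "act1 n (zq Z \<B>) (op1 n (True, b) (op1 n (False, b) ?w)) = act1 n (zq (insert b Z) \<B>) ?w"
      proof -
        have "act1 n (pp b) ?w = op1 n (True, b) (op1 n (False, b) ?w)" using bn(1) by (simp add: o1.act_pp)
        moreover have "zq (insert b Z) \<B> = zq Z \<B> * pp b" using bn(2) fin(1) by (simp add: zq_def mult_ac)
        ultimately show ?thesis by (simp add: o1.act_mult)
      qed
      have "L (act1 n (zq (insert b Z) \<B>) ?w) = 0"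
      proof (rule less.hyps)
        show "length (I1 @ I2) < length I" by (simp add: I)
        show "blocks_ok (insert b Z) \<B>" using ok bn unfolding blocks_ok_def by auto
        show "length (J1 @ J2) = length (I1 @ I2)" using less.prems(2) by (simp add: I J)
        show "distinct (I1 @ I2)" "distinct (J1 @ J2)" using less.prems(3,4) by (auto simp: I J)
        show "set (I1 @ I2) \<subseteq> {1..<n}" "set (J1 @ J2) \<subseteq> {1..<n}" using less.prems(5,6) by (auto simp: I J)
        have "b \<notin> set (I1 @ I2) \<union> set (J1 @ J2)" using less.prems(3,4) by (auto simp: I J)
        moreover have "set (I1 @ I2) \<union> set (J1 @ J2) \<subseteq> set I \<union> set J" by (auto simp: I J)
        ultimately show "(set (I1 @ I2) \<union> set (J1 @ J2)) \<inter> (insert b Z \<union> \<Union> \<B>) = {}"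
          using less.prems(7) by blast
        show "card (insert b Z) + card \<B> + length (I1 @ I2) = k - 1"
          using less.prems(8) bn(2) fin(1) by (simp add: I)
      qed
      then show ?thesis by (simp only: s act1_simps L_simps e mult_zero_right)
    next
      case dis: True
      let ?T = "\<lambda>i. op1 n (True, i)" and ?F = "\<lambda>i. op1 n (False, i)"
      let ?r = "act1 n (zq Z \<B>)"
      let ?I = "map (Pair True) I'"
      let ?J = "\<lambda>J. map (Pair False) J"
      define x where "x = L (?r (?T a (W ?I (W (?J J) (vbase n)))))"
      have a: "1 \<le> a" "a \<le> n" "a \<in> {1..<n}" using less.prems(5) Cons by auto
      \<comment> \<open>Exchanging the roles of \<open>a\<close> and \<open>j\<close> changes the
        value by a term with the bracket \<open>br a j\<close>, that is, with the new block
        \<open>{a, j}\<close>, which vanishes by induction.\<close>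
      have tm: "L (?r (?F a (W ?I (W (?J J1) (?T j (W (?J J2) (vbase n))))))) = x" if J: "J = J1 @ j # J2" for J1 j J2
      proof -
        define z where "z = W (?J J2) (vbase n)"
        define w where "w = W (?I @ ?J J1) z"
        define s :: complex where "s = (- 1) ^ length (?I @ ?J J1)"
        have ss: "s * s = 1" by (simp add: s_def flip: power_add)
        have j: "1 \<le> j" "j \<le> n" "j \<in> {1..<n}" using less.prems(6) J by auto
        have "?F a (W ?I (W (?J J1) (?T j z))) = ?F a (scl s (?T j w))"
          using W_pull[of "?I @ ?J J1" "(True, j)" z] by (simp add: w_def s_def)
        also have "\<dots> = scl s (- ?T j (?F a w))" by (simp add: o1.op_simps op1_anti[of n "(False, a)" "(True, j)"])
        also have "?T j (?F a w) = act1 n (br a j) w - ?T a (?F j w)"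
          using a j by (simp add: o1.act_br o1.brop_def)
        also have "?F j w = scl s (W (?I @ ?J J1) (?F j z))"
          using W_pull[of "?I @ ?J J1" "(False, j)" z] ss by (simp add: w_def s_def)
        finally have e: "?F a (W ?I (W (?J J1) (?T j z))) = scl s (- (act1 n (br a j) w - scl s (?T a (W (?I @ ?J J1) (?F j z)))))"
          by (simp only: o1.op_simps)
        have "L (?r (act1 n (br a j) w)) = 0"
        proof -
          have aj: "a \<noteq> j" "a \<notin> set I'" "j \<notin> set (J1 @ J2)" "a \<notin> set (J1 @ J2)" "j \<notin> set I'"
            using dis less.prems(3,4) Cons J by auto
          have nin: "a \<notin> Z \<union> \<Union> \<B>" "j \<notin> Z \<union> \<Union> \<B>" using less.prems(7) Cons J by auto
          have nB: "{a, j} \<notin> \<B>" using nin by blast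
          have "qq {a, j} = br j a" using qq_insert[of "{j}" a] aj by (simp add: bs_def)
          then have "zq Z (insert {a, j} \<B>) = zq Z \<B> * br a j"
            using nB fin(2) by (simp add: zq_def mult_ac br_commute[of j a])
          then have e1: "?r (act1 n (br a j) w) = act1 n (zq Z (insert {a, j} \<B>)) w" by (simp add: o1.act_mult)
          have e2: "w = W (map (Pair True) I' @ map (Pair False) (J1 @ J2)) (vbase n)"
            by (simp add: w_def z_def)
          have "L (act1 n (zq Z (insert {a, j} \<B>)) (W (map (Pair True) I' @ map (Pair False) (J1 @ J2)) (vbase n))) = 0"
          proof (rule less.hyps)
            show "length I' < length I" using Cons by simp
            have "{a, j} \<inter> \<Union> \<B> = {}" using nin by blast
            then have "disjoint (insert {a, j} \<B>)" using ok unfolding blocks_ok_def disjoint_def by blast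
            then show "blocks_ok Z (insert {a, j} \<B>)"
              using ok nin a(3) j(3) unfolding blocks_ok_def by auto
            show "length (J1 @ J2) = length I'" using less.prems(2) Cons J by simp
            show "distinct I'" "distinct (J1 @ J2)" using less.prems(3,4) Cons J by auto
            show "set I' \<subseteq> {1..<n}" "set (J1 @ J2) \<subseteq> {1..<n}" using less.prems(5,6) Cons J by auto
            have "set I' \<union> set (J1 @ J2) \<subseteq> set I \<union> set J" using Cons J by auto
            then show "(set I' \<union> set (J1 @ J2)) \<inter> (Z \<union> \<Union> (insert {a, j} \<B>)) = {}"
              using less.prems(7) aj by blast
            show "card Z + card (insert {a, j} \<B>) + length I' = k - 1"
              using less.prems(8) nB fin(2) Cons by simp
          qed
          then show ?thesis unfolding e1 unfolding e2 .
        qed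
        moreover have "?T a (W (?I @ ?J J1) (?F j z)) = ?T a (W ?I (W (?J J) (vbase n)))"
          by (simp add: J z_def)
        ultimately show ?thesis
          unfolding z_def[symmetric] e using ss by (simp add: act1_simps L_simps x_def)
      qed
      \<comment> \<open>Carried through the y-letters, \<open>dlt\<close> replaces each of them in
        turn by an x-letter, and by \<open>tm\<close> every replacement contributes
        \<open>- x\<close>. What finally reaches \<open>vbase n\<close> is in the image of
        \<open>xtot\<close> and is killed.\<close>
      have claim: "L (?r (?F a (W ?I (W (?J J1) (dlt n (W (?J J2) (vbase n))))))) = - of_nat (length J2) * x"
        if "J = J1 @ J2" for J1 J2
        using that
      proof (induction J2 arbitrary: J1)
        case Nil
        have "?F a (W ?I (W (?J J1) (dlt n (vbase n)))) = - W ((False, a) # ?I @ ?J J1) (xtot n (Theta n))"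
          by (simp add: vbase_facts W_simps o1.op_simps)
        then show ?case using L_W_xtot[OF g] by (simp add: act1_simps L_simps del: foldr_Cons)
      next
        case (Cons j J2)
        have j: "1 \<le> j" "j \<le> n" using less.prems(6) Cons.prems by auto
        have "W (?J J1) (dlt n (W (?J (j # J2)) (vbase n))) =
            W (?J (J1 @ [j])) (dlt n (W (?J J2) (vbase n))) - W (?J J1) (?T j (W (?J J2) (vbase n)))"
          using dlt_op1(2)[OF j] by (simp add: W_simps)
        then have "L (?r (?F a (W ?I (W (?J J1) (dlt n (W (?J (j # J2)) (vbase n))))))) =
            L (?r (?F a (W ?I (W (?J (J1 @ [j])) (dlt n (W (?J J2) (vbase n)))))))
            - L (?r (?F a (W ?I (W (?J J1) (?T j (W (?J J2) (vbase n)))))))"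
          by (simp only: W_simps o1.op_simps module_hom.diff[OF o1.lin_op] act1_simps L_simps)
        also have "\<dots> = - of_nat (length J2) * x - x"
          using Cons.IH[of "J1 @ [j]"] tm[OF Cons.prems] Cons.prems by simp
        also have "\<dots> = - of_nat (length (j # J2)) * x" by (simp add: algebra_simps)
        finally show ?case .
      qed
      have "dlt n (W ?I y) = W ?I (dlt n y)" for y
      proof -
        have "dlt n (W (map (Pair True) K) y) = W (map (Pair True) K) (dlt n y)" if "set K \<subseteq> {1..<n}" for K
          using that by (induction K) (simp_all add: dlt_op1(1))
        then show ?thesis using less.prems(5) Cons by simp
      qed
      then have "dlt n (?r (?F a (W ?I (W (?J J) (vbase n))))) =
          ?r (?F a (W ?I (dlt n (W (?J J) (vbase n))))) - ?r (?T a (W ?I (W (?J J) (vbase n))))"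
        by (simp add: good_commutes(1)[OF g] dlt_op1(2)[OF a(1,2)] act1_simps)
      \<comment> \<open>The letter with index \<open>a\<close>, placed in front as a y-letter, gives
        one more copy of \<open>- x\<close>, so in total \<open>Suc (length J)\<close> copies add up
        to zero.\<close>
      then have e0: "0 = - of_nat (length J) * x - x"
        using L_dlt[of "?r (?F a (W ?I (W (?J J) (vbase n))))"] claim[of "[]" J] by (simp add: L_simps x_def)
      have "of_nat (Suc (length J)) * x = - (- of_nat (length J) * x - x)" by (simp add: algebra_simps)
      also have "\<dots> = 0" by (simp only: e0[symmetric] minus_zero)
      finally have "of_nat (Suc (length J)) * x = 0" .
      then have "x = 0" by (simp del: of_nat_Suc)
      then show ?thesis by (simp add: x_def Cons)
    qed
  qed
qed

lemma W_zero_letter: "(c, n) \<in> set gs \<Longrightarrow> W gs y = 0"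
proof -
  assume "(c, n) \<in> set gs"
  then obtain xs ys where "gs = xs @ (c, n) # ys" using split_list by fastforce
  then show ?thesis using n by (simp add: W_simps)
qed

lemma W_not_distinct: "\<not> distinct gs \<Longrightarrow> W gs y = 0"
proof -
  assume "\<not> distinct gs"
  then obtain xs ys zs g where "gs = xs @ [g] @ ys @ [g] @ zs" using not_distinct_decomp by blast
  then show ?thesis by (simp add: W_pull o1.op_simps o1.op_square W_simps)
qed

text \<open>A letter of index \<open>n\<close> or a repeated letter makes the word zero; otherwise
  this is \<open>L_word_zero\<close> with an empty product of blocks in front.\<close>

lemma L_words1:
  assumes "length I = k - 1" "length J = k - 1" "set I \<subseteq> {1..n}" "set J \<subseteq> {1..n}"
  shows "L (W (map (Pair True) I @ map (Pair False) J) (vbase n)) = 0"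
proof (cases "n \<in> set I \<union> set J \<or> \<not> distinct I \<or> \<not> distinct J")
  case True
  then have "W (map (Pair True) I @ map (Pair False) J) (vbase n) = 0"
  proof (elim disjE UnE)
    assume "n \<in> set I" then show ?thesis by (intro W_zero_letter[of True]) auto
  next
    assume "n \<in> set J" then show ?thesis by (intro W_zero_letter[of False]) auto
  next
    assume "\<not> distinct I" then show ?thesis by (intro W_not_distinct) (auto simp: distinct_map)
  next
    assume "\<not> distinct J" then show ?thesis by (intro W_not_distinct) (auto simp: distinct_map)
  qed
  then show ?thesis by (simp only: L_simps)
next
  case False
  have s: "set I \<subseteq> {1..<n}" "set J \<subseteq> {1..<n}" using assms(3,4) False by (auto simp: subset_iff le_less)
  have "L (act1 n (zq {} {}) (W (map (Pair True) I @ map (Pair False) J) (vbase n))) = 0"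
    by (rule L_word_zero) (use assms False s in \<open>auto simp: blocks_ok_def disjoint_def\<close>)
  then show ?thesis by (simp add: zq_def o1.act_one)
qed

text \<open>The differences add up to the total operator minus \<open>n\<close> copies of the letter
  of index \<open>n\<close>.\<close>

lemma op0_n_expand:
  "scl (of_nat n) (op0 (False, n) z) = dth n z - (\<Sum>j\<in>{1..n}. op1 n (False, j) z)"
  "scl (of_nat n) (op0 (True, n) z) = xtot n z - (\<Sum>j\<in>{1..n}. op1 n (True, j) z)"
proof -
  have c: "(\<Sum>j\<in>{1..n}. y) = scl (of_nat n) y" for y :: vec
    by (rule ext) (simp add: sum_fun_apply pointwise)
  have e: "op1 n (c, j) z = op0 (c, j) z - op0 (c, n) z" if "j \<in> {1..n}" for c j
    using that by (simp add: op1_def)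
  have s: "(\<Sum>j\<in>{1..n}. op1 n (c, j) z) = (\<Sum>j\<in>{1..n}. op0 (c, j) z) - scl (of_nat n) (op0 (c, n) z)" for c
    unfolding c[symmetric] sum_subtractf[symmetric] by (rule sum.cong[OF refl]) (rule e)
  show "scl (of_nat n) (op0 (False, n) z) = dth n z - (\<Sum>j\<in>{1..n}. op1 n (False, j) z)"
    unfolding s by (simp add: dth_def)
  show "scl (of_nat n) (op0 (True, n) z) = xtot n z - (\<Sum>j\<in>{1..n}. op1 n (True, j) z)"
    unfolding s by (simp add: xtot_def)
qed

text \<open>A letter \<open>op0 (c, i)\<close> is a difference letter plus the average of all letters, up to the
  total operator, so it may be replaced by difference letters if the total operator contributes nothing.\<close>

lemma L_replace_letter:
  assumes i: "i \<in> {1..n}" and tot: "L (W gs (if c then xtot n z else dth n z)) = 0"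
    and z: "\<And>j. j \<in> {1..n} \<Longrightarrow> L (W gs (op1 n (c, j) z)) = 0"
  shows "L (W gs (op0 (c, i) z)) = 0"
proof -
  have "scl (of_nat n) (op0 (c, n) z) = (if c then xtot n z else dth n z) - (\<Sum>j\<in>{1..n}. op1 n (c, j) z)"
    using op0_n_expand[of z] by (cases c) auto
  then have "L (W gs (scl (of_nat n) (op0 (c, n) z))) = 0 - (\<Sum>j\<in>{1..n}. L (W gs (op1 n (c, j) z)))"
    using tot by (simp only: W_simps L_simps)
  also have "(\<Sum>j\<in>{1..n}. L (W gs (op1 n (c, j) z))) = 0" using z by (rule sum.neutral[OF ballI])
  finally have "L (W gs (scl (of_nat n) (op0 (c, n) z))) = 0" by simp
  then have "L (W gs (op0 (c, n) z)) = 0" using n by (simp add: W_simps L_simps)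
  moreover have "op0 (c, i) z = op1 n (c, i) z + op0 (c, n) z" using i by (simp add: op1_def)
  ultimately show ?thesis using z[OF i] by (simp only: W_simps L_simps add_0_right)
qed

lemma W0_pull_dth: "dth n (W0 gs y) = scl ((- 1) ^ length gs) (W0 gs (dth n y))"
  by (rule foldr_anti) (auto simp: dth_op0 o0.lin_op)

text \<open>The letters of \<open>J'\<close> are still original ones. They are converted from the
  left, and the total operator \<open>dth\<close> contributes nothing since it can be carried to
  \<open>vbase n\<close>, which it kills.\<close>

lemma L_words2:
  assumes "length I = k - 1" "set I \<subseteq> {1..n}" "set J \<subseteq> {1..n}" "set J' \<subseteq> {1..n}" "length J + length J' = k - 1"
  shows "L (W (map (Pair True) I @ map (Pair False) J) (W0 (map (Pair False) J') (vbase n))) = 0"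
  using assms(3-5)
proof (induction J' arbitrary: J)
  case Nil
  then show ?case using L_words1 assms by simp
next
  case (Cons j J')
  let ?z = "W0 (map (Pair False) J') (vbase n)"
  have "L (W (map (Pair True) I @ map (Pair False) J) (op0 (False, j) ?z)) = 0"
  proof (rule L_replace_letter)
    show "j \<in> {1..n}" using Cons.prems by simp
    show "L (W (map (Pair True) I @ map (Pair False) J) (if False then xtot n ?z else dth n ?z)) = 0"
      by (simp add: W0_pull_dth vbase_facts module_hom.zero[OF lin_W0] W_simps L_simps)
    fix i assume "i \<in> {1..n}"
    then have "L (W (map (Pair True) I @ map (Pair False) (J @ [i])) ?z) = 0"
      using Cons.prems by (intro Cons.IH) auto
    then show "L (W (map (Pair True) I @ map (Pair False) J) (op1 n (False, i) ?z)) = 0" by simp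
  qed
  then show ?case by simp
qed

lemma fin_W0_vbase: "fin_part (W0 (map (Pair False) J) (vbase n)) = W0 (map (Pair False) J) (vbase n)"
  by (induction J) (simp_all add: fin_vbase)

text \<open>Write \<open>n\<close> times \<open>Theta n\<close> as \<open>ttot n (vbase n)\<close>
  and carry \<open>ttot\<close> to the left. Each contraction it passes leaves a word of
  \<open>k - 1\<close> contractions on \<open>vbase n\<close>, covered by \<open>L_words2\<close>;
  once in front, \<open>ttot\<close> is killed by \<open>L\<close>.\<close>

lemma L_words3:
  assumes "length I = k - 1" "set I \<subseteq> {1..n}" "set J \<subseteq> {1..n}" "length J = k"
  shows "L (W (map (Pair True) I) (W0 (map (Pair False) J) (Theta n))) = 0"
proof -
  have "L (W (map (Pair True) I) (W0 (map (Pair False) J1) (ttot n (W0 (map (Pair False) J2) (vbase n))))) = 0"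
    if "set J1 \<subseteq> {1..n}" "set J2 \<subseteq> {1..n}" "length J1 + length J2 = k" for J1 J2
    using that
  proof (induction J1 arbitrary: J2 rule: rev_induct)
    case Nil
    have "W (map (Pair True) I) (ttot n y) = scl ((- 1) ^ length (map (Pair True) I)) (ttot n (W (map (Pair True) I) y))" for y
    proof (rule foldr_pull)
      fix g y assume "g \<in> set (map (Pair True) I)"
      then obtain i where "g = (True, i)" "1 \<le> i" "i \<le> n" using assms(2) by auto
      then show "ttot n (op1 n g y) = - op1 n g (ttot n y)" using antic_tot(3)[OF n] by (simp add: antic_def)
    qed (rule lin_op1)
    then show ?case by (simp add: L_simps L_ttot)
  next
    case (snoc j J1)
    let ?z = "W0 (map (Pair False) J2) (vbase n)"
    have j: "j \<in> {1..n}" using snoc.prems by simp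
    have "an (theta j) (ttot n ?z) = ?z - ttot n (an (theta j) ?z)"
      using ttot_theta[OF j, of ?z] by (simp add: fin_W0_vbase)
    then have "W0 (map (Pair False) (J1 @ [j])) (ttot n ?z) =
      W0 (map (Pair False) (J1 @ J2)) (vbase n) - W0 (map (Pair False) J1) (ttot n (W0 (map (Pair False) (j # J2)) (vbase n)))"
      by (simp add: module_hom.diff[OF lin_W0])
    moreover have "L (W (map (Pair True) I @ map (Pair False) []) (W0 (map (Pair False) (J1 @ J2)) (vbase n))) = 0"
      by (rule L_words2) (use assms snoc.prems in auto)
    moreover have "L (W (map (Pair True) I) (W0 (map (Pair False) J1) (ttot n (W0 (map (Pair False) (j # J2)) (vbase n))))) = 0"
      by (rule snoc.IH) (use snoc.prems in auto)
    ultimately show ?case by (simp only: W_simps L_simps list.map append_Nil2 diff_zero)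
  qed
  from this[of J "[]"] assms
  have "L (W (map (Pair True) I) (W0 (map (Pair False) J) (scl (of_nat n) (Theta n)))) = 0"
    by (simp add: vbase_facts)
  then show ?thesis using n by (simp add: module_hom.scale[OF lin_W0] W_simps L_simps)
qed

text \<open>The conversion of the x-letters, with \<open>xtot\<close> in the role of
  \<open>dth\<close>; here the total operator is killed by \<open>L\<close> and not by the base
  vector.\<close>

lemma L_words4:
  assumes "set J \<subseteq> {1..n}" "length J = k" "set I \<subseteq> {1..n}" "set I' \<subseteq> {1..n}" "length I + length I' = k - 1"
  shows "L (W (map (Pair True) I) (W0 (map (Pair True) I') (W0 (map (Pair False) J) (Theta n)))) = 0"
  using assms(3-5)
proof (induction I' arbitrary: I)
  case Nil
  then show ?case using L_words3 assms(1,2) by simp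
next
  case (Cons j I')
  let ?z = "W0 (map (Pair True) I') (W0 (map (Pair False) J) (Theta n))"
  have "L (W (map (Pair True) I) (op0 (True, j) ?z)) = 0"
  proof (rule L_replace_letter)
    show "j \<in> {1..n}" using Cons.prems by simp
    show "L (W (map (Pair True) I) (if True then xtot n ?z else dth n ?z)) = 0"
      using L_W_xtot[OF good_one, of "map (Pair True) I" ?z] by (simp add: o1.act_one)
    fix i assume "i \<in> {1..n}"
    then have "L (W (map (Pair True) (I @ [i])) ?z) = 0" using Cons.prems by (intro Cons.IH) auto
    then show "L (W (map (Pair True) I) (op1 n (True, i) ?z)) = 0" by simp
  qed
  then show ?case by simp
qed

text \<open>Up to a nonzero factor the monomial is a word of \<open>k\<close> contractions, by the
  missing theta indices, and \<open>k - 1\<close> multiplications, applied to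
  \<open>Theta n\<close>.\<close>

lemma L_basis_vec:
  assumes U: "U \<subseteq> gens n" "card (U \<inter> range theta) = n - k" "card (U \<inter> range xi) = k - 1"
  shows "L (basis_vec U) = 0"
proof -
  define A where "A = {i. xi i \<in> U}"
  define B where "B = {i \<in> {1..n}. theta i \<notin> U}"
  have A: "A \<subseteq> {1..n}" using U(1) by (auto simp: A_def gens_def)
  have finA: "finite A" by (rule finite_subset[OF A]) simp
  have UA: "U \<inter> range xi = xi ` A" by (auto simp: A_def)
  have UB: "U \<inter> range theta = theta ` ({1..n} - B)" using U(1) by (auto simp: B_def gens_def)
  have B: "B \<subseteq> {1..n}" by (auto simp: B_def)
  have "U = (U \<inter> range xi) \<union> (U \<inter> range theta)" using U(1) unfolding gens_def by blast
  then have Un: "U = xi ` A \<union> theta ` ({1..n} - B)" by (simp only: UA UB)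
  have cA: "card A = k - 1" using U(3) unfolding UA by (simp add: card_image inj_on_def)
  have "card (theta ` ({1..n} - B)) = card ({1..n} - B)" by (rule card_image) (rule inj_onI, blast)
  then have "card ({1..n} - B) = n - k" using U(2) unfolding UB by simp
  moreover have "card ({1..n} - B) = n - card B" using B finite_subset[OF B] by (simp add: card_Diff_subset)
  moreover have "card B \<le> n" using card_mono[OF _ B] by simp
  ultimately have cB: "card B = k" using k by linarith
  obtain J c where J: "set J = B" "length J = card B" "c \<noteq> 0"
    "W0 (map (Pair False) J) (Theta n) = scl c (basis_vec (theta ` ({1..n} - B)))"
    using an_word_Theta[OF B] by blast
  obtain I d where I: "set I = A" "length I = card A" "d \<noteq> 0"
    "W0 (map (Pair True) I) (basis_vec (theta ` ({1..n} - B))) = scl d (basis_vec U)"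
    using cr_word_basis[OF finA, of "theta ` ({1..n} - B)"] Un by auto
  have "L (W (map (Pair True) []) (W0 (map (Pair True) I) (W0 (map (Pair False) J) (Theta n)))) = 0"
    by (rule L_words4) (use I J A B cA cB in auto)
  then have "L (scl c (scl d (basis_vec U))) = 0"
    using J(4) I(4) by (simp add: module_hom.scale[OF lin_W0])
  then show ?thesis using J(3) I(3) by (simp add: L_simps)
qed

theorem L_bihomogeneous:
  assumes "x \<in> ext_bihomogeneous n (n - k) (k - 1)"
  shows "L x = 0"
proof -
  have x: "x \<in> supp_in (gens n)" "bideg (n - k) (k - 1) x" using assms by (auto simp: ext_bihomogeneous_eq)
  have "L x = (\<Sum>S\<in>Pow (gens n). x S * L (basis_vec S))"
    by (subst vec_expand[OF finite_gens x(1)]) (simp add: L_simps)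
  also have "\<dots> = 0"
  proof (rule sum.neutral, rule ballI)
    fix S assume "S \<in> Pow (gens n)"
    then show "x S * L (basis_vec S) = 0"
      using x(2) L_basis_vec[of S] unfolding bideg_def by (cases "x S = 0") simp_all
  qed
  finally show ?thesis .
qed

end

section \<open>The coinvariant ideal\<close>

lemma ext_mult_sum_left: "ext_mult (\<Sum>i\<in>A. F i) h = (\<Sum>i\<in>A. ext_mult (F i) h)"
  using module_hom.sum[OF lin_ext_mult_left] .

lemma ext_mult_sum_right: "ext_mult h (\<Sum>i\<in>A. F i) = (\<Sum>i\<in>A. ext_mult h (F i))"
  using module_hom.sum[OF lin_ext_mult_right] .

lemma ext_mult_cr_left: "ext_mult (cr g f) h = cr g (ext_mult f h)"
  by (simp add: cr_def ext_mult_assoc)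

lemma ext_mult_cr_right: "ext_mult f (cr g h) = cr g (ext_mult (parity f) h)"
proof -
  have "ext_mult f (cr g h) = ext_mult (ext_mult f (basis_vec {g})) h" by (simp add: cr_def ext_mult_assoc)
  then show ?thesis by (simp only: ext_mult_gen_right ext_mult_cr_left)
qed

lemma ext_mult_tot:
  "ext_mult (ttot n y) z = ttot n (ext_mult y z)" "ext_mult (xtot n y) z = xtot n (ext_mult y z)"
  "ext_mult (dlt n y) z = dlt n (ext_mult y z)"
  "ext_mult z (ttot n y) = ttot n (ext_mult (parity z) y)" "ext_mult z (xtot n y) = xtot n (ext_mult (parity z) y)"
  "ext_mult z (dlt n y) = dlt n (ext_mult z y)"
  by (simp_all add: ttot_def xtot_def dlt_def ext_mult_sum_left ext_mult_sum_right ext_mult_cr_left ext_mult_cr_right)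

lemma parity_supp_in: "f \<in> supp_in G \<Longrightarrow> parity f \<in> supp_in G"
  by (simp add: supp_in_def parity_def)

lemma tot_supp_in:
  assumes "y \<in> supp_in (gens n)"
  shows "ttot n y \<in> supp_in (gens n)" "xtot n y \<in> supp_in (gens n)" "dlt n y \<in> supp_in (gens n)"
  using assms unfolding ttot_def xtot_def dlt_def by (auto intro!: supp_in_sum cr_supp_in)

lemma ext_act_tot:
  assumes w: "w permutes {1..n}"
  shows "ext_act n w (ttot n y) = ttot n (ext_act n w y)" "ext_act n w (xtot n y) = xtot n (ext_act n w y)"
    "ext_act n w (dlt n y) = dlt n (ext_act n w y)"
proof -
  have r: "(\<Sum>i\<in>{1..n}. F (w i)) = (\<Sum>i\<in>{1..n}. F i)" for F :: "nat \<Rightarrow> vec"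
    by (rule sum.reindex_bij_betw[OF permutes_imp_bij[OF w]])
  have "ext_act n w (ttot n y) = (\<Sum>i\<in>{1..n}. cr (theta (w i)) (ext_act n w y))"
    unfolding ttot_def ext_act_simps by (rule sum.cong) (auto simp: ext_act_cr perm_gen_def)
  also have "\<dots> = ttot n (ext_act n w y)" unfolding ttot_def by (rule r)
  finally show "ext_act n w (ttot n y) = ttot n (ext_act n w y)" .
  have "ext_act n w (xtot n y) = (\<Sum>i\<in>{1..n}. cr (xi (w i)) (ext_act n w y))"
    unfolding xtot_def ext_act_simps by (rule sum.cong) (auto simp: ext_act_cr perm_gen_def)
  also have "\<dots> = xtot n (ext_act n w y)" unfolding xtot_def by (rule r)
  finally show "ext_act n w (xtot n y) = xtot n (ext_act n w y)" .
  have "ext_act n w (dlt n y) = (\<Sum>i\<in>{1..n}. cr (theta (w i)) (cr (xi (w i)) (ext_act n w y)))"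
    unfolding dlt_def ext_act_simps by (rule sum.cong) (auto simp: ext_act_cr perm_gen_def)
  also have "\<dots> = dlt n (ext_act n w y)" unfolding dlt_def by (rule r)
  finally show "ext_act n w (dlt n y) = dlt n (ext_act n w y)" .
qed

lemma tot_in_ideal:
  assumes y: "y \<in> supp_in (gens n)"
  shows "ttot n y \<in> coinvariant_ideal n" "xtot n y \<in> coinvariant_ideal n" "dlt n y \<in> coinvariant_ideal n"
proof -
  let ?u = "basis_vec {} :: vec"
  have u: "?u \<in> supp_in (gens n)" by simp
  have one: "ext_mult ?u y = y" using y by (simp add: ext_mult_one_left supp_in_fin_part[OF finite_gens])
  have z: "ttot n ?u {} = 0" "xtot n ?u {} = 0" "dlt n ?u {} = 0"
    by (simp_all add: ttot_def xtot_def dlt_def sum_fun_apply cr_apply[of _ _ "{}"])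
  have "{ttot n ?u, xtot n ?u, dlt n ?u} \<subseteq> positive_invariants n"
    using tot_supp_in[OF u] z
    by (auto simp: positive_invariants_def ext_alg_simps sym_group_def ext_act_tot)
  then have i: "ttot n ?u \<in> coinvariant_ideal n" "xtot n ?u \<in> coinvariant_ideal n" "dlt n ?u \<in> coinvariant_ideal n"
    using positive_invariants_subset by blast+
  show "ttot n y \<in> coinvariant_ideal n" "xtot n y \<in> coinvariant_ideal n" "dlt n y \<in> coinvariant_ideal n"
    using i[THEN coinvariant_ideal_closed(4)[OF _ y]] unfolding ext_mult_tot one by simp_all
qed

text \<open>The first fundamental theorem for the symmetric group: the ideal is generated by the three
  invariants of lowest degree.\<close>

definition tot_ideal :: "nat \<Rightarrow> vec set"
  where "tot_ideal n = {x. \<exists>a\<in>supp_in (gens n). \<exists>b\<in>supp_in (gens n). \<exists>c\<in>supp_in (gens n).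
    x = ttot n a + xtot n b + dlt n c}"

lemmas tot_simps = module_hom.add[OF lin_tot(1)] module_hom.add[OF lin_tot(2)] module_hom.add[OF lin_tot(4)]
  module_hom.scale[OF lin_tot(1)] module_hom.scale[OF lin_tot(2)] module_hom.scale[OF lin_tot(4)]
  module_hom.neg[OF lin_tot(1)] module_hom.neg[OF lin_tot(2)] module_hom.neg[OF lin_tot(4)]
  module_hom.zero[OF lin_tot(1)] module_hom.zero[OF lin_tot(2)] module_hom.zero[OF lin_tot(4)]

lemma tot_idealI:
  "a \<in> supp_in (gens n) \<Longrightarrow> b \<in> supp_in (gens n) \<Longrightarrow> c \<in> supp_in (gens n) \<Longrightarrow>
    ttot n a + xtot n b + dlt n c \<in> tot_ideal n"
  unfolding tot_ideal_def by blast

lemma tot_idealE: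
  assumes "x \<in> tot_ideal n"
  obtains a b c where "a \<in> supp_in (gens n)" "b \<in> supp_in (gens n)" "c \<in> supp_in (gens n)"
    "x = ttot n a + xtot n b + dlt n c"
  using assms unfolding tot_ideal_def by blast

lemma tot_in_tot_ideal:
  assumes y: "y \<in> supp_in (gens n)"
  shows "ttot n y \<in> tot_ideal n" "xtot n y \<in> tot_ideal n" "dlt n y \<in> tot_ideal n" "0 \<in> tot_ideal n"
  using tot_idealI[OF y supp_in_closed(1) supp_in_closed(1)] tot_idealI[OF supp_in_closed(1) y supp_in_closed(1)]
    tot_idealI[OF supp_in_closed(1) supp_in_closed(1) y]
    tot_idealI[OF supp_in_closed(1) supp_in_closed(1) supp_in_closed(1), of n]
  by (simp_all add: tot_simps)

lemma tot_ideal_add: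
  assumes "x \<in> tot_ideal n" "y \<in> tot_ideal n" shows "x + y \<in> tot_ideal n"
proof -
  obtain a b c where x: "a \<in> supp_in (gens n)" "b \<in> supp_in (gens n)" "c \<in> supp_in (gens n)"
    "x = ttot n a + xtot n b + dlt n c" using assms(1) by (rule tot_idealE)
  obtain a' b' c' where y: "a' \<in> supp_in (gens n)" "b' \<in> supp_in (gens n)" "c' \<in> supp_in (gens n)"
    "y = ttot n a' + xtot n b' + dlt n c'" using assms(2) by (rule tot_idealE)
  have "x + y = ttot n (a + a') + xtot n (b + b') + dlt n (c + c')" unfolding x(4) y(4) tot_simps by (simp only: add_ac)
  then show ?thesis using x y by (simp only: tot_idealI supp_in_closed)
qed

lemma tot_ideal_scl:
  assumes "x \<in> tot_ideal n" shows "scl s x \<in> tot_ideal n"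
proof -
  obtain a b c where x: "a \<in> supp_in (gens n)" "b \<in> supp_in (gens n)" "c \<in> supp_in (gens n)"
    "x = ttot n a + xtot n b + dlt n c" using assms by (rule tot_idealE)
  have "scl s x = ttot n (scl s a) + xtot n (scl s b) + dlt n (scl s c)"
    unfolding x(4) tot_simps fsp.scale_right_distrib ..
  then show ?thesis using x by (simp only: tot_idealI supp_in_closed)
qed

lemma tot_ideal_sum: "(\<And>i. i \<in> A \<Longrightarrow> F i \<in> tot_ideal n) \<Longrightarrow> sum F A \<in> tot_ideal n"
  using tot_in_tot_ideal(4)[OF supp_in_closed(1)]
  by (induction A rule: infinite_finite_induct) (simp_all add: tot_ideal_add)

lemma ideal_tot_ideal: "ideal (tot_ideal n) (ext_alg n)"
proof (rule ideal_ext_algI)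
  show "tot_ideal n \<subseteq> supp_in (gens n)" by (auto elim!: tot_idealE intro!: supp_in_closed tot_supp_in)
  show "0 \<in> tot_ideal n" by (rule tot_in_tot_ideal(4)[OF supp_in_closed(1)])
  show "x + y \<in> tot_ideal n" if "x \<in> tot_ideal n" "y \<in> tot_ideal n" for x y using that by (rule tot_ideal_add)
  show "- x \<in> tot_ideal n" if "x \<in> tot_ideal n" for x using tot_ideal_scl[OF that, of "- 1"] by simp
  fix x f assume f: "f \<in> supp_in (gens n)" and "x \<in> tot_ideal n"
  then obtain a b c where x: "a \<in> supp_in (gens n)" "b \<in> supp_in (gens n)" "c \<in> supp_in (gens n)"
    "x = ttot n a + xtot n b + dlt n c" by (elim tot_idealE)
  show "ext_mult f x \<in> tot_ideal n"
    unfolding x(4) ext_mult_add_right ext_mult_tot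
    by (intro tot_idealI ext_mult_supp_in parity_supp_in f x)
  show "ext_mult x f \<in> tot_ideal n"
    unfolding x(4) ext_mult_add_left ext_mult_tot
    by (intro tot_idealI ext_mult_supp_in f x)
qed

section \<open>Sums over the symmetric group and the generators of the ideal\<close>

definition avg :: "nat \<Rightarrow> vec \<Rightarrow> vec"
  where "avg n y = (\<Sum>w\<in>{w. w permutes {1..n}}. ext_act n w y)"

lemma lin_avg: "lin (avg n)"
  unfolding avg_def by (intro lin_sum_ops lin_ext_act)

lemmas avg_simps = module_hom.add[OF lin_avg] module_hom.scale[OF lin_avg] module_hom.sum[OF lin_avg]
  module_hom.zero[OF lin_avg] module_hom.diff[OF lin_avg]

lemma avg_supp_in: "y \<in> supp_in (gens n) \<Longrightarrow> avg n y \<in> supp_in (gens n)"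
  unfolding avg_def by (intro supp_in_sum ext_act_supp) auto

lemma avg_tot: "avg n (ttot n y) = ttot n (avg n y)" "avg n (xtot n y) = xtot n (avg n y)"
  "avg n (dlt n y) = dlt n (avg n y)"
  unfolding avg_def module_hom.sum[OF lin_tot(1)] module_hom.sum[OF lin_tot(2)] module_hom.sum[OF lin_tot(4)]
  by (auto intro!: sum.cong simp: ext_act_tot)

lemma avg_ext_act:
  assumes u: "u permutes {1..n}" and y: "y \<in> supp_in (gens n)"
  shows "avg n (ext_act n u y) = avg n y"
proof -
  have "avg n (ext_act n u y) = (\<Sum>w\<in>{w. w permutes {1..n}}. ext_act n (w \<circ> u) y)"
    unfolding avg_def by (rule sum.cong[OF refl]) (simp only: ext_act_compose[OF u y])
  also have "\<dots> = avg n y"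
    unfolding avg_def
    by (rule sum.reindex_bij_witness[where j = "\<lambda>w. w \<circ> u" and i = "\<lambda>w. w \<circ> Hilbert_Choice.inv u"])
      (simp_all only: mem_Collect_eq comp_assoc permutes_inv_o[OF u] comp_id permutes_compose[OF u] permutes_compose[OF permutes_inv[OF u]])
  finally show ?thesis .
qed

text \<open>Summing over the letters that are free to take the place of \<open>i\<close>: the nonzero terms
  all have the same average.\<close>

lemma avg_exchange:
  assumes i: "i \<in> {1..n}" and F: "\<And>j. j \<in> {1..n} \<Longrightarrow> F j \<in> supp_in (gens n)"
    and T: "avg n (\<Sum>j\<in>{1..n}. F j) \<in> tot_ideal n"
    and cases: "\<And>j. j \<in> {1..n} \<Longrightarrow> avg n (F j) \<in> tot_ideal n \<or> ext_act n (Transposition.transpose i j) (F i) = F j"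
  shows "avg n (F i) \<in> tot_ideal n"
proof (cases "avg n (F i) \<in> tot_ideal n")
  case False
  let ?A = "{j \<in> {1..n}. avg n (F j) \<in> tot_ideal n}"
  have e: "avg n (F j) = avg n (F i)" if "j \<in> {1..n} - ?A" for j
  proof -
    have j: "j \<in> {1..n}" using that by blast
    have "F j = ext_act n (Transposition.transpose i j) (F i)" using cases[OF j] that by auto
    then show ?thesis using avg_ext_act[OF permutes_swap_id[OF i j] F[OF i]] by simp
  qed
  have "avg n (\<Sum>j\<in>{1..n}. F j) = (\<Sum>j\<in>{1..n} - ?A. avg n (F j)) + (\<Sum>j\<in>?A. avg n (F j))"
    unfolding avg_simps by (rule sum.subset_diff) auto
  also have "(\<Sum>j\<in>{1..n} - ?A. avg n (F j)) = (\<Sum>j\<in>{1..n} - ?A. avg n (F i))"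
    by (rule sum.cong[OF refl]) (rule e)
  also have "\<dots> = scl (of_nat (card ({1..n} - ?A))) (avg n (F i))" by (rule ext) (simp add: sum_fun_apply pointwise)
  finally have "scl (of_nat (card ({1..n} - ?A))) (avg n (F i)) =
      avg n (\<Sum>j\<in>{1..n}. F j) + scl (- 1) (\<Sum>j\<in>?A. avg n (F j))" by simp
  also have "\<dots> \<in> tot_ideal n" by (intro tot_ideal_add T tot_ideal_scl tot_ideal_sum) blast
  finally have "scl (1 / of_nat (card ({1..n} - ?A))) (scl (of_nat (card ({1..n} - ?A))) (avg n (F i))) \<in> tot_ideal n"
    by (rule tot_ideal_scl)
  moreover have "card ({1..n} - ?A) \<noteq> 0" using False i by auto
  ultimately show ?thesis by (simp only: fsp.scale_scale) simp
qed

lemma perm_gen_transpose_fixed: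
  "g \<noteq> (True, i) \<Longrightarrow> g \<noteq> (False, i) \<Longrightarrow> g \<noteq> (True, j) \<Longrightarrow> g \<noteq> (False, j) \<Longrightarrow>
    perm_gen (Transposition.transpose i j) g = g"
  by (cases g; cases "fst g") (auto simp: perm_gen_def transpose_def)

lemma cr_basis_vec_member:
  assumes "g \<in> S" shows "cr g (basis_vec S) = 0"
proof (rule ext)
  fix U
  have "(U - {g} = S) = False" using assms by blast
  then show "cr g (basis_vec S) U = 0 U"
    by (simp only: cr_apply[of _ _ U] basis_vec_def zero_fun_apply of_bool_eq mult_zero_right if_cancel)
qed

text \<open>The objects exchanged are the pairs \<open>theta j\<close>, \<open>xi j\<close>, whose
  sum acts as \<open>dlt\<close>. If \<open>S\<close> contains a letter of index \<open>j\<close>,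
  the term is zero; otherwise the transposition of \<open>i\<close> and \<open>j\<close> fixes
  \<open>S\<close>.\<close>

lemma avg_double:
  assumes i: "i \<in> {1..n}" and S: "S \<subseteq> gens n" "theta i \<notin> S" "xi i \<notin> S"
  shows "avg n (cr (theta i) (cr (xi i) (basis_vec S))) \<in> tot_ideal n"
proof (rule avg_exchange[where F = "\<lambda>j. cr (theta j) (cr (xi j) (basis_vec S))"])
  have b: "basis_vec S \<in> supp_in (gens n)" using S by simp
  show "i \<in> {1..n}" by (rule i)
  show "cr (theta j) (cr (xi j) (basis_vec S)) \<in> supp_in (gens n)" if "j \<in> {1..n}" for j
    using that b by (intro cr_supp_in) auto
  have "avg n (dlt n (basis_vec S)) \<in> tot_ideal n"
    unfolding avg_tot by (intro tot_in_tot_ideal avg_supp_in b)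
  then show "avg n (\<Sum>j\<in>{1..n}. cr (theta j) (cr (xi j) (basis_vec S))) \<in> tot_ideal n" by (simp only: dlt_def)
  fix j assume j: "j \<in> {1..n}"
  show "avg n (cr (theta j) (cr (xi j) (basis_vec S))) \<in> tot_ideal n \<or>
    ext_act n (Transposition.transpose i j) (cr (theta i) (cr (xi i) (basis_vec S))) = cr (theta j) (cr (xi j) (basis_vec S))"
  proof (cases "theta j \<in> S \<or> xi j \<in> S")
    case True
    then have "cr (theta j) (cr (xi j) (basis_vec S)) = 0"
    proof (elim disjE)
      assume "theta j \<in> S"
      then show ?thesis unfolding cr_anti[of "theta j" "xi j"] by (simp add: cr_basis_vec_member module_hom.zero[OF lin_cr])
    qed (simp add: cr_basis_vec_member module_hom.zero[OF lin_cr])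
    then show ?thesis using tot_in_tot_ideal(4)[OF supp_in_closed(1)] by (simp add: avg_simps)
  next
    case False
    have "ext_act n (Transposition.transpose i j) (basis_vec S) = basis_vec S"
      by (rule ext_act_basis_vec_fixed[OF S(1)], rule perm_gen_transpose_fixed) (use S False in blast)+
    then show ?thesis using i j by (simp add: ext_act_cr perm_gen_def)
  qed
qed

text \<open>If \<open>(\<not> c, j)\<close> lies in \<open>S\<close>, the term is zero or contains a
  full pair of index \<open>j\<close>, a case of \<open>avg_double\<close>. If \<open>(c, j)\<close>
  lies in \<open>S\<close>, the term is zero. In the remaining case the transposition of
  \<open>i\<close> and \<open>j\<close> fixes \<open>S\<close>.\<close>

lemma avg_single:
  assumes i: "i \<in> {1..n}" and S: "S \<subseteq> gens n" "(\<not> c, i) \<notin> S" "(c, i) \<notin> S"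
  shows "avg n (cr (c, i) (basis_vec S)) \<in> tot_ideal n"
proof (rule avg_exchange[where F = "\<lambda>j. cr (c, j) (basis_vec S)"])
  have b: "basis_vec S \<in> supp_in (gens n)" using S by simp
  show "i \<in> {1..n}" by (rule i)
  show "cr (c, j) (basis_vec S) \<in> supp_in (gens n)" if "j \<in> {1..n}" for j
    using that b by (intro cr_supp_in) auto
  have "avg n (if c then xtot n (basis_vec S) else ttot n (basis_vec S)) \<in> tot_ideal n"
    by (cases c; simp only: if_True if_False avg_tot; intro tot_in_tot_ideal avg_supp_in b)
  then show "avg n (\<Sum>j\<in>{1..n}. cr (c, j) (basis_vec S)) \<in> tot_ideal n"
    by (cases c) (simp_all add: ttot_def xtot_def)
  fix j assume j: "j \<in> {1..n}"
  show "avg n (cr (c, j) (basis_vec S)) \<in> tot_ideal n \<or>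
    ext_act n (Transposition.transpose i j) (cr (c, i) (basis_vec S)) = cr (c, j) (basis_vec S)"
  proof (cases "(c, j) \<in> S")
    case True
    then show ?thesis using tot_in_tot_ideal(4)[OF supp_in_closed(1)] by (simp add: avg_simps cr_basis_vec_member)
  next
    case c: False
    show ?thesis
    proof (cases "(\<not> c, j) \<in> S")
      case True
      let ?S = "S - {(\<not> c, j)}"
      have fin: "finite ?S" using finite_subset[OF S(1)] by simp
      have "cr (\<not> c, j) (basis_vec ?S) = scl (esign (\<not> c, j) ?S) (basis_vec (insert (\<not> c, j) ?S))"
        by (rule cr_basis_vec[OF fin]) simp
      also have "insert (\<not> c, j) ?S = S" using True by blast
      finally have "scl (esign (\<not> c, j) ?S) (cr (c, j) (cr (\<not> c, j) (basis_vec ?S))) = cr (c, j) (basis_vec S)"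
        by (simp add: cr.op_simps)
      moreover have "avg n (cr (c, j) (cr (\<not> c, j) (basis_vec ?S))) \<in> tot_ideal n"
      proof -
        have d: "avg n (cr (theta j) (cr (xi j) (basis_vec ?S))) \<in> tot_ideal n"
          by (rule avg_double[OF j]) (use S(1) c in \<open>cases c; auto\<close>)+
        show ?thesis
        proof (cases c)
          case True
          have "cr (xi j) (cr (theta j) (basis_vec ?S)) = scl (- 1) (cr (theta j) (cr (xi j) (basis_vec ?S)))"
            using cr_anti[of "xi j" "theta j" "basis_vec ?S"] by simp
          then have "avg n (cr (xi j) (cr (theta j) (basis_vec ?S))) \<in> tot_ideal n"
            using tot_ideal_scl[OF d] by (simp only: avg_simps)
          then show ?thesis using True by simp
        next
          case False
          then show ?thesis using d by simp
        qed
      qed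
      ultimately show ?thesis by (metis avg_simps(2) tot_ideal_scl)
    next
      case False
      have "ext_act n (Transposition.transpose i j) (basis_vec S) = basis_vec S"
      proof (rule ext_act_basis_vec_fixed[OF S(1)])
        fix g assume "g \<in> S"
        then have "g \<noteq> (c, i)" "g \<noteq> (\<not> c, i)" "g \<noteq> (c, j)" "g \<noteq> (\<not> c, j)" using S c False by blast+
        then show "perm_gen (Transposition.transpose i j) g = g"
          by (intro perm_gen_transpose_fixed) (cases c; simp)+
      qed
      then show ?thesis using i j by (simp add: ext_act_cr perm_gen_def)
    qed
  qed
qed

lemma avg_basis_vec:
  assumes S: "S \<subseteq> gens n" "S \<noteq> {}"
  shows "avg n (basis_vec S) \<in> tot_ideal n"
proof -
  obtain c i where ci: "(c, i) \<in> S" using S(2) by auto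
  then have i: "i \<in> {1..n}" using S(1) by auto
  have fin: "finite S" using finite_subset[OF S(1)] by simp
  have red: "avg n (basis_vec R) \<in> tot_ideal n" if "avg n (cr g (basis_vec (R - {g}))) \<in> tot_ideal n" "g \<in> R" "finite R" for g R
  proof -
    have "cr g (basis_vec (R - {g})) = scl (esign g (R - {g})) (basis_vec (insert g (R - {g})))"
      by (rule cr_basis_vec) (use that in auto)
    also have "insert g (R - {g}) = R" using that by blast
    finally have "scl (esign g (R - {g})) (avg n (cr g (basis_vec (R - {g})))) = avg n (basis_vec R)"
      by (simp add: avg_simps del: esign_diff_self)
    then show ?thesis using tot_ideal_scl[OF that(1)] by metis
  qed
  show ?thesis
  proof (cases "(\<not> c, i) \<in> S")
    case False
    show ?thesis by (rule red[OF avg_single ci fin]) (use S(1) False i in auto)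
  next
    case True
    then have "theta i \<in> S" "xi i \<in> S" using ci by (cases c; simp)+
    have "avg n (cr (theta i) (cr (xi i) (basis_vec (S - {theta i} - {xi i})))) \<in> tot_ideal n"
      by (rule avg_double[OF i]) (use S(1) in auto)
    moreover have "cr (xi i) (basis_vec (S - {theta i} - {xi i})) =
        scl (esign (xi i) (S - {theta i} - {xi i})) (basis_vec (insert (xi i) (S - {theta i} - {xi i})))"
      by (rule cr_basis_vec) (use fin in auto)
    moreover have "insert (xi i) (S - {theta i} - {xi i}) = S - {theta i}" using \<open>xi i \<in> S\<close> by auto
    ultimately have "scl (esign (xi i) (S - {theta i} - {xi i})) (avg n (cr (theta i) (basis_vec (S - {theta i})))) \<in> tot_ideal n"
      by (simp add: cr.op_simps avg_simps del: esign_diff_self)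
    then have "scl (esign (xi i) (S - {theta i} - {xi i})) (scl (esign (xi i) (S - {theta i} - {xi i})) (avg n (cr (theta i) (basis_vec (S - {theta i}))))) \<in> tot_ideal n"
      by (rule tot_ideal_scl)
    then have "avg n (cr (theta i) (basis_vec (S - {theta i}))) \<in> tot_ideal n" by (simp only: fsp.scale_scale esign_square fsp.scale_one)
    then show ?thesis by (rule red) fact+
  qed
qed

text \<open>The sum of an invariant over the group is a positive multiple of it. Without constant
  term the invariant is a combination of nonempty monomials, whose group sums lie in
  \<open>tot_ideal\<close>.\<close>

theorem coinvariant_ideal_subset_tot_ideal: "coinvariant_ideal n \<subseteq> tot_ideal n"
proof (rule coinvariant_ideal_minimal[OF ideal_tot_ideal], rule subsetI)
  fix f assume "f \<in> positive_invariants n"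
  then have f: "f \<in> supp_in (gens n)" "\<And>w. w permutes {1..n} \<Longrightarrow> ext_act n w f = f" "f {} = 0"
    by (auto simp: positive_invariants_def ext_alg_simps sym_group_def)
  have fin: "finite {w. w permutes {1..n}}" by (rule finite_permutations) simp
  have "avg n f = (\<Sum>w\<in>{w. w permutes {1..n}}. f)" unfolding avg_def by (rule sum.cong) (auto simp: f(2))
  also have "\<dots> = scl (of_nat (card {w. w permutes {1..n}})) f" by (rule ext) (simp add: sum_fun_apply pointwise)
  finally have a: "avg n f = scl (of_nat (card {w. w permutes {1..n}})) f" .
  have "avg n f = (\<Sum>S\<in>Pow (gens n). scl (f S) (avg n (basis_vec S)))"
    by (subst vec_expand[OF finite_gens f(1)]) (simp add: avg_simps)
  also have "\<dots> \<in> tot_ideal n"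
  proof (rule tot_ideal_sum)
    fix S assume "S \<in> Pow (gens n)"
    then show "scl (f S) (avg n (basis_vec S)) \<in> tot_ideal n"
      using f(3) avg_basis_vec[of S n] tot_in_tot_ideal(4)[OF supp_in_closed(1)]
      by (cases "S = {}") (auto intro: tot_ideal_scl)
  qed
  finally have "scl (1 / of_nat (card {w. w permutes {1..n}})) (avg n f) \<in> tot_ideal n" by (rule tot_ideal_scl)
  moreover have "id \<in> {w. w permutes {1..n}}" by (simp add: permutes_id)
  then have "card {w. w permutes {1..n}} \<noteq> 0" using fin by (metis card_eq_0_iff empty_iff)
  ultimately show "f \<in> tot_ideal n" unfolding a by (simp only: fsp.scale_scale) simp
qed

section \<open>Spanning modulo the ideal\<close>

interpretation fsp_fun: vector_space_pair scl "(*) :: complex \<Rightarrow> complex \<Rightarrow> complex"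
  by unfold_locales (simp_all add: algebra_simps)

text \<open>Adjoin \<open>x\<close> to a basis of the span and take the coordinate at
  \<open>x\<close>.\<close>

lemma separating_functional:
  assumes "x \<notin> fsp.span U"
  shows "\<exists>L. module_hom scl (*) L \<and> (\<forall>y\<in>fsp.span U. L y = 0) \<and> L x = 1"
proof -
  obtain B where B: "B \<subseteq> U" "fsp.independent B" "U \<subseteq> fsp.span B" using fsp.maximal_independent_subset[of U] by blast
  have sp: "fsp.span U \<subseteq> fsp.span B" using B(3) by (metis fsp.span_mono fsp.span_span)
  have x: "x \<notin> fsp.span B" using assms B(1) fsp.span_mono by blast
  then have ind: "fsp.independent (insert x B)" using B(2) by (simp add: fsp.independent_insert)
  obtain L where L: "Vector_Spaces.linear scl (*) L" "\<forall>y\<in>insert x B. L y = (if y = x then 1 else 0)"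
    using fsp_fun.linear_independent_extend[OF ind, of "\<lambda>y. if y = x then 1 else 0"] by blast
  have m: "module_hom scl (*) L" using L(1) by (simp add: Vector_Spaces.linear_def)
  have xB: "x \<notin> B" using x fsp.span_base by blast
  have "L y = 0" if "y \<in> fsp.span B" for y
    using that
  proof (rule fsp_fun.linear_eq_0_on_span[OF L(1), rotated])
    show "L y = 0" if "y \<in> B" for y using L(2) xB that by auto
  qed
  then show ?thesis using m sp L(2) by (intro exI[of _ L]) auto
qed

text \<open>The locale asks the functional to kill the images of the total operators on the whole
  type. Restricting to the alphabet first moves these images into the ideal and changes nothing
  inside the algebra.\<close>

definition rs :: "nat \<Rightarrow> vec \<Rightarrow> vec"
  where "rs n y = (\<lambda>U. if U \<subseteq> gens n then y U else 0)"

lemma rs_supp_in: "rs n y \<in> supp_in (gens n)"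
  by (simp add: rs_def supp_in_def)

lemma rs_id: "y \<in> supp_in (gens n) \<Longrightarrow> rs n y = y"
  by (auto simp: rs_def supp_in_def fun_eq_iff)

lemma lin_rs: "lin (rs n)"
proof (rule linI)
  show "rs n (x + y) = rs n x + rs n y" for x y by (rule ext) (simp add: rs_def pointwise)
  show "rs n (scl c x) = scl c (rs n x)" for c x by (rule ext) (simp add: rs_def pointwise)
qed

lemma rs_cr: "g \<in> gens n \<Longrightarrow> rs n (cr g y) = cr g (rs n y)"
proof (rule ext)
  fix U assume "g \<in> gens n"
  then have "g \<in> U \<Longrightarrow> U \<subseteq> gens n \<longleftrightarrow> U - {g} \<subseteq> gens n" by blast
  then show "rs n (cr g y) U = cr g (rs n y) U"
    by (simp add: rs_def cr_apply[of _ _ U])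
qed

lemma rs_tot: "rs n (ttot n y) = ttot n (rs n y)" "rs n (xtot n y) = xtot n (rs n y)" "rs n (dlt n y) = dlt n (rs n y)"
  unfolding ttot_def xtot_def dlt_def module_hom.sum[OF lin_rs]
  by (auto intro!: sum.cong simp: rs_cr)

lemma rs_fin_part: "rs n (fin_part y) = rs n y"
  by (auto simp: rs_def fin_part_def fun_eq_iff dest: finite_subset)

theorem spanning:
  assumes n: "1 \<le> n" "1 \<le> k" "k \<le> n" and x: "x \<in> ext_bihomogeneous n (n - k) (k - 1)"
  shows "\<exists>y\<in>NCspan n k. x - y \<in> coinvariant_ideal n"
proof -
  let ?U = "fp n ` NC_blocks n k \<union> coinvariant_ideal n"
  have "x \<in> fsp.span ?U"
  proof (rule ccontr)
    assume "x \<notin> fsp.span ?U"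
    then obtain L :: "vec \<Rightarrow> complex" where L: "module_hom scl (*) L" "\<And>y. y \<in> fsp.span ?U \<Longrightarrow> L y = 0" "L x = 1"
      using separating_functional[of x ?U] by blast
    have I: "L y = 0" if "y \<in> coinvariant_ideal n" for y using L(2) that fsp.span_base by blast
    have "killing_functional n k (\<lambda>y. L (rs n y))"
    proof (rule killing_functional.intro)
      show "module_hom scl (*) (\<lambda>y. L (rs n y))"
        using module_hom_compose[OF lin_rs L(1)] by (simp add: comp_def)
      show "L (rs n (fin_part y)) = L (rs n y)" for y by (simp only: rs_fin_part)
      show "L (rs n (ttot n y)) = 0" "L (rs n (xtot n y)) = 0" "L (rs n (dlt n y)) = 0" for y
        unfolding rs_tot by (intro I tot_in_ideal rs_supp_in)+
      fix \<pi> assume p: "partition_on {1..n} \<pi>" "card \<pi> = k"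
      have "fp n \<pi> \<in> NCspan n k" using p by (intro fp_in_NCspan)
      then have "fp n \<pi> \<in> fsp.span ?U" unfolding NCspan_def using fsp.span_mono by blast
      then show "L (rs n (fp n \<pi>)) = 0" unfolding rs_id[OF fp_supp_in] by (rule L(2))
    qed (rule n)+
    then have "L (rs n x) = 0" using x by (rule killing_functional.L_bihomogeneous)
    moreover have "rs n x = x" using x by (intro rs_id) (simp add: ext_bihomogeneous_eq)
    ultimately show False using L(3) by simp
  qed
  then obtain y z where yz: "x = y + z" "y \<in> NCspan n k" "z \<in> fsp.span (coinvariant_ideal n)"
    unfolding NCspan_def fsp.span_Un by blast
  have "fsp.subspace (coinvariant_ideal n)"
    by (rule fsp.subspaceI) (simp_all add: coinvariant_ideal_closed coinvariant_ideal_scl)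
  then have "z \<in> coinvariant_ideal n" using yz(3) by (metis fsp.span_eq_iff)
  then show ?thesis using yz(1,2) by (intro bexI[of _ y]) simp_all
qed

section \<open>Harmonic elements\<close>

text \<open>Bilinear and not sesquilinear: it serves for adjoints and orthogonality only.\<close>

definition pairing :: "nat \<Rightarrow> vec \<Rightarrow> vec \<Rightarrow> complex"
  where "pairing n H x = (\<Sum>U\<in>Pow (gens n). H U * x U)"

lemma lin_pairing: "module_hom scl (*) (pairing n H)" "module_hom scl (*) (\<lambda>H. pairing n H x)"
proof -
  have m: "Modules.module ((*) :: complex \<Rightarrow> complex \<Rightarrow> complex)"
    by (rule Modules.module.intro) (simp_all only: distrib_left distrib_right mult.assoc mult_1_left)
  have a: "pairing n H (x + y) = pairing n H x + pairing n H y" "pairing n (H + H') x = pairing n H x + pairing n H' x"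
    for H H' x y unfolding pairing_def plus_fun_apply distrib_left distrib_right sum.distrib by (rule refl)+
  have s: "pairing n H (scl c x) = c * pairing n H x" "pairing n (scl c H) x = c * pairing n H x" for H c x
    unfolding pairing_def scl_apply sum_distrib_left by (simp_all only: mult.assoc mult.left_commute[of _ c])
  show "module_hom scl (*) (pairing n H)" "module_hom scl (*) (\<lambda>H. pairing n H x)"
    unfolding module_hom_iff a s by (intro conjI allI fsp.module_axioms m refl)+
qed

lemmas pairing_simps = module_hom.add[OF lin_pairing(1)] module_hom.scale[OF lin_pairing(1)]
  module_hom.sum[OF lin_pairing(1)] module_hom.zero[OF lin_pairing(1)]
  module_hom.add[OF lin_pairing(2)] module_hom.scale[OF lin_pairing(2)]
  module_hom.sum[OF lin_pairing(2)] module_hom.zero[OF lin_pairing(2)]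

lemma pairing_basis_vec: "U \<subseteq> gens n \<Longrightarrow> pairing n H (basis_vec U) = H U"
  unfolding pairing_def basis_vec_def by (subst sum.remove[of _ U]) (auto intro!: sum.neutral)

text \<open>Monomials with \<open>g\<close> correspond to monomials without it, and both operators
  use the same sign \<open>esign\<close>.\<close>

lemma pairing_cr:
  assumes g: "g \<in> gens n" shows "pairing n H (cr g x) = pairing n (an g H) x"
proof -
  have fin: "finite U" if "U \<in> Pow (gens n)" for U using that finite_subset[OF _ finite_gens] by blast
  have "pairing n H (cr g x) = (\<Sum>U\<in>{U \<in> Pow (gens n). g \<in> U}. H U * (esign g U * x (U - {g})))"
    unfolding pairing_def by (rule sum.mono_neutral_cong_right) (auto simp: cr_apply fin)
  also have "\<dots> = (\<Sum>U\<in>{U \<in> Pow (gens n). g \<notin> U}. esign g U * H (insert g U) * x U)"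
    by (rule sum.reindex_bij_witness[where i = "\<lambda>U. insert g U" and j = "\<lambda>U. U - {g}"])
      (use g in \<open>auto simp: insert_absorb\<close>)
  also have "\<dots> = pairing n (an g H) x"
    unfolding pairing_def by (rule sum.mono_neutral_cong_left) (auto simp: an_def fin)
  finally show ?thesis .
qed

text \<open>The adjoint of \<open>dlt\<close>, hence the reversed order of the two factors.\<close>

definition dlta :: "nat \<Rightarrow> vec \<Rightarrow> vec"
  where "dlta n y = (\<Sum>j\<in>{1..n}. an (xi j) (an (theta j) y))"

lemma lin_dlta: "lin (dlta n)"
  unfolding dlta_def by (intro lin_sum_ops lin_compose[OF lin_an lin_an])

lemma pairing_tot:
  "pairing n H (ttot n x) = pairing n (dth n H) x" "pairing n H (xtot n x) = pairing n (dxi n H) x"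
  "pairing n H (dlt n x) = pairing n (dlta n H) x"
  unfolding ttot_def xtot_def dlt_def dth_def dxi_def dlta_def pairing_simps
  by (auto intro!: sum.cong simp: pairing_cr)

definition harmonic :: "nat \<Rightarrow> vec \<Rightarrow> bool"
  where "harmonic n H \<longleftrightarrow> dth n H = 0 \<and> dxi n H = 0 \<and> dlta n H = 0"

lemma harmonic_pairing:
  assumes "harmonic n H" "x \<in> coinvariant_ideal n" shows "pairing n H x = 0"
proof -
  have "x \<in> tot_ideal n" using assms(2) coinvariant_ideal_subset_tot_ideal by blast
  then show ?thesis using assms(1)
    by (elim tot_idealE) (simp add: harmonic_def pairing_simps pairing_tot)
qed

lemma harmonic_sum: "(\<And>a. a \<in> A \<Longrightarrow> harmonic n (F a)) \<Longrightarrow> harmonic n (\<Sum>a\<in>A. scl (d a) (F a))"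
  by (simp add: harmonic_def module_hom.sum[OF lin_dxi] module_hom.sum[OF lin_tot(3)] module_hom.sum[OF lin_dlta]
      module_hom.scale[OF lin_dxi] module_hom.scale[OF lin_tot(3)] module_hom.scale[OF lin_dlta])

lemma dlta_theta: "dlta n (an (theta i) y) = an (theta i) (dlta n y)"
proof -
  have "an (xi j) (an (theta j) (an (theta i) y)) = an (theta i) (an (xi j) (an (theta j) y))" for j
  proof -
    have "an (xi j) (an (theta j) (an (theta i) y)) = - an (xi j) (an (theta i) (an (theta j) y))"
      by (simp only: an_anti[of "theta j" "theta i"] an_simps)
    also have "\<dots> = an (theta i) (an (xi j) (an (theta j) y))" by (subst an_anti) simp
    finally show ?thesis .
  qed
  then show ?thesis by (simp add: dlta_def an_simps)
qed

lemma dlta_xi: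
  assumes "i \<in> {1..n}" shows "dlta n (cr (xi i) y) = cr (xi i) (dlta n y) - an (theta i) y"
proof -
  have a: "an (theta j) (cr (xi i) y) = - cr (xi i) (an (theta j) y)" for j by (rule an_cr_neq) simp
  have "dlta n (cr (xi i) y) = - an (theta i) y - (\<Sum>j\<in>{1..n}. - cr (xi i) (an (xi j) (an (theta j) y)))"
    unfolding dlta_def
  proof (rule sum_single_term[OF assms])
    show "an (xi i) (an (theta i) (cr (xi i) y)) = - an (theta i) y - (- cr (xi i) (an (xi i) (an (theta i) y)))"
      unfolding a an_simps an_cr_eq by simp
    fix j assume "j \<noteq> i"
    then have "an (xi j) (cr (xi i) (an (theta j) y)) = - cr (xi i) (an (xi j) (an (theta j) y))"
      by (intro an_cr_neq) simp
    then show "an (xi j) (an (theta j) (cr (xi i) y)) = - (- cr (xi i) (an (xi j) (an (theta j) y)))"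
      unfolding a an_simps by simp
  qed
  then show ?thesis by (simp add: dlta_def cr.op_simps sum_negf)
qed

lemma dlta_op1:
  assumes "1 \<le> i" "i \<le> n"
  shows "dlta n (op1 n (True, i) y) = op1 n (True, i) (dlta n y) - op1 n (False, i) y"
    "dlta n (op1 n (False, i) y) = op1 n (False, i) (dlta n y)"
proof -
  have i: "i \<noteq> 0" "i \<in> {1..n}" "n \<in> {1..n}" using assms by auto
  show "dlta n (op1 n (True, i) y) = op1 n (True, i) (dlta n y) - op1 n (False, i) y"
    using i by (simp add: op1_def module_hom.diff[OF lin_dlta] dlta_xi)
  show "dlta n (op1 n (False, i) y) = op1 n (False, i) (dlta n y)"
    using i by (simp add: op1_def module_hom.diff[OF lin_dlta] dlta_theta)
qed

text \<open>The two extra terms cancel by anticommutation, as they do for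
  \<open>dlt\<close>.\<close>

lemma dlta_br:
  assumes "i \<in> {1..n}" "j \<in> {1..n}" shows "dlta n (act1 n (br i j) y) = act1 n (br i j) (dlta n y)"
proof -
  have ij: "1 \<le> i" "i \<le> n" "1 \<le> j" "j \<le> n" using assms by auto
  have FF: "op1 n (False, i) (op1 n (False, j) y) = - op1 n (False, j) (op1 n (False, i) y)" by (rule op1_anti)
  show ?thesis using ij
    by (simp add: o1.act_br o1.brop_def module_hom.add[OF lin_dlta] dlta_op1 FF)
qed

lemma vbase_adjoint_facts: "dxi n (vbase n) = 0" "dlta n (vbase n) = 0"
proof -
  have "an (xi j) (an (theta j) (Theta n)) = 0" for j
    unfolding an_anti[of "xi j" "theta j"] an_xi_Theta an_simps by simp
  then have "dlta n (Theta n) = 0" unfolding dlta_def by (intro sum.neutral ballI)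
  then show "dlta n (vbase n) = 0"
    by (simp add: vbase_def dth_def module_hom.sum[OF lin_dlta] dlta_theta an_simps)
  show "dxi n (vbase n) = 0"
    by (simp add: vbase_def dth_def module_hom.sum[OF lin_dxi] dxi_theta Theta_facts an_simps)
qed

text \<open>Only the ends of a block enter. A one-point block gives \<open>br a a\<close>, which is
  twice \<open>pp a\<close>, so it contributes a factor of the same degree as the others.\<close>

definition arcs :: "nat set set \<Rightarrow> ev"
  where "arcs \<B> = (\<Prod>B\<in>\<B>. br (Min B) (Max B))"

definition Hs :: "nat \<Rightarrow> nat set set \<Rightarrow> vec"
  where "Hs n \<B> = act1 n (arcs \<B>) (vbase n)"

text \<open>A partition is represented by the set of its blocks that do not contain \<open>n\<close>.\<close>

definition block_set :: "nat \<Rightarrow> nat set set \<Rightarrow> bool"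
  where "block_set n \<B> \<longleftrightarrow> finite \<B> \<and> (\<forall>B\<in>\<B>. B \<noteq> {} \<and> B \<subseteq> {1..<n}) \<and> (\<forall>B\<in>\<B>. \<forall>C\<in>\<B>. B \<noteq> C \<longrightarrow> B \<inter> C = {})"

lemma block_setD:
  assumes "block_set n \<B>" "B \<in> \<B>"
  shows "finite B" "Min B \<in> B" "Max B \<in> B" "Min B \<le> Max B" "Min B \<in> {1..<n}" "Max B \<in> {1..<n}"
    "Min B \<in> {1..n}" "Max B \<in> {1..n}"
proof -
  have B: "B \<noteq> {}" "B \<subseteq> {1..<n}" using assms by (auto simp: block_set_def)
  show fin: "finite B" by (rule finite_subset[OF B(2)]) simp
  show m: "Min B \<in> B" "Max B \<in> B" using fin B(1) by simp_all
  show "Min B \<le> Max B" using Min_le[OF fin m(2)] .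
  show b: "Min B \<in> {1..<n}" "Max B \<in> {1..<n}" using B(2) m by blast+
  then show "Min B \<in> {1..n}" "Max B \<in> {1..n}" by auto
qed

lemma block_set_insert: "block_set n (insert B \<B>) \<Longrightarrow> block_set n \<B>"
  by (simp add: block_set_def)

lemma good_arcs: "block_set n \<B> \<Longrightarrow> good n (arcs \<B>)"
  unfolding arcs_def by (intro good_prod good_br block_setD(7,8))

lemma dlta_arcs:
  assumes "block_set n \<B>" shows "dlta n (act1 n (arcs \<B>) y) = act1 n (arcs \<B>) (dlta n y)"
proof -
  have "finite \<B>" using assms by (simp add: block_set_def)
  then show ?thesis using assms
  proof (induction \<B> rule: finite_induct)
    case (insert B \<B>)
    have "arcs (insert B \<B>) = br (Min B) (Max B) * arcs \<B>" using insert.hyps by (simp add: arcs_def)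
    then show ?case
      using insert.IH[OF block_set_insert[OF insert.prems]] block_setD(7,8)[OF insert.prems, of B]
      by (simp add: o1.act_mult dlta_br)
  qed (simp add: arcs_def o1.act_one)
qed

lemma harmonic_Hs:
  assumes n: "1 \<le> n" and B: "block_set n \<B>" shows "harmonic n (Hs n \<B>)"
proof -
  have c: "commutes n (dth n) (arcs \<B>)" "commutes n (dxi n) (arcs \<B>)"
    using good_arcs[OF B] lin_tot(3) lin_dxi antic_tot(2,4)[OF n] unfolding good_def by blast+
  show ?thesis using c
    by (simp add: harmonic_def Hs_def commutes_def dlta_arcs[OF B] vbase_facts vbase_adjoint_facts
        module_hom.zero[OF o1.lin_act])
qed

text \<open>Multiplication by the sum of the thetas commutes with the arcs and replaces
  \<open>vbase n\<close>, a sum over \<open>n\<close> contractions, by a multiple of the single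
  monomial \<open>Theta n\<close>. This makes the leading monomial accessible.\<close>

lemma ttot_Hs:
  assumes n: "1 \<le> n" and B: "block_set n \<B>"
  shows "ttot n (Hs n \<B>) = scl (of_nat n) (act1 n (arcs \<B>) (Theta n))"
proof -
  have "commutes n (ttot n) (arcs \<B>)"
    using good_arcs[OF B] lin_tot(2) antic_tot(3)[OF n] unfolding good_def by blast
  then show ?thesis by (simp add: Hs_def commutes_def vbase_facts module_hom.scale[OF o1.lin_act])
qed

lemma supp_bideg_closed:
  assumes "x \<in> supp_in G \<and> bideg a b x" "y \<in> supp_in G \<and> bideg a b y"
  shows "x + y \<in> supp_in G \<and> bideg a b (x + y)" "x - y \<in> supp_in G \<and> bideg a b (x - y)"
proof -
  show "x + y \<in> supp_in G \<and> bideg a b (x + y)" using assms by (simp add: bideg_closed)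
  have "x + - y \<in> supp_in G \<and> bideg a b (x + - y)" using assms by (simp only: bideg_closed supp_in_closed simp_thms)
  then show "x - y \<in> supp_in G \<and> bideg a b (x - y)" by simp
qed

lemma bideg_op1:
  assumes "1 \<le> i" "i \<le> n"
  shows "y \<in> supp_in (gens n) \<and> bideg a b y \<Longrightarrow>
      op1 n (True, i) y \<in> supp_in (gens n) \<and> bideg a (Suc b) (op1 n (True, i) y)"
    "y \<in> supp_in (gens n) \<and> bideg (Suc a) b y \<Longrightarrow>
      op1 n (False, i) y \<in> supp_in (gens n) \<and> bideg a b (op1 n (False, i) y)"
proof -
  have e: "op1 n (True, i) y = cr (xi i) y - cr (xi n) y" "op1 n (False, i) y = an (theta i) y - an (theta n) y"
    using assms(1) by (simp_all add: op1_def)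
  show "op1 n (True, i) y \<in> supp_in (gens n) \<and> bideg a (Suc b) (op1 n (True, i) y)"
    if "y \<in> supp_in (gens n) \<and> bideg a b y"
    unfolding e by (rule supp_bideg_closed(2); use that assms in \<open>auto intro: cr_supp_in bideg_cr_xi\<close>)
  show "op1 n (False, i) y \<in> supp_in (gens n) \<and> bideg a b (op1 n (False, i) y)"
    if "y \<in> supp_in (gens n) \<and> bideg (Suc a) b y"
    unfolding e by (rule supp_bideg_closed(2); use that assms in \<open>auto intro: an_supp_in bideg_an_theta\<close>)
qed

lemma Hs_bihomogeneous:
  assumes n: "1 \<le> n" and B: "block_set n \<B>" "card \<B> \<le> n - 1"
  shows "Hs n \<B> \<in> ext_bihomogeneous n (n - 1 - card \<B>) (card \<B>)"
proof -
  have "finite \<B>" using B(1) by (simp add: block_set_def)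
  then have "Hs n \<B> \<in> supp_in (gens n) \<and> bideg (n - 1 - card \<B>) (card \<B>) (Hs n \<B>)" using B
  proof (induction \<B> rule: finite_induct)
    case empty
    have "theta ` {1..n} \<inter> range theta = theta ` {1..n}" "theta ` {1..n} \<inter> range xi = {}" by auto
    then have "bideg (Suc (n - 1)) 0 (Theta n)"
      using n by (simp add: Theta_def bideg_basis_vec card_image inj_on_def)
    then have "bideg (n - 1) 0 (vbase n)" unfolding vbase_def dth_def by (intro bideg_sum bideg_an_theta)
    moreover have "vbase n \<in> supp_in (gens n)"
      unfolding vbase_def dth_def by (intro supp_in_sum an_supp_in Theta_supp_in) auto
    ultimately show ?case by (simp add: Hs_def arcs_def o1.act_one)
  next
    case (insert B \<B>)
    have c: "n - 1 - card \<B> = Suc (n - 1 - card (insert B \<B>))" using insert.hyps insert.prems by simp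
    have y: "Hs n \<B> \<in> supp_in (gens n) \<and> bideg (Suc (n - 1 - card (insert B \<B>))) (card \<B>) (Hs n \<B>)"
      using insert.IH[OF block_set_insert[OF insert.prems(1)]] insert.prems(2) insert.hyps unfolding c by simp
    have m: "1 \<le> Min B" "Min B \<le> n" "1 \<le> Max B" "Max B \<le> n"
      using block_setD(7,8)[OF insert.prems(1), of B] by auto
    have e: "Hs n (insert B \<B>) = op1 n (True, Min B) (op1 n (False, Max B) (Hs n \<B>)) + op1 n (True, Max B) (op1 n (False, Min B) (Hs n \<B>))"
      using insert.hyps m by (simp add: Hs_def arcs_def o1.act_mult o1.act_br o1.brop_def)
    have "Hs n (insert B \<B>) \<in> supp_in (gens n) \<and>
        bideg (n - 1 - card (insert B \<B>)) (Suc (card \<B>)) (Hs n (insert B \<B>))"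
      unfolding e by (intro supp_bideg_closed(1) bideg_op1 m y)
    then show ?case using insert.hyps by simp
  qed
  then show ?thesis by (simp add: ext_bihomogeneous_eq)
qed

section \<open>Leading monomials\<close>

text \<open>The part with \<open>theta n\<close> and without \<open>xi n\<close>. Creation of
  \<open>xi n\<close> and contraction with \<open>theta n\<close> never contribute to it, so on it
  the difference letters of smaller index act as the original letters.\<close>

definition pj :: "nat \<Rightarrow> vec \<Rightarrow> vec"
  where "pj n y = (\<lambda>U. if xi n \<notin> U \<and> theta n \<in> U then y U else 0)"

lemma lin_pj: "lin (pj n)"
proof (rule linI)
  show "pj n (x + y) = pj n x + pj n y" for x y by (rule ext) (simp add: pj_def pointwise)
  show "pj n (scl c x) = scl c (pj n x)" for c x by (rule ext) (simp add: pj_def pointwise)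
qed

lemma pj_op1:
  assumes "1 \<le> i" "i < n" shows "pj n (op1 n (c, i) y) = op0 (c, i) (pj n y)"
proof (rule ext)
  fix U
  have i: "i \<noteq> n" "i \<noteq> 0" using assms by auto
  show "pj n (op1 n (c, i) y) U = op0 (c, i) (pj n y) U"
  proof (cases c)
    case True
    have a: "cr (xi n) y U = 0" if "xi n \<notin> U" using that by (simp add: cr_apply[of _ _ U])
    show ?thesis using True i a by (auto simp: pj_def op1_def cr_apply[of _ _ U] pointwise)
  next
    case False
    have a: "an (theta n) y U = 0" if "theta n \<in> U" using that by (simp add: an_def)
    show ?thesis using False i a by (auto simp: pj_def op1_def an_def pointwise)
  qed
qed

lemma pj_Theta: "1 \<le> n \<Longrightarrow> pj n (Theta n) = Theta n"
  by (rule ext) (auto simp: pj_def Theta_def basis_vec_def)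

definition Gs :: "nat \<Rightarrow> nat set set \<Rightarrow> vec"
  where "Gs n \<B> = act0 n (arcs \<B>) (Theta n)"

lemma pj_arcs:
  assumes n: "1 \<le> n" and B: "block_set n \<B>"
  shows "pj n (act1 n (arcs \<B>) (Theta n)) = Gs n \<B>"
proof -
  have "finite \<B>" using B by (simp add: block_set_def)
  then show ?thesis using B
  proof (induction \<B> rule: finite_induct)
    case empty
    then show ?case using n by (simp add: Gs_def arcs_def o1.act_one o0.act_one pj_Theta)
  next
    case (insert B \<B>)
    have m: "1 \<le> Min B" "Min B < n" "1 \<le> Max B" "Max B < n"
      using block_setD(5,6)[OF insert.prems, of B] by auto
    have e: "arcs (insert B \<B>) = br (Min B) (Max B) * arcs \<B>" using insert.hyps by (simp add: arcs_def)
    show ?case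
      using m insert.IH[OF block_set_insert[OF insert.prems]]
      by (simp add: Gs_def e o1.act_mult o0.act_mult o1.act_br o0.act_br o1.brop_def o0.brop_def
          module_hom.add[OF lin_pj] pj_op1 del: op0_simps)
  qed
qed

text \<open>Monomials are compared by the sum of their xi indices; leading means of least
  weight.\<close>

definition wx :: "gen set \<Rightarrow> nat"
  where "wx U = \<Sum>{i. xi i \<in> U}"

lemma wx_exchange:
  assumes "finite U" "xi p \<in> U" shows "wx U = p + wx (insert (theta q) (U - {xi p}))"
proof -
  let ?A = "{i. xi i \<in> insert (theta q) (U - {xi p})}"
  have "{i. xi i \<in> U} = insert p ?A" using assms(2) by auto
  moreover have "finite ?A"
  proof -
    have "?A \<subseteq> snd ` U" by force
    then show ?thesis using assms(1) finite_subset by blast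
  qed
  moreover have "p \<notin> ?A" by simp
  ultimately show ?thesis by (simp add: wx_def)
qed

definition lead :: "nat \<Rightarrow> nat set set \<Rightarrow> gen set"
  where "lead n \<B> = xi ` Min ` \<B> \<union> theta ` ({1..n} - Max ` \<B>)"

text \<open>In \<open>x_a d_b + x_b d_a\<close> with \<open>a < b\<close> the first term adds the
  smaller index. Taking it for every block gives the only monomial of least weight; for
  \<open>a = b\<close> the two terms coincide and add up.\<close>

lemma Gs_lead:
  assumes B: "block_set n \<B>"
  shows "Gs n \<B> (lead n \<B>) \<noteq> 0 \<and> (\<forall>U. Gs n \<B> U \<noteq> 0 \<longrightarrow> U = lead n \<B> \<or> wx (lead n \<B>) < wx U)"
proof -
  have "finite \<B>" using B by (simp add: block_set_def)
  then show ?thesis using B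
  proof (induction \<B> rule: finite_induct)
    case empty
    show ?case by (simp add: Gs_def arcs_def o0.act_one lead_def Theta_def basis_vec_def)
  next
    case (insert B \<B>)
    let ?a = "Min B" and ?b = "Max B" and ?S = "lead n \<B>" and ?S' = "lead n (insert B \<B>)" and ?y = "Gs n \<B>"
    note d = block_setD[OF insert.prems]
    have m: "1 \<le> ?a" "?a \<le> n" "1 \<le> ?b" "?b \<le> n" "?a \<le> ?b" using d(4,7,8)[of B] by auto
    have IH: "?y ?S \<noteq> 0" "\<And>U. ?y U \<noteq> 0 \<Longrightarrow> U = ?S \<or> wx ?S < wx U"
      using insert.IH[OF block_set_insert[OF insert.prems]] by blast+
    have dis: "B \<inter> D = {}" if "D \<in> \<B>" for D
    proof -
      have "\<forall>D\<in>insert B \<B>. \<forall>C\<in>insert B \<B>. D \<noteq> C \<longrightarrow> D \<inter> C = {}"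
        using insert.prems unfolding block_set_def by (elim conjE)
      moreover have "B \<noteq> D" using that insert.hyps(2) by auto
      ultimately show ?thesis using that by simp
    qed
    have a: "?a \<notin> Min ` \<B>"
    proof
      assume "?a \<in> Min ` \<B>"
      then obtain D where "D \<in> \<B>" "?a = Min D" by blast
      then show False using dis[of D] d(2)[of B] d(2)[of D] by auto
    qed
    have b: "?b \<notin> Max ` \<B>"
    proof
      assume "?b \<in> Max ` \<B>"
      then obtain D where "D \<in> \<B>" "?b = Max D" by blast
      then show False using dis[of D] d(3)[of B] d(3)[of D] by auto
    qed
    have S: "xi ?a \<notin> ?S" "theta ?b \<in> ?S" "finite ?S" "finite ?S'"
      using a b m insert.hyps(1) by (auto simp: lead_def)
    have S': "?S' = insert (xi ?a) (?S - {theta ?b})" by (auto simp: lead_def)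
    have S'': "insert (theta ?b) (?S' - {xi ?a}) = ?S" unfolding S' using S(1,2) by auto
    have wS: "wx ?S' = ?a + wx ?S" using wx_exchange[OF S(4), of ?a ?b] unfolding S'' by (simp add: S')
    define t where "t p q = cr (xi p) (an (theta q) ?y)" for p q
    have y': "Gs n (insert B \<B>) U = t ?a ?b U + t ?b ?a U" for U
      using insert.hyps m by (simp add: Gs_def arcs_def o0.act_mult o0.act_br o0.brop_def t_def pointwise)
    have t: "finite U" "xi p \<in> U" "theta q \<notin> U" "?y (insert (theta q) (U - {xi p})) \<noteq> 0" if "t p q U \<noteq> 0" for p q U
      using that by (auto simp: t_def cr_apply[of _ _ U] an_def split: if_splits)
    have tab: "U = ?S' \<or> wx ?S' < wx U" if nz: "t ?a ?b U \<noteq> 0" for U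
    proof -
      note tU = t[OF nz]
      from IH(2)[OF tU(4)] show ?thesis
      proof
        assume e: "insert (theta ?b) (U - {xi ?a}) = ?S"
        have "U = insert (xi ?a) (insert (theta ?b) (U - {xi ?a}) - {theta ?b})" using tU(2,3) by blast
        then show ?thesis unfolding e S'[symmetric] by (rule disjI1)
      next
        assume "wx ?S < wx (insert (theta ?b) (U - {xi ?a}))"
        then show ?thesis using wx_exchange[OF tU(1,2), of ?b] wS by linarith
      qed
    qed
    have tba: "wx ?S' < wx U" if nz: "t ?b ?a U \<noteq> 0" and ab: "?a \<noteq> ?b" for U
    proof -
      note tU = t[OF nz]
      have "wx ?S \<le> wx (insert (theta ?a) (U - {xi ?b}))" using IH(2)[OF tU(4)] by (elim disjE) (simp_all only: order_refl less_imp_le)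
      moreover have "?a < ?b" using m(5) ab by (rule le_neq_trans)
      ultimately show ?thesis using wx_exchange[OF tU(1,2), of ?a] wS by linarith
    qed
    have tS: "t ?a ?b ?S' \<noteq> 0"
    proof -
      have "xi ?a \<in> ?S'" "theta ?b \<notin> ?S' - {xi ?a}" by (auto simp: S')
      then show ?thesis using S(4) IH(1) S'' by (simp add: t_def cr_apply[of _ _ ?S'] an_def)
    qed
    show ?case
    proof (cases "?a = ?b")
      case True
      show ?thesis unfolding y' using True tS tab by auto
    next
      case False
      have "t ?b ?a ?S' = 0" using tba[OF _ False] by blast
      then have "Gs n (insert B \<B>) ?S' \<noteq> 0" unfolding y' using tS by simp
      moreover have "U = ?S' \<or> wx ?S' < wx U" if "Gs n (insert B \<B>) U \<noteq> 0" for U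
      proof (cases "t ?a ?b U = 0")
        case True
        then have "t ?b ?a U \<noteq> 0" using that unfolding y' by simp
        then show ?thesis using tba[OF _ False] by blast
      qed (rule tab)
      ultimately show ?thesis by blast
    qed
  qed
qed

lemma lead_eqD:
  assumes "block_set n \<B>" "block_set n \<C>" "lead n \<B> = lead n \<C>"
  shows "Min ` \<B> = Min ` \<C>" "Max ` \<B> = Max ` \<C>"
proof -
  have x: "{i. xi i \<in> lead n \<D>} = Min ` \<D>" for \<D> by (auto simp: lead_def)
  have t: "{1..n} - {i. theta i \<in> lead n \<D>} = Max ` \<D>" if "block_set n \<D>" for \<D>
    using block_setD(8)[OF that] by (auto simp: lead_def)
  show "Min ` \<B> = Min ` \<C>" using x[of \<B>] x[of \<C>] assms(3) by simp
  show "Max ` \<B> = Max ` \<C>" using t[OF assms(1)] t[OF assms(2)] assms(3) by simp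
qed

section \<open>Noncrossing partitions and their arcs\<close>

definition inner :: "nat \<Rightarrow> nat set set \<Rightarrow> nat set set"
  where "inner n \<sigma> = {B \<in> \<sigma>. n \<notin> B}"

definition ends :: "nat \<Rightarrow> nat set set \<Rightarrow> (nat \<times> nat) set"
  where "ends n \<sigma> = (\<lambda>B. (Min B, Max B)) ` inner n \<sigma>"

lemma NC_disjoint: "\<sigma> \<in> NC n \<Longrightarrow> B \<in> \<sigma> \<Longrightarrow> C \<in> \<sigma> \<Longrightarrow> x \<in> B \<Longrightarrow> x \<in> C \<Longrightarrow> B = C"
  using NC_D(1)[of \<sigma> n] unfolding partition_on_def disjoint_def by blast

lemma NC_cover: "\<sigma> \<in> NC n \<Longrightarrow> x \<in> {1..n} \<Longrightarrow> \<exists>B\<in>\<sigma>. x \<in> B"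
  using NC_D(1)[of \<sigma> n] unfolding partition_on_def by blast

lemma NC_Min_Max:
  assumes "\<sigma> \<in> NC n" "B \<in> \<sigma>"
  shows "Min B \<in> B" "Max B \<in> B" "\<And>x. x \<in> B \<Longrightarrow> Min B \<le> x" "\<And>x. x \<in> B \<Longrightarrow> x \<le> Max B"
  using NC_D(4,6)[OF assms(1,2)] by simp_all

text \<open>Otherwise \<open>i\<close> and an end of \<open>C\<close> would alternate with the two
  ends of \<open>B\<close>.\<close>

lemma NC_nested:
  assumes \<sigma>: "\<sigma> \<in> NC n" and B: "B \<in> \<sigma>" and C: "C \<in> \<sigma>" and BC: "B \<noteq> C"
    and i: "i \<in> C" "Min B \<le> i" "i \<le> Max B"
  shows "Min B < Min C" "Max C < Max B"
proof -
  note mB = NC_Min_Max[OF \<sigma> B] and mC = NC_Min_Max[OF \<sigma> C]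
  have ne: "x \<noteq> y" if "x \<in> B" "y \<in> C" for x y using NC_disjoint[OF \<sigma> B C] that BC by auto
  have nc: "\<not> (a < b \<and> b < c \<and> c < d)" if "D \<in> \<sigma>" "E \<in> \<sigma>" "D \<noteq> E" "a \<in> D" "c \<in> D" "b \<in> E" "d \<in> E" for D E a b c d
    using NC_D(2)[OF \<sigma>] that unfolding noncrossing_def by meson
  have i': "Min B < i" "i < Max B" using i ne[OF mB(1) i(1)] ne[OF mB(2) i(1)] by simp_all
  show "Min B < Min C"
    using nc[OF C B BC[symmetric] mC(1) i(1) mB(1) mB(2)] i' ne[OF mB(1) mC(1)] by linarith
  show "Max C < Max B"
    using nc[OF B C BC mB(1) mB(2) i(1) mC(2)] i' ne[OF mB(2) mC(2)] by linarith
qed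

lemma ends_iff: "(a, z) \<in> ends n \<sigma> \<longleftrightarrow> (\<exists>B\<in>\<sigma>. n \<notin> B \<and> a = Min B \<and> z = Max B)"
  by (auto simp: ends_def inner_def)

text \<open>A parenthesis matching argument, the step of an induction on the right end
  \<open>z\<close>. If the block of \<sigma> ending at \<open>z\<close> started before
  \<open>a'\<close>, the block of \<sigma> starting at \<open>a'\<close> would be nested in it and
  end before \<open>z\<close>. By induction \<tau> would have a block with the same ends, but its
  block starting at \<open>a'\<close> ends at \<open>z\<close>.\<close>

lemma ends_aux:
  assumes \<sigma>: "\<sigma> \<in> NC n" and \<tau>: "\<tau> \<in> NC n" and Min: "Min ` inner n \<tau> \<subseteq> Min ` inner n \<sigma>"
    and IH: "\<And>y c. y < z \<Longrightarrow> (c, y) \<in> ends n \<sigma> \<Longrightarrow> (c, y) \<in> ends n \<tau>"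
    and az: "(a, z) \<in> ends n \<sigma>" and az': "(a', z) \<in> ends n \<tau>"
  shows "\<not> a < a'"
proof
  assume less: "a < a'"
  obtain B where B: "B \<in> \<sigma>" "a = Min B" "z = Max B" using az unfolding ends_iff by blast
  obtain B' where B': "B' \<in> \<tau>" "n \<notin> B'" "a' = Min B'" "z = Max B'" using az' unfolding ends_iff by blast
  have "a' \<in> Min ` inner n \<tau>" using B' by (auto simp: inner_def)
  then obtain C where C: "C \<in> \<sigma>" "n \<notin> C" "a' = Min C" using Min by (auto simp: inner_def)
  have m: "Min B \<le> Min C" "Min C \<le> Max B"
    using less B C(3) B'(3,4) NC_Min_Max(3)[OF \<tau> B'(1) NC_Min_Max(2)[OF \<tau> B'(1)]] by simp_all
  have "B \<noteq> C" using less B(2) C(3) by auto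
  then have lt: "Max C < z" using NC_nested(2)[OF \<sigma> B(1) C(1) _ NC_Min_Max(1)[OF \<sigma> C(1)] m] B(3) by simp
  have "(a', Max C) \<in> ends n \<sigma>" using C by (auto simp: ends_iff)
  from IH[OF lt this] obtain D where D: "D \<in> \<tau>" "a' = Min D" "Max C = Max D" unfolding ends_iff by blast
  have "a' \<in> D" unfolding D(2) by (rule NC_Min_Max(1)[OF \<tau> D(1)])
  moreover have "a' \<in> B'" unfolding B'(3) by (rule NC_Min_Max(1)[OF \<tau> B'(1)])
  ultimately have "D = B'" by (rule NC_disjoint[OF \<tau> D(1) B'(1)])
  then show False using lt D(3) B'(4) by simp
qed

lemma ends_eq:
  assumes \<sigma>: "\<sigma> \<in> NC n" and \<tau>: "\<tau> \<in> NC n" and Min: "Min ` inner n \<sigma> = Min ` inner n \<tau>"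
    and Max: "Max ` inner n \<sigma> = Max ` inner n \<tau>"
  shows "ends n \<sigma> = ends n \<tau>"
proof -
  have snds: "\<exists>a. (a, z) \<in> ends n \<rho>" if "z \<in> Max ` inner n \<rho>" for z \<rho> using that by (auto simp: ends_def)
  have Maxs: "z \<in> Max ` inner n \<rho>" if "(a, z) \<in> ends n \<rho>" for a z \<rho> using that by (auto simp: ends_def)
  have "\<forall>a. (a, z) \<in> ends n \<sigma> \<longleftrightarrow> (a, z) \<in> ends n \<tau>" for z
  proof (induction z rule: less_induct)
    case (less z)
    have eq: "a = a'" if "(a, z) \<in> ends n \<sigma>" "(a', z) \<in> ends n \<tau>" for a a'
    proof (rule antisym)
      show "a' \<le> a" using ends_aux[OF \<sigma> \<tau> _ _ that] Min less by (metis order_refl not_le)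
      show "a \<le> a'" using ends_aux[OF \<tau> \<sigma> _ _ that(2,1)] Min less by (metis order_refl not_le)
    qed
    show ?case
    proof (intro allI iffI)
      fix a assume a: "(a, z) \<in> ends n \<sigma>"
      then obtain a' where a': "(a', z) \<in> ends n \<tau>" using snds[of z \<tau>] Maxs[OF a] Max by auto
      then show "(a, z) \<in> ends n \<tau>" using eq[OF a a'] by simp
    next
      fix a assume a: "(a, z) \<in> ends n \<tau>"
      then obtain a' where a': "(a', z) \<in> ends n \<sigma>" using snds[of z \<sigma>] Maxs[OF a] Max by auto
      then show "(a, z) \<in> ends n \<sigma>" using eq[OF a' a] by simp
    qed
  qed
  then show ?thesis by auto
qed

text \<open>A point of \<open>B\<close> outside \<open>B'\<close> would lie in a block of \<tau>
  nested strictly inside \<open>B'\<close>, hence without \<open>n\<close>. Some block of \<sigma>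
  has the same ends, and \<open>B\<close> would be nested in that block although its own ends are
  those of \<open>B'\<close>.\<close>

lemma ends_block_subset:
  assumes \<sigma>: "\<sigma> \<in> NC n" and \<tau>: "\<tau> \<in> NC n" and e: "ends n \<tau> \<subseteq> ends n \<sigma>"
    and B: "B \<in> \<sigma>" and B': "B' \<in> \<tau>" and m: "Min B = Min B'" "Max B = Max B'"
  shows "B \<subseteq> B'"
proof
  fix i assume i: "i \<in> B"
  then have "i \<in> {1..n}" using NC_D(5)[OF \<sigma> B] by blast
  then obtain C' where C': "C' \<in> \<tau>" "i \<in> C'" using NC_cover[OF \<tau>] by blast
  show "i \<in> B'"
  proof (cases "C' = B'")
    case False
    have b: "Min B' \<le> i" "i \<le> Max B'" using NC_Min_Max(3,4)[OF \<sigma> B i] m by simp_all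
    have ne: "B' \<noteq> C'" using False by simp
    note nest = NC_nested[OF \<tau> B' C'(1) ne C'(2) b]
    have "n \<notin> C'"
    proof
      assume "n \<in> C'"
      then have "n \<le> Max C'" by (rule NC_Min_Max(4)[OF \<tau> C'(1)])
      moreover have "Max B' \<le> n" using NC_Min_Max(2)[OF \<tau> B'] NC_D(5)[OF \<tau> B'] by auto
      ultimately show False using nest(2) by linarith
    qed
    then have "(Min C', Max C') \<in> ends n \<tau>" using C'(1) by (auto simp: ends_iff)
    then have "(Min C', Max C') \<in> ends n \<sigma>" using e by blast
    then obtain C where C: "C \<in> \<sigma>" "Min C' = Min C" "Max C' = Max C" by (auto simp: ends_iff)
    have CB: "C \<noteq> B" using nest(1) C(2) m(1) by auto
    have "Min C \<le> i" "i \<le> Max C" using NC_Min_Max(3,4)[OF \<tau> C'(1,2)] C(2,3) by simp_all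
    from NC_nested(1)[OF \<sigma> C(1) B CB i this] show ?thesis using nest(1) C(2) m(1) by simp
  qed (use C'(2) in simp)
qed

text \<open>The ends determine the blocks without \<open>n\<close>, and the block of
  \<open>n\<close> is the complement of their union.\<close>

lemma NC_eqI:
  assumes n: "1 \<le> n" and \<sigma>: "\<sigma> \<in> NC n" and \<tau>: "\<tau> \<in> NC n"
    and e: "ends n \<sigma> = ends n \<tau>"
  shows "\<sigma> = \<tau>"
proof -
  have sub: "inner n \<sigma> \<subseteq> inner n \<tau>" if \<sigma>: "\<sigma> \<in> NC n" and \<tau>: "\<tau> \<in> NC n" and e: "ends n \<sigma> = ends n \<tau>" for \<sigma> \<tau>
  proof
    fix B assume "B \<in> inner n \<sigma>"
    then have B: "B \<in> \<sigma>" "n \<notin> B" by (auto simp: inner_def)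
    then have "(Min B, Max B) \<in> ends n \<sigma>" by (auto simp: ends_iff)
    then have "(Min B, Max B) \<in> ends n \<tau>" by (simp only: e)
    then obtain B' where B': "B' \<in> \<tau>" "n \<notin> B'" "Min B = Min B'" "Max B = Max B'" by (auto simp: ends_iff)
    have "B \<subseteq> B'" by (rule ends_block_subset[OF \<sigma> \<tau> _ B(1) B'(1,3,4)]) (simp add: e)
    moreover have "B' \<subseteq> B"
      by (rule ends_block_subset[OF \<tau> \<sigma> _ B'(1) B(1) B'(3,4)[symmetric]]) (simp add: e)
    ultimately show "B \<in> inner n \<tau>" using B' by (auto simp: inner_def)
  qed
  have in_eq: "inner n \<sigma> = inner n \<tau>" using sub[OF \<sigma> \<tau> e] sub[OF \<tau> \<sigma> e[symmetric]] by (rule subset_antisym)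
  have out: "C = {1..n} - \<Union> (inner n \<rho>)" if \<rho>: "\<rho> \<in> NC n" and C: "C \<in> \<rho>" "n \<in> C" for \<rho> C
  proof (intro subset_antisym subsetI)
    fix x assume x: "x \<in> C"
    have "x \<notin> B" if "B \<in> inner n \<rho>" for B
      using NC_disjoint[OF \<rho> C(1), of B x] that x C(2) by (auto simp: inner_def)
    then show "x \<in> {1..n} - \<Union> (inner n \<rho>)" using x NC_D(5)[OF \<rho> C(1)] by blast
  next
    fix x assume x: "x \<in> {1..n} - \<Union> (inner n \<rho>)"
    then obtain B where B: "B \<in> \<rho>" "x \<in> B" using NC_cover[OF \<rho>] by blast
    then have "n \<in> B" using x by (auto simp: inner_def)
    then show "x \<in> C" using NC_disjoint[OF \<rho> C(1) B(1), of n] C(2) B(2) by simp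
  qed
  have sub2: "\<sigma> \<subseteq> \<tau>" if \<sigma>: "\<sigma> \<in> NC n" and \<tau>: "\<tau> \<in> NC n" and eq: "inner n \<sigma> = inner n \<tau>" for \<sigma> \<tau>
  proof
    fix C assume C: "C \<in> \<sigma>"
    show "C \<in> \<tau>"
    proof (cases "n \<in> C")
      case True
      obtain D where D: "D \<in> \<tau>" "n \<in> D" using NC_cover[OF \<tau>, of n] n by auto
      show ?thesis using out[OF \<sigma> C True] out[OF \<tau> D] D(1) eq by simp
    next
      case False
      then have "C \<in> inner n \<tau>" using C eq[symmetric] by (simp add: inner_def)
      then show ?thesis by (simp add: inner_def)
    qed
  qed
  show ?thesis using sub2[OF \<sigma> \<tau> in_eq] sub2[OF \<tau> \<sigma> in_eq[symmetric]] by (rule subset_antisym)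
qed

lemma block_set_inner:
  assumes "\<sigma> \<in> NC n" shows "block_set n (inner n \<sigma>)"
  unfolding block_set_def
proof (intro conjI ballI impI)
  show "finite (inner n \<sigma>)" using NC_D(3)[OF assms] by (simp add: inner_def)
  fix B assume B: "B \<in> inner n \<sigma>"
  then have b: "B \<in> \<sigma>" "n \<notin> B" by (auto simp: inner_def)
  show "B \<noteq> {}" by (rule NC_D(6)[OF assms b(1)])
  show "B \<subseteq> {1..<n}"
  proof
    fix x assume x: "x \<in> B"
    then have "x \<in> {1..n}" "x \<noteq> n" using NC_D(5)[OF assms b(1)] b(2) by auto
    then show "x \<in> {1..<n}" by simp
  qed
  fix C assume C: "C \<in> inner n \<sigma>" "B \<noteq> C"
  then show "B \<inter> C = {}" using NC_disjoint[OF assms b(1), of C] by (auto simp: inner_def)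
qed

lemma card_inner:
  assumes "1 \<le> n" "\<sigma> \<in> NC n" shows "card (inner n \<sigma>) = card \<sigma> - 1"
proof -
  obtain C where C: "C \<in> \<sigma>" "n \<in> C" using NC_cover[OF assms(2), of n] assms(1) by auto
  have "inner n \<sigma> = \<sigma> - {C}"
  proof (intro subset_antisym subsetI)
    fix B assume "B \<in> inner n \<sigma>"
    then show "B \<in> \<sigma> - {C}" using C(2) by (auto simp: inner_def)
  next
    fix B assume B: "B \<in> \<sigma> - {C}"
    then show "B \<in> inner n \<sigma>" using NC_disjoint[OF assms(2) C(1) _ C(2), of B] by (auto simp: inner_def)
  qed
  then show ?thesis using C(1) by simp
qed

lemma lead_inj:
  assumes "1 \<le> n" "\<sigma> \<in> NC n" "\<tau> \<in> NC n" "lead n (inner n \<sigma>) = lead n (inner n \<tau>)"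
  shows "\<sigma> = \<tau>"
  using lead_eqD[OF block_set_inner[OF assms(2)] block_set_inner[OF assms(3)] assms(4)]
  by (intro NC_eqI[OF assms(1-3)] ends_eq assms(2,3))

section \<open>Linear independence modulo the ideal\<close>

lemma finite_NC_blocks: "finite (NC_blocks n k)" "finite (NC n)"
proof -
  have "NC n \<subseteq> Pow (Pow {1..n})" using NC_D(5) by blast
  then show "finite (NC n)" by (rule finite_subset) simp
  then show "finite (NC_blocks n k)" by (rule finite_subset[rotated]) (auto simp: NC_blocks_def)
qed

lemma NC_blocksD: "\<sigma> \<in> NC_blocks n k \<Longrightarrow> \<sigma> \<in> NC n" "\<sigma> \<in> NC_blocks n k \<Longrightarrow> card \<sigma> = k"
  by (auto simp: NC_blocks_def)

text \<open>A triangular system: at the leading monomial of least weight among the partitions with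
  nonzero coefficient no other such partition contributes, because different partitions have
  different leading monomials.\<close>

lemma Hs_independent:
  assumes n: "1 \<le> n" and z: "(\<Sum>\<sigma>\<in>NC_blocks n k. scl (d \<sigma>) (Hs n (inner n \<sigma>))) = 0"
    and \<sigma>: "\<sigma> \<in> NC_blocks n k"
  shows "d \<sigma> = 0"
proof (rule ccontr)
  let ?N = "NC_blocks n k"
  assume "d \<sigma> \<noteq> 0"
  then have "\<sigma> \<in> ?N \<and> d \<sigma> \<noteq> 0" using \<sigma> by simp
  from ex_has_least_nat[of "\<lambda>\<sigma>. \<sigma> \<in> ?N \<and> d \<sigma> \<noteq> 0", OF this, of "\<lambda>\<sigma>. wx (lead n (inner n \<sigma>))"]
  obtain \<rho> where \<rho>: "\<rho> \<in> ?N" "d \<rho> \<noteq> 0"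
    and least: "\<And>\<tau>. \<tau> \<in> ?N \<Longrightarrow> d \<tau> \<noteq> 0 \<Longrightarrow> wx (lead n (inner n \<rho>)) \<le> wx (lead n (inner n \<tau>))" by blast
  have "pj n (ttot n (\<Sum>\<sigma>\<in>?N. scl (d \<sigma>) (Hs n (inner n \<sigma>)))) =
      (\<Sum>\<sigma>\<in>?N. scl (d \<sigma> * of_nat n) (Gs n (inner n \<sigma>)))"
    unfolding module_hom.sum[OF lin_tot(2)] module_hom.sum[OF lin_pj]
    by (rule sum.cong[OF refl])
      (simp add: module_hom.scale[OF lin_tot(2)] module_hom.scale[OF lin_pj] ttot_Hs[OF n block_set_inner[OF NC_blocksD(1)]]
        pj_arcs[OF n block_set_inner[OF NC_blocksD(1)]])
  then have s0: "(\<Sum>\<sigma>\<in>?N. scl (d \<sigma> * of_nat n) (Gs n (inner n \<sigma>))) = 0"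
    unfolding z by (simp add: module_hom.zero[OF lin_tot(2)] module_hom.zero[OF lin_pj])
  have "0 = (\<Sum>\<sigma>\<in>?N. d \<sigma> * of_nat n * Gs n (inner n \<sigma>) (lead n (inner n \<rho>)))"
    using fun_cong[OF s0, of "lead n (inner n \<rho>)"] by (simp only: sum_fun_apply scl_apply zero_fun_apply)
  also have "\<dots> = (\<Sum>\<sigma>\<in>{\<rho>}. d \<sigma> * of_nat n * Gs n (inner n \<sigma>) (lead n (inner n \<rho>)))"
  proof (rule sum.mono_neutral_right[OF finite_NC_blocks(1)])
    show "{\<rho>} \<subseteq> ?N" using \<rho>(1) by simp
    show "\<forall>\<tau>\<in>?N - {\<rho>}. d \<tau> * of_nat n * Gs n (inner n \<tau>) (lead n (inner n \<rho>)) = 0"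
    proof
      fix \<tau> assume \<tau>: "\<tau> \<in> ?N - {\<rho>}"
      show "d \<tau> * of_nat n * Gs n (inner n \<tau>) (lead n (inner n \<rho>)) = 0"
      proof (rule ccontr)
        assume nz: "d \<tau> * of_nat n * Gs n (inner n \<tau>) (lead n (inner n \<rho>)) \<noteq> 0"
        have \<tau>N: "\<tau> \<in> NC n" "\<rho> \<in> NC n" using \<tau> \<rho>(1) NC_blocksD(1) by blast+
        have "lead n (inner n \<rho>) = lead n (inner n \<tau>) \<or> wx (lead n (inner n \<tau>)) < wx (lead n (inner n \<rho>))"
          using Gs_lead[OF block_set_inner[OF \<tau>N(1)]] nz by auto
        then show False
          using lead_inj[OF n \<tau>N(2,1)] least[of \<tau>] \<tau> nz by auto
      qed
    qed
  qed
  also have "\<dots> \<noteq> 0" using \<rho> n Gs_lead[OF block_set_inner[OF NC_blocksD(1)[OF \<rho>(1)]]] by simp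
  finally show False by simp
qed

text \<open>As many independent rows as there are columns span every basis vector, while a relation
  among the columns annihilates the whole row space; evaluated at a basis vector it gives the
  coefficient.\<close>

lemma independent_columns:
  fixes M :: "'a \<Rightarrow> 'a \<Rightarrow> complex"
  assumes fin: "finite A" and rows: "\<And>d. (\<And>b. b \<in> A \<Longrightarrow> (\<Sum>a\<in>A. d a * M a b) = 0) \<Longrightarrow> \<forall>a\<in>A. d a = 0"
    and cols: "\<And>a. a \<in> A \<Longrightarrow> (\<Sum>b\<in>A. c b * M a b) = 0" and b0: "b0 \<in> A"
  shows "c b0 = 0"
proof -
  define r where "r a = (\<lambda>b. if b \<in> A then M a b else 0)" for a
  have inj: "inj_on r A"
  proof (rule inj_onI, rule ccontr)
    fix x y assume xy: "x \<in> A" "y \<in> A" "r x = r y" "x \<noteq> y"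
    have "(\<Sum>a\<in>A. ((if a = x then 1 else 0) - (if a = y then 1 else 0)) * M a b) = 0" if "b \<in> A" for b
    proof -
      have "M x b = M y b" using fun_cong[OF xy(3), of b] that by (simp add: r_def)
      moreover have "(\<Sum>a\<in>A. (if a = z then 1 else 0) * M a b) = M z b" if "z \<in> A" for z
        using fin that by (subst sum.remove[of _ z]) (auto intro!: sum.neutral)
      ultimately show ?thesis using xy(1,2) by (simp only: left_diff_distrib sum_subtractf) simp
    qed
    from rows[of "\<lambda>a. (if a = x then 1 else 0) - (if a = y then 1 else 0)", OF this] show False
      using xy by auto
  qed
  have ind: "fsp.independent (r ` A)"
  proof
    assume "fsp.dependent (r ` A)"
    then obtain u where u: "\<exists>v\<in>r ` A. u v \<noteq> 0" "(\<Sum>v\<in>r ` A. scl (u v) v) = 0"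
      using fsp.dependent_finite[of "r ` A"] fin by auto
    have s: "(\<Sum>a\<in>A. scl (u (r a)) (r a)) = 0" using u(2) sum.reindex[OF inj, of "\<lambda>v. scl (u v) v"] by simp
    have "(\<Sum>a\<in>A. u (r a) * M a b) = 0" if "b \<in> A" for b
      using fun_cong[OF s, of b] that by (simp add: sum_fun_apply r_def pointwise)
    then have "\<forall>a\<in>A. u (r a) = 0" by (rule rows)
    then show False using u(1) by auto
  qed
  have sub: "f \<in> fsp.span (basis_vec ` A)" if "\<And>b. b \<notin> A \<Longrightarrow> f b = 0" for f :: "'a \<Rightarrow> complex"
  proof -
    have e: "f = (\<Sum>a\<in>A. scl (f a) (basis_vec a))"
    proof
      fix b
      have "(\<Sum>a\<in>A. f a * basis_vec a b) = (\<Sum>a\<in>A. if a = b then f a else 0)"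
        by (rule sum.cong) (auto simp: basis_vec_def)
      also have "\<dots> = f b" using fin that by (simp add: sum.delta)
      finally show "f b = (\<Sum>a\<in>A. scl (f a) (basis_vec a)) b" by (simp add: sum_fun_apply pointwise)
    qed
    show ?thesis by (subst e) (intro fsp.span_sum fsp.span_scale fsp.span_base imageI)
  qed
  have e: "basis_vec b0 \<in> fsp.span (r ` A)"
  proof (rule ccontr)
    assume no: "basis_vec b0 \<notin> fsp.span (r ` A)"
    then have "fsp.independent (insert (basis_vec b0) (r ` A))" using ind by (simp add: fsp.independent_insert)
    moreover have "basis_vec b0 \<in> fsp.span (basis_vec ` A)" by (rule fsp.span_base) (use b0 in blast)
    moreover have "r a \<in> fsp.span (basis_vec ` A)" for a by (rule sub) (simp add: r_def)
    ultimately have "fsp.independent (insert (basis_vec b0) (r ` A))"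
      "insert (basis_vec b0) (r ` A) \<subseteq> fsp.span (basis_vec ` A)" by blast+
    then have "card (insert (basis_vec b0) (r ` A)) \<le> card (basis_vec ` A :: ('a \<Rightarrow> complex) set)"
      using fsp.independent_span_bound[of "basis_vec ` A"] fin by blast
    also have "\<dots> \<le> card A" using fin by (rule card_image_le)
    also have "card A = card (r ` A)" using inj by (simp add: card_image)
    finally have "card (insert (basis_vec b0) (r ` A)) \<le> card (r ` A)" .
    moreover have nin: "basis_vec b0 \<notin> r ` A" using no fsp.span_base[of "basis_vec b0" "r ` A"] by (rule contrapos_nn)
    ultimately show False unfolding card_insert_disjoint[OF finite_imageI[OF fin] nin] by linarith
  qed
  have "(\<Sum>b\<in>A. c b * f b) = 0" if "f \<in> fsp.span (r ` A)" for f
    using that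
  proof (induction f rule: fsp.span_induct_alt)
    case base
    show ?case by (simp add: zero_fun_apply)
  next
    case (step s x y)
    then obtain a where a: "a \<in> A" "x = r a" by blast
    have "(\<Sum>b\<in>A. c b * (scl s x + y) b) = s * (\<Sum>b\<in>A. c b * x b) + (\<Sum>b\<in>A. c b * y b)"
      by (simp only: pointwise distrib_left sum.distrib sum_distrib_left mult.left_commute)
    moreover have "(\<Sum>b\<in>A. c b * x b) = (\<Sum>b\<in>A. c b * M a b)" by (rule sum.cong) (auto simp: a(2) r_def)
    ultimately show ?case using step(2) cols[OF a(1)] by simp
  qed
  from this[OF e] have "(\<Sum>b\<in>A. c b * basis_vec b0 b) = 0" .
  moreover have "(\<Sum>b\<in>A. c b * basis_vec b0 b) = c b0"
    using fin b0 by (subst sum.remove[of _ b0]) (auto simp: basis_vec_def intro!: sum.neutral)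
  ultimately show ?thesis by simp
qed

lemma fp_bihomogeneous:
  assumes "1 \<le> k" "k \<le> n" "\<pi> \<in> NC_blocks n k" shows "fp n \<pi> \<in> ext_bihomogeneous n (n - k) (k - 1)"
  using bideg_fp[OF NC_D(1)[OF NC_blocksD(1)[OF assms(3)]], of "k - 1"] NC_blocksD(2)[OF assms(3)] assms(1,2)
  by (simp add: ext_bihomogeneous_eq fp_supp_in)

text \<open>Harmonic elements turn the hypothesis into a relation among the columns of the pairing
  matrix, so its rows must be shown independent. If a combination \<open>K\<close> of harmonic
  elements is orthogonal to all fermions, \<open>spanning\<close> makes it orthogonal to the whole
  bidegree. As \<open>K\<close> lies in that bidegree, it is zero, and \<open>Hs_independent\<close>
  applies.\<close>

theorem fp_independent:
  assumes n: "1 \<le> n" "1 \<le> k" "k \<le> n"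
    and I: "(\<Sum>\<pi>\<in>NC_blocks n k. scl (c \<pi>) (fp n \<pi>)) \<in> coinvariant_ideal n" and \<pi>: "\<pi> \<in> NC_blocks n k"
  shows "c \<pi> = 0"
proof (rule independent_columns[OF finite_NC_blocks(1) _ _ \<pi>])
  let ?N = "NC_blocks n k"
  define H where "H \<sigma> = Hs n (inner n \<sigma>)" for \<sigma>
  let ?M = "\<lambda>\<sigma> \<pi>. pairing n (H \<sigma>) (fp n \<pi>)"
  have harm: "harmonic n (H \<sigma>)" if "\<sigma> \<in> ?N" for \<sigma>
    unfolding H_def by (rule harmonic_Hs[OF n(1) block_set_inner[OF NC_blocksD(1)[OF that]]])
  show "(\<Sum>\<pi>\<in>?N. c \<pi> * ?M \<sigma> \<pi>) = 0" if "\<sigma> \<in> ?N" for \<sigma>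
    using harmonic_pairing[OF harm[OF that] I] by (simp only: pairing_simps)
  show "\<forall>\<sigma>\<in>?N. d \<sigma> = 0" if 0: "\<And>\<pi>. \<pi> \<in> ?N \<Longrightarrow> (\<Sum>\<sigma>\<in>?N. d \<sigma> * ?M \<sigma> \<pi>) = 0" for d
  proof
    define K where "K = (\<Sum>\<sigma>\<in>?N. scl (d \<sigma>) (H \<sigma>))"
    have KI: "pairing n K x = 0" if "x \<in> coinvariant_ideal n" for x
      unfolding K_def by (intro harmonic_pairing harmonic_sum harm that)
    have Kfp: "pairing n K (fp n \<pi>) = 0" if "\<pi> \<in> ?N" for \<pi> using 0[OF that] unfolding K_def by (simp only: pairing_simps)
    have KN: "pairing n K y = 0" if "y \<in> NCspan n k" for y
      using that unfolding NCspan_def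
      by (induction y rule: fsp.span_induct_alt) (auto simp: pairing_simps Kfp)
    have Kb: "pairing n K x = 0" if xb: "x \<in> ext_bihomogeneous n (n - k) (k - 1)" for x
    proof -
      obtain y where y: "y \<in> NCspan n k" "x - y \<in> coinvariant_ideal n" using spanning[OF n xb] by blast
      have "pairing n K (y + (x - y)) = 0" unfolding pairing_simps KN[OF y(1)] KI[OF y(2)] by simp
      then show ?thesis by simp
    qed
    have Hb: "H \<sigma> \<in> ext_bihomogeneous n (n - k) (k - 1)" if "\<sigma> \<in> ?N" for \<sigma>
    proof -
      have "card (inner n \<sigma>) = k - 1" using card_inner[OF n(1) NC_blocksD(1)[OF that]] NC_blocksD(2)[OF that] by simp
      moreover have "n - 1 - (k - 1) = n - k" "k - 1 \<le> n - 1" using n by auto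
      ultimately show ?thesis
        using Hs_bihomogeneous[OF n(1) block_set_inner[OF NC_blocksD(1)[OF that]]] unfolding H_def by simp
    qed
    have Kbi: "K \<in> supp_in (gens n)" "bideg (n - k) (k - 1) K"
      unfolding K_def using Hb by (auto intro!: supp_in_sum bideg_sum bideg_closed simp: ext_bihomogeneous_eq)
    have "K = 0"
    proof
      fix U
      show "K U = 0 U"
      proof (rule ccontr)
        assume "K U \<noteq> 0 U"
        then have U: "K U \<noteq> 0" by (simp only: zero_fun_apply not_False_eq_True)
        have Ug: "U \<subseteq> gens n" using Kbi(1) U by (auto simp: supp_in_def)
        \<comment> \<open>Pairing with this monomial reads off the coefficient of \<open>K\<close>
          at \<open>U\<close>.\<close>
        have "basis_vec U \<in> ext_bihomogeneous n (n - k) (k - 1)"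
          using Ug U Kbi(2) by (simp add: ext_bihomogeneous_eq bideg_basis_vec) (simp add: bideg_def)
        from Kb[OF this] show False using U unfolding pairing_basis_vec[OF Ug] by simp
      qed
    qed
    then have z: "(\<Sum>\<sigma>\<in>?N. scl (d \<sigma>) (Hs n (inner n \<sigma>))) = 0" unfolding K_def H_def .
    fix \<sigma> assume "\<sigma> \<in> ?N"
    then show "d \<sigma> = 0" by (rule Hs_independent[OF n(1) z])
  qed
qed

section \<open>The isomorphism\<close>

lemma free_space_simps:
  "carrier (free_space A) = {f. \<forall>a. a \<notin> A \<longrightarrow> f a = 0}" "ring.zero (free_space A) = 0"
  "add (free_space A) = (+)" "module.smult (free_space A) = scl"
  by (auto simp: free_space_def fun_eq_iff pointwise)

definition psi :: "nat \<Rightarrow> nat \<Rightarrow> (nat set set \<Rightarrow> complex) \<Rightarrow> vec"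
  where "psi n k f = (\<Sum>\<pi>\<in>NC_blocks n k. scl (f \<pi>) (fp n \<pi>))"

lemma lin_psi: "lin (psi n k)"
proof (rule linI)
  show "psi n k (x + y) = psi n k x + psi n k y" for x y
    unfolding psi_def plus_fun_apply fsp.scale_left_distrib sum.distrib ..
  show "psi n k (scl c x) = scl c (psi n k x)" for c x
    unfolding psi_def scl_apply fsp.scale_sum_right fsp.scale_scale ..
qed

lemmas psi_simps = module_hom.add[OF lin_psi] module_hom.scale[OF lin_psi] module_hom.neg[OF lin_psi]
  module_hom.zero[OF lin_psi] module_hom.sum[OF lin_psi] module_hom.diff[OF lin_psi]

lemma psi_basis_vec:
  assumes "\<pi> \<in> NC_blocks n k" shows "psi n k (basis_vec \<pi>) = fp n \<pi>"
proof -
  have "psi n k (basis_vec \<pi>) = (\<Sum>\<sigma>\<in>NC_blocks n k. if \<sigma> = \<pi> then fp n \<sigma> else 0)"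
    unfolding psi_def by (rule sum.cong) (auto simp: basis_vec_def)
  also have "\<dots> = fp n \<pi>" using assms finite_NC_blocks(1) by (subst sum.delta) auto
  finally show ?thesis .
qed

lemma psi_supp_in: "psi n k f \<in> supp_in (gens n)"
  unfolding psi_def by (intro supp_in_sum supp_in_closed fp_supp_in)

abbreviation NCvec :: "nat \<Rightarrow> nat \<Rightarrow> (nat set set \<Rightarrow> complex) set"
  where "NCvec n k \<equiv> carrier (free_space (NC_blocks n k))"

lemma NCvec_closed:
  "0 \<in> NCvec n k" "f \<in> NCvec n k \<Longrightarrow> g \<in> NCvec n k \<Longrightarrow> f + g \<in> NCvec n k"
  "f \<in> NCvec n k \<Longrightarrow> g \<in> NCvec n k \<Longrightarrow> f - g \<in> NCvec n k"
  "f \<in> NCvec n k \<Longrightarrow> scl c f \<in> NCvec n k" "f \<in> NCvec n k \<Longrightarrow> - f \<in> NCvec n k"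
  "\<pi> \<in> NC_blocks n k \<Longrightarrow> basis_vec \<pi> \<in> NCvec n k"
  by (auto simp: free_space_simps pointwise basis_vec_def)

text \<open>Stated modulo the ideal, as the isomorphism requires; with difference zero it also gives
  the plain injectivity by which the skein action is controlled.\<close>

lemma psi_inj:
  assumes "1 \<le> n" "1 \<le> k" "k \<le> n" "f \<in> NCvec n k" "g \<in> NCvec n k" "psi n k f - psi n k g \<in> coinvariant_ideal n"
  shows "f = g"
proof
  fix \<pi>
  have "psi n k (f - g) \<in> coinvariant_ideal n" using assms(6) by (simp only: psi_simps)
  then have "\<pi> \<in> NC_blocks n k \<Longrightarrow> (f - g) \<pi> = 0"
    unfolding psi_def by (rule fp_independent[OF assms(1-3)])
  moreover have "\<pi> \<notin> NC_blocks n k \<Longrightarrow> f \<pi> = g \<pi>" using assms(4,5) by (simp add: free_space_simps)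
  ultimately show "f \<pi> = g \<pi>" by (cases "\<pi> \<in> NC_blocks n k") (simp_all add: pointwise)
qed

text \<open>The skein operators and the relation between fermions match term by term; the sign comes
  from \<open>ext_act_fp\<close>.\<close>

lemma psi_skein_gen_basis:
  assumes \<pi>: "\<pi> \<in> NC_blocks n k" and i: "1 \<le> i" "i < n"
  shows "skein_gen_basis i \<pi> \<in> NCvec n k \<and> psi n k (skein_gen_basis i \<pi>) = ext_act n (adj_transp i) (fp n \<pi>)"
proof -
  have nc: "\<pi> \<in> NC n" "card \<pi> = k" using NC_blocksD[OF \<pi>] by auto
  have N: "\<sigma> \<in> NC_blocks n k" if "\<sigma> \<in> NC n" "card \<sigma> = card \<pi>" for \<sigma> using that nc by (simp add: NC_blocks_def)
  note act = ext_act_fp[OF NC_D(1)[OF nc(1)] i]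
  show ?thesis
    using nc(1) i
  proof (cases rule: skein_gen_basis_cases)
    case flip
    have e: "skein_gen_basis i \<pi> = - basis_vec (perm_partition (adj_transp i) \<pi>)"
      unfolding flip(3) by (rule ext) (simp add: pointwise)
    show ?thesis unfolding e act psi_simps psi_basis_vec[OF N[OF flip(1,2)]]
      by (intro conjI NCvec_closed N[OF flip(1,2)] refl)
  next
    case (resolve B C \<rho>)
    let ?\<mu>2 = "\<rho> \<union> {B \<union> C, {i, Suc i}}" and ?\<mu>3 = "\<rho> \<union> {B, insert i (insert (Suc i) C)}"
      and ?\<mu>4 = "\<rho> \<union> {C, insert (Suc i) (insert i B)}"
    have e: "skein_gen_basis i \<pi> = basis_vec \<pi> + basis_vec ?\<mu>2
      - (if card B > 1 then basis_vec ?\<mu>3 else 0) - (if card C > 1 then basis_vec ?\<mu>4 else 0)"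
      unfolding resolve(19) by (rule ext) (simp add: pointwise)
    have "- fp n (perm_partition (adj_transp i) \<pi>) = fp n \<pi> + fp n ?\<mu>2
      - (if card B > 1 then fp n ?\<mu>3 else 0) - (if card C > 1 then fp n ?\<mu>4 else 0)"
      using fp_skein[OF resolve(1-10), of n] unfolding resolve(12) unfolding resolve(11)[symmetric]
      by (rule neg_of_sum_zero)
    moreover have "psi n k (if P then basis_vec \<sigma> else 0) = (if P then fp n \<sigma> else 0)" if "\<sigma> \<in> NC_blocks n k" for P \<sigma>
      using psi_basis_vec[OF that] by (simp add: psi_simps)
    moreover have "(if P then basis_vec \<sigma> else 0) \<in> NCvec n k" if "\<sigma> \<in> NC_blocks n k" for P \<sigma>
      using NCvec_closed(1,6) that by simp
    ultimately show ?thesis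
      unfolding e act psi_simps psi_basis_vec[OF \<pi>] psi_basis_vec[OF N[OF resolve(13,14)]]
      using N[OF resolve(13,14)] N[OF resolve(15,16)] N[OF resolve(17,18)] \<pi>
      by (simp only: NCvec_closed simp_thms)
  qed
qed

lemma psi_skein_gen:
  assumes f: "f \<in> NCvec n k" and i: "1 \<le> i" "i < n"
  shows "skein_gen n i f \<in> NCvec n k" "psi n k (skein_gen n i f) = ext_act n (adj_transp i) (psi n k f)"
proof -
  have f0: "f \<pi> = 0" if "\<pi> \<notin> NC_blocks n k" for \<pi> using f that by (simp add: free_space_simps)
  have e: "skein_gen n i f = (\<Sum>\<pi>\<in>NC_blocks n k. scl (f \<pi>) (skein_gen_basis i \<pi>))"
  proof
    fix \<nu>
    have "skein_gen n i f \<nu> = (\<Sum>\<pi>\<in>NC_blocks n k. f \<pi> * skein_gen_basis i \<pi> \<nu>)"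
      unfolding skein_gen_def using finite_NC_blocks(2) NC_blocksD(1)
      by (intro sum.mono_neutral_right) (auto simp: f0)
    then show "skein_gen n i f \<nu> = (\<Sum>\<pi>\<in>NC_blocks n k. scl (f \<pi>) (skein_gen_basis i \<pi>)) \<nu>"
      by (simp only: sum_fun_apply scl_apply)
  qed
  have "sum F S \<in> NCvec n k" if "\<And>\<pi>. \<pi> \<in> S \<Longrightarrow> F \<pi> \<in> NCvec n k" for F and S :: "nat set set set"
    using that by (induction S rule: infinite_finite_induct) (simp_all add: NCvec_closed)
  then show "skein_gen n i f \<in> NCvec n k"
    unfolding e using psi_skein_gen_basis[OF _ i] by (simp add: NCvec_closed)
  show "psi n k (skein_gen n i f) = ext_act n (adj_transp i) (psi n k f)"
    unfolding e psi_simps psi_def[of n k f] ext_act_simps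
    by (rule sum.cong[OF refl]) (simp only: psi_skein_gen_basis[OF _ i])
qed

lemma psi_skein_word:
  assumes "set is \<subseteq> {1..<n}" "f \<in> NCvec n k"
  shows "foldr (skein_gen n) is f \<in> NCvec n k \<and>
    psi n k (foldr (skein_gen n) is f) = ext_act n (tword is) (psi n k f)"
  using assms(1)
proof (induction "is")
  case Nil
  have e: "foldr (skein_gen n) [] f = f" by simp
  show ?case unfolding e tword_simps(1) ext_act_id[OF psi_supp_in] using assms(2) by (intro conjI refl)
next
  case (Cons i "is")
  have i: "1 \<le> i" "i < n" "set is \<subseteq> {1..<n}" using Cons.prems by auto
  have IH: "foldr (skein_gen n) is f \<in> NCvec n k"
    "psi n k (foldr (skein_gen n) is f) = ext_act n (tword is) (psi n k f)" using Cons.IH[OF i(3)] by blast+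
  have e: "foldr (skein_gen n) (i # is) f = skein_gen n i (foldr (skein_gen n) is f)" by simp
  show ?case
    using psi_skein_gen[OF IH(1) i(1,2)]
    unfolding e IH(2) tword_simps(2) ext_act_compose[OF tword_permutes[OF i(3)] psi_supp_in] by (rule conjI)
qed

text \<open>The description in \<open>skein_act\<close> requires that the result does not depend on
  the word. All words for \<open>w\<close> have the same image under \<open>psi\<close>, given by
  the group action on the exterior algebra, and \<open>psi\<close> is injective.\<close>

lemma psi_skein_act:
  assumes n: "1 \<le> n" "1 \<le> k" "k \<le> n" and w: "w permutes {1..n}" and f: "f \<in> NCvec n k"
  shows "skein_act n w f \<in> NCvec n k" "psi n k (skein_act n w f) = ext_act n w (psi n k f)"
proof -
  obtain "is" where i: "set is \<subseteq> {1..<n}" "tword is = w" using permutes_tword[OF w] by blast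
  note p = psi_skein_word[OF i(1) f, unfolded i(2)]
  have "skein_act n w f = foldr (skein_gen n) is f"
    unfolding skein_act_def tword_def[symmetric]
  proof (rule the_equality)
    show "\<exists>js. set js \<subseteq> {1..<n} \<and> w = tword js \<and> foldr (skein_gen n) is f = foldr (skein_gen n) js f"
      using i by blast
    fix g assume "\<exists>js. set js \<subseteq> {1..<n} \<and> w = tword js \<and> g = foldr (skein_gen n) js f"
    then obtain js where j: "set js \<subseteq> {1..<n}" "tword js = w" "g = foldr (skein_gen n) js f" by blast
    note q = psi_skein_word[OF j(1) f, unfolded j(2), folded j(3)]
    show "g = foldr (skein_gen n) is f"
      by (rule psi_inj[OF n]) (use p q in \<open>simp_all add: coinvariant_ideal_closed\<close>)
  qed
  then show "skein_act n w f \<in> NCvec n k" "psi n k (skein_act n w f) = ext_act n w (psi n k f)"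
    using p by simp_all
qed

lemma NCspan_psi: "y \<in> NCspan n k \<Longrightarrow> \<exists>f\<in>NCvec n k. y = psi n k f"
  unfolding NCspan_def
proof (induction y rule: fsp.span_induct_alt)
  case base
  show ?case by (rule bexI[of _ 0]) (simp_all add: psi_simps NCvec_closed)
next
  case (step c x y)
  then obtain \<pi> f where "\<pi> \<in> NC_blocks n k" "x = fp n \<pi>" "f \<in> NCvec n k" "y = psi n k f" by blast
  then show ?case
    by (intro bexI[of _ "scl c (basis_vec \<pi>) + f"]) (simp_all only: psi_simps psi_basis_vec NCvec_closed)
qed

text \<open>The laws of the action and its linearity hold after applying \<open>psi\<close>, in the
  exterior algebra, and are pulled back by injectivity.\<close>

lemma sym_group_module_skein:
  assumes n: "1 \<le> n" "1 \<le> k" "k \<le> n"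
  shows "sym_group_module n (free_space (NC_blocks n k)) (skein_act n)"
proof -
  let ?V = "free_space (NC_blocks n k)"
  have eqI: "f = g" if "f \<in> NCvec n k" "g \<in> NCvec n k" "psi n k f = psi n k g" for f g
    by (rule psi_inj[OF n that(1,2)]) (simp add: that(3) coinvariant_ideal_closed)
  note cl = NCvec_closed psi_skein_act[OF n]
  have "abelian_group ?V"
  proof (rule abelian_groupI)
    fix x assume x: "x \<in> carrier ?V"
    show "\<exists>y\<in>carrier ?V. y \<oplus>\<^bsub>?V\<^esub> x = \<zero>\<^bsub>?V\<^esub>"
      by (rule bexI[of _ "- x"]) (use x in \<open>simp_all only: free_space_simps(2,3) NCvec_closed left_minus\<close>)
  qed (simp_all only: free_space_simps(2,3) NCvec_closed add_ac add_0_right)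
  then have "module complex_field ?V"
    by (intro moduleI cring_complex_field)
      (simp_all only: complex_field_simps free_space_simps(2,3,4) NCvec_closed
        fsp.scale_left_distrib fsp.scale_right_distrib fsp.scale_scale fsp.scale_one)
  moreover have "group_action (sym_group n) (carrier ?V) (\<lambda>w. restrict (skein_act n w) (carrier ?V))"
  proof (rule sym_group_actionI)
    show "skein_act n w x \<in> carrier ?V" if "w permutes {1..n}" "x \<in> carrier ?V" for w x
      by (rule cl(7)[OF that])
    fix x assume x: "x \<in> carrier ?V"
    show "skein_act n id x = x"
      by (rule eqI) (simp_all only: cl permutes_id x ext_act_id psi_supp_in)
    fix v w assume vw: "v permutes {1..n}" "w permutes {1..n}"
    show "skein_act n (v \<circ> w) x = skein_act n v (skein_act n w x)"
      by (rule eqI) (simp_all only: cl permutes_compose vw x ext_act_compose psi_supp_in)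
  qed
  moreover have "linear_map ?V ?V (skein_act n w)" if "w \<in> carrier (sym_group n)" for w
  proof -
    have w: "w permutes {1..n}" using that by (simp add: sym_group_def)
    have "skein_act n w (x + y) = skein_act n w x + skein_act n w y" if "x \<in> NCvec n k" "y \<in> NCvec n k" for x y
      by (rule eqI) (simp_all only: cl w that psi_simps ext_act_simps)
    moreover have "skein_act n w (scl c x) = scl c (skein_act n w x)" if "x \<in> NCvec n k" for x c
      by (rule eqI) (simp_all only: cl w that psi_simps ext_act_simps)
    ultimately show ?thesis
      unfolding linear_map_def free_space_simps(3,4) using cl(7)[OF w] by (intro conjI ballI allI funcsetI)
  qed
  ultimately show ?thesis unfolding sym_group_module_def by (intro conjI ballI)
qed

theorem corollary7p3:
  fixes n k :: nat
  assumes "n \<ge> 1" and "1 \<le> k" and "k \<le> n"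
  shows "sym_group_module_isomorphic n
    (free_space (NC_blocks n k)) (skein_act n)
    (FDR_component n (n - k) (k - 1)) (FDR_act n)"
proof -
  let ?W = "FDR_component n (n - k) (k - 1)"
  define \<phi> where "\<phi> f = cst n (psi n k f)" for f
  have bh: "psi n k f \<in> ext_bihomogeneous n (n - k) (k - 1)" for f
    unfolding psi_def using fp_bihomogeneous[OF assms(2,3)]
    by (auto intro!: supp_in_sum bideg_sum bideg_closed simp: ext_bihomogeneous_eq)
  have "\<phi> f \<in> carrier ?W" for f unfolding \<phi>_def FDR_component_simps using bh by blast
  then have lin: "linear_map (free_space (NC_blocks n k)) ?W \<phi>"
    unfolding linear_map_def \<phi>_def free_space_simps(3,4) psi_simps
    by (auto simp: FDR_component_simps(3,4)[OF psi_supp_in] psi_supp_in)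
  have "inj_on \<phi> (NCvec n k)"
    by (rule inj_onI, rule psi_inj[OF assms]) (simp_all add: \<phi>_def cst_eq_iff psi_supp_in)
  moreover have "\<phi> ` NCvec n k = carrier ?W"
  proof (intro subset_antisym subsetI)
    fix K assume "K \<in> carrier ?W"
    then obtain x where x: "x \<in> ext_bihomogeneous n (n - k) (k - 1)" "K = cst n x"
      by (auto simp: FDR_component_simps)
    obtain y where y: "y \<in> NCspan n k" "x - y \<in> coinvariant_ideal n" using spanning[OF assms x(1)] by blast
    obtain f where f: "f \<in> NCvec n k" "y = psi n k f" using NCspan_psi[OF y(1)] by blast
    have "x \<in> supp_in (gens n)" using x(1) by (simp add: ext_bihomogeneous_eq)
    then have "cst n x = \<phi> f" using y(2) by (simp add: \<phi>_def f(2) cst_eq_iff psi_supp_in)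
    then show "K \<in> \<phi> ` NCvec n k" using f(1) x(2) by blast
  qed (use \<open>\<And>f. \<phi> f \<in> carrier ?W\<close> in auto)
  ultimately have "bij_betw \<phi> (NCvec n k) (carrier ?W)" by (simp add: bij_betw_def)
  moreover have "\<phi> (skein_act n w x) = FDR_act n w (\<phi> x)"
    if "w \<in> carrier (sym_group n)" "x \<in> NCvec n k" for w x
    using that psi_skein_act[OF assms] by (simp add: \<phi>_def sym_group_def FDR_act_cst psi_supp_in)
  ultimately show ?thesis
    unfolding sym_group_module_isomorphic_def
    using sym_group_module_skein[OF assms] sym_group_module_FDR_component lin by blast
qed

end
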